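(* Let $\mathcal M$ be a compact complex supermanifold and let $\varphi=(\varphi_t)_{t\in\mathbb R}$ be a continuous one-parameter subgroup of automorphisms of $\mathcal M$. Then the action of $\varphi$ on $\mathcal M$ is analytic.
   Context: A complex supermanifold $\mathcal M=(M,\mathcal O_{\mathcal M})$ of dimension $(m|n)$ is a complex manifold $M$ with a sheaf $\mathcal O_{\mathcal M}$ of $\mathbb Z_2$-graded algebras which is locally, on small open $U\subset M$, isomorphic to $\mathcal O_U\otimes\bigwedge\mathbb C^n$, with $\mathcal O_U$ the sheaf of holomorphic functions; it is compact if $M$ is compact. A morphism $\varphi$ has underlying map $\tilde\varphi$ and parity-preserving pullback $\varphi^*$. $\mathrm{Aut}_{\bar 0}(\mathcal M)$ is the group of automorphisms (biholomorphic morphisms $\mathcal M\to\mathcal M$) under composition, with the topology generated by the following subbase. For $K\subseteq M$ compact contained in a coordinate domain with odd coordinates $\theta_1,\dots,\theta_n$, $U\subseteq M$ open, $f\in\mathcal O_{\mathcal M}(U)$, and $U_\nu\subseteq\mathbb C$ open ($\nu\in(\mathbb Z_2)^n$), the set of all $\varphi$ with $\tilde\varphi(K)\subseteq U$ and $\varphi_{f,\nu}(K)\subseteq U_\nu$ for all $\nu$, where $\varphi^*(f)=\sum_\nu\varphi_{f,\nu}\theta^\nu$ near $K$ with $\varphi_{f,\nu}$ holomorphic. A continuous one-parameter subgroup of automorphisms of $\mathcal M$ is a family of automorphisms $\varphi_t:\mathcal M\to\mathcal M$, $t\in\mathbb R$, such that $\mathbb R\to\mathrm{Aut}_{\bar 0}(\mathcal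 M)$, $t\mapsto\varphi_t$, is a continuous group homomorphism. For such a family: whenever $U,V\subset M$ are open, $[a,b]\subset\mathbb R$ satisfies $\tilde\varphi_t(U)\subseteq V$ for all $t\in[a,b]$, there are local coordinates $z_1,\dots,z_m,\xi_1,\dots,\xi_n$ for $\mathcal M$ on $U$, and $f\in\mathcal O_{\mathcal M}(V)$, there are continuous functions $f_\nu:[a,b]\times U\to\mathbb C$, with $f_\nu(t,\cdot)$ holomorphic on $U$ for fixed $t$, such that $(\varphi_t)^*(f)=\sum_\nu f_\nu(t,z)\xi^\nu$. The action of $\varphi$ on $\mathcal M$ is called analytic if, for all such data, each $f_\nu(t,z)$ is analytic in both components $(t,z)$. *)

theory Defs
  imports
    "HOL-Analysis.Analysis"
    "HOL-Algebra.Algebraic_Closure_Type"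
    "HOL-Library.Z2"
begin

section \<open>Analytic functions of several variables\<close>

text \<open>
  Dimensions are natural numbers, with \<open>m = 0\<close> and \<open>n = 0\<close> allowed, so points of \<open>\<complex>\<^sup>m\<close> are
  extensional functions on \<open>{..<m}\<close> rather than elements of a type indexed by the dimension.
\<close>

definition complex_space :: "nat \<Rightarrow> (nat \<Rightarrow> complex) topology"
  where "complex_space m = product_topology (\<lambda>_. euclidean) {..<m}"

definition multi_indices :: "nat \<Rightarrow> (nat \<Rightarrow> nat) set"
  where "multi_indices m = ({..<m} \<rightarrow>\<^sub>E UNIV)"

definition multi_power :: "nat \<Rightarrow> (nat \<Rightarrow> complex) \<Rightarrow> (nat \<Rightarrow> nat) \<Rightarrow> complex"
  where "multi_power m w \<alpha> = (\<Prod>i<m. w i ^ \<alpha> i)"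

text \<open>Holomorphy on an open subset \<open>D\<close> of \<open>\<complex>\<^sup>m\<close>: local expansion in an (absolutely convergent)
  power series.\<close>

definition holomorphic_fun_on :: "nat \<Rightarrow> (nat \<Rightarrow> complex) set \<Rightarrow> ((nat \<Rightarrow> complex) \<Rightarrow> complex) \<Rightarrow> bool"
  where "holomorphic_fun_on m D f \<longleftrightarrow>
    (\<forall>p\<in>D. \<exists>c. \<exists>r>0. \<forall>w\<in>D. (\<forall>i<m. cmod (w i - p i) < r) \<longrightarrow>
       ((\<lambda>\<alpha>. c \<alpha> * multi_power m (\<lambda>i. w i - p i) \<alpha>) has_sum f w) (multi_indices m))"

text \<open>Joint analyticity in a real variable \<open>t\<close> and \<open>m\<close> complex variables on \<open>[a,b] \<times> D\<close>; at the
  end points of \<open>[a,b]\<close> the power series is required to represent the function on the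
  one-sided neighbourhood that lies in \<open>[a,b]\<close>.\<close>

definition jointly_analytic_on ::
    "nat \<Rightarrow> real \<Rightarrow> real \<Rightarrow> (nat \<Rightarrow> complex) set \<Rightarrow> (real \<Rightarrow> (nat \<Rightarrow> complex) \<Rightarrow> complex) \<Rightarrow> bool"
  where "jointly_analytic_on m a b D f \<longleftrightarrow>
    (\<forall>s\<in>{a..b}. \<forall>p\<in>D. \<exists>c. \<exists>r>0. \<forall>t\<in>{a..b}. \<forall>w\<in>D.
       \<bar>t - s\<bar> < r \<and> (\<forall>i<m. cmod (w i - p i) < r) \<longrightarrow>
       ((\<lambda>(k, \<alpha>). c k \<alpha> * of_real (t - s) ^ k * multi_power m (\<lambda>i. w i - p i) \<alpha>) has_sum f t w)
         ((UNIV :: nat set) \<times> multi_indices m))"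


section \<open>Complex manifolds\<close>

record 'p manifold =
  points :: "'p topology"
  atlas :: "('p set \<times> ('p \<Rightarrow> nat \<Rightarrow> complex)) set"

definition chart :: "nat \<Rightarrow> 'p topology \<Rightarrow> 'p set \<Rightarrow> ('p \<Rightarrow> nat \<Rightarrow> complex) \<Rightarrow> bool"
  where "chart m S U z \<longleftrightarrow>
    openin S U \<and> openin (complex_space m) (z ` U) \<and>
    homeomorphic_map (subtopology S U) (subtopology (complex_space m) (z ` U)) z"

definition holomorphic_transition ::
    "nat \<Rightarrow> 'p set \<Rightarrow> ('p \<Rightarrow> nat \<Rightarrow> complex) \<Rightarrow> 'p set \<Rightarrow> ('p \<Rightarrow> nat \<Rightarrow> complex) \<Rightarrow> bool"
  where "holomorphic_transition m U z V w \<longleftrightarrow>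
    (\<forall>i<m. holomorphic_fun_on m (z ` (U \<inter> V)) (\<lambda>p. w (inv_into U z p) i))"

definition complex_manifold :: "nat \<Rightarrow> ('p, 'x) manifold_scheme \<Rightarrow> bool"
  where "complex_manifold m M \<longleftrightarrow>
    Hausdorff_space (points M) \<and> second_countable (points M) \<and>
    (\<forall>(U, z)\<in>atlas M. chart m (points M) U z) \<and>
    (\<Union>(U, z)\<in>atlas M. U) = topspace (points M) \<and>
    (\<forall>(U, z)\<in>atlas M. \<forall>(V, w)\<in>atlas M. holomorphic_transition m U z V w)"

text \<open>Members of the maximal atlas.\<close>

definition holomorphic_chart ::
    "nat \<Rightarrow> ('p, 'x) manifold_scheme \<Rightarrow> 'p set \<Rightarrow> ('p \<Rightarrow> nat \<Rightarrow> complex) \<Rightarrow> bool"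
  where "holomorphic_chart m M U z \<longleftrightarrow>
    chart m (points M) U z \<and>
    (\<forall>(V, w)\<in>atlas M. holomorphic_transition m U z V w \<and> holomorphic_transition m V w U z)"

definition holomorphic_on_manifold ::
    "nat \<Rightarrow> ('p, 'x) manifold_scheme \<Rightarrow> 'p set \<Rightarrow> ('p \<Rightarrow> complex) \<Rightarrow> bool"
  where "holomorphic_on_manifold m M W f \<longleftrightarrow>
    (\<forall>(U, z)\<in>atlas M. holomorphic_fun_on m (z ` (U \<inter> W)) (\<lambda>p. f (inv_into U z p)))"


section \<open>Sheaves of \<open>\<int>\<^sub>2\<close>-graded algebras\<close>

record 's superalgebra = "(complex, 's) module" +
  grade :: "bit \<Rightarrow> 's set"

definition superalgebra :: "'s superalgebra \<Rightarrow> bool"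
  where "superalgebra A \<longleftrightarrow>
    ring A \<and> module (ring_of_type_algebra :: complex ring) A \<and>
    (\<forall>c. \<forall>x\<in>carrier A. \<forall>y\<in>carrier A.
       (c \<odot>\<^bsub>A\<^esub> x) \<otimes>\<^bsub>A\<^esub> y = c \<odot>\<^bsub>A\<^esub> (x \<otimes>\<^bsub>A\<^esub> y) \<and> x \<otimes>\<^bsub>A\<^esub> (c \<odot>\<^bsub>A\<^esub> y) = c \<odot>\<^bsub>A\<^esub> (x \<otimes>\<^bsub>A\<^esub> y)) \<and>
    (\<forall>i. submodule (grade A i) (ring_of_type_algebra :: complex ring) A) \<and>
    (\<forall>x\<in>carrier A. \<exists>!(y, y'). y \<in> grade A 0 \<and> y' \<in> grade A 1 \<and> x = y \<oplus>\<^bsub>A\<^esub> y') \<and>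
    (\<forall>i j. \<forall>x\<in>grade A i. \<forall>y\<in>grade A j. x \<otimes>\<^bsub>A\<^esub> y \<in> grade A (i + j))"

definition superalgebra_hom :: "'s superalgebra \<Rightarrow> 't superalgebra \<Rightarrow> ('s \<Rightarrow> 't) set"
  where "superalgebra_hom A B =
    {h \<in> ring_hom A B.
       (\<forall>c. \<forall>x\<in>carrier A. h (c \<odot>\<^bsub>A\<^esub> x) = c \<odot>\<^bsub>B\<^esub> h x) \<and>
       (\<forall>i. h ` grade A i \<subseteq> grade B i)}"

record ('p, 's) sheaf =
  sections :: "'p set \<Rightarrow> 's superalgebra"
  res :: "'p set \<Rightarrow> 'p set \<Rightarrow> 's \<Rightarrow> 's"

definition superalgebra_sheaf :: "'p topology \<Rightarrow> ('p, 's) sheaf \<Rightarrow> bool"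
  where "superalgebra_sheaf S F \<longleftrightarrow>
    (\<forall>U. openin S U \<longrightarrow> superalgebra (sections F U)) \<and>
    (\<forall>U V. openin S U \<and> openin S V \<and> V \<subseteq> U \<longrightarrow>
       res F U V \<in> superalgebra_hom (sections F U) (sections F V)) \<and>
    (\<forall>U. openin S U \<longrightarrow> (\<forall>s\<in>carrier (sections F U). res F U U s = s)) \<and>
    (\<forall>U V W. openin S U \<and> openin S V \<and> openin S W \<and> W \<subseteq> V \<and> V \<subseteq> U \<longrightarrow>
       (\<forall>s\<in>carrier (sections F U). res F V W (res F U V s) = res F U W s)) \<and>
    (\<forall>\<W> s. (\<forall>W\<in>\<W>. openin S W \<and> s W \<in> carrier (sections F W)) \<and>
       (\<forall>V\<in>\<W>. \<forall>W\<in>\<W>. res F V (V \<inter> W) (s V) = res F W (V \<inter> W) (s W)) \<longrightarrow>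
       (\<exists>!g. g \<in> carrier (sections F (\<Union>\<W>)) \<and> (\<forall>W\<in>\<W>. res F (\<Union>\<W>) W g = s W)))"

text \<open>Isomorphisms of the restrictions of two sheaves to the open set \<open>U\<close>.\<close>

definition sheaf_iso_on ::
    "'p topology \<Rightarrow> 'p set \<Rightarrow> ('p, 's) sheaf \<Rightarrow> ('p, 't) sheaf \<Rightarrow> ('p set \<Rightarrow> 's \<Rightarrow> 't) \<Rightarrow> bool"
  where "sheaf_iso_on S U F G \<Phi> \<longleftrightarrow>
    (\<forall>W. openin S W \<and> W \<subseteq> U \<longrightarrow>
       \<Phi> W \<in> superalgebra_hom (sections F W) (sections G W) \<and>
       bij_betw (\<Phi> W) (carrier (sections F W)) (carrier (sections G W)) \<and>
       (\<forall>i. \<Phi> W ` grade (sections F W) i = grade (sections G W) i)) \<and>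
    (\<forall>V W. openin S V \<and> openin S W \<and> W \<subseteq> V \<and> V \<subseteq> U \<longrightarrow>
       (\<forall>s\<in>carrier (sections F V). \<Phi> W (res F V W s) = res G V W (\<Phi> V s)))"


section \<open>Complex supermanifolds\<close>

text \<open>
  The sheaf \<open>\<O>\<^sub>M \<otimes> \<Lambda>\<complex>\<^sup>n\<close>. An index \<open>\<nu> \<in> (\<int>\<^sub>2)\<^sup>n\<close> is encoded by its support, a subset of \<open>{..<n}\<close>,
  and \<open>\<theta>\<^sup>\<nu>\<close> is the product of the \<open>\<theta>\<^sub>j\<close>, \<open>j \<in> \<nu>\<close>, in increasing order of \<open>j\<close>. The section
  \<open>\<Sum>\<^sub>\<nu> f\<^sub>\<nu> \<theta>\<^sup>\<nu>\<close> over \<open>W\<close> is the family of its coefficients, set to zero off \<open>W\<close> and for indices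
  that are not subsets of \<open>{..<n}\<close>. For disjoint \<open>\<mu>\<close> and \<open>\<nu>\<close> we have
  \<open>\<theta>\<^sup>\<mu> \<theta>\<^sup>\<nu> = exterior_sign \<mu> \<nu> \<cdot> \<theta>\<^sup>\<mu>\<^sup>\<union>\<^sup>\<nu>\<close>.
\<close>

definition exterior_sign :: "nat set \<Rightarrow> nat set \<Rightarrow> complex"
  where "exterior_sign \<mu> \<nu> = (-1) ^ card {(i, j). i \<in> \<mu> \<and> j \<in> \<nu> \<and> j < i}"

definition exterior_carrier ::
    "nat \<Rightarrow> nat \<Rightarrow> ('p, 'x) manifold_scheme \<Rightarrow> 'p set \<Rightarrow> (nat set \<Rightarrow> 'p \<Rightarrow> complex) set"
  where "exterior_carrier m n M W =
    {f. (\<forall>\<nu>. holomorphic_on_manifold m M W (f \<nu>)) \<and>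
        (\<forall>\<nu> x. \<not> (\<nu> \<subseteq> {..<n} \<and> x \<in> W) \<longrightarrow> f \<nu> x = 0)}"

definition exterior_sheaf ::
    "nat \<Rightarrow> nat \<Rightarrow> ('p, 'x) manifold_scheme \<Rightarrow> ('p, nat set \<Rightarrow> 'p \<Rightarrow> complex) sheaf"
  where "exterior_sheaf m n M =
    \<lparr> sections = (\<lambda>W.
        \<lparr> carrier = exterior_carrier m n M W,
          mult = (\<lambda>f g \<nu> x. \<Sum>\<mu>\<in>Pow \<nu>. exterior_sign \<mu> (\<nu> - \<mu>) * f \<mu> x * g (\<nu> - \<mu>) x),
          one = (\<lambda>\<nu> x. if \<nu> = {} \<and> x \<in> W then 1 else 0),
          zero = (\<lambda>\<nu> x. 0),
          add = (\<lambda>f g \<nu> x. f \<nu> x + g \<nu> x),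
          smult = (\<lambda>c f \<nu> x. c * f \<nu> x),
          grade = (\<lambda>i. {f \<in> exterior_carrier m n M W. \<forall>\<nu> x. f \<nu> x \<noteq> 0 \<longrightarrow> of_nat (card \<nu>) = i}) \<rparr>),
      res = (\<lambda>V W f \<nu> x. if x \<in> W then f \<nu> x else 0) \<rparr>"

record ('p, 's) supermanifold = "'p manifold" +
  structure_sheaf :: "('p, 's) sheaf"

definition complex_supermanifold :: "nat \<Rightarrow> nat \<Rightarrow> ('p, 's) supermanifold \<Rightarrow> bool"
  where "complex_supermanifold m n M \<longleftrightarrow>
    complex_manifold m M \<and> superalgebra_sheaf (points M) (structure_sheaf M) \<and>
    (\<forall>x\<in>topspace (points M). \<exists>U \<Phi>. openin (points M) U \<and> x \<in> U \<and>
       sheaf_iso_on (points M) U (structure_sheaf M) (exterior_sheaf m n M) \<Phi>)"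

definition compact_complex_supermanifold :: "nat \<Rightarrow> nat \<Rightarrow> ('p, 's) supermanifold \<Rightarrow> bool"
  where "compact_complex_supermanifold m n M \<longleftrightarrow>
    complex_supermanifold m n M \<and> compact_space (points M)"

text \<open>
  A local coordinate system on \<open>U\<close>, given as an isomorphism of \<open>(U, \<O>|\<^sub>U)\<close> onto a superdomain:
  \<open>z\<close> identifies \<open>U\<close> with an open subset of \<open>\<complex>\<^sup>m\<close> and \<open>\<Phi>\<close> identifies the structure sheaf with
  \<open>\<O>\<^sub>U \<otimes> \<Lambda>\<complex>\<^sup>n\<close>. The even and odd coordinates, as superfunctions, are the preimages under \<open>\<Phi> U\<close> of the
  functions \<open>z\<^sub>i\<close> and of the generators \<open>\<theta>\<^sub>j\<close>, so that \<open>\<Phi> W f\<close> is the family of coefficients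
  \<open>f\<^sub>\<nu>\<close> in the expansion \<open>f = \<Sum>\<^sub>\<nu> f\<^sub>\<nu>(z) \<theta>\<^sup>\<nu>\<close>.
\<close>

definition local_coordinates ::
    "nat \<Rightarrow> nat \<Rightarrow> ('p, 's) supermanifold \<Rightarrow> 'p set \<Rightarrow> ('p \<Rightarrow> nat \<Rightarrow> complex) \<Rightarrow>
     ('p set \<Rightarrow> 's \<Rightarrow> nat set \<Rightarrow> 'p \<Rightarrow> complex) \<Rightarrow> bool"
  where "local_coordinates m n M U z \<Phi> \<longleftrightarrow>
    holomorphic_chart m M U z \<and>
    sheaf_iso_on (points M) U (structure_sheaf M) (exterior_sheaf m n M) \<Phi>"


section \<open>Automorphisms\<close>

record ('p, 's) morphism =
  underlying :: "'p \<Rightarrow> 'p"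
  pullback :: "'p set \<Rightarrow> 's \<Rightarrow> 's"

abbreviation superfunctions :: "('p, 's) supermanifold \<Rightarrow> 'p set \<Rightarrow> 's superalgebra"
  where "superfunctions M U \<equiv> sections (structure_sheaf M) U"

definition preimage :: "('p, 's) supermanifold \<Rightarrow> ('p, 's) morphism \<Rightarrow> 'p set \<Rightarrow> 'p set"
  where "preimage M \<phi> V = {x \<in> topspace (points M). underlying \<phi> x \<in> V}"

text \<open>
  Morphisms \<open>M \<rightarrow> M\<close> of spaces with sheaves of graded \<open>\<complex>\<close>-algebras. The underlying map is then
  automatically holomorphic: a homomorphism of \<open>\<complex>\<close>-algebras between stalks, which are local with
  residue field \<open>\<complex>\<close>, is local, so reduction modulo nilpotents turns pullback into composition.
  All components are extensional, so that equality of morphisms is equality of records.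
\<close>

definition endomorphism :: "('p, 's) supermanifold \<Rightarrow> ('p, 's) morphism \<Rightarrow> bool"
  where "endomorphism M \<phi> \<longleftrightarrow>
    continuous_map (points M) (points M) (underlying \<phi>) \<and>
    underlying \<phi> \<in> extensional (topspace (points M)) \<and>
    (\<forall>V. openin (points M) V \<longrightarrow>
       pullback \<phi> V \<in> superalgebra_hom (superfunctions M V) (superfunctions M (preimage M \<phi> V)) \<and>
       pullback \<phi> V \<in> extensional (carrier (superfunctions M V))) \<and>
    (\<forall>V. \<not> openin (points M) V \<longrightarrow> pullback \<phi> V = (\<lambda>_. undefined)) \<and>
    (\<forall>V W. openin (points M) V \<and> openin (points M) W \<and> W \<subseteq> V \<longrightarrow>
       (\<forall>f\<in>carrier (superfunctions M V).
          pullback \<phi> W (res (structure_sheaf M) V W f) =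
          res (structure_sheaf M) (preimage M \<phi> V) (preimage M \<phi> W) (pullback \<phi> V f)))"

definition identity_morphism :: "('p, 's) supermanifold \<Rightarrow> ('p, 's) morphism"
  where "identity_morphism M =
    \<lparr> underlying = (\<lambda>x\<in>topspace (points M). x),
      pullback = (\<lambda>V f. if openin (points M) V \<and> f \<in> carrier (superfunctions M V)
        then f else undefined) \<rparr>"

definition compose_morphism ::
    "('p, 's) supermanifold \<Rightarrow> ('p, 's) morphism \<Rightarrow> ('p, 's) morphism \<Rightarrow> ('p, 's) morphism"
  where "compose_morphism M \<phi> \<psi> =
    \<lparr> underlying = compose (topspace (points M)) (underlying \<phi>) (underlying \<psi>),
      pullback = (\<lambda>V f. if openin (points M) V \<and> f \<in> carrier (superfunctions M V)
        then pullback \<psi> (preimage M \<phi> V) (pullback \<phi> V f) else undefined) \<rparr>"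

definition automorphism :: "('p, 's) supermanifold \<Rightarrow> ('p, 's) morphism \<Rightarrow> bool"
  where "automorphism M \<phi> \<longleftrightarrow> endomorphism M \<phi> \<and>
    (\<exists>\<psi>. endomorphism M \<psi> \<and> compose_morphism M \<phi> \<psi> = identity_morphism M \<and>
       compose_morphism M \<psi> \<phi> = identity_morphism M)"

definition Aut :: "('p, 's) supermanifold \<Rightarrow> ('p, 's) morphism monoid"
  where "Aut M =
    \<lparr> carrier = {\<phi>. automorphism M \<phi>}, mult = compose_morphism M, one = identity_morphism M \<rparr>"

text \<open>For \<open>f\<close> over \<open>V\<close> and local coordinates \<open>(z, \<Phi>)\<close> on \<open>U\<close>, the coefficient \<open>\<phi>\<^sub>f\<^sub>,\<^sub>\<nu>\<close> in
  \<open>\<phi>\<^sup>*(f) = \<Sum>\<^sub>\<nu> \<phi>\<^sub>f\<^sub>,\<^sub>\<nu> \<theta>\<^sup>\<nu>\<close>, which is defined on the part of \<open>U\<close> that is mapped to \<open>V\<close>.\<close>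

definition pullback_coeff ::
    "('p, 's) supermanifold \<Rightarrow> 'p set \<Rightarrow> ('p set \<Rightarrow> 's \<Rightarrow> nat set \<Rightarrow> 'p \<Rightarrow> complex) \<Rightarrow>
     'p set \<Rightarrow> 's \<Rightarrow> ('p, 's) morphism \<Rightarrow> nat set \<Rightarrow> 'p \<Rightarrow> complex"
  where "pullback_coeff M U \<Phi> V f \<phi> =
    (let W = U \<inter> preimage M \<phi> V
     in \<Phi> W (res (structure_sheaf M) (preimage M \<phi> V) W (pullback \<phi> V f)))"

definition Aut_subbasic ::
    "nat \<Rightarrow> ('p, 's) supermanifold \<Rightarrow> 'p set \<Rightarrow> 'p set \<Rightarrow> ('p set \<Rightarrow> 's \<Rightarrow> nat set \<Rightarrow> 'p \<Rightarrow> complex) \<Rightarrow>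
     'p set \<Rightarrow> 's \<Rightarrow> (nat set \<Rightarrow> complex set) \<Rightarrow> ('p, 's) morphism set"
  where "Aut_subbasic n M K D \<Phi> U f T =
    {\<phi> \<in> carrier (Aut M). underlying \<phi> ` K \<subseteq> U \<and>
       (\<forall>\<nu>\<subseteq>{..<n}. pullback_coeff M D \<Phi> U f \<phi> \<nu> ` K \<subseteq> T \<nu>)}"

definition Aut_topology :: "nat \<Rightarrow> nat \<Rightarrow> ('p, 's) supermanifold \<Rightarrow> ('p, 's) morphism topology"
  where "Aut_topology m n M = topology_generated_by
    {Aut_subbasic n M K D \<Phi> U f T | K D z \<Phi> U f T.
       local_coordinates m n M D z \<Phi> \<and> compactin (points M) K \<and> K \<subseteq> D \<and>
       openin (points M) U \<and> f \<in> carrier (superfunctions M U) \<and> (\<forall>\<nu>\<subseteq>{..<n}. open (T \<nu>))}"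


section \<open>One-parameter subgroups and analytic actions\<close>

definition one_parameter_subgroup ::
    "nat \<Rightarrow> nat \<Rightarrow> ('p, 's) supermanifold \<Rightarrow> (real \<Rightarrow> ('p, 's) morphism) \<Rightarrow> bool"
  where "one_parameter_subgroup m n M \<phi> \<longleftrightarrow>
    \<phi> \<in> hom (add_monoid (ring_of_type_algebra :: real ring)) (Aut M) \<and>
    continuous_map euclidean (Aut_topology m n M) \<phi>"

definition analytic_action ::
    "nat \<Rightarrow> nat \<Rightarrow> ('p, 's) supermanifold \<Rightarrow> (real \<Rightarrow> ('p, 's) morphism) \<Rightarrow> bool"
  where "analytic_action m n M \<phi> \<longleftrightarrow>
    (\<forall>U V a b z \<Phi> f.
       openin (points M) U \<and> openin (points M) V \<and> a \<le> b \<and>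
       (\<forall>t\<in>{a..b}. underlying (\<phi> t) ` U \<subseteq> V) \<and>
       local_coordinates m n M U z \<Phi> \<and> f \<in> carrier (superfunctions M V) \<longrightarrow>
       (\<forall>\<nu>\<subseteq>{..<n}. jointly_analytic_on m a b (z ` U)
          (\<lambda>t p. pullback_coeff M U \<Phi> V f (\<phi> t) \<nu> (inv_into U z p))))"

end

theory Submission
  imports Defs "HOL-Complex_Analysis.Complex_Analysis"
begin

text \<open>
  Analyticity of \<open>\<phi>\<^sub>t\<^sup>*(f)\<close> in \<open>(t, z)\<close> is a local question, and the group law
  \<open>\<phi>\<^sub>t\<^sup>*(f) = \<phi>\<^sub>t\<^sub>-\<^sub>s\<^sup>*(\<phi>\<^sub>s\<^sup>*(f))\<close> moves it to the time \<open>0\<close>. So let \<open>g\<close> be a superfunction on a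
  polydisc in local coordinates, and let \<open>T\<^sub>h\<close> be the pullback by \<open>\<phi>\<^sub>h\<close> for small \<open>h\<close>, as a map from
  superfunctions on a polydisc to superfunctions on a slightly smaller one. The coefficients of
  superfunctions are measured by the \<open>\<ell>\<^sup>1\<close>-norm of their Taylor coefficients at a given radius. It
  is submultiplicative and does not increase under substitution of power series; Cauchy's estimates
  bound it by suprema on larger polydiscs, which are what the topology of the automorphism group
  controls. The proof then has three steps.

  The first step concerns a single algebra homomorphism \<open>T\<close>. By division of power series and nilpotency
  of odd elements, \<open>T\<close> acts on power series by substitution (\<open>map_series\<close>). If it moves the
  coordinates and the products of the odd coordinates by at most \<open>d\<close>, it therefore moves a
  superfunction of norm \<open>B\<close> at radius \<open>r + \<sigma>\<close> by at most \<open>2 d B / \<sigma>\<close> at radius \<open>r\<close>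
  (\<open>map_minus_id\<close>). In other words, \<open>T - 1\<close> behaves like a differential operator of order one with
  coefficients of size \<open>d\<close>.

  In the second step, continuity of the subgroup makes the displacement of finitely many generators
  small for all small times (\<open>flow_near_identity\<close>). Averaging over an orbit, as in the proof that
  continuous one-parameter groups of matrices are differentiable, and inserting the first step improves
  this to a displacement of size \<open>C h\<close> at time \<open>h\<close> (\<open>generator_lipschitz\<close>).

  In the third step, the difference of order \<open>K\<close> and mesh \<open>h\<close> of an orbit \<open>t \<mapsto> T\<^sub>t g\<close> is
  \<open>(T\<^sub>h - 1)\<^sup>K\<close> applied to a point of the orbit. With radius \<open>\<rho> / K\<close> given up at each of the \<open>K\<close>
  factors, the first two steps bound it by \<open>(2 C K h / \<rho>)\<^sup>K\<close> times the norm of the orbit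
  (\<open>diff_bound\<close>). As \<open>K\<^sup>K\<close> is at most \<open>e\<^sup>K K!\<close>, Newton's interpolation formula converges to a power
  series in \<open>t\<close> when \<open>h\<close> tends to \<open>0\<close> (\<open>analytic_from_differences\<close>). This holds for every Taylor
  coefficient in \<open>z\<close>, with the same radius and with bounds that make the double series in \<open>(t, z)\<close>
  converge (\<open>orbit_analytic\<close>).
\<close>

section \<open>Coefficient families of bounded weighted norm\<close>

text \<open>The bound \<open>(\<Sum>i\<in>I. |c\<^sub>i| \<omega>\<^sub>i) \<le> B\<close> is expressed by finite partial sums, so that it carries summability with it.\<close>

definition l1_bounded :: "'i set \<Rightarrow> ('i \<Rightarrow> real) \<Rightarrow> real \<Rightarrow> ('i \<Rightarrow> complex) \<Rightarrow> bool"
  where "l1_bounded I \<omega> B c \<longleftrightarrow> (\<forall>F. finite F \<and> F \<subseteq> I \<longrightarrow> (\<Sum>i\<in>F. cmod (c i) * \<omega> i) \<le> B)"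

lemma l1_bounded_nonneg: "l1_bounded I \<omega> B c \<Longrightarrow> 0 \<le> B"
  unfolding l1_bounded_def by (metis empty_subsetI finite.emptyI sum.empty)

lemma l1_bounded_mono: "l1_bounded I \<omega> B c \<Longrightarrow> B \<le> B' \<Longrightarrow> l1_bounded I \<omega> B' c"
  unfolding l1_bounded_def by (meson order_trans)

lemma l1_bounded_coeff: "l1_bounded I \<omega> B c \<Longrightarrow> i \<in> I \<Longrightarrow> cmod (c i) * \<omega> i \<le> B"
  unfolding l1_bounded_def by (drule spec[of _ "{i}"]) simp

lemma l1_bounded_weight_mono:
  assumes "l1_bounded I \<omega> B c" "\<And>i. i \<in> I \<Longrightarrow> cmod (c' i) * \<omega>' i \<le> cmod (c i) * \<omega> i"
  shows "l1_bounded I \<omega>' B c'"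
  unfolding l1_bounded_def
proof safe
  fix F assume "finite F" "F \<subseteq> I"
  then have "(\<Sum>i\<in>F. cmod (c' i) * \<omega>' i) \<le> (\<Sum>i\<in>F. cmod (c i) * \<omega> i)"
    using assms(2) by (intro sum_mono) auto
  also have "\<dots> \<le> B" using assms(1) \<open>finite F\<close> \<open>F \<subseteq> I\<close> by (simp add: l1_bounded_def)
  finally show "(\<Sum>i\<in>F. cmod (c' i) * \<omega>' i) \<le> B" .
qed

lemma l1_bounded_add:
  assumes "l1_bounded I \<omega> B c" "l1_bounded I \<omega> B' c'" "\<And>i. i \<in> I \<Longrightarrow> 0 \<le> \<omega> i"
  shows "l1_bounded I \<omega> (B + B') (\<lambda>i. c i + c' i)"
  unfolding l1_bounded_def
proof safe
  fix F assume F: "finite F" "F \<subseteq> I"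
  have "(\<Sum>i\<in>F. cmod (c i + c' i) * \<omega> i) \<le> (\<Sum>i\<in>F. cmod (c i) * \<omega> i + cmod (c' i) * \<omega> i)"
    using F assms(3) by (intro sum_mono) (simp add: subset_iff mult_right_mono norm_triangle_ineq flip: distrib_right)
  also have "\<dots> \<le> B + B'"
    using F assms(1,2) unfolding l1_bounded_def sum.distrib by (intro add_mono) auto
  finally show "(\<Sum>i\<in>F. cmod (c i + c' i) * \<omega> i) \<le> B + B'" .
qed

lemma l1_bounded_cmult:
  assumes "l1_bounded I \<omega> B c"
  shows "l1_bounded I \<omega> (cmod k * B) (\<lambda>i. k * c i)"
  unfolding l1_bounded_def norm_mult mult.assoc
  using assms by (auto simp: l1_bounded_def mult_left_mono simp flip: sum_distrib_left)

lemma l1_bounded_single: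
  assumes "\<And>i. i \<in> I \<Longrightarrow> 0 \<le> \<omega> i" "j \<in> I \<Longrightarrow> cmod k * \<omega> j \<le> B" "0 \<le> B"
  shows "l1_bounded I \<omega> B (\<lambda>i. if i = j then k else 0)"
  unfolding l1_bounded_def
proof safe
  fix F assume F: "finite F" "F \<subseteq> I"
  have "(\<Sum>i\<in>F. cmod (if i = j then k else 0) * \<omega> i) = (\<Sum>i\<in>F. if i = j then cmod k * \<omega> j else 0)"
    by (intro sum.cong) auto
  also have "\<dots> \<le> B" using F assms by (auto simp: subset_iff)
  finally show "(\<Sum>i\<in>F. cmod (if i = j then k else 0) * \<omega> i) \<le> B" .
qed

lemma l1_bounded_abs_summable:
  assumes "l1_bounded I \<omega> B c" "\<And>i. i \<in> I \<Longrightarrow> cmod (e i) \<le> \<omega> i"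
  shows "(\<lambda>i. cmod (c i * e i)) summable_on I"
    and "(\<Sum>\<^sub>\<infinity>i\<in>I. cmod (c i * e i)) \<le> B"
proof -
  have *: "(\<Sum>i\<in>F. cmod (c i * e i)) \<le> B" if F: "finite F" "F \<subseteq> I" for F
  proof -
    have "(\<Sum>i\<in>F. cmod (c i * e i)) \<le> (\<Sum>i\<in>F. cmod (c i) * \<omega> i)"
      using F assms(2) by (intro sum_mono) (auto simp: norm_mult intro!: mult_left_mono)
    then show ?thesis using assms(1) F by (force simp: l1_bounded_def)
  qed
  show S: "(\<lambda>i. cmod (c i * e i)) summable_on I"
    using * by (intro nonneg_bdd_above_summable_on) (auto simp: bdd_above_def)
  show "(\<Sum>\<^sub>\<infinity>i\<in>I. cmod (c i * e i)) \<le> B"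
    using * by (intro infsum_le_finite_sums S) auto
qed

lemma l1_bounded_has_sum:
  assumes "l1_bounded I \<omega> B c" "\<And>i. i \<in> I \<Longrightarrow> cmod (e i) \<le> \<omega> i"
  shows "((\<lambda>i. c i * e i) has_sum (\<Sum>\<^sub>\<infinity>i\<in>I. c i * e i)) I"
    and "cmod (\<Sum>\<^sub>\<infinity>i\<in>I. c i * e i) \<le> B"
proof -
  note S = l1_bounded_abs_summable[OF assms]
  show "((\<lambda>i. c i * e i) has_sum (\<Sum>\<^sub>\<infinity>i\<in>I. c i * e i)) I"
    by (rule has_sum_infsum[OF abs_summable_summable[OF S(1)]])
  show "cmod (\<Sum>\<^sub>\<infinity>i\<in>I. c i * e i) \<le> B"
    using norm_infsum_bound[OF S(1)] S(2) by (rule order_trans)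
qed

lemma l1_boundedI_abs_summable:
  assumes "(\<lambda>i. cmod (c i * of_real (\<omega> i))) summable_on I" "\<And>i. i \<in> I \<Longrightarrow> 0 \<le> \<omega> i"
    "(\<Sum>\<^sub>\<infinity>i\<in>I. cmod (c i * of_real (\<omega> i))) \<le> B"
  shows "l1_bounded I \<omega> B c"
  unfolding l1_bounded_def
proof safe
  fix F assume F: "finite F" "F \<subseteq> I"
  have "(\<Sum>i\<in>F. cmod (c i) * \<omega> i) = (\<Sum>i\<in>F. cmod (c i * of_real (\<omega> i)))"
    using F assms(2) by (intro sum.cong) (auto simp: norm_mult subset_iff)
  also have "\<dots> \<le> (\<Sum>\<^sub>\<infinity>i\<in>I. cmod (c i * of_real (\<omega> i)))"
    using F assms(1) by (intro finite_sum_le_infsum) auto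
  finally show "(\<Sum>i\<in>F. cmod (c i) * \<omega> i) \<le> B" using assms(3) by simp
qed

lemma has_sum_finite_sum:
  fixes f :: "'a \<Rightarrow> 'b \<Rightarrow> 'c :: {topological_comm_monoid_add}"
  assumes "finite F" "\<And>i. i \<in> F \<Longrightarrow> (f i has_sum s i) K"
  shows "((\<lambda>k. \<Sum>i\<in>F. f i k) has_sum (\<Sum>i\<in>F. s i)) K"
  using assms by (induction F rule: finite_induct) (auto intro!: has_sum_add)

text \<open>
  Fubini's theorem for a sum of families whose weighted norms are summable. The numbers \<open>e\<^sub>i\<close>,
  dominated by the weight, stand for the values at which the families are evaluated: for power
  series these are the values of the monomials at a point, but also the coefficients of their
  images under an algebra homomorphism.
\<close>

lemma l1_bounded_sum:
  assumes pos: "\<And>i. i \<in> I \<Longrightarrow> 0 < \<omega> i"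
    and d: "\<And>k. k \<in> K \<Longrightarrow> l1_bounded I \<omega> (\<beta> k) (d k)" and \<beta>: "(\<beta> has_sum S) K"
  shows "l1_bounded I \<omega> S (\<lambda>i. \<Sum>\<^sub>\<infinity>k\<in>K. d k i)" (is ?A)
    and "(\<And>i. i \<in> I \<Longrightarrow> cmod (e i) \<le> \<omega> i) \<Longrightarrow>
      ((\<lambda>k. \<Sum>\<^sub>\<infinity>i\<in>I. d k i * e i) has_sum (\<Sum>\<^sub>\<infinity>i\<in>I. (\<Sum>\<^sub>\<infinity>k\<in>K. d k i) * e i)) K"
proof -
  have \<beta>0: "0 \<le> \<beta> k" if "k \<in> K" for k using d[OF that] by (rule l1_bounded_nonneg)
  have key: "(\<lambda>(k, i). cmod (d k i * e i)) summable_on K \<times> I \<and>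
      (\<Sum>\<^sub>\<infinity>(k, i)\<in>K \<times> I. cmod (d k i * e i)) \<le> S"
    if e: "\<And>i. i \<in> I \<Longrightarrow> cmod (e i) \<le> \<omega> i" for e
  proof -
    have 1: "(\<lambda>i. cmod (d k i * e i)) summable_on I" "(\<Sum>\<^sub>\<infinity>i\<in>I. cmod (d k i * e i)) \<le> \<beta> k"
      if "k \<in> K" for k
      using l1_bounded_abs_summable[OF d[OF that], of e] e by auto
    have 2: "(\<lambda>k. norm (\<Sum>\<^sub>\<infinity>i\<in>I. cmod (d k i * e i))) summable_on K"
    proof (rule Infinite_Sum.abs_summable_on_comparison_test[of \<beta>])
      show "(\<lambda>k. norm (\<beta> k)) summable_on K"
        using \<beta> by (simp only: has_sum_imp_summable flip: summable_on_iff_abs_summable_on_real)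
    qed (use 1 \<beta>0 in \<open>auto simp: infsum_nonneg\<close>)
    have 3: "(\<lambda>(k, i). cmod (d k i * e i)) summable_on K \<times> I"
      using Infinite_Sum.abs_summable_on_Sigma_iff[of "\<lambda>(k, i). d k i * e i" K "\<lambda>_. I"] 1 2 by (simp add: case_prod_unfold)
    have "(\<Sum>\<^sub>\<infinity>(k, i)\<in>K \<times> I. cmod (d k i * e i)) = (\<Sum>\<^sub>\<infinity>k\<in>K. \<Sum>\<^sub>\<infinity>i\<in>I. cmod (d k i * e i))"
      by (rule infsum_Sigma'_banach[OF 3, symmetric])
    also have "\<dots> \<le> infsum \<beta> K"
    proof (rule infsum_mono)
      show "(\<lambda>k. \<Sum>\<^sub>\<infinity>i\<in>I. cmod (d k i * e i)) summable_on K"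
        using 2 by (simp add: infsum_nonneg)
      show "\<beta> summable_on K" using \<beta> by (rule has_sum_imp_summable)
    qed (use 1 in blast)
    finally show ?thesis using 3 \<beta> by (simp add: infsumI)
  qed
  have col: "(\<lambda>k. cmod (d k i)) summable_on K" if "i \<in> I" for i
  proof -
    have "(\<lambda>(k, i). cmod (d k i * of_real (\<omega> i))) summable_on K \<times> I"
      using key[of "\<lambda>i. of_real (\<omega> i)"] pos by (simp add: less_imp_le)
    then have "(\<lambda>(k, i). cmod (d k i * of_real (\<omega> i))) summable_on ((\<lambda>k. (k, i)) ` K)"
      by (rule summable_on_subset_banach) (use that in auto)
    then have "(\<lambda>k. cmod (d k i * of_real (\<omega> i))) summable_on K"
      by (subst (asm) summable_on_reindex) (auto simp: inj_on_def o_def)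
    then have "(\<lambda>k. cmod (d k i) * \<omega> i) summable_on K"
      using pos[OF that] by (simp add: norm_mult)
    then show ?thesis
      using pos[OF that] summable_on_cmult_left'[of "\<omega> i" "\<lambda>k. cmod (d k i)" K] by simp
  qed
  have e_case: "((\<lambda>k. \<Sum>\<^sub>\<infinity>i\<in>I. d k i * e i) has_sum (\<Sum>\<^sub>\<infinity>i\<in>I. (\<Sum>\<^sub>\<infinity>k\<in>K. d k i) * e i)) K"
    if e: "\<And>i. i \<in> I \<Longrightarrow> cmod (e i) \<le> \<omega> i" for e
  proof -
    have s: "(\<lambda>(k, i). d k i * e i) summable_on K \<times> I"
      by (rule abs_summable_summable) (use key[OF e] in \<open>simp add: case_prod_unfold\<close>)
    define T where "T = (\<Sum>\<^sub>\<infinity>(k, i)\<in>K \<times> I. d k i * e i)"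
    have T: "((\<lambda>(k, i). d k i * e i) has_sum T) (K \<times> I)"
      unfolding T_def using s by simp
    have 1: "((\<lambda>k. \<Sum>\<^sub>\<infinity>i\<in>I. d k i * e i) has_sum T) K"
      using T by (rule has_sum_SigmaD) (use l1_bounded_has_sum(1)[OF d] e in auto)
    have "((\<lambda>(i, k). d k i * e i) has_sum T) (I \<times> K)"
      using T by (subst has_sum_swap) (simp add: case_prod_unfold)
    then have "((\<lambda>i. (\<Sum>\<^sub>\<infinity>k\<in>K. d k i) * e i) has_sum T) I"
      by (rule has_sum_SigmaD) (auto intro!: has_sum_cmult_left has_sum_infsum abs_summable_summable col)
    then show ?thesis using 1 by (simp add: infsumI)
  qed
  then show "(\<And>i. i \<in> I \<Longrightarrow> cmod (e i) \<le> \<omega> i) \<Longrightarrow>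
      ((\<lambda>k. \<Sum>\<^sub>\<infinity>i\<in>I. d k i * e i) has_sum (\<Sum>\<^sub>\<infinity>i\<in>I. (\<Sum>\<^sub>\<infinity>k\<in>K. d k i) * e i)) K" by blast
  show ?A
    unfolding l1_bounded_def
  proof safe
    fix F assume F: "finite F" "F \<subseteq> I"
    have "(\<Sum>i\<in>F. cmod (\<Sum>\<^sub>\<infinity>k\<in>K. d k i) * \<omega> i) \<le> (\<Sum>i\<in>F. (\<Sum>\<^sub>\<infinity>k\<in>K. cmod (d k i)) * \<omega> i)"
      using F pos col by (intro sum_mono mult_right_mono norm_infsum_bound) (auto simp: less_imp_le subset_iff)
    also have "\<dots> = (\<Sum>i\<in>F. (\<Sum>\<^sub>\<infinity>k\<in>K. cmod (d k i) * \<omega> i))"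
      by (simp add: infsum_cmult_left')
    also have "\<dots> = (\<Sum>\<^sub>\<infinity>k\<in>K. (\<Sum>i\<in>F. cmod (d k i) * \<omega> i))"
      by (rule infsumI[symmetric], rule has_sum_finite_sum[OF F(1)], rule has_sum_infsum,
          rule summable_on_cmult_left, rule col) (use F in auto)
    also have "\<dots> \<le> infsum \<beta> K"
    proof (rule infsum_mono)
      show "(\<lambda>k. (\<Sum>i\<in>F. cmod (d k i) * \<omega> i)) summable_on K"
        by (rule has_sum_imp_summable, rule has_sum_finite_sum[OF F(1)], rule has_sum_infsum,
            rule summable_on_cmult_left, rule col) (use F in auto)
      show "\<beta> summable_on K" using \<beta> by (rule has_sum_imp_summable)
      show "(\<Sum>i\<in>F. cmod (d k i) * \<omega> i) \<le> \<beta> k" if "k \<in> K" for k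
        using d[OF that] F by (auto simp: l1_bounded_def)
    qed
    finally show "(\<Sum>i\<in>F. cmod (\<Sum>\<^sub>\<infinity>k\<in>K. d k i) * \<omega> i) \<le> S" using \<beta> by (simp add: infsumI)
  qed
qed

section \<open>Multi-indices\<close>

definition multi_degree :: "nat \<Rightarrow> (nat \<Rightarrow> nat) \<Rightarrow> nat"
  where "multi_degree m \<alpha> = (\<Sum>i<m. \<alpha> i)"

definition multi_zero :: "nat \<Rightarrow> nat \<Rightarrow> nat"
  where "multi_zero m = (\<lambda>i\<in>{..<m}. 0)"

definition multi_add :: "nat \<Rightarrow> (nat \<Rightarrow> nat) \<Rightarrow> (nat \<Rightarrow> nat) \<Rightarrow> nat \<Rightarrow> nat"
  where "multi_add m \<alpha> \<beta> = (\<lambda>i\<in>{..<m}. \<alpha> i + \<beta> i)"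

definition multi_unit :: "nat \<Rightarrow> nat \<Rightarrow> nat \<Rightarrow> nat"
  where "multi_unit m j = (\<lambda>i\<in>{..<m}. if i = j then 1 else 0)"

lemma multi_zero_in [simp]: "multi_zero m \<in> multi_indices m"
  and multi_add_in [simp]: "multi_add m \<alpha> \<beta> \<in> multi_indices m"
  and multi_unit_in [simp]: "multi_unit m j \<in> multi_indices m"
  by (auto simp: multi_zero_def multi_add_def multi_unit_def multi_indices_def)

lemma multi_degree_zero [simp]: "multi_degree m (multi_zero m) = 0"
  and multi_degree_add [simp]: "multi_degree m (multi_add m \<alpha> \<beta>) = multi_degree m \<alpha> + multi_degree m \<beta>"
  and multi_degree_unit [simp]: "j < m \<Longrightarrow> multi_degree m (multi_unit m j) = 1"
  by (simp_all add: multi_degree_def multi_zero_def multi_add_def multi_unit_def sum.distrib sum.If_cases)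

lemma multi_degree_eq_0_iff: "\<alpha> \<in> multi_indices m \<Longrightarrow> multi_degree m \<alpha> = 0 \<longleftrightarrow> \<alpha> = multi_zero m"
  unfolding multi_degree_def multi_zero_def multi_indices_def
  by (auto simp: PiE_def extensional_def fun_eq_iff restrict_def)

lemma multi_power_zero [simp]: "multi_power m w (multi_zero m) = 1"
  and multi_power_add: "multi_power m w (multi_add m \<alpha> \<beta>) = multi_power m w \<alpha> * multi_power m w \<beta>"
  by (simp_all add: multi_power_def multi_zero_def multi_add_def power_add prod.distrib)

lemma multi_power_unit [simp]: "j < m \<Longrightarrow> multi_power m w (multi_unit m j) = w j"
  unfolding multi_power_def multi_unit_def
  by (subst prod.cong[OF refl, of _ _ "\<lambda>i. if i = j then w j else 1"]) auto

lemma multi_power_cong: "(\<And>i. i < m \<Longrightarrow> w i = w' i) \<Longrightarrow> multi_power m w \<alpha> = multi_power m w' \<alpha>"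
  unfolding multi_power_def by (intro prod.cong) auto

lemma multi_power_bound:
  assumes "\<And>i. i < m \<Longrightarrow> cmod (w i) \<le> r"
  shows "cmod (multi_power m w \<alpha>) \<le> r ^ multi_degree m \<alpha>"
proof -
  have "cmod (multi_power m w \<alpha>) = (\<Prod>i<m. cmod (w i) ^ \<alpha> i)"
    by (simp add: multi_power_def norm_power flip: prod_norm)
  also have "\<dots> \<le> (\<Prod>i<m. r ^ \<alpha> i)"
    using assms by (intro prod_mono) (auto intro: power_mono)
  finally show ?thesis by (simp add: multi_degree_def power_sum)
qed

lemma multi_power_0:
  assumes "\<alpha> \<in> multi_indices m" "\<And>i. i < m \<Longrightarrow> w i = 0"
  shows "multi_power m w \<alpha> = (if \<alpha> = multi_zero m then 1 else 0)"
proof (cases "\<alpha> = multi_zero m")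
  case False
  then have "multi_degree m \<alpha> \<noteq> 0" using assms(1) multi_degree_eq_0_iff by blast
  then obtain i where "i < m" "\<alpha> i \<noteq> 0" by (auto simp: multi_degree_def)
  then show ?thesis using False assms(2) by (auto simp: multi_power_def intro!: prod_zero bexI[of _ i])
qed auto

lemma multi_index_split:
  assumes "\<alpha> \<in> multi_indices m" "\<alpha> \<noteq> multi_zero m"
  obtains j \<beta> where "j < m" "\<beta> \<in> multi_indices m" "\<alpha> = multi_add m (multi_unit m j) \<beta>"
    "multi_degree m \<alpha> = Suc (multi_degree m \<beta>)"
proof -
  have "multi_degree m \<alpha> \<noteq> 0" using assms multi_degree_eq_0_iff by blast
  then obtain j where j: "j < m" "\<alpha> j \<noteq> 0" by (auto simp: multi_degree_def)
  define \<beta> where "\<beta> = (\<lambda>i\<in>{..<m}. if i = j then \<alpha> j - 1 else \<alpha> i)"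
  have eq: "\<alpha> = multi_add m (multi_unit m j) \<beta>"
    using j assms(1) by (auto simp: fun_eq_iff \<beta>_def multi_add_def multi_unit_def multi_indices_def PiE_def extensional_def)
  have "\<beta> \<in> multi_indices m" by (simp add: \<beta>_def multi_indices_def)
  moreover have "multi_degree m \<alpha> = Suc (multi_degree m \<beta>)"
    by (subst eq) (use j in simp)
  ultimately show ?thesis using that j eq by blast
qed

lemma multi_index_induct [consumes 1, case_names zero add]:
  assumes "\<alpha> \<in> multi_indices m" "P (multi_zero m)"
    "\<And>j \<beta>. j < m \<Longrightarrow> \<beta> \<in> multi_indices m \<Longrightarrow> P \<beta> \<Longrightarrow> P (multi_add m (multi_unit m j) \<beta>)"
  shows "P \<alpha>"
  using assms(1)
proof (induction "multi_degree m \<alpha>" arbitrary: \<alpha> rule: less_induct)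
  case less
  show ?case
  proof (cases "\<alpha> = multi_zero m")
    case False
    then show ?thesis using less assms(3) by (elim multi_index_split[OF less.prems]) auto
  qed (use assms in simp)
qed

section \<open>Functions with a power series of bounded norm\<close>

abbreviation series_bounded :: "nat \<Rightarrow> real \<Rightarrow> real \<Rightarrow> ((nat \<Rightarrow> nat) \<Rightarrow> complex) \<Rightarrow> bool"
  where "series_bounded m r \<equiv> l1_bounded (multi_indices m) (\<lambda>\<alpha>. r ^ multi_degree m \<alpha>)"

definition series_value :: "nat \<Rightarrow> ((nat \<Rightarrow> nat) \<Rightarrow> complex) \<Rightarrow> (nat \<Rightarrow> complex) \<Rightarrow> complex"
  where "series_value m c w = (\<Sum>\<^sub>\<infinity>\<alpha>\<in>multi_indices m. c \<alpha> * multi_power m w \<alpha>)"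

text \<open>
  The \<open>y\<^sub>i\<close> are arbitrary functions on \<open>D\<close> rather than the coordinates of \<open>\<complex>\<^sup>m\<close>: below they are coordinates of a chart, centred at varying points, and
  coordinates of one chart expanded in those of another.
\<close>

definition majorized ::
    "nat \<Rightarrow> 'a set \<Rightarrow> ('a \<Rightarrow> nat \<Rightarrow> complex) \<Rightarrow> real \<Rightarrow> real \<Rightarrow> ('a \<Rightarrow> complex) \<Rightarrow> bool"
  where "majorized m D y r B f \<longleftrightarrow> (\<exists>c. series_bounded m r B c \<and> (\<forall>x. x \<in> D \<longrightarrow> f x = series_value m c (y x)))"

definition in_polydisc :: "nat \<Rightarrow> 'a set \<Rightarrow> ('a \<Rightarrow> nat \<Rightarrow> complex) \<Rightarrow> real \<Rightarrow> bool"
  where "in_polydisc m D y r \<longleftrightarrow> (\<forall>x\<in>D. \<forall>i<m. cmod (y x i) \<le> r)"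

lemma series_value_cong: "(\<And>i. i < m \<Longrightarrow> w i = w' i) \<Longrightarrow> series_value m c w = series_value m c w'"
  unfolding series_value_def by (intro infsum_cong) (simp add: multi_power_cong[of m w w'])

lemma series_value_has_sum:
  assumes "series_bounded m r B c" "\<And>i. i < m \<Longrightarrow> cmod (w i) \<le> r"
  shows "((\<lambda>\<alpha>. c \<alpha> * multi_power m w \<alpha>) has_sum series_value m c w) (multi_indices m)"
    and "cmod (series_value m c w) \<le> B"
  using l1_bounded_has_sum[OF assms(1), of "multi_power m w"] multi_power_bound[of m w r] assms(2)
  unfolding series_value_def by auto

lemma series_value_at_0:
  assumes "\<And>i. i < m \<Longrightarrow> w i = 0"
  shows "series_value m c w = c (multi_zero m)"
proof -
  have "series_value m c w = (\<Sum>\<^sub>\<infinity>\<alpha>\<in>{multi_zero m}. c \<alpha> * multi_power m w \<alpha>)"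
    unfolding series_value_def
    by (rule infsum_cong_neutral) (auto simp: multi_power_0[OF _ assms])
  then show ?thesis by simp
qed

lemma series_bounded_radius_mono:
  "series_bounded m r B c \<Longrightarrow> 0 \<le> r' \<Longrightarrow> r' \<le> r \<Longrightarrow> series_bounded m r' B c"
  by (erule l1_bounded_weight_mono) (auto intro!: mult_left_mono power_mono)

lemma majorized_nonneg: "majorized m D y r B f \<Longrightarrow> 0 \<le> B"
  unfolding majorized_def using l1_bounded_nonneg by blast

lemma majorized_mono:
  assumes "majorized m D y r B f" "D' \<subseteq> D" "0 \<le> r'" "r' \<le> r" "B \<le> B'"
  shows "majorized m D' y r' B' f"
proof -
  obtain c where c: "series_bounded m r B c" "\<forall>x. x \<in> D \<longrightarrow> f x = series_value m c (y x)"
    using assms(1) by (auto simp: majorized_def)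
  have "series_bounded m r' B' c"
    by (rule l1_bounded_mono[OF series_bounded_radius_mono[OF c(1) assms(3,4)] assms(5)])
  then show ?thesis using c(2) assms(2) unfolding majorized_def by (intro exI[of _ c]) auto
qed

lemma majorized_cong:
  assumes "majorized m D y r B f" "\<And>x. x \<in> D \<Longrightarrow> f x = g x"
  shows "majorized m D y r B g"
  using assms unfolding majorized_def by metis

lemma majorized_norm_le:
  assumes "majorized m D y r B f" "in_polydisc m D y r" "x \<in> D"
  shows "cmod (f x) \<le> B"
  using assms series_value_has_sum(2) unfolding majorized_def in_polydisc_def by metis

lemma majorized_cmult:
  assumes "majorized m D y r B f"
  shows "majorized m D y r (cmod k * B) (\<lambda>x. k * f x)"
proof -
  obtain c where c: "series_bounded m r B c" "\<forall>x. x \<in> D \<longrightarrow> f x = series_value m c (y x)"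
    using assms by (auto simp: majorized_def)
  have "series_value m (\<lambda>\<alpha>. k * c \<alpha>) w = k * series_value m c w" for w
    by (simp add: series_value_def mult.assoc infsum_cmult_right')
  then show ?thesis
    unfolding majorized_def using c l1_bounded_cmult by (intro exI[of _ "\<lambda>\<alpha>. k * c \<alpha>"]) auto
qed

lemma series_value_add:
  assumes "series_bounded m r B c" "series_bounded m r B' c'" "\<And>i. i < m \<Longrightarrow> cmod (w i) \<le> r"
  shows "series_value m (\<lambda>\<alpha>. c \<alpha> + c' \<alpha>) w = series_value m c w + series_value m c' w"
  using has_sum_add[OF series_value_has_sum(1)[OF assms(1,3)] series_value_has_sum(1)[OF assms(2,3)]]
  unfolding series_value_def[of m "\<lambda>\<alpha>. c \<alpha> + c' \<alpha>"] by (simp add: infsumI distrib_right)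

lemma majorized_add:
  assumes "majorized m D y r B f" "majorized m D y r B' g" "in_polydisc m D y r" "0 \<le> r"
  shows "majorized m D y r (B + B') (\<lambda>x. f x + g x)"
proof -
  obtain c c' where c: "series_bounded m r B c" "\<forall>x. x \<in> D \<longrightarrow> f x = series_value m c (y x)"
     and c': "series_bounded m r B' c'" "\<forall>x. x \<in> D \<longrightarrow> g x = series_value m c' (y x)"
    using assms(1,2) by (auto simp: majorized_def)
  show ?thesis
    unfolding majorized_def
    using c c' l1_bounded_add[OF c(1) c'(1)] series_value_add[OF c(1) c'(1)] assms(3,4)
    by (intro exI[of _ "\<lambda>\<alpha>. c \<alpha> + c' \<alpha>"]) (auto simp: in_polydisc_def)
qed

lemma majorized_const:
  assumes "cmod k \<le> B" "0 \<le> r"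
  shows "majorized m D y r B (\<lambda>x. k)"
  unfolding majorized_def
proof (intro exI conjI allI impI)
  let ?c = "\<lambda>\<alpha>. if \<alpha> = multi_zero m then k else 0"
  show "series_bounded m r B ?c"
    using assms norm_ge_zero[of k] by (intro l1_bounded_single) (simp, simp, linarith)
  fix x
  have "series_value m ?c (y x) = (\<Sum>\<^sub>\<infinity>\<alpha>\<in>{multi_zero m}. ?c \<alpha> * multi_power m (y x) \<alpha>)"
    unfolding series_value_def by (rule infsum_cong_neutral) auto
  then show "k = series_value m ?c (y x)" by simp
qed

lemma majorized_coordinate:
  assumes "j < m" "0 \<le> r"
  shows "majorized m D y r r (\<lambda>x. y x j)"
  unfolding majorized_def
proof (intro exI conjI allI impI)
  let ?c = "\<lambda>\<alpha>. if \<alpha> = multi_unit m j then 1 else 0"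
  show "series_bounded m r r ?c"
    using assms by (intro l1_bounded_single) auto
  fix x
  have "series_value m ?c (y x) = (\<Sum>\<^sub>\<infinity>\<alpha>\<in>{multi_unit m j}. ?c \<alpha> * multi_power m (y x) \<alpha>)"
    unfolding series_value_def by (rule infsum_cong_neutral) auto
  then show "y x j = series_value m ?c (y x)" using assms by simp
qed

text \<open>Completeness of the space of power series with finite norm.\<close>

lemma majorized_infsum:
  assumes f: "\<And>k. k \<in> K \<Longrightarrow> majorized m D y r (\<beta> k) (f k)"
    and \<beta>: "\<And>F. finite F \<Longrightarrow> F \<subseteq> K \<Longrightarrow> sum \<beta> F \<le> B"
    and g: "\<And>x. x \<in> D \<Longrightarrow> ((\<lambda>k. f k x) has_sum g x) K"
    and D: "in_polydisc m D y r" "0 < r"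
  shows "majorized m D y r B g"
proof -
  have "\<forall>k\<in>K. \<exists>c. series_bounded m r (\<beta> k) c \<and> (\<forall>x. x \<in> D \<longrightarrow> f k x = series_value m c (y x))"
    using f by (auto simp: majorized_def)
  then obtain d where d: "\<And>k. k \<in> K \<Longrightarrow> series_bounded m r (\<beta> k) (d k)"
      "\<And>k x. k \<in> K \<Longrightarrow> x \<in> D \<Longrightarrow> f k x = series_value m (d k) (y x)"
    using bchoice[of K "\<lambda>k c. series_bounded m r (\<beta> k) c \<and> (\<forall>x. x \<in> D \<longrightarrow> f k x = series_value m c (y x))"]
    by blast
  have s: "\<beta> summable_on K"
  proof (rule nonneg_bdd_above_summable_on)
    show "0 \<le> \<beta> k" if "k \<in> K" for k using d(1)[OF that] by (rule l1_bounded_nonneg)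
    show "bdd_above (sum \<beta> ` {F. F \<subseteq> K \<and> finite F})" using \<beta> by (intro bdd_aboveI2[of _ _ B]) auto
  qed
  then have hs: "(\<beta> has_sum infsum \<beta> K) K" by simp
  have le: "infsum \<beta> K \<le> B" using s \<beta> by (rule infsum_le_finite_sums)
  define c where "c = (\<lambda>\<alpha>. \<Sum>\<^sub>\<infinity>k\<in>K. d k \<alpha>)"
  have pos: "0 < r ^ multi_degree m \<alpha>" for \<alpha> using D(2) by simp
  have "series_bounded m r B c"
    unfolding c_def by (rule l1_bounded_mono[OF l1_bounded_sum(1)[OF pos d(1) hs] le])
  moreover have "g x = series_value m c (y x)" if x: "x \<in> D" for x
  proof -
    have "((\<lambda>k. series_value m (d k) (y x)) has_sum series_value m c (y x)) K"
      unfolding series_value_def c_def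
      by (rule l1_bounded_sum(2)[OF pos d(1) hs])
        (use D x in \<open>auto simp: in_polydisc_def intro!: multi_power_bound\<close>)
    then have "((\<lambda>k. f k x) has_sum series_value m c (y x)) K"
      by (rule has_sum_cong[THEN iffD1, rotated]) (use d x in auto)
    then show ?thesis using g[OF x] has_sum_unique by blast
  qed
  ultimately show ?thesis unfolding majorized_def by blast
qed

lemma majorized_shift:
  assumes "majorized m D y r B f" "0 \<le> r" "\<beta> \<in> multi_indices m"
  shows "majorized m D y r (r ^ multi_degree m \<beta> * B) (\<lambda>x. multi_power m (y x) \<beta> * f x)"
proof -
  obtain c where c: "series_bounded m r B c" "\<forall>x. x \<in> D \<longrightarrow> f x = series_value m c (y x)"
    using assms by (auto simp: majorized_def)
  let ?I = "multi_indices m" and ?\<omega> = "\<lambda>\<alpha>. r ^ multi_degree m \<alpha>"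
  define S where "S = multi_add m \<beta>"
  have inj: "inj_on S ?I"
    unfolding S_def inj_on_def multi_add_def multi_indices_def
    by (auto simp: fun_eq_iff PiE_def extensional_def) (metis add_left_cancel)
  have SI: "S ` ?I \<subseteq> ?I" by (auto simp: S_def)
  define c' where "c' \<gamma> = (if \<gamma> \<in> S ` ?I then c (inv_into ?I S \<gamma>) else 0)" for \<gamma>
  have c'S: "c' (S \<alpha>) = c \<alpha>" if "\<alpha> \<in> ?I" for \<alpha>
    using that inj by (simp add: c'_def)
  have "series_bounded m r (?\<omega> \<beta> * B) c'"
    unfolding l1_bounded_def
  proof safe
    fix F assume F: "finite F" "F \<subseteq> ?I"
    define G where "G = {\<alpha>\<in>?I. S \<alpha> \<in> F}"
    have G: "G \<subseteq> ?I" "F \<inter> S ` ?I = S ` G" by (auto simp: G_def)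
    moreover have "finite (S ` G)" using F G(2) by (metis finite_Int)
    ultimately have "finite G" using inj by (meson finite_imageD inj_on_subset)
    note G = this G
    have "(\<Sum>\<gamma>\<in>F. cmod (c' \<gamma>) * ?\<omega> \<gamma>) = (\<Sum>\<gamma>\<in>S ` G. cmod (c' \<gamma>) * ?\<omega> \<gamma>)"
      unfolding G(3)[symmetric] using F by (intro sum.mono_neutral_right) (auto simp: c'_def)
    also have "\<dots> = (\<Sum>\<alpha>\<in>G. cmod (c' (S \<alpha>)) * ?\<omega> (S \<alpha>))"
      using inj G(2) by (subst sum.reindex) (auto intro: inj_on_subset)
    also have "\<dots> = ?\<omega> \<beta> * (\<Sum>\<alpha>\<in>G. cmod (c \<alpha>) * ?\<omega> \<alpha>)"
      using G(2) c'S by (auto simp: S_def power_add sum_distrib_left subset_iff intro!: sum.cong)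
    also have "\<dots> \<le> ?\<omega> \<beta> * B"
      using c(1) G assms(2) unfolding l1_bounded_def by (intro mult_left_mono) auto
    finally show "(\<Sum>\<gamma>\<in>F. cmod (c' \<gamma>) * ?\<omega> \<gamma>) \<le> ?\<omega> \<beta> * B" .
  qed
  moreover have "series_value m c' w = multi_power m w \<beta> * series_value m c w" for w
  proof -
    have "series_value m c' w = (\<Sum>\<^sub>\<infinity>\<gamma>\<in>S ` ?I. c' \<gamma> * multi_power m w \<gamma>)"
      unfolding series_value_def using SI by (intro infsum_cong_neutral) (auto simp: c'_def)
    also have "\<dots> = (\<Sum>\<^sub>\<infinity>\<alpha>\<in>?I. c' (S \<alpha>) * multi_power m w (S \<alpha>))"
      using inj by (simp add: infsum_reindex o_def)
    also have "\<dots> = (\<Sum>\<^sub>\<infinity>\<alpha>\<in>?I. multi_power m w \<beta> * (c \<alpha> * multi_power m w \<alpha>))"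
      by (intro infsum_cong) (simp add: c'S, simp add: S_def multi_power_add)
    finally show ?thesis by (simp add: series_value_def infsum_cmult_right')
  qed
  ultimately show ?thesis unfolding majorized_def using c by (intro exI[of _ c']) auto
qed

text \<open>
  The norm is submultiplicative: expanding the first factor writes the product as a sum of
  multiples of the second factor by monomials.
\<close>

lemma majorized_mult:
  assumes f: "majorized m D y r B f" and g: "majorized m D y r B' g"
    and D: "in_polydisc m D y r" "0 < r"
  shows "majorized m D y r (B * B') (\<lambda>x. f x * g x)"
proof -
  obtain c where c: "series_bounded m r B c" "\<forall>x. x \<in> D \<longrightarrow> f x = series_value m c (y x)"
    using f by (auto simp: majorized_def)
  show ?thesis
  proof (rule majorized_infsum[OF _ _ _ D])
    show "majorized m D y r (cmod (c \<alpha>) * (r ^ multi_degree m \<alpha> * B'))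
        (\<lambda>x. c \<alpha> * (multi_power m (y x) \<alpha> * g x))" if "\<alpha> \<in> multi_indices m" for \<alpha>
      using that g D by (intro majorized_cmult majorized_shift) auto
    show "sum (\<lambda>\<alpha>. cmod (c \<alpha>) * (r ^ multi_degree m \<alpha> * B')) F \<le> B * B'"
      if "finite F" "F \<subseteq> multi_indices m" for F
      using c(1) that majorized_nonneg[OF g]
      by (auto simp: l1_bounded_def mult_right_mono simp flip: sum_distrib_right mult.assoc)
    show "((\<lambda>\<alpha>. c \<alpha> * (multi_power m (y x) \<alpha> * g x)) has_sum f x * g x) (multi_indices m)"
      if "x \<in> D" for x
      using has_sum_cmult_left[OF series_value_has_sum(1)[OF c(1), of "y x"], of "g x"] that c(2) D
      by (auto simp: in_polydisc_def mult.assoc)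
  qed
qed

lemma majorized_multi_power:
  assumes Y: "\<And>i. i < m' \<Longrightarrow> majorized m D y r \<rho> (\<lambda>x. Y x i)" and "\<alpha> \<in> multi_indices m'"
    and D: "in_polydisc m D y r" "0 < r"
  shows "majorized m D y r (\<rho> ^ multi_degree m' \<alpha>) (\<lambda>x. multi_power m' (Y x) \<alpha>)"
  using assms(2)
proof (induction rule: multi_index_induct)
  case zero
  show ?case using D by (auto intro!: majorized_const)
next
  case (add j \<beta>)
  then show ?case using majorized_mult[OF Y[OF \<open>j < m'\<close>] add.IH D]
    by (simp add: multi_power_add)
qed

text \<open>
  Substitution does not increase the norm, because a monomial \<open>Y\<^sup>\<alpha>\<close> in functions of norm at
  most \<open>\<rho>\<close> has norm at most \<open>\<rho>\<^sup>|\<^sup>\<alpha>\<^sup>|\<close>. This is why \<open>\<ell>\<^sup>1\<close>-norms are used instead of suprema.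
\<close>

lemma majorized_compose:
  assumes Y: "\<And>i. i < m' \<Longrightarrow> majorized m D y r \<rho> (\<lambda>x. Y x i)" and f: "majorized m' D Y \<rho> B f"
    and D: "in_polydisc m D y r" "0 < r"
  shows "majorized m D y r B f"
proof -
  obtain c where c: "series_bounded m' \<rho> B c" "\<forall>x. x \<in> D \<longrightarrow> f x = series_value m' c (Y x)"
    using f by (auto simp: majorized_def)
  show ?thesis
  proof (rule majorized_infsum[OF _ _ _ D])
    show "majorized m D y r (cmod (c \<alpha>) * \<rho> ^ multi_degree m' \<alpha>) (\<lambda>x. c \<alpha> * multi_power m' (Y x) \<alpha>)"
      if "\<alpha> \<in> multi_indices m'" for \<alpha>
      using that Y D by (intro majorized_cmult majorized_multi_power) auto
    show "sum (\<lambda>\<alpha>. cmod (c \<alpha>) * \<rho> ^ multi_degree m' \<alpha>) F \<le> B"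
      if "finite F" "F \<subseteq> multi_indices m'" for F
      using c(1) that by (auto simp: l1_bounded_def)
    show "((\<lambda>\<alpha>. c \<alpha> * multi_power m' (Y x) \<alpha>) has_sum f x) (multi_indices m')" if "x \<in> D" for x
      using series_value_has_sum(1)[OF c(1), of "Y x"] c(2) that majorized_norm_le[OF Y D(1) that]
      by auto
  qed
qed

text \<open>
  A Schwarz lemma: once the constant term is removed, each remaining term of the series shrinks by a factor
  of at most \<open>r' / r\<close>.
\<close>

lemma majorized_shrink:
  assumes f: "majorized m D y r B f" and r': "0 \<le> r'" "r' \<le> r" "0 < r"
    and p: "p \<in> D" "\<And>i. i < m \<Longrightarrow> y p i = 0" and D: "in_polydisc m D y r"
  shows "majorized m D y r' (r' / r * B) (\<lambda>x. f x - f p)"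
proof -
  obtain c where c: "series_bounded m r B c" "\<forall>x. x \<in> D \<longrightarrow> f x = series_value m c (y x)"
    using f by (auto simp: majorized_def)
  have fp: "f p = c (multi_zero m)" using c(2) p series_value_at_0[of m "y p" c] by auto
  define c' where "c' \<alpha> = c \<alpha> + (if \<alpha> = multi_zero m then - f p else 0)" for \<alpha>
  have c'0: "c' \<alpha> = (if \<alpha> = multi_zero m then 0 else c \<alpha>)" for \<alpha> by (simp add: c'_def fp)
  have "series_bounded m r' (r' / r * B) c'"
    unfolding l1_bounded_def
  proof safe
    fix F assume F: "finite F" "F \<subseteq> multi_indices m"
    have "cmod (c' \<alpha>) * r' ^ multi_degree m \<alpha> \<le> r' / r * (cmod (c \<alpha>) * r ^ multi_degree m \<alpha>)"
      if \<alpha>: "\<alpha> \<in> F" for \<alpha>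
    proof (cases "\<alpha> = multi_zero m")
      case False
      then obtain k where k: "multi_degree m \<alpha> = Suc k"
        using F \<alpha> multi_degree_eq_0_iff[of \<alpha> m] by (auto simp: gr0_conv_Suc)
      have "r' ^ Suc k \<le> r' / r * r ^ Suc k"
        using r' by (auto intro!: mult_left_mono power_mono)
      from this have "cmod (c \<alpha>) * r' ^ Suc k \<le> cmod (c \<alpha>) * (r' / r * r ^ Suc k)"
        by (rule mult_left_mono) simp
      also have "\<dots> = r' / r * (cmod (c \<alpha>) * r ^ Suc k)" by (simp only: mult.left_commute)
      finally show ?thesis using False by (simp only: c'0 k if_False)
    qed (use r' in \<open>simp add: c'0\<close>)
    then have "(\<Sum>\<alpha>\<in>F. cmod (c' \<alpha>) * r' ^ multi_degree m \<alpha>) \<le> (\<Sum>\<alpha>\<in>F. r' / r * (cmod (c \<alpha>) * r ^ multi_degree m \<alpha>))"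
      by (rule sum_mono)
    also have "\<dots> \<le> r' / r * B"
      using c(1) F r' unfolding sum_distrib_left[symmetric] l1_bounded_def by (intro mult_left_mono) auto
    finally show "(\<Sum>\<alpha>\<in>F. cmod (c' \<alpha>) * r' ^ multi_degree m \<alpha>) \<le> r' / r * B" .
  qed
  moreover have "f x - f p = series_value m c' (y x)" if x: "x \<in> D" for x
  proof -
    have "((\<lambda>\<alpha>. if \<alpha> = multi_zero m then - f p else 0) has_sum - f p) (multi_indices m)"
      by (rule has_sum_finite_neutralI[of "{multi_zero m}"]) auto
    then have "((\<lambda>\<alpha>. (if \<alpha> = multi_zero m then - f p else 0) * multi_power m (y x) \<alpha>) has_sum - f p) (multi_indices m)"
      by (rule has_sum_cong[THEN iffD1, rotated]) auto
    from has_sum_add[OF series_value_has_sum(1)[OF c(1), of "y x"] this]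
    have "((\<lambda>\<alpha>. c' \<alpha> * multi_power m (y x) \<alpha>) has_sum (series_value m c (y x) - f p)) (multi_indices m)"
      using x D by (simp add: c'_def distrib_right in_polydisc_def)
    then show ?thesis using c(2) x by (simp add: series_value_def infsumI)
  qed
  ultimately show ?thesis unfolding majorized_def by (intro exI[of _ c']) auto
qed

section \<open>Cauchy's estimates on polydiscs\<close>

lemma geometric_multi_sum:
  assumes x: "0 \<le> x" "x < (1::real)" and F: "finite F" "F \<subseteq> multi_indices m"
  shows "(\<Sum>\<alpha>\<in>F. x ^ multi_degree m \<alpha>) \<le> (1 / (1 - x)) ^ m"
proof -
  define N where "N = (\<Sum>\<alpha>\<in>F. multi_degree m \<alpha>)"
  define E where "E = ({..<m} \<rightarrow>\<^sub>E {..N})"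
  have sub: "F \<subseteq> E"
  proof
    fix \<alpha> assume \<alpha>: "\<alpha> \<in> F"
    have "\<alpha> i \<le> N" if "i < m" for i
    proof -
      have "\<alpha> i \<le> multi_degree m \<alpha>"
        unfolding multi_degree_def using that by (intro member_le_sum) auto
      also have "\<dots> \<le> N" unfolding N_def using F \<alpha> by (intro member_le_sum) auto
      finally show ?thesis .
    qed
    then show "\<alpha> \<in> E" using \<alpha> F(2) by (auto simp: E_def multi_indices_def PiE_iff subset_iff)
  qed
  have geo: "(\<Sum>a\<le>N. x ^ a) \<le> 1 / (1 - x)"
    using x sum_le_suminf[of "\<lambda>a. x ^ a" "{..N}"] by (simp add: suminf_geometric summable_geometric)
  have "(\<Sum>\<alpha>\<in>F. x ^ multi_degree m \<alpha>) \<le> (\<Sum>\<alpha>\<in>E. x ^ multi_degree m \<alpha>)"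
    using sub x by (intro sum_mono2) (auto simp: E_def finite_PiE)
  also have "\<dots> = (\<Prod>i<m. \<Sum>a\<le>N. x ^ a)"
    unfolding E_def by (subst prod_sum_PiE) (auto simp: multi_degree_def power_sum)
  also have "\<dots> \<le> (\<Prod>i<m. 1 / (1 - x))"
    using geo x by (intro prod_mono) (auto intro: sum_nonneg)
  finally show ?thesis by simp
qed

definition degree_indices :: "nat \<Rightarrow> nat \<Rightarrow> (nat \<Rightarrow> nat) set"
  where "degree_indices m k = {\<alpha> \<in> multi_indices m. multi_degree m \<alpha> = k}"

definition homogeneous_part :: "nat \<Rightarrow> ((nat \<Rightarrow> nat) \<Rightarrow> complex) \<Rightarrow> nat \<Rightarrow> (nat \<Rightarrow> complex) \<Rightarrow> complex"
  where "homogeneous_part m c k v = (\<Sum>\<alpha>\<in>degree_indices m k. c \<alpha> * multi_power m v \<alpha>)"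

lemma degree_indices_le: "\<alpha> \<in> degree_indices m k \<Longrightarrow> i < m \<Longrightarrow> \<alpha> i \<le> k"
  unfolding degree_indices_def multi_degree_def by (auto intro: member_le_sum)

lemma finite_degree_indices [simp]: "finite (degree_indices m k)"
proof (rule finite_subset)
  show "degree_indices m k \<subseteq> ({..<m} \<rightarrow>\<^sub>E {..k})"
  proof
    fix \<alpha> assume \<alpha>: "\<alpha> \<in> degree_indices m k"
    then show "\<alpha> \<in> ({..<m} \<rightarrow>\<^sub>E {..k})"
      using degree_indices_le[OF \<alpha>] by (simp add: degree_indices_def multi_indices_def PiE_iff)
  qed
qed (auto intro: finite_PiE)

lemma has_sum_by_degree:
  fixes f :: "(nat \<Rightarrow> nat) \<Rightarrow> complex"
  assumes "(f has_sum S) (multi_indices m)"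
  shows "(\<lambda>k. \<Sum>\<alpha>\<in>degree_indices m k. f \<alpha>) sums S"
proof -
  have bij: "bij_betw snd (Sigma UNIV (degree_indices m)) (multi_indices m)"
    unfolding bij_betw_def inj_on_def by (force simp: degree_indices_def image_iff)
  have "((\<lambda>x. f (snd x)) has_sum S) (Sigma UNIV (degree_indices m))"
    using has_sum_reindex_bij_betw[OF bij, of f S] assms by simp
  then have "((\<lambda>k. \<Sum>\<alpha>\<in>degree_indices m k. f \<alpha>) has_sum S) UNIV"
    by (rule has_sum_SigmaD) (auto intro: has_sum_finiteI)
  then show ?thesis by (rule has_sum_imp_sums)
qed

lemma has_sum_along_line:
  assumes "((\<lambda>\<alpha>. c \<alpha> * multi_power m (\<lambda>i. u * v i) \<alpha>) has_sum S) (multi_indices m)"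
  shows "(\<lambda>k. homogeneous_part m c k v * u ^ k) sums S"
proof -
  have "(\<Sum>\<alpha>\<in>degree_indices m k. c \<alpha> * multi_power m (\<lambda>i. u * v i) \<alpha>) = homogeneous_part m c k v * u ^ k" for k
    unfolding homogeneous_part_def sum_distrib_right
    by (intro sum.cong refl)
      (auto simp: degree_indices_def multi_degree_def multi_power_def power_mult_distrib prod.distrib
        simp flip: power_sum)
  then show ?thesis using has_sum_by_degree[OF assms] by simp
qed

text \<open>
  Fourier inversion on a finite group. On the torus of \<open>N\<close>-th roots of unity with \<open>N = k + 1\<close>, distinct
  exponents of degree \<open>k\<close> give distinct characters, so a coefficient is the average of the homogeneous
  part against the conjugate of its character.
\<close>

lemma homogeneous_coeff_bound:
  assumes B: "\<And>v. \<forall>i<m. cmod (v i) = 1 \<Longrightarrow> cmod (homogeneous_part m c k v) \<le> B"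
    and \<alpha>: "\<alpha> \<in> degree_indices m k"
  shows "cmod (c \<alpha>) \<le> B"
proof -
  define N where "N = Suc k"
  define \<zeta> where "\<zeta> = cis (2 * pi / real N)"
  have N: "0 < N" by (simp add: N_def)
  have \<zeta>pow: "\<zeta> ^ a = cis (2 * pi * real a / real N)" for a
    by (simp only: \<zeta>_def Complex.DeMoivre) (simp add: mult_ac)
  have \<zeta>N: "\<zeta> ^ N = 1" using N by (simp add: \<zeta>pow)
  have \<zeta>inj: "a = b" if "\<zeta> ^ a = \<zeta> ^ b" "a < N" "b < N" for a b
    using Complex.bij_betw_roots_unity[OF N] that by (auto simp: bij_betw_def inj_on_def \<zeta>pow)
  have norm\<zeta>: "cmod \<zeta> = 1" by (simp add: \<zeta>_def)
  then have \<zeta>0: "\<zeta> \<noteq> 0" by auto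
  define E where "E = ({..<m} \<rightarrow>\<^sub>E {..<N})"
  define w where "w e = (\<Prod>i<m. inverse \<zeta> ^ (e i * \<alpha> i))" for e :: "nat \<Rightarrow> nat"
  have root_sum: "(\<Sum>a<N. (\<zeta> ^ b * inverse \<zeta> ^ a') ^ a) = (if b = a' then of_nat N else 0)"
    if "b < N" "a' < N" for a' b
  proof (cases "b = a'")
    case False
    let ?x = "\<zeta> ^ b * inverse \<zeta> ^ a'"
    have "?x \<noteq> 1" using False \<zeta>inj[OF _ that] \<zeta>0 by (auto simp: field_simps)
    moreover have "?x ^ N = 1"
      by (simp add: power_mult_distrib power_inverse \<zeta>N mult.commute[of _ N] flip: power_mult)
        (simp add: power_mult \<zeta>N)
    ultimately show ?thesis using False by (simp add: geometric_sum)
  qed (use \<zeta>0 in \<open>simp add: power_inverse\<close>)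
  have "(\<Sum>e\<in>E. homogeneous_part m c k (\<lambda>i. \<zeta> ^ e i) * w e) =
      (\<Sum>\<beta>\<in>degree_indices m k. c \<beta> * (\<Sum>e\<in>E. (\<Prod>i<m. (\<zeta> ^ \<beta> i * inverse \<zeta> ^ \<alpha> i) ^ e i)))"
  proof -
    have "(\<Sum>e\<in>E. homogeneous_part m c k (\<lambda>i. \<zeta> ^ e i) * w e) =
       (\<Sum>e\<in>E. \<Sum>\<beta>\<in>degree_indices m k. c \<beta> * (multi_power m (\<lambda>i. \<zeta> ^ e i) \<beta> * w e))"
      by (simp add: homogeneous_part_def sum_distrib_right mult.assoc)
    also have "\<dots> = (\<Sum>\<beta>\<in>degree_indices m k. \<Sum>e\<in>E. c \<beta> * (multi_power m (\<lambda>i. \<zeta> ^ e i) \<beta> * w e))"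
      by (rule sum.swap)
    also have "\<dots> = (\<Sum>\<beta>\<in>degree_indices m k. c \<beta> * (\<Sum>e\<in>E. (\<Prod>i<m. (\<zeta> ^ \<beta> i * inverse \<zeta> ^ \<alpha> i) ^ e i)))"
      unfolding sum_distrib_left
      by (intro sum.cong refl arg_cong[where f = "\<lambda>x. _ * x"])
        (simp add: multi_power_def w_def power_mult_distrib mult.commute flip: prod.distrib power_mult)
    finally show ?thesis .
  qed
  also have "\<dots> = (\<Sum>\<beta>\<in>degree_indices m k. if \<beta> = \<alpha> then c \<alpha> * of_nat N ^ m else 0)"
  proof (rule sum.cong[OF refl])
    fix \<beta> assume \<beta>: "\<beta> \<in> degree_indices m k"
    have "(\<Sum>e\<in>E. (\<Prod>i<m. (\<zeta> ^ \<beta> i * inverse \<zeta> ^ \<alpha> i) ^ e i)) =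
        (\<Prod>i<m. \<Sum>a<N. (\<zeta> ^ \<beta> i * inverse \<zeta> ^ \<alpha> i) ^ a)"
      unfolding E_def by (subst prod_sum_PiE) auto
    also have "\<dots> = (\<Prod>i<m. if \<beta> i = \<alpha> i then of_nat N else 0)"
      using degree_indices_le[OF \<alpha>] degree_indices_le[OF \<beta>]
      by (intro prod.cong refl root_sum) (auto simp: N_def less_Suc_eq_le)
    also have "\<dots> = (if \<beta> = \<alpha> then of_nat N ^ m else 0)"
    proof (cases "\<beta> = \<alpha>")
      case False
      then obtain i where "\<beta> i \<noteq> \<alpha> i" by auto
      moreover from this have "i < m"
        using \<alpha> \<beta> by (fastforce simp: degree_indices_def multi_indices_def PiE_iff extensional_def)
      ultimately have "\<exists>i<m. \<beta> i \<noteq> \<alpha> i" by blast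
      then show ?thesis using False by (auto intro!: prod_zero)
    qed auto
    finally show "c \<beta> * (\<Sum>e\<in>E. (\<Prod>i<m. (\<zeta> ^ \<beta> i * inverse \<zeta> ^ \<alpha> i) ^ e i)) =
        (if \<beta> = \<alpha> then c \<alpha> * of_nat N ^ m else 0)" by auto
  qed
  also have "\<dots> = c \<alpha> * of_nat N ^ m" using \<alpha> by simp
  finally have eq: "(\<Sum>e\<in>E. homogeneous_part m c k (\<lambda>i. \<zeta> ^ e i) * w e) = c \<alpha> * of_nat N ^ m" .
  have "cmod (c \<alpha>) * real N ^ m = cmod (\<Sum>e\<in>E. homogeneous_part m c k (\<lambda>i. \<zeta> ^ e i) * w e)"
    by (simp add: eq norm_mult norm_power)
  also have "\<dots> \<le> (\<Sum>e\<in>E. B)"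
  proof (rule sum_norm_le)
    fix e
    have "cmod (w e) = 1" by (simp add: w_def norm_power norm_inverse norm\<zeta> flip: prod_norm)
    moreover have "cmod (homogeneous_part m c k (\<lambda>i. \<zeta> ^ e i)) \<le> B"
      by (rule B) (simp add: norm_power norm\<zeta>)
    ultimately show "cmod (homogeneous_part m c k (\<lambda>i. \<zeta> ^ e i) * w e) \<le> B" by (simp add: norm_mult)
  qed
  also have "\<dots> = B * real N ^ m" by (simp add: E_def card_PiE)
  finally show ?thesis using N by simp
qed

text \<open>
  The Taylor expansion at the centre of the disc represents the function on the whole disc, and
  Cauchy's inequality for radii below \<open>R\<close> passes to the limit.
\<close>

lemma power_series_continuation:
  fixes s :: "complex \<Rightarrow> complex"
  assumes hol: "s holomorphic_on ball 0 R" and R: "0 < R"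
    and near: "0 < \<delta>" "\<And>u. cmod u < \<delta> \<Longrightarrow> (\<lambda>k. a k * u ^ k) sums s u"
  shows "cmod u < R \<Longrightarrow> (\<lambda>k. a k * u ^ k) sums s u"
    and "(\<And>u. cmod u < R \<Longrightarrow> cmod (s u) \<le> B) \<Longrightarrow> cmod (a k) * R ^ k \<le> B"
proof -
  have "s has_fps_expansion Abs_fps a"
    using near by (intro has_fps_expansionI) (auto simp: eventually_nhds_metric intro!: exI[of _ \<delta>])
  then have a: "a k = (deriv ^^ k) s 0 / fact k" for k
    using fps_nth_fps_expansion[of s "Abs_fps a" k] by simp
  show "(\<lambda>k. a k * u ^ k) sums s u" if "cmod u < R"
    using holomorphic_power_series[OF hol, of u] that by (simp add: a)
  show "cmod (a k) * R ^ k \<le> B" if B: "\<And>u. cmod u < R \<Longrightarrow> cmod (s u) \<le> B"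
  proof -
    have "cmod (a k) * l ^ k \<le> B" if l: "0 < l" "l < R" for l
    proof -
      have "cmod ((deriv ^^ k) s 0) \<le> fact k * B / l ^ k"
      proof (rule Cauchy_inequality)
        have sub: "ball 0 l \<subseteq> ball (0::complex) R" "cball 0 l \<subseteq> ball (0::complex) R" using l by auto
        show "s holomorphic_on ball 0 l" using hol sub(1) by (rule holomorphic_on_subset)
        show "continuous_on (cball 0 l) s"
          using hol sub(2) by (meson holomorphic_on_imp_continuous_on holomorphic_on_subset)
      qed (use l B in auto)
      then show ?thesis using l by (simp add: a norm_divide field_simps)
    qed
    moreover have "((\<lambda>l. cmod (a k) * l ^ k) \<longlongrightarrow> cmod (a k) * R ^ k) (at_left R)"
      by (intro tendsto_intros)
    moreover have "\<forall>\<^sub>F l in at_left R. 0 < l \<and> l < R"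
      using R eventually_at_left_real[of 0 R] by (auto elim: eventually_mono)
    ultimately show ?thesis
      by (intro tendsto_upperbound[of "\<lambda>l. cmod (a k) * l ^ k" _ "at_left R"]) (auto elim: eventually_mono)
  qed
qed

text \<open>
  Restriction to the complex lines through the centre reduces Cauchy's inequality in several
  variables to the case of one variable: the homogeneous parts of the series are the Taylor
  coefficients on the lines.
\<close>

lemma slice_coeff_bound:
  assumes R: "0 < R"
    and s: "\<And>v. \<forall>i<m. cmod (v i) = 1 \<Longrightarrow> s v holomorphic_on ball 0 R"
      "\<And>v u. \<forall>i<m. cmod (v i) = 1 \<Longrightarrow> cmod u < R \<Longrightarrow> cmod (s v u) \<le> B"
    and \<delta>: "0 < \<delta>" "\<And>v u. \<forall>i<m. cmod (v i) = 1 \<Longrightarrow> cmod u < \<delta> \<Longrightarrow>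
        (\<lambda>k. homogeneous_part m c k v * u ^ k) sums s v u"
    and \<alpha>: "\<alpha> \<in> multi_indices m"
  shows "cmod (c \<alpha>) * R ^ multi_degree m \<alpha> \<le> B"
proof -
  let ?k = "multi_degree m \<alpha>"
  have "cmod (c \<alpha>) \<le> B / R ^ ?k"
  proof (rule homogeneous_coeff_bound[where c = c and k = ?k and m = m])
    fix v :: "nat \<Rightarrow> complex"
    assume v: "\<forall>i<m. cmod (v i) = 1"
    have "cmod (homogeneous_part m c ?k v) * R ^ ?k \<le> B"
      by (rule power_series_continuation(2)[of "s v" R \<delta> "\<lambda>k. homogeneous_part m c k v"])
        (rule s(1)[OF v], rule R, rule \<delta>(1), erule \<delta>(2)[OF v], erule s(2)[OF v])
    then show "cmod (homogeneous_part m c ?k v) \<le> B / R ^ ?k" using R by (simp add: field_simps)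
  qed (use \<alpha> in \<open>simp add: degree_indices_def\<close>)
  then show ?thesis using R by (simp add: field_simps)
qed

definition open_polydisc :: "nat \<Rightarrow> (nat \<Rightarrow> complex) \<Rightarrow> real \<Rightarrow> (nat \<Rightarrow> complex) set"
  where "open_polydisc m q R = {w \<in> extensional {..<m}. \<forall>i<m. cmod (w i - q i) < R}"

definition line_point :: "nat \<Rightarrow> (nat \<Rightarrow> complex) \<Rightarrow> (nat \<Rightarrow> complex) \<Rightarrow> complex \<Rightarrow> nat \<Rightarrow> complex"
  where "line_point m q v u = (\<lambda>i\<in>{..<m}. q i + u * v i)"

lemma line_point_in:
  assumes v: "\<forall>i<m. cmod (v i) \<le> 1" and u: "cmod u < R"
  shows "line_point m q v u \<in> open_polydisc m q R"
proof -
  have "cmod (u * v i) < R" if "i < m" for i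
    using mult_left_mono[OF v[rule_format, OF that] norm_ge_zero[of u]] u by (simp add: norm_mult)
  then show ?thesis by (simp add: open_polydisc_def line_point_def)
qed

lemma holomorphic_fun_onD:
  assumes "holomorphic_fun_on m D F" "p \<in> D"
  shows "\<exists>c. \<exists>r>0. \<forall>w\<in>D. (\<forall>i<m. cmod (w i - p i) < r) \<longrightarrow>
    ((\<lambda>\<alpha>. c \<alpha> * multi_power m (\<lambda>i. w i - p i) \<alpha>) has_sum F w) (multi_indices m)"
  using assms unfolding holomorphic_fun_on_def by (rule bspec)

lemma slice_power_series:
  assumes hol: "holomorphic_fun_on m (open_polydisc m q R) F"
    and v: "\<forall>i<m. cmod (v i) \<le> 1" and u\<^sub>0: "cmod u\<^sub>0 < R"
  shows "\<exists>c. \<exists>r>0. \<forall>u\<in>ball u\<^sub>0 r.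
      (\<lambda>k. homogeneous_part m c k v * (u - u\<^sub>0) ^ k) sums F (line_point m q v u)"
proof -
  let ?p = "line_point m q v u\<^sub>0"
  obtain c r where r: "r > 0" and c: "\<forall>w\<in>open_polydisc m q R. (\<forall>i<m. cmod (w i - ?p i) < r) \<longrightarrow>
       ((\<lambda>\<alpha>. c \<alpha> * multi_power m (\<lambda>i. w i - ?p i) \<alpha>) has_sum F w) (multi_indices m)"
    using holomorphic_fun_onD[OF hol line_point_in[OF v u\<^sub>0]] by (elim exE conjE) (rule that)
  have ball: "ball u\<^sub>0 (min r (R - cmod u\<^sub>0)) \<subseteq> ball 0 R"
  proof
    fix u assume "u \<in> ball u\<^sub>0 (min r (R - cmod u\<^sub>0))"
    then show "u \<in> ball 0 R"
      using norm_triangle_sub[of u u\<^sub>0] by (simp add: dist_norm norm_minus_commute)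
  qed
  show ?thesis
  proof (intro exI[of _ c] exI[of _ "min r (R - cmod u\<^sub>0)"] conjI ballI)
    show "0 < min r (R - cmod u\<^sub>0)" using r u\<^sub>0 by simp
    fix u assume u: "u \<in> ball u\<^sub>0 (min r (R - cmod u\<^sub>0))"
    let ?w = "line_point m q v u"
    have diff: "?w i - ?p i = (u - u\<^sub>0) * v i" if "i < m" for i
      using that by (simp add: line_point_def algebra_simps)
    have "cmod (?w i - ?p i) < r" if "i < m" for i
      using mult_left_mono[OF v[rule_format, OF that] norm_ge_zero[of "u - u\<^sub>0"]] u
      by (simp add: diff[OF that] norm_mult dist_norm norm_minus_commute)
    then have "((\<lambda>\<alpha>. c \<alpha> * multi_power m (\<lambda>i. ?w i - ?p i) \<alpha>) has_sum F ?w) (multi_indices m)"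
      using u ball by (intro c[rule_format] line_point_in[OF v]) auto
    then have "((\<lambda>\<alpha>. c \<alpha> * multi_power m (\<lambda>i. (u - u\<^sub>0) * v i) \<alpha>) has_sum F ?w) (multi_indices m)"
      using multi_power_cong[OF diff] by simp
    then show "(\<lambda>k. homogeneous_part m c k v * (u - u\<^sub>0) ^ k) sums F ?w"
      by (rule has_sum_along_line)
  qed
qed

lemma slice_holomorphic:
  assumes hol: "holomorphic_fun_on m (open_polydisc m q R) F"
    and v: "\<forall>i<m. cmod (v i) \<le> 1"
  shows "(\<lambda>u. F (line_point m q v u)) holomorphic_on ball 0 R"
proof -
  have "\<exists>r>0. (\<lambda>u. F (line_point m q v u)) holomorphic_on ball u\<^sub>0 r" if u\<^sub>0: "u\<^sub>0 \<in> ball 0 R" for u\<^sub>0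
  proof -
    have "cmod u\<^sub>0 < R" using u\<^sub>0 by simp
    from slice_power_series[OF hol v this] obtain c r where "0 < r"
      and c: "\<forall>u\<in>ball u\<^sub>0 r. (\<lambda>k. homogeneous_part m c k v * (u - u\<^sub>0) ^ k) sums F (line_point m q v u)"
      by blast
    from \<open>0 < r\<close> show ?thesis
      by (intro exI[of _ r] conjI power_series_holomorphic[OF c[rule_format]])
  qed
  then have "(\<lambda>u. F (line_point m q v u)) analytic_on ball 0 R"
    unfolding analytic_on_def by blast
  then show ?thesis by (rule analytic_imp_holomorphic)
qed

lemma series_bounded_of_coeff_bound:
  assumes c: "\<And>\<alpha>. \<alpha> \<in> multi_indices m \<Longrightarrow> cmod (c \<alpha>) * R ^ multi_degree m \<alpha> \<le> B"
    and r: "0 \<le> r" "r < R"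
  shows "series_bounded m r (B * (1 / (1 - r / R)) ^ m) c"
  unfolding l1_bounded_def
proof safe
  fix F assume F: "finite F" "F \<subseteq> multi_indices m"
  have B: "0 \<le> B" using c[OF multi_zero_in] by (auto intro: order_trans[OF norm_ge_zero])
  have "(\<Sum>\<alpha>\<in>F. cmod (c \<alpha>) * r ^ multi_degree m \<alpha>) \<le> (\<Sum>\<alpha>\<in>F. B * (r / R) ^ multi_degree m \<alpha>)"
  proof (rule sum_mono)
    fix \<alpha> assume "\<alpha> \<in> F"
    then have "cmod (c \<alpha>) * R ^ multi_degree m \<alpha> * (r / R) ^ multi_degree m \<alpha> \<le> B * (r / R) ^ multi_degree m \<alpha>"
      using F c r by (intro mult_right_mono) auto
    then show "cmod (c \<alpha>) * r ^ multi_degree m \<alpha> \<le> B * (r / R) ^ multi_degree m \<alpha>"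
      using r by (simp add: power_divide)
  qed
  also have "\<dots> = B * (\<Sum>\<alpha>\<in>F. (r / R) ^ multi_degree m \<alpha>)" by (simp add: sum_distrib_left)
  also have "\<dots> \<le> B * (1 / (1 - r / R)) ^ m"
    using geometric_multi_sum[of "r / R" F m] F r B by (intro mult_left_mono) auto
  finally show "(\<Sum>\<alpha>\<in>F. cmod (c \<alpha>) * r ^ multi_degree m \<alpha>) \<le> B * (1 / (1 - r / R)) ^ m" .
qed

text \<open>
  Holomorphic functions are defined by local expansions, so it has to be shown that the expansion at
  the centre represents the function on the whole polydisc. The local expansions make the function
  holomorphic on every complex line through the centre, which gives the coefficient bounds; these make
  the series converge on the polydisc, and on each line its sum is the continuation of the
  function.
\<close>

proposition Cauchy_polydisc:
  assumes hol: "holomorphic_fun_on m (open_polydisc m q R) F" and R: "0 < R"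
    and B: "\<And>w. w \<in> open_polydisc m q R \<Longrightarrow> cmod (F w) \<le> B"
  shows "\<exists>c. (\<forall>\<alpha>\<in>multi_indices m. cmod (c \<alpha>) * R ^ multi_degree m \<alpha> \<le> B) \<and>
    (\<forall>w\<in>open_polydisc m q R. F w = series_value m c (\<lambda>i. w i - q i))"
proof -
  define q' where "q' = restrict q {..<m}"
  have q': "open_polydisc m q' R = open_polydisc m q R" by (simp add: open_polydisc_def q'_def)
  have "q' \<in> open_polydisc m q R" using R by (simp add: open_polydisc_def q'_def)
  then obtain c r where r: "r > 0" and c: "\<forall>w\<in>open_polydisc m q R. (\<forall>i<m. cmod (w i - q' i) < r) \<longrightarrow>
       ((\<lambda>\<alpha>. c \<alpha> * multi_power m (\<lambda>i. w i - q' i) \<alpha>) has_sum F w) (multi_indices m)"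
    using holomorphic_fun_onD[OF hol] by blast
  define s where "s v u = F (line_point m q v u)" for v u
  have near: "(\<lambda>k. homogeneous_part m c k v * u ^ k) sums s v u"
    if v: "\<forall>i<m. cmod (v i) \<le> 1" and u: "cmod u < min r R" for v u
  proof -
    have diff: "line_point m q v u i - q' i = u * v i" if "i < m" for i
      using that by (simp add: line_point_def q'_def)
    have "cmod (line_point m q v u i - q' i) < r" if "i < m" for i
      using mult_left_mono[OF v[rule_format, OF that] norm_ge_zero[of "u"]] u
      by (simp add: diff[OF that] norm_mult)
    then have "((\<lambda>\<alpha>. c \<alpha> * multi_power m (\<lambda>i. line_point m q v u i - q' i) \<alpha>) has_sum s v u) (multi_indices m)"
      unfolding s_def using u by (intro c[rule_format] line_point_in[OF v]) auto
    then show ?thesis using multi_power_cong[OF diff] by (intro has_sum_along_line) simp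
  qed
  have hol_s: "s v holomorphic_on ball 0 R" if "\<forall>i<m. cmod (v i) \<le> 1" for v
    unfolding s_def using slice_holomorphic[OF hol that] .
  have bound: "cmod (c \<alpha>) * R ^ multi_degree m \<alpha> \<le> B" if "\<alpha> \<in> multi_indices m" for \<alpha>
  proof (rule slice_coeff_bound[OF R, of m s B "min r R" c])
    show "s v holomorphic_on ball 0 R" if "\<forall>i<m. cmod (v i) = 1" for v
      by (rule hol_s) (simp add: that)
    show "cmod (s v u) \<le> B" if "\<forall>i<m. cmod (v i) = 1" "cmod u < R" for v u
      unfolding s_def by (rule B, rule line_point_in) (simp_all add: that)
    show "(\<lambda>k. homogeneous_part m c k v * u ^ k) sums s v u"
      if "\<forall>i<m. cmod (v i) = 1" "cmod u < min r R" for v u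
      by (rule near) (simp add: that(1), rule that(2))
  qed (use r R that in auto)
  have "F w = series_value m c (\<lambda>i. w i - q i)" if w: "w \<in> open_polydisc m q R" for w
  proof -
    define \<rho> where "\<rho> = Max (insert (R / 2) ((\<lambda>i. cmod (w i - q i)) ` {..<m}))"
    have \<rho>: "0 < \<rho>" "\<rho> < R" "\<And>i. i < m \<Longrightarrow> cmod (w i - q i) \<le> \<rho>"
    proof -
      have "R / 2 \<le> \<rho>" unfolding \<rho>_def by (intro Max_ge) auto
      then show "0 < \<rho>" using R by linarith
      show "\<rho> < R" unfolding \<rho>_def using w R by (subst Max_less_iff) (auto simp: open_polydisc_def)
      show "cmod (w i - q i) \<le> \<rho>" if "i < m" for i unfolding \<rho>_def using that by (intro Max_ge) auto
    qed
    define v where "v i = (w i - q i) / of_real \<rho>" for i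
    have v: "\<forall>i<m. cmod (v i) \<le> 1"
      using \<rho>(1) \<rho>(3) by (simp add: v_def norm_divide)
    have lin: "line_point m q v (of_real \<rho>) = w"
      using w \<rho>(1) by (auto simp: line_point_def v_def open_polydisc_def extensional_def fun_eq_iff)
    have sb: "series_bounded m \<rho> (B * (1 / (1 - \<rho> / R)) ^ m) c"
      by (rule series_bounded_of_coeff_bound[OF bound]) (use \<rho> in auto)
    have "((\<lambda>\<alpha>. c \<alpha> * multi_power m (\<lambda>i. w i - q i) \<alpha>) has_sum series_value m c (\<lambda>i. w i - q i)) (multi_indices m)"
      by (rule series_value_has_sum(1)[OF sb]) (rule \<rho>(3))
    moreover have "(\<lambda>i. w i - q i) = (\<lambda>i. of_real \<rho> * v i)" using \<rho>(1) by (simp add: v_def)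
    ultimately have "((\<lambda>\<alpha>. c \<alpha> * multi_power m (\<lambda>i. of_real \<rho> * v i) \<alpha>) has_sum series_value m c (\<lambda>i. w i - q i)) (multi_indices m)"
      by simp
    then have "(\<lambda>k. homogeneous_part m c k v * of_real \<rho> ^ k) sums series_value m c (\<lambda>i. w i - q i)"
      by (rule has_sum_along_line)
    moreover have "(\<lambda>k. homogeneous_part m c k v * of_real \<rho> ^ k) sums s v (of_real \<rho>)"
    proof (rule power_series_continuation(1)[OF hol_s[OF v] R, of "min r R"])
      show "(\<lambda>k. homogeneous_part m c k v * u ^ k) sums s v u" if "cmod u < min r R" for u
        using v that by (rule near)
    qed (use r R \<rho> in auto)
    ultimately show ?thesis using sums_unique2 by (fastforce simp: s_def lin)
  qed
  with bound show ?thesis by blast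
qed

lemma series_coeff_bound:
  assumes c: "series_bounded m r A c" and r: "0 < r"
    and B: "\<And>w. (\<And>i. i < m \<Longrightarrow> cmod (w i) < r) \<Longrightarrow> cmod (series_value m c w) \<le> B"
    and \<alpha>: "\<alpha> \<in> multi_indices m"
  shows "cmod (c \<alpha>) * r ^ multi_degree m \<alpha> \<le> B"
proof (rule slice_coeff_bound[OF r, of m "\<lambda>v u. series_value m c (\<lambda>i. u * v i)" B r c])
  have sums: "(\<lambda>k. homogeneous_part m c k v * u ^ k) sums series_value m c (\<lambda>i. u * v i)"
    if v: "\<forall>i<m. cmod (v i) = 1" "cmod u < r" for v u
    by (rule has_sum_along_line, rule series_value_has_sum(1)[OF c]) (use v in \<open>simp add: norm_mult\<close>)
  show "(\<lambda>k. homogeneous_part m c k v * u ^ k) sums series_value m c (\<lambda>i. u * v i)"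
    if v: "\<forall>i<m. cmod (v i) = 1" "cmod u < r" for v u
    using v by (rule sums)
  show "(\<lambda>u. series_value m c (\<lambda>i. u * v i)) holomorphic_on ball 0 r"
    if v: "\<forall>i<m. cmod (v i) = 1" for v
    by (rule power_series_holomorphic[of 0 r "\<lambda>k. homogeneous_part m c k v"]) (use sums[OF v] in auto)
  show "cmod (series_value m c (\<lambda>i. u * v i)) \<le> B"
    if v: "\<forall>i<m. cmod (v i) = 1" "cmod u < r" for v u
    by (rule B) (use v in \<open>simp add: norm_mult\<close>)
qed (use r \<alpha> in auto)

text \<open>Cauchy's inequality for the difference of the two series, with the bound \<open>0\<close>.\<close>

lemma series_unique:
  assumes c: "series_bounded m r A c" and c': "series_bounded m r A' c'" and r: "0 < r"
    and eq: "\<And>w. (\<And>i. i < m \<Longrightarrow> cmod (w i) < r) \<Longrightarrow> series_value m c w = series_value m c' w"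
    and \<alpha>: "\<alpha> \<in> multi_indices m"
  shows "c \<alpha> = c' \<alpha>"
proof -
  have neg: "series_bounded m r A' (\<lambda>\<alpha>. - c' \<alpha>)" using l1_bounded_cmult[OF c', of "-1"] by simp
  have sum: "series_bounded m r (A + A') (\<lambda>\<alpha>. c \<alpha> + - c' \<alpha>)"
    by (rule l1_bounded_add[OF c neg]) (use r in simp)
  have "cmod (c \<alpha> + - c' \<alpha>) * r ^ multi_degree m \<alpha> \<le> 0"
  proof (rule series_coeff_bound[OF sum r _ \<alpha>])
    fix w :: "nat \<Rightarrow> complex" assume w: "\<And>i. i < m \<Longrightarrow> cmod (w i) < r"
    then have "series_value m (\<lambda>\<alpha>. c \<alpha> + - c' \<alpha>) w = series_value m c w + series_value m (\<lambda>\<alpha>. - c' \<alpha>) w"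
      by (intro series_value_add[OF c neg]) (simp add: less_imp_le)
    also have "series_value m (\<lambda>\<alpha>. - c' \<alpha>) w = - series_value m c' w"
      by (simp add: series_value_def infsum_uminus)
    finally show "cmod (series_value m (\<lambda>\<alpha>. c \<alpha> + - c' \<alpha>) w) \<le> 0" using eq[OF w] by simp
  qed
  then have "c \<alpha> + - c' \<alpha> = 0" using zero_less_power[OF r, of "multi_degree m \<alpha>"]
    by (metis linorder_not_less mult_pos_pos zero_less_norm_iff)
  then show ?thesis by simp
qed

section \<open>Analyticity from bounds on finite differences\<close>

fun forward_diff :: "nat \<Rightarrow> (nat \<Rightarrow> complex) \<Rightarrow> nat \<Rightarrow> complex" where
  "forward_diff 0 v j = v j"
| "forward_diff (Suc k) v j = forward_diff k v (Suc j) - forward_diff k v j"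

text \<open>Newton's interpolation formula at equidistant points.\<close>

lemma Newton_forward: "v (i + j) = (\<Sum>k\<le>j. of_nat (j choose k) * forward_diff k v i)"
proof (induction j arbitrary: i)
  case (Suc j)
  let ?d = "\<lambda>k. forward_diff k v i"
  have "v (i + Suc j) = v (Suc i + j)" by simp
  also have "\<dots> = (\<Sum>k\<le>j. of_nat (j choose k) * forward_diff k v (Suc i))" by (rule Suc.IH)
  also have "\<dots> = (\<Sum>k\<le>j. of_nat (j choose k) * ?d k) + (\<Sum>k\<le>j. of_nat (j choose k) * ?d (Suc k))"
    by (simp add: algebra_simps flip: sum.distrib)
  also have "(\<Sum>k\<le>j. of_nat (j choose k) * ?d k) = (\<Sum>k\<le>Suc j. of_nat (j choose k) * ?d k)" by simp
  also have "\<dots> = ?d 0 + (\<Sum>k\<le>j. of_nat (j choose Suc k) * ?d (Suc k))"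
    by (subst sum.atMost_Suc_shift) simp
  also have "\<dots> + (\<Sum>k\<le>j. of_nat (j choose k) * ?d (Suc k)) =
      ?d 0 + (\<Sum>k\<le>j. of_nat (Suc j choose Suc k) * ?d (Suc k))"
    by (simp add: algebra_simps flip: sum.distrib)
  also have "\<dots> = (\<Sum>k\<le>Suc j. of_nat (Suc j choose k) * ?d k)"
    by (subst sum.atMost_Suc_shift) simp
  finally show ?case .
qed simp

lemma power_self_le_exp_fact: "real k ^ k \<le> exp 1 ^ k * fact k"
proof -
  have "(\<lambda>n. real k ^ n / fact n) sums exp (real k)"
    using exp_converges[of "real k"] by (simp add: scaleR_conv_of_real field_simps)
  then have "(\<Sum>n\<in>{k}. real k ^ n / fact n) \<le> exp (real k)"
    by (subst sums_unique[of _ "exp (real k)"], assumption, intro sum_le_suminf) (auto simp: sums_iff)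
  then show ?thesis by (simp add: field_simps flip: exp_of_nat_mult)
qed

lemma binomial_step_tendsto:
  fixes J :: "nat \<Rightarrow> nat" and h :: "nat \<Rightarrow> real"
  assumes "h \<longlonglongrightarrow> 0" "\<forall>\<^sub>F N in sequentially. real (J N) * h N = t"
  shows "(\<lambda>N. of_nat (J N choose k) * complex_of_real (h N) ^ k) \<longlonglongrightarrow> of_real t ^ k / fact k"
proof -
  have "(\<lambda>N. (\<Prod>i=0..<k. t - real i * h N) / fact k) \<longlonglongrightarrow> (\<Prod>i=0..<k. t - real i * 0) / fact k"
    using assms(1) by (intro tendsto_intros) auto
  moreover have "\<forall>\<^sub>F N in sequentially. (\<Prod>i=0..<k. t - real i * h N) / fact k = real (J N choose k) * h N ^ k"
    using assms(2)
  proof eventually_elim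
    case (elim N)
    have "real (J N choose k) * h N ^ k = (\<Prod>i=0..<k. real (J N) - real i) * (\<Prod>i=0..<k. h N) / fact k"
      by (simp add: binomial_gbinomial gbinomial_prod_rev)
    also have "\<dots> = (\<Prod>i=0..<k. t - real i * h N) / fact k"
      unfolding prod.distrib[symmetric] using elim by (simp add: algebra_simps)
    finally show ?case by simp
  qed
  ultimately have "(\<lambda>N. real (J N choose k) * h N ^ k) \<longlonglongrightarrow> t ^ k / fact k"
    by (subst (asm) tendsto_cong) auto
  from tendsto_of_real[OF this, where 'a = complex] show ?thesis by simp
qed

text \<open>
  By Newton's formula, the value of \<open>u\<close> at a point of the dyadic grid of mesh \<open>h = L / 2\<^sup>N\<close> is
  \<open>\<Sum>\<^sub>k (J choose k) \<Delta>\<^sup>k u(0)\<close>, where \<open>J h = t\<close>. The bound on the differences makes the quotients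
  \<open>\<Delta>\<^sup>k u(0) / (k! h\<^sup>k)\<close> bounded for each \<open>k\<close>, so a diagonal sequence of meshes has limits \<open>a\<^sub>k\<close>. Since
  \<open>(J choose k) h\<^sup>k\<close> tends to \<open>t\<^sup>k / k!\<close>, dominated convergence of series turns Newton's formula into the
  power series with coefficients \<open>a\<^sub>k\<close>, at dyadic points and then, by continuity, everywhere.
\<close>

lemma Newton_series:
  fixes u :: "real \<Rightarrow> complex"
  assumes L: "0 < L" and C: "0 \<le> C" "C * L < 1" and A: "0 \<le> A" and u: "continuous_on {0..L} u"
    and diff: "\<And>N k. N \<ge> N0 \<Longrightarrow> k \<le> 2 ^ N \<Longrightarrow>
      cmod (forward_diff k (\<lambda>j. u (real j * (L / 2 ^ N))) 0) \<le> A * fact k * (C * (L / 2 ^ N)) ^ k"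
  obtains a where "\<And>k. cmod (a k) \<le> A * C ^ k"
    "\<And>t. t \<in> {0..L} \<Longrightarrow> (\<lambda>k. a k * of_real t ^ k) sums u t"
proof -
  define h where "h N = L / 2 ^ N" for N
  define D where "D N k = forward_diff k (\<lambda>j. u (real j * h N)) 0" for N k
  define b where "b N k = (if N0 \<le> N \<and> k \<le> 2 ^ N then D N k / (fact k * of_real (h N) ^ k) else 0)" for N k
  have h: "0 < h N" for N using L by (simp add: h_def)
  have h0: "h \<longlonglongrightarrow> 0"
    unfolding h_def by (rule LIMSEQ_divide_realpow_zero) simp
  have b: "cmod (b N k) \<le> A * C ^ k" for N k
  proof (cases "N0 \<le> N \<and> k \<le> 2 ^ N")
    case True
    then have "cmod (D N k) \<le> A * fact k * (C * h N) ^ k"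
      unfolding D_def h_def using diff by blast
    then show ?thesis using True h[of N]
      by (simp add: b_def norm_divide norm_mult norm_power pos_divide_le_eq power_mult_distrib mult_ac)
  qed (use A C in \<open>auto simp: b_def\<close>)
  \<comment> \<open>positive scale factors for the compactness argument, also when \<open>C = 0\<close>\<close>
  define C' where "C' k = (if C = 0 \<and> k > 0 then 1 else C ^ k)" for k
  have C': "0 < C' k" "C ^ k \<le> C' k" for k using C by (auto simp: C'_def power_0_left)
  have bC: "norm (b N k / of_real (C' k)) \<le> A" for N k
  proof -
    have "cmod (b N k) \<le> A * C' k"
      using b[of N k] mult_left_mono[OF C'(2)[of k] A] by linarith
    then show ?thesis using C'(1)[of k] by (simp add: norm_divide pos_divide_le_eq)
  qed
  have "\<exists>\<sigma>. strict_mono \<sigma> \<and> (\<forall>k. \<exists>l. (\<lambda>n. b (\<sigma> n) k / of_real (C' k)) \<longlonglongrightarrow> l)"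
    by (rule function_convergent_subsequence[of "UNIV :: nat set" "\<lambda>N k. b N k / of_real (C' k)" A])
      (use bC in simp_all, blast)
  then obtain \<sigma> where \<sigma>: "strict_mono \<sigma>" "\<And>k. \<exists>l. (\<lambda>n. b (\<sigma> n) k / of_real (C' k)) \<longlonglongrightarrow> l"
    by blast
  have "\<exists>l. (\<lambda>n. b (\<sigma> n) k) \<longlonglongrightarrow> l" for k
  proof -
    obtain l where "(\<lambda>n. b (\<sigma> n) k / of_real (C' k)) \<longlonglongrightarrow> l" using \<sigma>(2) by blast
    then have "(\<lambda>n. b (\<sigma> n) k / of_real (C' k) * of_real (C' k)) \<longlonglongrightarrow> l * of_real (C' k)"
      by (intro tendsto_intros)
    then show ?thesis using C'(1)[of k] by auto
  qed
  then obtain a where a: "\<And>k. (\<lambda>n. b (\<sigma> n) k) \<longlonglongrightarrow> a k" by metis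
  have a_bound: "cmod (a k) \<le> A * C ^ k" for k
    by (rule tendsto_upperbound[OF tendsto_norm[OF a[of k]]]) (use b in auto)
  have summ: "summable (\<lambda>k. A * (C * t) ^ k)" if "t \<in> {0..L}" for t
  proof -
    have "C * t \<le> C * L" using that C by (intro mult_left_mono) auto
    then have "norm (C * t) < 1" using that C by simp
    then show ?thesis by (intro summable_mult summable_geometric)
  qed
  have norm_term: "cmod (a k * of_real t ^ k) \<le> A * (C * t) ^ k" if "0 \<le> t" for k t
    using mult_right_mono[OF a_bound[of k], of "t ^ k"] that
    by (simp add: norm_mult norm_power power_mult_distrib mult_ac)
  have a_summable: "summable (\<lambda>k. a k * of_real t ^ k)" if "t \<in> {0..L}" for t
    by (rule summable_comparison_test'[OF summ[OF that], of 0]) (use norm_term that in auto)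
  define V where "V t = (\<Sum>k. a k * complex_of_real t ^ k)" for t
  have dyadic: "u (real i * h M) = V (real i * h M)" if i: "i \<le> 2 ^ M" for i M
  proof -
    define t where "t = real i * h M"
    have t: "t \<in> {0..L}"
    proof -
      have "real i * h M \<le> 2 ^ M * h M" using i h[of M] by (intro mult_right_mono) auto
      then show ?thesis using L by (simp add: t_def h_def)
    qed
    define J where "J N = i * 2 ^ (N - M)" for N
    have Jt: "real (J N) * h N = t" if "M \<le> N" for N
    proof -
      have "(2::real) ^ N = 2 ^ M * 2 ^ (N - M)" using that by (simp flip: power_add)
      then show ?thesis by (simp add: J_def t_def h_def)
    qed
    define T where "T k n = of_nat (J (\<sigma> n) choose k) * complex_of_real (h (\<sigma> n)) ^ k * (fact k * b (\<sigma> n) k)" for k n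
    have ev: "\<forall>\<^sub>F n in sequentially. max M N0 \<le> \<sigma> n"
      using eventually_ge_at_top[of "max M N0"] by eventually_elim (metis \<sigma>(1) le_trans seq_suble)
    have Jle: "J N \<le> 2 ^ N" if "M \<le> N" for N
    proof -
      have "J N \<le> 2 ^ M * 2 ^ (N - M)" unfolding J_def using i by (rule mult_right_mono) simp
      then show ?thesis using that by (simp flip: power_add)
    qed
    have sum_eq: "(\<Sum>k. T k n) = u t" if n: "max M N0 \<le> \<sigma> n" for n
    proof -
      have "u t = (\<Sum>k\<le>J (\<sigma> n). of_nat (J (\<sigma> n) choose k) * D (\<sigma> n) k)"
        using Newton_forward[of "\<lambda>j. u (real j * h (\<sigma> n))" 0 "J (\<sigma> n)"] Jt[of "\<sigma> n"] n
        by (simp add: D_def)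
      also have "\<dots> = (\<Sum>k\<le>J (\<sigma> n). T k n)"
      proof (rule sum.cong[OF refl])
        fix k assume "k \<in> {..J (\<sigma> n)}"
        then have "k \<le> 2 ^ \<sigma> n" using Jle[of "\<sigma> n"] n by simp
        then show "of_nat (J (\<sigma> n) choose k) * D (\<sigma> n) k = T k n"
          using n h[of "\<sigma> n"] by (simp add: T_def b_def)
      qed
      also have "\<dots> = (\<Sum>k. T k n)"
        by (rule suminf_finite[symmetric]) (auto simp: T_def binomial_eq_0)
      finally show ?thesis by simp
    qed
    have T_bound: "norm (T k n) \<le> A * (C * t) ^ k" if n: "max M N0 \<le> \<sigma> n" for k n
    proof -
      let ?J = "J (\<sigma> n)" and ?h = "h (\<sigma> n)"
      have "norm (T k n) = real ((?J choose k) * fact k) * ?h ^ k * cmod (b (\<sigma> n) k)"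
        using h[of "\<sigma> n"] by (simp add: T_def norm_mult norm_power mult_ac)
      also have "\<dots> \<le> real ?J ^ k * ?h ^ k * (A * C ^ k)"
      proof (intro mult_mono b)
        show "real ((?J choose k) * fact k) \<le> real ?J ^ k"
          using binomial_fact_pow[of ?J k] by (metis of_nat_le_iff of_nat_power)
      qed (use h[of "\<sigma> n"] in auto)
      also have "real ?J ^ k * ?h ^ k = t ^ k"
        using Jt[of "\<sigma> n"] n by (simp flip: power_mult_distrib)
      finally show ?thesis by (simp add: power_mult_distrib mult_ac)
    qed
    have lim: "(\<lambda>n. T k n) \<longlonglongrightarrow> a k * of_real t ^ k" for k
    proof -
      have "(\<lambda>n. of_nat (J (\<sigma> n) choose k) * complex_of_real (h (\<sigma> n)) ^ k) \<longlonglongrightarrow> of_real t ^ k / fact k"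
      proof (rule binomial_step_tendsto)
        show "(\<lambda>n. h (\<sigma> n)) \<longlonglongrightarrow> 0"
          using LIMSEQ_subseq_LIMSEQ[OF h0 \<sigma>(1)] by (simp add: o_def)
        show "\<forall>\<^sub>F n in sequentially. real (J (\<sigma> n)) * h (\<sigma> n) = t"
          using ev by eventually_elim (use Jt in auto)
      qed
      then have "(\<lambda>n. T k n) \<longlonglongrightarrow> of_real t ^ k / fact k * (fact k * a k)"
        unfolding T_def by (intro tendsto_mult tendsto_const a)
      then show ?thesis by (simp add: mult_ac)
    qed
    have "((\<lambda>n. \<Sum>k. T k n) \<longlonglongrightarrow> (\<Sum>k. a k * of_real t ^ k))"
    proof (rule conjunct2[OF conjunct2[OF tannerys_theorem[OF lim _ summ[OF t]]]])
      have "\<forall>\<^sub>F x in sequentially \<times>\<^sub>F sequentially. True \<and> max M N0 \<le> \<sigma> (snd x)"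
        by (rule eventually_prodI[OF _ ev]) simp
      then show "\<forall>\<^sub>F (k, n) in sequentially \<times>\<^sub>F sequentially. norm (T k n) \<le> A * (C * t) ^ k"
        by (rule eventually_mono) (use T_bound in \<open>simp add: case_prod_unfold\<close>)
    qed simp
    moreover have "((\<lambda>n. \<Sum>k. T k n) \<longlonglongrightarrow> u t)"
      by (rule tendsto_eventually, rule eventually_mono[OF ev], rule sum_eq)
    ultimately show ?thesis unfolding V_def t_def using LIMSEQ_unique by blast
  qed
  have V_cont: "continuous_on {0..L} V"
  proof -
    have "uniform_limit {0..L} (\<lambda>n t. \<Sum>k<n. a k * complex_of_real t ^ k) V sequentially"
      unfolding V_def
    proof (rule Weierstrass_m_test)
      show "norm (a k * complex_of_real t ^ k) \<le> A * (C * L) ^ k" if "t \<in> {0..L}" for k t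
      proof -
        have "(C * t) ^ k \<le> (C * L) ^ k" using that C by (intro power_mono mult_left_mono) auto
        then show ?thesis using norm_term[of t k] that mult_left_mono[of "(C * t) ^ k" "(C * L) ^ k" A] A by fastforce
      qed
      show "summable (\<lambda>k. A * (C * L) ^ k)" using summ[of L] L by simp
    qed
    then show ?thesis
      by (rule uniform_limit_theorem[rotated]) (auto intro!: continuous_intros always_eventually)
  qed
  have "u t = V t" if t: "t \<in> {0..L}" for t
  proof -
    define i where "i M = nat \<lfloor>t / h M\<rfloor>" for M
    have i: "real (i M) * h M \<le> t" "t < real (i M) * h M + h M" for M
    proof -
      have "0 \<le> t / h M" using t h[of M] by simp
      then have "real (i M) = of_int \<lfloor>t / h M\<rfloor>" by (simp add: i_def)
      then have "real (i M) \<le> t / h M" "t / h M < real (i M) + 1" by linarith+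
      then show "real (i M) * h M \<le> t" "t < real (i M) * h M + h M"
        using h[of M] by (simp_all add: pos_le_divide_eq pos_divide_less_eq distrib_right)
    qed
    have i2: "i M \<le> 2 ^ M" for M
    proof -
      have "real (i M) * h M \<le> 2 ^ M * h M" using i(1)[of M] t by (simp add: h_def)
      then have "real (i M) \<le> real (2 ^ M)" using h[of M] by simp
      then show ?thesis by (simp only: of_nat_le_iff)
    qed
    have in_L: "real (i M) * h M \<in> {0..L}" for M using i(1)[of M] t h[of M] by (simp add: order_trans)
    have lim: "(\<lambda>M. real (i M) * h M) \<longlonglongrightarrow> t"
    proof (rule tendsto_sandwich[of "\<lambda>M. t - h M" _ _ "\<lambda>M. t"])
      show "(\<lambda>M. t - h M) \<longlonglongrightarrow> t" using tendsto_diff[OF tendsto_const[of t] h0] by simp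
    qed (use i in \<open>auto intro!: always_eventually simp: less_imp_le algebra_simps\<close>)
    have "(\<lambda>M. u (real (i M) * h M)) \<longlonglongrightarrow> u t"
      using u lim t in_L by (intro continuous_on_tendsto_compose[where f = u]) auto
    moreover have "(\<lambda>M. V (real (i M) * h M)) \<longlonglongrightarrow> V t"
      using V_cont lim t in_L by (intro continuous_on_tendsto_compose[where f = V]) auto
    ultimately show ?thesis using dyadic[OF i2] LIMSEQ_unique by simp
  qed
  then have "(\<lambda>k. a k * of_real t ^ k) sums u t" if "t \<in> {0..L}" for t
    using summable_sums[OF a_summable[OF that]] that by (simp add: V_def)
  with a_bound show ?thesis by (rule that)
qed

text \<open>
  Newton's series has its centre at the left end point of the interval. Its sum is
  holomorphic on a disc of radius \<open>2 L\<close>, hence has an expansion at the midpoint of the interval, which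
  represents \<open>u\<close> on both sides.
\<close>

lemma recentre_power_series:
  assumes L: "0 < L" and C: "0 \<le> C" "4 * C * L \<le> 1" and A: "0 \<le> A"
    and a: "\<And>k. cmod (a k) \<le> A * C ^ k"
    and u: "\<And>t. t \<in> {0..L} \<Longrightarrow> (\<lambda>k. a k * of_real t ^ k) sums u t"
  shows "\<exists>b. (\<forall>k. cmod (b k) \<le> 2 * A / L ^ k) \<and>
    (\<forall>t. \<bar>t\<bar> \<le> L / 2 \<longrightarrow> (\<lambda>k. b k * of_real t ^ k) sums u (L / 2 + t))"
proof -
  define V where "V z = (\<Sum>k. a k * z ^ k)" for z :: complex
  have V: "(\<lambda>k. a k * z ^ k) sums V z" "cmod (V z) \<le> 2 * A" if z: "cmod z \<le> 2 * L" for z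
  proof -
    have "C * cmod z \<le> C * (2 * L)" using z C by (intro mult_left_mono) auto
    then have half: "C * cmod z \<le> 1 / 2" using C by simp
    have le: "norm (a k * z ^ k) \<le> A * (1 / 2) ^ k" for k
    proof -
      have "norm (a k * z ^ k) \<le> A * C ^ k * cmod z ^ k"
        using a[of k] by (simp add: norm_mult norm_power mult_right_mono)
      also have "\<dots> = A * (C * cmod z) ^ k" by (simp add: power_mult_distrib)
      also have "\<dots> \<le> A * (1 / 2) ^ k" using half A C by (intro mult_left_mono power_mono) auto
      finally show ?thesis .
    qed
    have sm: "summable (\<lambda>k. A * (1 / 2) ^ k)" by (intro summable_mult summable_geometric) simp
    show "(\<lambda>k. a k * z ^ k) sums V z"
      unfolding V_def by (rule summable_sums[OF summable_comparison_test'[OF sm, of 0]]) (rule le)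
    have "norm (V z) \<le> (\<Sum>k. A * (1 / 2) ^ k)"
      unfolding V_def by (rule norm_suminf_le[OF le sm])
    also have "\<dots> = 2 * A" by (subst suminf_mult) (simp_all add: suminf_geometric)
    finally show "cmod (V z) \<le> 2 * A" .
  qed
  let ?c = "complex_of_real (L / 2)"
  have hol: "V holomorphic_on ball 0 (2 * L)"
    by (rule power_series_holomorphic[of 0 _ a]) (use V(1) in auto)
  have sub: "cball ?c L \<subseteq> ball 0 (2 * L)"
  proof
    fix z assume "z \<in> cball ?c L"
    then have "cmod (z - ?c) \<le> L" by (simp add: dist_norm norm_minus_commute)
    moreover have "cmod z \<le> cmod ?c + cmod (z - ?c)" by (rule norm_triangle_sub)
    ultimately show "z \<in> ball 0 (2 * L)" using L by simp
  qed
  define b where "b k = (deriv ^^ k) V ?c / fact k" for k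
  have bound: "cmod (b k) \<le> 2 * A / L ^ k" for k
  proof -
    have "cmod ((deriv ^^ k) V ?c) \<le> fact k * (2 * A) / L ^ k"
    proof (rule Cauchy_inequality)
      show "V holomorphic_on ball ?c L"
        using hol by (rule holomorphic_on_subset) (use sub in auto)
      show "continuous_on (cball ?c L) V"
        using hol sub by (meson holomorphic_on_imp_continuous_on holomorphic_on_subset)
      show "cmod (V z) \<le> 2 * A" if "cmod (?c - z) = L" for z
      proof (rule V(2))
        have "z \<in> cball ?c L" using that by (simp add: dist_norm)
        then have "z \<in> ball 0 (2 * L)" using sub by blast
        then show "cmod z \<le> 2 * L" by simp
      qed
    qed (use L in auto)
    then show ?thesis by (simp add: b_def norm_divide field_simps)
  qed
  have "(\<lambda>k. b k * of_real t ^ k) sums u (L / 2 + t)" if t: "\<bar>t\<bar> \<le> L / 2" for t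
  proof -
    have w: "?c + of_real t \<in> ball ?c L" using t L by (simp add: dist_norm)
    have "V holomorphic_on ball ?c L"
      using hol by (rule holomorphic_on_subset) (use sub in auto)
    from holomorphic_power_series[OF this w]
    have "(\<lambda>k. b k * of_real t ^ k) sums V (?c + of_real t)" by (simp add: b_def)
    moreover have "V (?c + of_real t) = u (L / 2 + t)"
    proof -
      have "(\<lambda>k. a k * of_real (L / 2 + t) ^ k) sums u (L / 2 + t)" using t by (intro u) auto
      moreover have "(\<lambda>k. a k * of_real (L / 2 + t) ^ k) sums V (of_real (L / 2 + t))"
      proof (rule V(1))
        have "\<bar>L / 2 + t\<bar> \<le> 2 * L" using t L by linarith
        then show "cmod (of_real (L / 2 + t)) \<le> 2 * L" by (simp only: norm_of_real)
      qed
      ultimately show ?thesis using sums_unique2 by fastforce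
    qed
    ultimately show ?thesis by simp
  qed
  with bound show ?thesis by blast
qed

text \<open>
  Differences of order \<open>k\<close> and step \<open>h\<close> are allowed to grow like \<open>(k h)\<^sup>k\<close>, because
  \<open>k\<^sup>k \<le> e\<^sup>k k!\<close>. The radius of convergence \<open>L\<close> does not depend on \<open>A\<close>.
\<close>

proposition analytic_from_differences:
  fixes u :: "real \<Rightarrow> complex"
  assumes L: "0 < L" and Q: "0 \<le> Q" "4 * exp 1 * Q * L \<le> 1" and A: "0 \<le> A"
    and u: "continuous_on {0..L} u"
    and diff: "\<And>N k. N \<ge> N0 \<Longrightarrow> k \<le> 2 ^ N \<Longrightarrow>
      cmod (forward_diff k (\<lambda>j. u (real j * (L / 2 ^ N))) 0) \<le> A * (Q * real k * (L / 2 ^ N)) ^ k"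
  shows "\<exists>b. (\<forall>k. cmod (b k) \<le> 2 * A / L ^ k) \<and>
    (\<forall>t. \<bar>t\<bar> \<le> L / 2 \<longrightarrow> (\<lambda>k. b k * of_real t ^ k) sums u (L / 2 + t))"
proof -
  define C where "C = exp 1 * Q"
  have C: "0 \<le> C" "4 * C * L \<le> 1" using Q by (simp_all add: C_def mult_ac)
  have "C * L < 1" using C L by (simp add: mult_ac)
  have "cmod (forward_diff k (\<lambda>j. u (real j * (L / 2 ^ N))) 0) \<le> A * fact k * (C * (L / 2 ^ N)) ^ k"
    if "N \<ge> N0" "k \<le> 2 ^ N" for N k
  proof -
    have "cmod (forward_diff k (\<lambda>j. u (real j * (L / 2 ^ N))) 0) \<le> A * (Q * real k * (L / 2 ^ N)) ^ k"
      using that by (rule diff)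
    also have "\<dots> = A * (Q * (L / 2 ^ N)) ^ k * real k ^ k" by (simp only: power_mult_distrib mult_ac)
    also have "\<dots> \<le> A * (Q * (L / 2 ^ N)) ^ k * (exp 1 ^ k * fact k)"
      using A Q L by (intro mult_left_mono power_self_le_exp_fact) auto
    also have "\<dots> = A * fact k * (C * (L / 2 ^ N)) ^ k" by (simp only: C_def power_mult_distrib mult_ac)
    finally show ?thesis .
  qed
  from Newton_series[OF L C(1) \<open>C * L < 1\<close> A u this]
  obtain a where a: "\<And>k. cmod (a k) \<le> A * C ^ k"
    "\<And>t. t \<in> {0..L} \<Longrightarrow> (\<lambda>k. a k * of_real t ^ k) sums u t" by blast
  show ?thesis by (rule recentre_power_series[OF L C A a])
qed

section \<open>Exterior algebra valued functions\<close>

definition wedge :: "(nat set \<Rightarrow> complex) \<Rightarrow> (nat set \<Rightarrow> complex) \<Rightarrow> nat set \<Rightarrow> complex"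
  where "wedge a b \<nu> = (\<Sum>\<mu>\<in>Pow \<nu>. exterior_sign \<mu> (\<nu> - \<mu>) * a \<mu> * b (\<nu> - \<mu>))"

definition super_mult ::
    "(nat set \<Rightarrow> 'p \<Rightarrow> complex) \<Rightarrow> (nat set \<Rightarrow> 'p \<Rightarrow> complex) \<Rightarrow> nat set \<Rightarrow> 'p \<Rightarrow> complex"
  where "super_mult f g \<nu> x = wedge (\<lambda>\<mu>. f \<mu> x) (\<lambda>\<mu>. g \<mu> x) \<nu>"

definition wedge_norm :: "nat \<Rightarrow> (nat set \<Rightarrow> complex) \<Rightarrow> real"
  where "wedge_norm n a = (\<Sum>\<nu>\<in>Pow {..<n}. cmod (a \<nu>))"

lemma norm_exterior_sign [simp]: "cmod (exterior_sign \<mu> \<nu>) = 1"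
  by (simp add: exterior_sign_def norm_power)

lemma exterior_sign_empty [simp]: "exterior_sign {} \<nu> = 1" "exterior_sign \<mu> {} = 1"
  by (simp_all add: exterior_sign_def)

text \<open>
  The pairs \<open>(\<mu>, \<nu> - \<mu>)\<close> with \<open>\<mu> \<subseteq> \<nu>\<close> are distinct pairs of subsets, so the left-hand side is part of
  the expanded product on the right.
\<close>

lemma sum_disjoint_pairs_le:
  fixes a b :: "nat set \<Rightarrow> real"
  assumes N: "finite N" and a: "\<And>\<nu>. \<nu> \<subseteq> N \<Longrightarrow> 0 \<le> a \<nu>" and b: "\<And>\<nu>. \<nu> \<subseteq> N \<Longrightarrow> 0 \<le> b \<nu>"
  shows "(\<Sum>\<nu>\<in>Pow N. \<Sum>\<mu>\<in>Pow \<nu>. a \<mu> * b (\<nu> - \<mu>)) \<le> (\<Sum>\<nu>\<in>Pow N. a \<nu>) * (\<Sum>\<nu>\<in>Pow N. b \<nu>)"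
proof -
  let ?S = "Sigma (Pow N) Pow" and ?f = "\<lambda>(\<nu>, \<mu>). (\<mu>, \<nu> - \<mu>)"
  have fin: "finite \<nu>" if "\<nu> \<subseteq> N" for \<nu> using N that by (rule finite_subset[rotated])
  have inj: "inj_on ?f ?S" by (auto simp: inj_on_def)
  have "(\<Sum>\<nu>\<in>Pow N. \<Sum>\<mu>\<in>Pow \<nu>. a \<mu> * b (\<nu> - \<mu>)) = (\<Sum>(\<nu>, \<mu>)\<in>?S. a \<mu> * b (\<nu> - \<mu>))"
    using N fin by (subst sum.Sigma) auto
  also have "\<dots> = (\<Sum>(\<mu>, \<kappa>)\<in>?f ` ?S. a \<mu> * b \<kappa>)"
    by (subst sum.reindex[OF inj]) (simp add: case_prod_unfold o_def)
  also have "\<dots> \<le> (\<Sum>(\<mu>, \<kappa>)\<in>Pow N \<times> Pow N. a \<mu> * b \<kappa>)"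
    using N a b by (intro sum_mono2) auto
  also have "\<dots> = (\<Sum>\<nu>\<in>Pow N. a \<nu>) * (\<Sum>\<nu>\<in>Pow N. b \<nu>)"
    by (simp add: sum_product sum.cartesian_product)
  finally show ?thesis .
qed

lemma wedge_norm_nonneg: "0 \<le> wedge_norm n a"
  by (simp add: wedge_norm_def sum_nonneg)

lemma norm_le_wedge_norm: "\<nu> \<subseteq> {..<n} \<Longrightarrow> cmod (a \<nu>) \<le> wedge_norm n a"
  unfolding wedge_norm_def by (intro member_le_sum) auto

lemma wedge_norm_wedge: "wedge_norm n (wedge a b) \<le> wedge_norm n a * wedge_norm n b"
proof -
  have "wedge_norm n (wedge a b) \<le> (\<Sum>\<nu>\<in>Pow {..<n}. \<Sum>\<mu>\<in>Pow \<nu>. cmod (a \<mu>) * cmod (b (\<nu> - \<mu>)))"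
    unfolding wedge_norm_def wedge_def
    by (intro sum_mono order_trans[OF norm_sum]) (simp add: norm_mult)
  also have "\<dots> \<le> wedge_norm n a * wedge_norm n b"
    unfolding wedge_norm_def by (rule sum_disjoint_pairs_le) auto
  finally show ?thesis .
qed

lemma wedge_diff_left: "wedge (\<lambda>\<nu>. a \<nu> - a' \<nu>) b \<nu> = wedge a b \<nu> - wedge a' b \<nu>"
  and wedge_diff_right: "wedge a (\<lambda>\<nu>. b \<nu> - b' \<nu>) \<nu> = wedge a b \<nu> - wedge a b' \<nu>"
  by (simp_all add: wedge_def algebra_simps flip: sum_subtractf)

lemma wedge_scalar_left:
  assumes "finite \<nu>" "\<And>\<mu>. \<mu> \<subseteq> \<nu> \<Longrightarrow> \<mu> \<noteq> {} \<Longrightarrow> a \<mu> = 0"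
  shows "wedge a b \<nu> = a {} * b \<nu>"
proof -
  have "wedge a b \<nu> = (\<Sum>\<mu>\<in>{{}}. exterior_sign \<mu> (\<nu> - \<mu>) * a \<mu> * b (\<nu> - \<mu>))"
    unfolding wedge_def using assms by (intro sum.mono_neutral_right) auto
  then show ?thesis by simp
qed

lemma majorized_zero: "majorized m D y r 0 (\<lambda>x. 0)"
  unfolding majorized_def
  by (intro exI[of _ "\<lambda>_. 0"]) (auto simp: l1_bounded_def series_value_def)

lemma majorized_sum:
  assumes "finite F" "\<And>k. k \<in> F \<Longrightarrow> majorized m D y r (\<beta> k) (f k)" "in_polydisc m D y r" "0 \<le> r"
  shows "majorized m D y r (\<Sum>k\<in>F. \<beta> k) (\<lambda>x. \<Sum>k\<in>F. f k x)"
  using assms(1,2) by (induction F rule: finite_induct) (auto intro!: majorized_zero majorized_add assms(3,4))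

definition super_majorized ::
    "nat \<Rightarrow> nat \<Rightarrow> 'p set \<Rightarrow> ('p \<Rightarrow> nat \<Rightarrow> complex) \<Rightarrow> real \<Rightarrow> real \<Rightarrow> (nat set \<Rightarrow> 'p \<Rightarrow> complex) \<Rightarrow> bool"
  where "super_majorized m n D y r B f \<longleftrightarrow>
    (\<exists>b. (\<forall>\<nu>\<subseteq>{..<n}. majorized m D y r (b \<nu>) (f \<nu>)) \<and> (\<Sum>\<nu>\<in>Pow {..<n}. b \<nu>) \<le> B)"

lemma super_majorizedI:
  assumes "\<And>\<nu>. \<nu> \<subseteq> {..<n} \<Longrightarrow> majorized m D y r (b \<nu>) (f \<nu>)" "(\<Sum>\<nu>\<in>Pow {..<n}. b \<nu>) \<le> B"
  shows "super_majorized m n D y r B f"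
  unfolding super_majorized_def using assms by (intro exI[of _ b]) blast

lemma super_majorizedE:
  assumes "super_majorized m n D y r B f"
  obtains b where "\<And>\<nu>. \<nu> \<subseteq> {..<n} \<Longrightarrow> majorized m D y r (b \<nu>) (f \<nu>)" "(\<Sum>\<nu>\<in>Pow {..<n}. b \<nu>) \<le> B"
    "\<And>\<nu>. \<nu> \<subseteq> {..<n} \<Longrightarrow> 0 \<le> b \<nu>" "\<And>\<nu>. \<nu> \<subseteq> {..<n} \<Longrightarrow> b \<nu> \<le> B"
proof -
  obtain b where b: "\<forall>\<nu>\<subseteq>{..<n}. majorized m D y r (b \<nu>) (f \<nu>)" "(\<Sum>\<nu>\<in>Pow {..<n}. b \<nu>) \<le> B"
    using assms unfolding super_majorized_def by (elim exE conjE) (rule that)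
  have nonneg: "0 \<le> b \<nu>" if "\<nu> \<subseteq> {..<n}" for \<nu> using b(1) that majorized_nonneg by blast
  have "b \<nu> \<le> B" if "\<nu> \<subseteq> {..<n}" for \<nu>
  proof -
    have "b \<nu> \<le> (\<Sum>\<nu>\<in>Pow {..<n}. b \<nu>)" using that nonneg by (intro member_le_sum) auto
    then show ?thesis using b(2) by simp
  qed
  with b nonneg show ?thesis by (intro that[of b]) blast+
qed

lemma super_majorized_nonneg:
  assumes "super_majorized m n D y r B f" shows "0 \<le> B"
  by (rule super_majorizedE[OF assms]) (metis empty_subsetI order_trans)

lemma super_majorized_component:
  assumes "super_majorized m n D y r B f" "\<nu> \<subseteq> {..<n}" "0 \<le> r"
  shows "majorized m D y r B (f \<nu>)"
proof (rule super_majorizedE[OF assms(1)])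
  fix b assume b: "\<And>\<nu>. \<nu> \<subseteq> {..<n} \<Longrightarrow> majorized m D y r (b \<nu>) (f \<nu>)"
    "\<And>\<nu>. \<nu> \<subseteq> {..<n} \<Longrightarrow> b \<nu> \<le> B"
  show ?thesis
    by (rule majorized_mono[OF b(1)[OF assms(2)] order_refl assms(3) order_refl b(2)[OF assms(2)]])
qed

lemma super_majorized_mono:
  assumes "super_majorized m n D y r B f" "D' \<subseteq> D" "0 \<le> r'" "r' \<le> r" "B \<le> B'"
  shows "super_majorized m n D' y r' B' f"
proof (rule super_majorizedE[OF assms(1)])
  fix b assume b: "\<And>\<nu>. \<nu> \<subseteq> {..<n} \<Longrightarrow> majorized m D y r (b \<nu>) (f \<nu>)" "(\<Sum>\<nu>\<in>Pow {..<n}. b \<nu>) \<le> B"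
  show ?thesis
  proof (rule super_majorizedI)
    show "majorized m D' y r' (b \<nu>) (f \<nu>)" if "\<nu> \<subseteq> {..<n}" for \<nu>
      using b(1)[OF that] assms(2-4) by (rule majorized_mono) simp
  qed (use b(2) assms(5) in simp)
qed

lemma super_majorized_cong:
  assumes "super_majorized m n D y r B f" "\<And>\<nu> x. \<nu> \<subseteq> {..<n} \<Longrightarrow> x \<in> D \<Longrightarrow> f \<nu> x = g \<nu> x"
  shows "super_majorized m n D y r B g"
proof (rule super_majorizedE[OF assms(1)])
  fix b assume b: "\<And>\<nu>. \<nu> \<subseteq> {..<n} \<Longrightarrow> majorized m D y r (b \<nu>) (f \<nu>)" "(\<Sum>\<nu>\<in>Pow {..<n}. b \<nu>) \<le> B"
  show ?thesis
  proof (rule super_majorizedI)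
    show "majorized m D y r (b \<nu>) (g \<nu>)" if "\<nu> \<subseteq> {..<n}" for \<nu>
      using b(1)[OF that] assms(2)[OF that] by (rule majorized_cong)
  qed (rule b(2))
qed

lemma super_majorized_cmult:
  assumes "super_majorized m n D y r B f"
  shows "super_majorized m n D y r (cmod k * B) (\<lambda>\<nu> x. k * f \<nu> x)"
proof (rule super_majorizedE[OF assms])
  fix b assume b: "\<And>\<nu>. \<nu> \<subseteq> {..<n} \<Longrightarrow> majorized m D y r (b \<nu>) (f \<nu>)" "(\<Sum>\<nu>\<in>Pow {..<n}. b \<nu>) \<le> B"
  show ?thesis
  proof (rule super_majorizedI)
    show "majorized m D y r (cmod k * b \<nu>) (\<lambda>x. k * f \<nu> x)" if "\<nu> \<subseteq> {..<n}" for \<nu>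
      using b(1)[OF that] by (rule majorized_cmult)
  qed (use b(2) in \<open>simp add: mult_left_mono flip: sum_distrib_left\<close>)
qed

lemma super_majorized_add:
  assumes f: "super_majorized m n D y r B f" and g: "super_majorized m n D y r B' g"
    and D: "in_polydisc m D y r" "0 \<le> r"
  shows "super_majorized m n D y r (B + B') (\<lambda>\<nu> x. f \<nu> x + g \<nu> x)"
proof (rule super_majorizedE[OF f], rule super_majorizedE[OF g])
  fix b b'
  assume b: "\<And>\<nu>. \<nu> \<subseteq> {..<n} \<Longrightarrow> majorized m D y r (b \<nu>) (f \<nu>)" "(\<Sum>\<nu>\<in>Pow {..<n}. b \<nu>) \<le> B"
    and b': "\<And>\<nu>. \<nu> \<subseteq> {..<n} \<Longrightarrow> majorized m D y r (b' \<nu>) (g \<nu>)" "(\<Sum>\<nu>\<in>Pow {..<n}. b' \<nu>) \<le> B'"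
  show ?thesis
  proof (rule super_majorizedI)
    show "majorized m D y r (b \<nu> + b' \<nu>) (\<lambda>x. f \<nu> x + g \<nu> x)" if "\<nu> \<subseteq> {..<n}" for \<nu>
      using b(1)[OF that] b'(1)[OF that] D by (rule majorized_add)
  qed (use b(2) b'(2) in \<open>simp add: sum.distrib\<close>)
qed

lemma super_majorized_diff:
  assumes f: "super_majorized m n D y r B f" and g: "super_majorized m n D y r B' g"
    and D: "in_polydisc m D y r" "0 \<le> r"
  shows "super_majorized m n D y r (B + B') (\<lambda>\<nu> x. f \<nu> x - g \<nu> x)"
  using super_majorized_add[OF f super_majorized_cmult[OF g, of "-1"] D] by simp

lemma super_majorized_zero: "super_majorized m n D y r 0 (\<lambda>\<nu> x. 0)"
  by (rule super_majorizedI[where b = "\<lambda>_. 0"]) (auto intro: majorized_zero)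

lemma super_majorized_sum:
  assumes "finite F" "\<And>k. k \<in> F \<Longrightarrow> super_majorized m n D y r (\<beta> k) (f k)" "in_polydisc m D y r" "0 \<le> r"
  shows "super_majorized m n D y r (\<Sum>k\<in>F. \<beta> k) (\<lambda>\<nu> x. \<Sum>k\<in>F. f k \<nu> x)"
  using assms(1,2)
  by (induction F rule: finite_induct) (auto intro!: super_majorized_zero super_majorized_add assms(3,4))

lemma super_majorized_infsum:
  assumes f: "\<And>k. k \<in> K \<Longrightarrow> super_majorized m n D y r (\<beta> k) (f k)"
    and \<beta>: "\<And>F. finite F \<Longrightarrow> F \<subseteq> K \<Longrightarrow> sum \<beta> F \<le> B"
    and g: "\<And>\<nu> x. \<nu> \<subseteq> {..<n} \<Longrightarrow> x \<in> D \<Longrightarrow> ((\<lambda>k. f k \<nu> x) has_sum g \<nu> x) K"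
    and D: "in_polydisc m D y r" "0 < r"
  shows "super_majorized m n D y r B g"
proof -
  have "\<forall>k\<in>K. \<exists>b. (\<forall>\<nu>\<subseteq>{..<n}. majorized m D y r (b \<nu>) (f k \<nu>)) \<and> (\<Sum>\<nu>\<in>Pow {..<n}. b \<nu>) \<le> \<beta> k"
    using f unfolding super_majorized_def by blast
  from bchoice[OF this] obtain b where
    b: "\<forall>k\<in>K. (\<forall>\<nu>\<subseteq>{..<n}. majorized m D y r (b k \<nu>) (f k \<nu>)) \<and> (\<Sum>\<nu>\<in>Pow {..<n}. b k \<nu>) \<le> \<beta> k" ..
  have maj: "majorized m D y r (b k \<nu>) (f k \<nu>)" if "k \<in> K" "\<nu> \<subseteq> {..<n}" for k \<nu> using b that by blast
  have b0: "0 \<le> b k \<nu>" if "k \<in> K" "\<nu> \<subseteq> {..<n}" for k \<nu> using maj[OF that] by (rule majorized_nonneg)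
  have fin_sum: "(\<Sum>\<nu>\<in>Pow {..<n}. \<Sum>k\<in>F. b k \<nu>) \<le> B" if F: "finite F" "F \<subseteq> K" for F
  proof -
    have "(\<Sum>\<nu>\<in>Pow {..<n}. \<Sum>k\<in>F. b k \<nu>) = (\<Sum>k\<in>F. \<Sum>\<nu>\<in>Pow {..<n}. b k \<nu>)" by (rule sum.swap)
    also have "\<dots> \<le> sum \<beta> F" using b F by (intro sum_mono) blast
    also have "\<dots> \<le> B" using F by (rule \<beta>)
    finally show ?thesis .
  qed
  have col: "(\<lambda>k. b k \<nu>) summable_on K" if \<nu>: "\<nu> \<subseteq> {..<n}" for \<nu>
  proof (rule nonneg_bdd_above_summable_on)
    show "bdd_above (sum (\<lambda>k. b k \<nu>) ` {F. F \<subseteq> K \<and> finite F})"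
    proof (rule bdd_aboveI2[of _ _ B])
      fix F assume "F \<in> {F. F \<subseteq> K \<and> finite F}"
      then have F: "finite F" "F \<subseteq> K" by auto
      have "(\<Sum>k\<in>F. b k \<nu>) \<le> (\<Sum>\<nu>\<in>Pow {..<n}. \<Sum>k\<in>F. b k \<nu>)"
        using \<nu> F b0 by (intro member_le_sum[where f = "\<lambda>\<nu>. \<Sum>k\<in>F. b k \<nu>"] sum_nonneg) (auto simp: subset_iff)
      then show "(\<Sum>k\<in>F. b k \<nu>) \<le> B" using fin_sum[OF F] by simp
    qed
  qed (use b0 \<nu> in auto)
  show ?thesis
  proof (rule super_majorizedI)
    fix \<nu> :: "nat set" assume \<nu>: "\<nu> \<subseteq> {..<n}"
    show "majorized m D y r (\<Sum>\<^sub>\<infinity>k\<in>K. b k \<nu>) (g \<nu>)"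
    proof (rule majorized_infsum[where f = "\<lambda>k. f k \<nu>", OF maj _ g D])
      show "sum (\<lambda>k. b k \<nu>) F \<le> (\<Sum>\<^sub>\<infinity>k\<in>K. b k \<nu>)" if "finite F" "F \<subseteq> K" for F
        using col[OF \<nu>] that by (rule finite_sum_le_infsum) (use b0 \<nu> in auto)
    qed (use \<nu> in auto)
  next
    have "((\<lambda>k. \<Sum>\<nu>\<in>Pow {..<n}. b k \<nu>) has_sum (\<Sum>\<nu>\<in>Pow {..<n}. \<Sum>\<^sub>\<infinity>k\<in>K. b k \<nu>)) K"
      by (rule has_sum_finite_sum) (auto intro!: has_sum_infsum col)
    then show "(\<Sum>\<nu>\<in>Pow {..<n}. \<Sum>\<^sub>\<infinity>k\<in>K. b k \<nu>) \<le> B"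
    proof (rule has_sum_le_finite_sums)
      fix F assume "finite F" "F \<subseteq> K"
      then show "(\<Sum>k\<in>F. \<Sum>\<nu>\<in>Pow {..<n}. b k \<nu>) \<le> B" using fin_sum by (subst sum.swap) auto
    qed
  qed
qed

lemma super_majorized_mult:
  assumes f: "super_majorized m n D y r B f" and g: "super_majorized m n D y r B' g"
    and D: "in_polydisc m D y r" "0 < r"
  shows "super_majorized m n D y r (B * B') (super_mult f g)"
proof (rule super_majorizedE[OF f], rule super_majorizedE[OF g])
  fix b b'
  assume b: "\<And>\<nu>. \<nu> \<subseteq> {..<n} \<Longrightarrow> majorized m D y r (b \<nu>) (f \<nu>)" "(\<Sum>\<nu>\<in>Pow {..<n}. b \<nu>) \<le> B"
      "\<And>\<nu>. \<nu> \<subseteq> {..<n} \<Longrightarrow> 0 \<le> b \<nu>"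
    and b': "\<And>\<nu>. \<nu> \<subseteq> {..<n} \<Longrightarrow> majorized m D y r (b' \<nu>) (g \<nu>)" "(\<Sum>\<nu>\<in>Pow {..<n}. b' \<nu>) \<le> B'"
      "\<And>\<nu>. \<nu> \<subseteq> {..<n} \<Longrightarrow> 0 \<le> b' \<nu>"
  show ?thesis
  proof (rule super_majorizedI)
    fix \<nu> :: "nat set" assume \<nu>: "\<nu> \<subseteq> {..<n}"
    have "majorized m D y r (\<Sum>\<mu>\<in>Pow \<nu>. b \<mu> * b' (\<nu> - \<mu>))
        (\<lambda>x. \<Sum>\<mu>\<in>Pow \<nu>. exterior_sign \<mu> (\<nu> - \<mu>) * (f \<mu> x * g (\<nu> - \<mu>) x))"
    proof (rule majorized_sum)
      show "finite (Pow \<nu>)" using \<nu> by (simp add: finite_subset[OF \<nu>])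
      fix \<mu> assume \<mu>: "\<mu> \<in> Pow \<nu>"
      have "\<mu> \<subseteq> {..<n}" "\<nu> - \<mu> \<subseteq> {..<n}" using \<mu> \<nu> by auto
      then have "majorized m D y r (b \<mu> * b' (\<nu> - \<mu>)) (\<lambda>x. f \<mu> x * g (\<nu> - \<mu>) x)"
        using D by (intro majorized_mult b b')
      from majorized_cmult[OF this, of "exterior_sign \<mu> (\<nu> - \<mu>)"]
      show "majorized m D y r (b \<mu> * b' (\<nu> - \<mu>))
          (\<lambda>x. exterior_sign \<mu> (\<nu> - \<mu>) * (f \<mu> x * g (\<nu> - \<mu>) x))" by simp
    qed (use D in auto)
    then show "majorized m D y r (\<Sum>\<mu>\<in>Pow \<nu>. b \<mu> * b' (\<nu> - \<mu>)) (super_mult f g \<nu>)"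
      by (rule majorized_cong) (simp add: super_mult_def wedge_def mult.assoc)
  next
    have "(\<Sum>\<nu>\<in>Pow {..<n}. \<Sum>\<mu>\<in>Pow \<nu>. b \<mu> * b' (\<nu> - \<mu>)) \<le> (\<Sum>\<nu>\<in>Pow {..<n}. b \<nu>) * (\<Sum>\<nu>\<in>Pow {..<n}. b' \<nu>)"
      by (rule sum_disjoint_pairs_le) (use b(3) b'(3) in auto)
    also have "\<dots> \<le> B * B'"
      by (rule mult_mono[OF b(2) b'(2)])
        (use b(3) b'(3) super_majorized_nonneg[OF f] in \<open>auto intro!: sum_nonneg\<close>)
    finally show "(\<Sum>\<nu>\<in>Pow {..<n}. \<Sum>\<mu>\<in>Pow \<nu>. b \<mu> * b' (\<nu> - \<mu>)) \<le> B * B'" .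
  qed
qed

lemma super_majorized_scalar:
  assumes "majorized m D y r B (f {})" "\<And>\<nu> x. \<nu> \<subseteq> {..<n} \<Longrightarrow> \<nu> \<noteq> {} \<Longrightarrow> x \<in> D \<Longrightarrow> f \<nu> x = 0"
  shows "super_majorized m n D y r B f"
proof (rule super_majorizedI[where b = "\<lambda>\<nu>. if \<nu> = {} then B else 0"])
  fix \<nu> assume \<nu>: "\<nu> \<subseteq> {..<n}"
  show "majorized m D y r (if \<nu> = {} then B else 0) (f \<nu>)"
  proof (cases "\<nu> = {}")
    case False
    have "majorized m D y r 0 (f \<nu>)"
      using majorized_zero by (rule majorized_cong) (use assms(2)[OF \<nu> False] in simp)
    then show ?thesis using False by simp
  qed (use assms in simp)
qed simp

lemma wedge_norm_le_of_super_majorized: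
  assumes "super_majorized m n D y r B f" "in_polydisc m D y r" "x \<in> D"
  shows "wedge_norm n (\<lambda>\<nu>. f \<nu> x) \<le> B"
proof (rule super_majorizedE[OF assms(1)])
  fix b assume b: "\<And>\<nu>. \<nu> \<subseteq> {..<n} \<Longrightarrow> majorized m D y r (b \<nu>) (f \<nu>)" "(\<Sum>\<nu>\<in>Pow {..<n}. b \<nu>) \<le> B"
  have "wedge_norm n (\<lambda>\<nu>. f \<nu> x) \<le> (\<Sum>\<nu>\<in>Pow {..<n}. b \<nu>)"
    unfolding wedge_norm_def by (intro sum_mono majorized_norm_le[OF b(1) assms(2,3)]) auto
  then show ?thesis using b(2) by simp
qed

section \<open>Algebra homomorphisms are given by substitution\<close>

lemma index_update_in: "\<beta> \<in> multi_indices m \<Longrightarrow> i < m \<Longrightarrow> \<beta>(i := l) \<in> multi_indices m"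
  by (auto simp: multi_indices_def PiE_iff extensional_def)

lemma degree_update:
  assumes "i < m" shows "multi_degree m (\<beta>(i := l)) + \<beta> i = multi_degree m \<beta> + l"
proof -
  have eq: "multi_degree m \<gamma> = \<gamma> i + (\<Sum>j\<in>{..<m} - {i}. \<gamma> j)" for \<gamma> :: "nat \<Rightarrow> nat"
    unfolding multi_degree_def using assms by (subst sum.remove[of _ i]) auto
  have "(\<Sum>j\<in>{..<m} - {i}. (\<beta>(i := l)) j) = (\<Sum>j\<in>{..<m} - {i}. \<beta> j)" by (intro sum.cong) auto
  then show ?thesis using eq[of \<beta>] eq[of "\<beta>(i := l)"] by simp
qed

lemma add_unit_update:
  "\<beta> \<in> multi_indices m \<Longrightarrow> i < m \<Longrightarrow> multi_add m (multi_unit m i) (\<beta>(i := l)) = \<beta>(i := Suc l)"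
  by (auto simp: multi_add_def multi_unit_def multi_indices_def PiE_iff extensional_def fun_eq_iff)

text \<open>
  Division of a power series by \<open>y\<^sub>i - b\<close>: as power series, \<open>c = c'' + (y\<^sub>i - b) c'\<close>, where the remainder
  \<open>c''\<close> is free of \<open>y\<^sub>i\<close> and depends on no further variable than \<open>c\<close> does. The identity is stated for
  the functional that replaces each monomial \<open>y\<^sup>\<alpha>\<close> by an arbitrary number \<open>e\<^sub>\<alpha>\<close> of admissible
  size, since it is needed both for the values of the monomials and for the coefficients of their
  images under a homomorphism, of which nothing but multiplicativity is known.
\<close>

lemma power_series_division:
  assumes c: "series_bounded m R B c" and i: "i < m" and b: "cmod b \<le> \<rho>" and \<rho>: "0 \<le> \<rho>" "\<rho> < R"
  shows "\<exists>c' c''. series_bounded m R (B / (R - \<rho>)) c' \<and> series_bounded m R B c'' \<and>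
    (\<forall>e. (\<forall>\<alpha>\<in>multi_indices m. cmod (e \<alpha>) \<le> R ^ multi_degree m \<alpha>) \<longrightarrow>
      (\<Sum>\<^sub>\<infinity>\<alpha>\<in>multi_indices m. c \<alpha> * e \<alpha>) = (\<Sum>\<^sub>\<infinity>\<alpha>\<in>multi_indices m. c'' \<alpha> * e \<alpha>) +
        (\<Sum>\<^sub>\<infinity>\<alpha>\<in>multi_indices m. c' \<alpha> * e (multi_add m (multi_unit m i) \<alpha>)) -
        b * (\<Sum>\<^sub>\<infinity>\<alpha>\<in>multi_indices m. c' \<alpha> * e \<alpha>)) \<and>
    (\<forall>\<gamma>. c'' \<gamma> \<noteq> 0 \<longrightarrow> (\<exists>\<beta>\<in>multi_indices m. c \<beta> \<noteq> 0 \<and> \<gamma> = \<beta>(i := 0)))"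
proof -
  let ?I = "multi_indices m" and ?\<omega> = "\<lambda>\<alpha>. R ^ multi_degree m \<alpha>"
  have R: "0 < R" using \<rho> by simp
  \<comment> \<open>the quotient \<open>d'\<close> and the remainder \<open>d''\<close> of a single term, by the geometric sum for \<open>(y\<^sup>a - b\<^sup>a) / (y - b)\<close>\<close>
  define d' where "d' \<beta> \<gamma> = (\<Sum>l<\<beta> i. if \<gamma> = \<beta>(i := l) then c \<beta> * b ^ (\<beta> i - Suc l) else 0)" for \<beta> \<gamma>
  define d'' where "d'' \<beta> \<gamma> = (if \<gamma> = \<beta>(i := 0) then c \<beta> * b ^ \<beta> i else 0)" for \<beta> \<gamma>
  have wt: "R ^ multi_degree m (\<beta>(i := l)) * R ^ \<beta> i = R ^ multi_degree m \<beta> * R ^ l" for \<beta> l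
    using degree_update[OF i, of \<beta> l] by (simp flip: power_add)
  have single: "l1_bounded ?I ?\<omega> (cmod k * ?\<omega> \<delta>) (\<lambda>\<gamma>. if \<gamma> = \<delta> then k else 0)" for k \<delta>
    by (rule l1_bounded_single) (use R in auto)
  have l1_fin: "l1_bounded ?I ?\<omega> (\<Sum>l\<in>F. \<beta>' l) (\<lambda>\<gamma>. \<Sum>l\<in>F. g l \<gamma>)"
    if "finite F" "\<And>l. l \<in> F \<Longrightarrow> l1_bounded ?I ?\<omega> (\<beta>' l) (g l)" for F :: "nat set" and \<beta>' g
    using that
  proof (induction F rule: finite_induct)
    case empty
    show ?case by (simp add: l1_bounded_def)
  next
    case (insert l F)
    have "l1_bounded ?I ?\<omega> (\<beta>' l + (\<Sum>l\<in>F. \<beta>' l)) (\<lambda>\<gamma>. g l \<gamma> + (\<Sum>l\<in>F. g l \<gamma>))"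
      by (rule l1_bounded_add) (use insert R in auto)
    then show ?case using insert.hyps by simp
  qed
  have d'b: "l1_bounded ?I ?\<omega> (cmod (c \<beta>) * ?\<omega> \<beta> * (1 / (R - \<rho>))) (d' \<beta>)" for \<beta>
  proof -
    let ?q = "\<lambda>l. cmod (c \<beta> * b ^ (\<beta> i - Suc l)) * ?\<omega> (\<beta>(i := l))"
    have 1: "l1_bounded ?I ?\<omega> (\<Sum>l<\<beta> i. ?q l) (d' \<beta>)"
      unfolding d'_def by (rule l1_fin) (simp, rule single)
    have "(\<Sum>l<\<beta> i. ?q l) * (R ^ \<beta> i * (R - \<rho>)) \<le> cmod (c \<beta>) * ?\<omega> \<beta> * R ^ \<beta> i"
    proof -
      have "(\<Sum>l<\<beta> i. ?q l) * R ^ \<beta> i = (\<Sum>l<\<beta> i. cmod (c \<beta>) * ?\<omega> \<beta> * (cmod b ^ (\<beta> i - Suc l) * R ^ l))"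
        unfolding sum_distrib_right
        by (intro sum.cong refl) (simp add: norm_mult norm_power wt mult.assoc mult.left_commute)
      also have "\<dots> = cmod (c \<beta>) * ?\<omega> \<beta> * (\<Sum>l<\<beta> i. cmod b ^ (\<beta> i - Suc l) * R ^ l)"
        by (simp add: sum_distrib_left)
      also have "\<dots> \<le> cmod (c \<beta>) * ?\<omega> \<beta> * (\<Sum>l<\<beta> i. \<rho> ^ (\<beta> i - Suc l) * R ^ l)"
        using b R by (intro mult_left_mono sum_mono mult_right_mono power_mono) auto
      finally have "(\<Sum>l<\<beta> i. ?q l) * R ^ \<beta> i * (R - \<rho>) \<le>
          cmod (c \<beta>) * ?\<omega> \<beta> * (\<Sum>l<\<beta> i. \<rho> ^ (\<beta> i - Suc l) * R ^ l) * (R - \<rho>)"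
        using \<rho> by (intro mult_right_mono) auto
      also have "\<dots> = cmod (c \<beta>) * ?\<omega> \<beta> * (R ^ \<beta> i - \<rho> ^ \<beta> i)"
        by (simp add: power_diff_sumr2[of R "\<beta> i" \<rho>] mult.assoc mult.commute[of _ "R - \<rho>"])
      also have "\<dots> \<le> cmod (c \<beta>) * ?\<omega> \<beta> * R ^ \<beta> i"
        using \<rho> R by (intro mult_left_mono) auto
      finally show ?thesis by (simp add: mult.assoc)
    qed
    then have "(\<Sum>l<\<beta> i. ?q l) * (R - \<rho>) * R ^ \<beta> i \<le> cmod (c \<beta>) * ?\<omega> \<beta> * R ^ \<beta> i"
      by (simp add: mult_ac)
    then have "(\<Sum>l<\<beta> i. ?q l) * (R - \<rho>) \<le> cmod (c \<beta>) * ?\<omega> \<beta>"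
      using R by (simp only: mult_le_cancel_right_pos zero_less_power)
    then have "(\<Sum>l<\<beta> i. ?q l) \<le> cmod (c \<beta>) * ?\<omega> \<beta> * (1 / (R - \<rho>))"
      using \<rho> by (simp add: pos_le_divide_eq)
    with 1 show ?thesis by (rule l1_bounded_mono)
  qed
  have d''b: "l1_bounded ?I ?\<omega> (cmod (c \<beta>) * ?\<omega> \<beta>) (d'' \<beta>)" for \<beta>
  proof -
    have "cmod (c \<beta> * b ^ \<beta> i) * ?\<omega> (\<beta>(i := 0)) \<le> cmod (c \<beta>) * (R ^ \<beta> i * ?\<omega> (\<beta>(i := 0)))"
      using b \<rho> R unfolding norm_mult norm_power mult.assoc
      by (intro mult_left_mono mult_right_mono power_mono) auto
    also have "\<dots> = cmod (c \<beta>) * ?\<omega> \<beta>" using wt[of \<beta> 0] by (simp add: mult_ac)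
    finally have le: "cmod (c \<beta> * b ^ \<beta> i) * ?\<omega> (\<beta>(i := 0)) \<le> cmod (c \<beta>) * ?\<omega> \<beta>" .
    show ?thesis unfolding d''_def by (rule l1_bounded_mono[OF single le])
  qed
  define S where "S = (\<Sum>\<^sub>\<infinity>\<alpha>\<in>?I. cmod (c \<alpha>) * ?\<omega> \<alpha>)"
  have "(\<lambda>\<alpha>. cmod (c \<alpha> * of_real (?\<omega> \<alpha>))) summable_on ?I"
    "(\<Sum>\<^sub>\<infinity>\<alpha>\<in>?I. cmod (c \<alpha> * of_real (?\<omega> \<alpha>))) \<le> B"
    using l1_bounded_abs_summable[OF c, of "\<lambda>\<alpha>. of_real (?\<omega> \<alpha>)"] R by (simp_all add: norm_power)
  then have S: "((\<lambda>\<alpha>. cmod (c \<alpha>) * ?\<omega> \<alpha>) has_sum S) ?I" "S \<le> B"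
    unfolding S_def using R by (simp_all add: norm_mult norm_power)
  have S': "((\<lambda>\<alpha>. cmod (c \<alpha>) * ?\<omega> \<alpha> * (1 / (R - \<rho>))) has_sum S * (1 / (R - \<rho>))) ?I"
    using S(1) by (rule has_sum_cmult_left)
  have pos: "0 < ?\<omega> \<alpha>" for \<alpha> using R by simp
  define c' where "c' \<gamma> = (\<Sum>\<^sub>\<infinity>\<beta>\<in>?I. d' \<beta> \<gamma>)" for \<gamma>
  define c'' where "c'' \<gamma> = (\<Sum>\<^sub>\<infinity>\<beta>\<in>?I. d'' \<beta> \<gamma>)" for \<gamma>
  have c'b: "series_bounded m R (B / (R - \<rho>)) c'"
  proof (rule l1_bounded_mono)
    show "series_bounded m R (S * (1 / (R - \<rho>))) c'"
      unfolding c'_def by (rule l1_bounded_sum(1)[OF pos d'b S'])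
    show "S * (1 / (R - \<rho>)) \<le> B / (R - \<rho>)" using S(2) \<rho> by (simp add: divide_right_mono)
  qed
  have c''b: "series_bounded m R B c''"
    unfolding c''_def by (rule l1_bounded_mono[OF l1_bounded_sum(1)[OF pos d''b S(1)] S(2)])
  have ev: "(\<Sum>\<^sub>\<infinity>\<alpha>\<in>?I. c \<alpha> * e \<alpha>) = (\<Sum>\<^sub>\<infinity>\<alpha>\<in>?I. c'' \<alpha> * e \<alpha>) +
        (\<Sum>\<^sub>\<infinity>\<alpha>\<in>?I. c' \<alpha> * e (multi_add m (multi_unit m i) \<alpha>)) - b * (\<Sum>\<^sub>\<infinity>\<alpha>\<in>?I. c' \<alpha> * e \<alpha>)"
    if e: "\<And>\<alpha>. \<alpha> \<in> ?I \<Longrightarrow> cmod (e \<alpha>) \<le> ?\<omega> \<alpha>" for e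
  proof -
    define e1 where "e1 \<alpha> = e (multi_add m (multi_unit m i) \<alpha>)" for \<alpha>
    have e1: "cmod (e1 \<alpha> / of_real R) \<le> ?\<omega> \<alpha>" if "\<alpha> \<in> ?I" for \<alpha>
    proof -
      have "cmod (e1 \<alpha>) \<le> R * ?\<omega> \<alpha>" using e[of "multi_add m (multi_unit m i) \<alpha>"] i by (simp add: e1_def)
      then show ?thesis using R by (simp add: norm_divide pos_divide_le_eq mult.commute)
    qed
    have single_ev: "((\<lambda>\<gamma>. (if \<gamma> = \<delta> then k else 0) * f \<gamma>) has_sum k * f \<delta>) ?I" if "\<delta> \<in> ?I" for k \<delta> and f :: "_ \<Rightarrow> complex"
      by (rule has_sum_finite_neutralI[of "{\<delta>}"]) (use that in auto)
    have ev_d': "(\<Sum>\<^sub>\<infinity>\<gamma>\<in>?I. d' \<beta> \<gamma> * f \<gamma>) = c \<beta> * (\<Sum>l<\<beta> i. b ^ (\<beta> i - Suc l) * f (\<beta>(i := l)))"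
      if "\<beta> \<in> ?I" for \<beta> and f :: "_ \<Rightarrow> complex"
    proof -
      have "((\<lambda>\<gamma>. \<Sum>l<\<beta> i. (if \<gamma> = \<beta>(i := l) then c \<beta> * b ^ (\<beta> i - Suc l) else 0) * f \<gamma>) has_sum
          (\<Sum>l<\<beta> i. c \<beta> * b ^ (\<beta> i - Suc l) * f (\<beta>(i := l)))) ?I"
        by (rule has_sum_finite_sum) (simp, rule single_ev, rule index_update_in[OF that i])
      then show ?thesis
        by (simp add: d'_def infsumI sum_distrib_left mult.assoc flip: sum_distrib_right)
    qed
    have ev_d'': "(\<Sum>\<^sub>\<infinity>\<gamma>\<in>?I. d'' \<beta> \<gamma> * f \<gamma>) = c \<beta> * b ^ \<beta> i * f (\<beta>(i := 0))"
      if "\<beta> \<in> ?I" for \<beta> and f :: "_ \<Rightarrow> complex"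
      unfolding d''_def by (rule infsumI, rule single_ev, rule index_update_in[OF that i])
    have h'': "((\<lambda>\<beta>. \<Sum>\<^sub>\<infinity>\<gamma>\<in>?I. d'' \<beta> \<gamma> * e \<gamma>) has_sum (\<Sum>\<^sub>\<infinity>\<alpha>\<in>?I. c'' \<alpha> * e \<alpha>)) ?I"
      unfolding c''_def by (rule l1_bounded_sum(2)[OF pos d''b S(1) e])
    have h': "((\<lambda>\<beta>. \<Sum>\<^sub>\<infinity>\<gamma>\<in>?I. d' \<beta> \<gamma> * e \<gamma>) has_sum (\<Sum>\<^sub>\<infinity>\<alpha>\<in>?I. c' \<alpha> * e \<alpha>)) ?I"
      unfolding c'_def by (rule l1_bounded_sum(2)[OF pos d'b S' e])
    have h1: "((\<lambda>\<beta>. \<Sum>\<^sub>\<infinity>\<gamma>\<in>?I. d' \<beta> \<gamma> * (e1 \<gamma> / of_real R)) has_sum (\<Sum>\<^sub>\<infinity>\<alpha>\<in>?I. c' \<alpha> * (e1 \<alpha> / of_real R))) ?I"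
      unfolding c'_def by (rule l1_bounded_sum(2)[OF pos d'b S' e1])
    have h1': "((\<lambda>\<beta>. \<Sum>\<^sub>\<infinity>\<gamma>\<in>?I. d' \<beta> \<gamma> * e1 \<gamma>) has_sum (\<Sum>\<^sub>\<infinity>\<alpha>\<in>?I. c' \<alpha> * e1 \<alpha>)) ?I"
    proof -
      have *: "(\<Sum>\<^sub>\<infinity>\<gamma>\<in>?I. g \<gamma> * (e1 \<gamma> / of_real R)) * of_real R = (\<Sum>\<^sub>\<infinity>\<gamma>\<in>?I. g \<gamma> * e1 \<gamma>)" for g
        using R by (simp flip: infsum_cmult_left')
      show ?thesis using has_sum_cmult_left[OF h1, of "of_real R"] by (simp only: *)
    qed
    have "((\<lambda>\<beta>. c \<beta> * e \<beta>) has_sum ((\<Sum>\<^sub>\<infinity>\<alpha>\<in>?I. c'' \<alpha> * e \<alpha>) + (\<Sum>\<^sub>\<infinity>\<alpha>\<in>?I. c' \<alpha> * e1 \<alpha>) +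
        - b * (\<Sum>\<^sub>\<infinity>\<alpha>\<in>?I. c' \<alpha> * e \<alpha>))) ?I"
    proof (rule has_sum_cong[THEN iffD1, OF _ has_sum_add[OF has_sum_add[OF h'' h1'] has_sum_cmult_right[OF h', of "- b"]]])
      fix \<beta> assume \<beta>: "\<beta> \<in> ?I"
      have e1u: "e1 (\<beta>(i := l)) = e (\<beta>(i := Suc l))" for l
        by (simp add: e1_def add_unit_update[OF \<beta> i])
      define E where "E l = e (\<beta>(i := l))" for l
      have tele: "b ^ a * E 0 + (\<Sum>l<a. b ^ (a - Suc l) * (E (Suc l) - b * E l)) = E a" for a
      proof (induction a)
        case (Suc a)
        let ?S = "\<Sum>l<a. b ^ (a - Suc l) * (E (Suc l) - b * E l)"
        have eq: "(\<Sum>l<a. b ^ (Suc a - Suc l) * (E (Suc l) - b * E l)) = b * ?S"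
          unfolding sum_distrib_left
        proof (rule sum.cong[OF refl])
          fix l assume "l \<in> {..<a}"
          then have "Suc a - Suc l = Suc (a - Suc l)" by simp
          then show "b ^ (Suc a - Suc l) * (E (Suc l) - b * E l) = b * (b ^ (a - Suc l) * (E (Suc l) - b * E l))"
            by (simp only: power_Suc mult.assoc)
        qed
        have "b ^ Suc a * E 0 + (\<Sum>l<Suc a. b ^ (Suc a - Suc l) * (E (Suc l) - b * E l)) =
            b * (b ^ a * E 0 + ?S) + (E (Suc a) - b * E a)"
          unfolding sum.lessThan_Suc eq by (simp add: distrib_left mult.assoc)
        then show ?case by (simp only: Suc.IH) simp
      qed simp
      show "(\<Sum>\<^sub>\<infinity>\<gamma>\<in>?I. d'' \<beta> \<gamma> * e \<gamma>) + (\<Sum>\<^sub>\<infinity>\<gamma>\<in>?I. d' \<beta> \<gamma> * e1 \<gamma>) + - b * (\<Sum>\<^sub>\<infinity>\<gamma>\<in>?I. d' \<beta> \<gamma> * e \<gamma>) = c \<beta> * e \<beta>"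
      proof -
        have "(\<Sum>\<^sub>\<infinity>\<gamma>\<in>?I. d'' \<beta> \<gamma> * e \<gamma>) + (\<Sum>\<^sub>\<infinity>\<gamma>\<in>?I. d' \<beta> \<gamma> * e1 \<gamma>) + - b * (\<Sum>\<^sub>\<infinity>\<gamma>\<in>?I. d' \<beta> \<gamma> * e \<gamma>) =
          c \<beta> * (b ^ \<beta> i * E 0 + (\<Sum>l<\<beta> i. b ^ (\<beta> i - Suc l) * (E (Suc l) - b * E l)))"
          unfolding E_def ev_d'[OF \<beta>] ev_d''[OF \<beta>] e1u
          by (simp add: algebra_simps sum_subtractf sum_distrib_left sum_negf)
        also have "\<dots> = c \<beta> * E (\<beta> i)" by (simp only: tele)
        finally show ?thesis by (simp add: E_def)
      qed
    qed
    then show ?thesis by (simp add: infsumI e1_def)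
  qed
  have supp: "\<exists>\<beta>\<in>?I. c \<beta> \<noteq> 0 \<and> \<gamma> = \<beta>(i := 0)" if "c'' \<gamma> \<noteq> 0" for \<gamma>
  proof (rule ccontr)
    assume "\<not> ?thesis"
    then have "d'' \<beta> \<gamma> = 0" if "\<beta> \<in> ?I" for \<beta> using that by (auto simp: d''_def)
    then have "c'' \<gamma> = 0" unfolding c''_def by (rule infsum_0)
    then show False using that by simp
  qed
  show ?thesis
  proof (rule exI[of _ c'], rule exI[of _ c''], intro conjI allI impI)
    fix e :: "(nat \<Rightarrow> nat) \<Rightarrow> complex"
    assume e: "\<forall>\<alpha>\<in>?I. cmod (e \<alpha>) \<le> ?\<omega> \<alpha>"
    show "(\<Sum>\<^sub>\<infinity>\<alpha>\<in>?I. c \<alpha> * e \<alpha>) = (\<Sum>\<^sub>\<infinity>\<alpha>\<in>?I. c'' \<alpha> * e \<alpha>) +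
        (\<Sum>\<^sub>\<infinity>\<alpha>\<in>?I. c' \<alpha> * e (multi_add m (multi_unit m i) \<alpha>)) - b * (\<Sum>\<^sub>\<infinity>\<alpha>\<in>?I. c' \<alpha> * e \<alpha>)"
      by (rule ev, rule e[rule_format])
  qed (fact c'b c''b supp)+
qed

definition super_series ::
    "nat \<Rightarrow> 'p set \<Rightarrow> ('p \<Rightarrow> nat \<Rightarrow> complex) \<Rightarrow> ((nat \<Rightarrow> nat) \<Rightarrow> complex) \<Rightarrow> nat set \<Rightarrow> 'p \<Rightarrow> complex"
  where "super_series m W y c \<nu> x = (if \<nu> = {} \<and> x \<in> W then series_value m c (y x) else 0)"

definition super_monomial ::
    "nat \<Rightarrow> 'p set \<Rightarrow> ('p \<Rightarrow> nat \<Rightarrow> complex) \<Rightarrow> (nat \<Rightarrow> nat) \<Rightarrow> nat set \<Rightarrow> 'p \<Rightarrow> complex"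
  where "super_monomial m W y \<alpha> \<nu> x = (if \<nu> = {} \<and> x \<in> W then multi_power m (y x) \<alpha> else 0)"

definition exterior_basis :: "'p set \<Rightarrow> nat set \<Rightarrow> nat set \<Rightarrow> 'p \<Rightarrow> complex"
  where "exterior_basis W \<mu> \<nu> x = (if \<nu> = \<mu> \<and> x \<in> W then 1 else 0)"

lemma super_monomial_eq_series:
  assumes "\<alpha> \<in> multi_indices m"
  shows "super_monomial m W y \<alpha> = super_series m W y (\<lambda>\<beta>. if \<beta> = \<alpha> then 1 else 0)"
proof -
  have "series_value m (\<lambda>\<beta>. if \<beta> = \<alpha> then 1 else 0) w = multi_power m w \<alpha>" for w
    unfolding series_value_def
    by (rule infsumI, rule has_sum_finite_neutralI[of "{\<alpha>}"]) (use assms in auto)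
  then show ?thesis by (simp add: super_monomial_def super_series_def fun_eq_iff)
qed

text \<open>
  An algebra homomorphism \<open>T\<close> from superfunctions on the polydisc \<open>W\<close> to superfunctions on \<open>W'\<close>,
  both in terms of their coefficients. The laws are required only for the values that are meaningful,
  that is for indices in \<open>{..<n}\<close> and points of \<open>W'\<close>. They are purely algebraic; that \<open>T\<close> respects
  infinite sums is a theorem below.
\<close>

locale superdomain_map =
  fixes m n :: nat and W :: "'p set" and y :: "'p \<Rightarrow> nat \<Rightarrow> complex" and R :: real
    and A :: "(nat set \<Rightarrow> 'p \<Rightarrow> complex) set"
    and W' :: "'p set" and T :: "(nat set \<Rightarrow> 'p \<Rightarrow> complex) \<Rightarrow> nat set \<Rightarrow> 'p \<Rightarrow> complex"
  assumes R: "0 < R" and polydisc: "in_polydisc m W y R" and sub: "W' \<subseteq> W"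
    and A_zero: "\<And>f \<nu> x. f \<in> A \<Longrightarrow> \<not> (\<nu> \<subseteq> {..<n} \<and> x \<in> W) \<Longrightarrow> f \<nu> x = 0"
    and A_add: "\<And>f g. f \<in> A \<Longrightarrow> g \<in> A \<Longrightarrow> (\<lambda>\<nu> x. f \<nu> x + g \<nu> x) \<in> A"
    and A_cmult: "\<And>k f. f \<in> A \<Longrightarrow> (\<lambda>\<nu> x. k * f \<nu> x) \<in> A"
    and A_mult: "\<And>f g. f \<in> A \<Longrightarrow> g \<in> A \<Longrightarrow> super_mult f g \<in> A"
    and A_series: "\<And>c B. series_bounded m R B c \<Longrightarrow> super_series m W y c \<in> A"
    and A_basis: "\<And>\<mu>. \<mu> \<subseteq> {..<n} \<Longrightarrow> exterior_basis W \<mu> \<in> A"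
    and T_add: "\<And>f g \<nu> x. f \<in> A \<Longrightarrow> g \<in> A \<Longrightarrow> \<nu> \<subseteq> {..<n} \<Longrightarrow> x \<in> W' \<Longrightarrow>
      T (\<lambda>\<nu> x. f \<nu> x + g \<nu> x) \<nu> x = T f \<nu> x + T g \<nu> x"
    and T_cmult: "\<And>k f \<nu> x. f \<in> A \<Longrightarrow> \<nu> \<subseteq> {..<n} \<Longrightarrow> x \<in> W' \<Longrightarrow> T (\<lambda>\<nu> x. k * f \<nu> x) \<nu> x = k * T f \<nu> x"
    and T_mult: "\<And>f g \<nu> x. f \<in> A \<Longrightarrow> g \<in> A \<Longrightarrow> \<nu> \<subseteq> {..<n} \<Longrightarrow> x \<in> W' \<Longrightarrow>
      T (super_mult f g) \<nu> x = super_mult (T f) (T g) \<nu> x"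
    and T_one: "\<And>\<nu> x. \<nu> \<subseteq> {..<n} \<Longrightarrow> x \<in> W' \<Longrightarrow> T (exterior_basis W {}) \<nu> x = (if \<nu> = {} then 1 else 0)"
begin

abbreviation coord where "coord j \<equiv> super_monomial m W y (multi_unit m j)"
abbreviation mono where "mono \<equiv> super_monomial m W y"
abbreviation series where "series \<equiv> super_series m W y"

lemma mono_zero: "mono (multi_zero m) = exterior_basis W {}"
  by (simp add: super_monomial_def exterior_basis_def fun_eq_iff)

lemma super_mult_scalar:
  assumes "\<And>\<nu> x. \<nu> \<noteq> {} \<Longrightarrow> f \<nu> x = 0" "\<And>\<nu> x. infinite \<nu> \<Longrightarrow> g \<nu> x = 0"
  shows "super_mult f g = (\<lambda>\<nu> x. f {} x * g \<nu> x)"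
proof (intro ext)
  fix \<nu> x
  show "super_mult f g \<nu> x = f {} x * g \<nu> x"
  proof (cases "finite \<nu>")
    case True
    then show ?thesis unfolding super_mult_def using assms(1) by (subst wedge_scalar_left) auto
  next
    case False
    then show ?thesis using assms(2) by (simp add: super_mult_def wedge_def)
  qed
qed

lemma mono_add: "mono (multi_add m \<alpha> \<beta>) = super_mult (mono \<alpha>) (mono \<beta>)"
  by (subst super_mult_scalar) (auto simp: super_monomial_def multi_power_add fun_eq_iff)

lemma mono_in: assumes "\<alpha> \<in> multi_indices m" shows "mono \<alpha> \<in> A"
  unfolding super_monomial_eq_series[OF assms]
  by (rule A_series[where B = "R ^ multi_degree m \<alpha>"], rule l1_bounded_single) (use R in auto)

lemma A_diff: "f \<in> A \<Longrightarrow> g \<in> A \<Longrightarrow> (\<lambda>\<nu> x. f \<nu> x - g \<nu> x) \<in> A"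
  using A_add[of f "\<lambda>\<nu> x. (-1) * g \<nu> x"] A_cmult[of g "-1"] by simp

lemma T_diff: "f \<in> A \<Longrightarrow> g \<in> A \<Longrightarrow> \<nu> \<subseteq> {..<n} \<Longrightarrow> x \<in> W' \<Longrightarrow>
    T (\<lambda>\<nu> x. f \<nu> x - g \<nu> x) \<nu> x = T f \<nu> x - T g \<nu> x"
  using T_add[of f "\<lambda>\<nu> x. (-1) * g \<nu> x" \<nu> x] T_cmult[of g \<nu> x "-1"] A_cmult[of g "-1"] by simp

lemma A_0: "(\<lambda>\<nu> x. 0) \<in> A"
  using A_cmult[OF A_basis[of "{}"], of 0] by simp

lemma A_sum:
  assumes "finite F" "\<And>k. k \<in> F \<Longrightarrow> f k \<in> A" shows "(\<lambda>\<nu> x. \<Sum>k\<in>F. f k \<nu> x) \<in> A"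
  using assms by (induction F rule: finite_induct) (auto intro: A_add A_0)

lemma T_sum:
  assumes "finite F" "\<And>k. k \<in> F \<Longrightarrow> f k \<in> A" "\<nu> \<subseteq> {..<n}" "x \<in> W'"
  shows "T (\<lambda>\<nu> x. \<Sum>k\<in>F. f k \<nu> x) \<nu> x = (\<Sum>k\<in>F. T (f k) \<nu> x)"
  using assms(1,2)
proof (induction F rule: finite_induct)
  case empty
  show ?case using T_cmult[OF A_basis[of "{}"] assms(3,4), of 0] by simp
next
  case (insert k F)
  then show ?case
    using T_add[of "f k" "\<lambda>\<nu> x. \<Sum>k\<in>F. f k \<nu> x" \<nu> x] A_sum[of F f] assms(3,4) by simp
qed

lemma wedge_norm_T_mono:
  assumes x: "x \<in> W'" and \<rho>: "0 \<le> \<rho>" "\<And>j. j < m \<Longrightarrow> wedge_norm n (\<lambda>\<nu>. T (coord j) \<nu> x) \<le> \<rho>"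
    and \<alpha>: "\<alpha> \<in> multi_indices m"
  shows "wedge_norm n (\<lambda>\<nu>. T (mono \<alpha>) \<nu> x) \<le> \<rho> ^ multi_degree m \<alpha>"
  using \<alpha>
proof (induction rule: multi_index_induct)
  case zero
  have "wedge_norm n (\<lambda>\<nu>. T (mono (multi_zero m)) \<nu> x) = (\<Sum>\<nu>\<in>Pow {..<n}. if \<nu> = {} then 1 else 0)"
    unfolding wedge_norm_def mono_zero using x by (intro sum.cong) (auto simp: T_one)
  then show ?case by simp
next
  case (add j \<beta>)
  let ?a = "\<lambda>\<nu>. T (coord j) \<nu> x" and ?b = "\<lambda>\<nu>. T (mono \<beta>) \<nu> x"
  have "wedge_norm n (\<lambda>\<nu>. T (mono (multi_add m (multi_unit m j) \<beta>)) \<nu> x) = wedge_norm n (wedge ?a ?b)"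
    unfolding wedge_norm_def
  proof (rule sum.cong[OF refl])
    fix \<nu> assume "\<nu> \<in> Pow {..<n}"
    then have "T (super_mult (coord j) (mono \<beta>)) \<nu> x = super_mult (T (coord j)) (T (mono \<beta>)) \<nu> x"
      using x add.hyps by (intro T_mult mono_in) auto
    then show "cmod (T (mono (multi_add m (multi_unit m j) \<beta>)) \<nu> x) = cmod (wedge ?a ?b \<nu>)"
      by (simp add: mono_add super_mult_def)
  qed
  also have "\<dots> \<le> wedge_norm n ?a * wedge_norm n ?b" by (rule wedge_norm_wedge)
  also have "\<dots> \<le> \<rho> * \<rho> ^ multi_degree m \<beta>"
    using \<rho> add by (intro mult_mono) (auto simp: wedge_norm_nonneg)
  finally show ?case using \<open>j < m\<close> by simp
qed

text \<open>
  A homomorphism is determined by the images of the coordinates: it may be applied to a power series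
  term by term, a form of automatic continuity. Let \<open>E c\<close> be the difference of the two
  sides. Dividing by \<open>y\<^sub>j - b\<close>, where \<open>b\<close> is the value at \<open>x\<close> of the image \<open>a\<close> of \<open>y\<^sub>j\<close>, gives
  \<open>E c = E c'' + (a - b) E c'\<close>. The element \<open>a - b\<close> of the exterior algebra has no constant term, so
  the coefficient of \<open>\<theta>\<^sup>\<nu>\<close> in \<open>(a - b) E c'\<close> involves only coefficients of \<open>E c'\<close> of lower degree,
  which vanish by induction on the degree. An inner induction removes one variable after the other
  from \<open>c\<close>; a constant series is mapped correctly because \<open>T\<close> preserves the unit.
\<close>

lemma map_series:
  assumes c: "series_bounded m R B c" and x: "x \<in> W'"
    and \<rho>: "0 \<le> \<rho>" "\<rho> < R" "\<And>j. j < m \<Longrightarrow> wedge_norm n (\<lambda>\<nu>. T (coord j) \<nu> x) \<le> \<rho>"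
    and \<nu>: "\<nu> \<subseteq> {..<n}"
  shows "T (series c) \<nu> x = (\<Sum>\<^sub>\<infinity>\<alpha>\<in>multi_indices m. c \<alpha> * T (mono \<alpha>) \<nu> x)"
proof -
  define S where "S c \<nu> = (\<Sum>\<^sub>\<infinity>\<alpha>\<in>multi_indices m. c \<alpha> * T (mono \<alpha>) \<nu> x)" for c \<nu>
  define E where "E c \<nu> = T (series c) \<nu> x - S c \<nu>" for c \<nu>
  have Tm: "cmod (T (mono \<alpha>) \<nu> x) \<le> R ^ multi_degree m \<alpha>" if "\<alpha> \<in> multi_indices m" "\<nu> \<subseteq> {..<n}" for \<alpha> \<nu>
  proof -
    have "cmod (T (mono \<alpha>) \<nu> x) \<le> wedge_norm n (\<lambda>\<nu>. T (mono \<alpha>) \<nu> x)"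
      using norm_le_wedge_norm[OF that(2), of "\<lambda>\<nu>. T (mono \<alpha>) \<nu> x"] by simp
    also have "\<dots> \<le> \<rho> ^ multi_degree m \<alpha>" by (rule wedge_norm_T_mono[OF x \<rho>(1,3) that(1)])
    also have "\<dots> \<le> R ^ multi_degree m \<alpha>" using \<rho> by (intro power_mono) auto
    finally show ?thesis .
  qed
  have "E c \<nu> = 0" if "series_bounded m R B c" "\<nu> \<subseteq> {..<n}" "card \<nu> < k" for k B c \<nu>
    using that
  proof (induction k arbitrary: B c \<nu>)
    case (Suc k)
    note lower = Suc.IH
    \<comment> \<open>inner induction on the number \<open>j\<close> of variables that may occur in \<open>c\<close>\<close>
    have "E c \<nu> = 0"
      if "series_bounded m R B c" "\<nu> \<subseteq> {..<n}" "card \<nu> < Suc k" "j \<le> m"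
        "\<And>\<alpha> i. \<alpha> \<in> multi_indices m \<Longrightarrow> j \<le> i \<Longrightarrow> i < m \<Longrightarrow> \<alpha> i \<noteq> 0 \<Longrightarrow> c \<alpha> = 0" for j B c \<nu>
      using that
    proof (induction j arbitrary: B c)
      case 0
      have supp: "c \<alpha> = 0" if "\<alpha> \<in> multi_indices m" "\<alpha> \<noteq> multi_zero m" for \<alpha>
      proof -
        have "multi_degree m \<alpha> \<noteq> 0" using that multi_degree_eq_0_iff by blast
        then obtain i where "i < m" "\<alpha> i \<noteq> 0" by (auto simp: multi_degree_def)
        then show ?thesis using 0(5)[OF that(1)] by simp
      qed
      let ?c0 = "c (multi_zero m)"
      have val: "series_value m c w = ?c0" for w
        unfolding series_value_def
        by (rule infsumI, rule has_sum_finite_neutralI[of "{multi_zero m}"]) (use supp in auto)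
      have "series c = (\<lambda>\<nu> x. ?c0 * exterior_basis W {} \<nu> x)"
        by (auto simp: super_series_def exterior_basis_def val fun_eq_iff)
      then have "T (series c) \<nu> x = ?c0 * T (exterior_basis W {}) \<nu> x"
        using T_cmult[OF A_basis[of "{}"] 0(2) x] by simp
      moreover have "S c \<nu> = ?c0 * T (mono (multi_zero m)) \<nu> x"
        unfolding S_def by (rule infsumI, rule has_sum_finite_neutralI[of "{multi_zero m}"]) (use supp in auto)
      ultimately show ?case by (simp add: E_def mono_zero)
    next
      case (Suc j)
      have j: "j < m" using Suc.prems(4) by simp
      define a where "a \<nu> = T (coord j) \<nu> x" for \<nu>
      define b where "b = a {}"
      have b: "cmod b \<le> \<rho>"
        using norm_le_wedge_norm[of "{}" n a] \<rho>(3)[OF j] by (simp add: b_def a_def[abs_def])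
      obtain c' c'' where c': "series_bounded m R (B / (R - \<rho>)) c'" and c'': "series_bounded m R B c''"
        and ev: "\<forall>e. (\<forall>\<alpha>\<in>multi_indices m. cmod (e \<alpha>) \<le> R ^ multi_degree m \<alpha>) \<longrightarrow>
          (\<Sum>\<^sub>\<infinity>\<alpha>\<in>multi_indices m. c \<alpha> * e \<alpha>) = (\<Sum>\<^sub>\<infinity>\<alpha>\<in>multi_indices m. c'' \<alpha> * e \<alpha>) +
            (\<Sum>\<^sub>\<infinity>\<alpha>\<in>multi_indices m. c' \<alpha> * e (multi_add m (multi_unit m j) \<alpha>)) -
            b * (\<Sum>\<^sub>\<infinity>\<alpha>\<in>multi_indices m. c' \<alpha> * e \<alpha>)"
        and supp: "\<forall>\<gamma>. c'' \<gamma> \<noteq> 0 \<longrightarrow> (\<exists>\<beta>\<in>multi_indices m. c \<beta> \<noteq> 0 \<and> \<gamma> = \<beta>(j := 0))"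
        using power_series_division[OF Suc.prems(1) j b \<rho>(1,2)] by (elim exE conjE) (rule that)
      have E'': "E c'' \<nu> = 0"
      proof (rule Suc.IH[OF c'' Suc.prems(2,3)])
        fix \<alpha> i assume \<alpha>: "\<alpha> \<in> multi_indices m" "j \<le> i" "i < m" "\<alpha> i \<noteq> 0"
        show "c'' \<alpha> = 0"
        proof (rule ccontr)
          assume "c'' \<alpha> \<noteq> 0"
          then obtain \<beta> where \<beta>: "\<beta> \<in> multi_indices m" "c \<beta> \<noteq> 0" "\<alpha> = \<beta>(j := 0)" using supp by blast
          then have "i \<noteq> j" "\<beta> i \<noteq> 0" using \<alpha>(4) by (auto split: if_splits)
          then have "c \<beta> = 0" using \<alpha> by (intro Suc.prems(5)[OF \<beta>(1), of i]) auto
          then show False using \<beta>(2) by simp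
        qed
      qed (use j in simp)
      have Tser: "T (series c) \<nu> x = T (series c'') \<nu> x + wedge a (\<lambda>\<nu>. T (series c') \<nu> x) \<nu> - b * T (series c') \<nu> x"
      proof -
        have val: "series_value m c (y z) = series_value m c'' (y z) + y z j * series_value m c' (y z) - b * series_value m c' (y z)"
          if "z \<in> W" for z
        proof -
          have e: "\<forall>\<alpha>\<in>multi_indices m. cmod (multi_power m (y z) \<alpha>) \<le> R ^ multi_degree m \<alpha>"
            using polydisc that by (intro ballI multi_power_bound) (auto simp: in_polydisc_def)
          have *: "c' \<alpha> * multi_power m (y z) (multi_add m (multi_unit m j) \<alpha>) = y z j * (c' \<alpha> * multi_power m (y z) \<alpha>)" for \<alpha>
            using j by (simp add: multi_power_add)
          show ?thesis
            unfolding series_value_def using ev[rule_format, of "multi_power m (y z)", OF e[rule_format]]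
            by (simp only: * infsum_cmult_right')
        qed
        have prod: "super_mult (coord j) (series c') = (\<lambda>\<nu> z. coord j {} z * series c' \<nu> z)"
          by (rule super_mult_scalar) (auto simp: super_monomial_def super_series_def)
        have eq: "series c = (\<lambda>\<nu> z. (series c'' \<nu> z + super_mult (coord j) (series c') \<nu> z) - b * series c' \<nu> z)"
          unfolding prod using val j by (auto simp: super_series_def super_monomial_def fun_eq_iff)
        note in1 = A_series[OF c''] A_series[OF c'] mono_in[OF multi_unit_in[of m j]]
        have in2: "super_mult (coord j) (series c') \<in> A" using in1 by (intro A_mult)
        have "T (series c) \<nu> x = T (\<lambda>\<nu> z. series c'' \<nu> z + super_mult (coord j) (series c') \<nu> z) \<nu> x - T (\<lambda>\<nu> z. b * series c' \<nu> z) \<nu> x"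
          unfolding eq by (rule T_diff[OF A_add[OF in1(1) in2] A_cmult[OF in1(2)] Suc.prems(2) x])
        also have "\<dots> = T (series c'') \<nu> x + super_mult (T (coord j)) (T (series c')) \<nu> x - b * T (series c') \<nu> x"
          using T_add[OF in1(1) in2 Suc.prems(2) x] T_mult[OF in1(3,2) Suc.prems(2) x] T_cmult[OF in1(2) Suc.prems(2) x]
          by simp
        finally show ?thesis by (simp add: super_mult_def a_def[abs_def])
      qed
      have Sser: "S c \<nu> = S c'' \<nu> + wedge a (S c') \<nu> - b * S c' \<nu>"
      proof -
        have "(\<Sum>\<^sub>\<infinity>\<alpha>\<in>multi_indices m. c' \<alpha> * T (mono (multi_add m (multi_unit m j) \<alpha>)) \<nu> x) = wedge a (S c') \<nu>"
        proof (rule infsumI)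
          have "((\<lambda>\<alpha>. \<Sum>\<mu>\<in>Pow \<nu>. exterior_sign \<mu> (\<nu> - \<mu>) * a \<mu> * (c' \<alpha> * T (mono \<alpha>) (\<nu> - \<mu>) x)) has_sum
             (\<Sum>\<mu>\<in>Pow \<nu>. exterior_sign \<mu> (\<nu> - \<mu>) * a \<mu> * S c' (\<nu> - \<mu>))) (multi_indices m)"
          proof (rule has_sum_finite_sum)
            show "finite (Pow \<nu>)" using finite_subset[OF Suc.prems(2)] by simp
            fix \<mu> assume "\<mu> \<in> Pow \<nu>"
            then have "\<nu> - \<mu> \<subseteq> {..<n}" using Suc.prems(2) by auto
            then have "((\<lambda>\<alpha>. c' \<alpha> * T (mono \<alpha>) (\<nu> - \<mu>) x) has_sum S c' (\<nu> - \<mu>)) (multi_indices m)"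
              unfolding S_def by (intro l1_bounded_has_sum(1)[OF c'] Tm)
            then show "((\<lambda>\<alpha>. exterior_sign \<mu> (\<nu> - \<mu>) * a \<mu> * (c' \<alpha> * T (mono \<alpha>) (\<nu> - \<mu>) x)) has_sum
               exterior_sign \<mu> (\<nu> - \<mu>) * a \<mu> * S c' (\<nu> - \<mu>)) (multi_indices m)"
              by (rule has_sum_cmult_right)
          qed
          then have "((\<lambda>\<alpha>. \<Sum>\<mu>\<in>Pow \<nu>. exterior_sign \<mu> (\<nu> - \<mu>) * a \<mu> * (c' \<alpha> * T (mono \<alpha>) (\<nu> - \<mu>) x)) has_sum wedge a (S c') \<nu>) (multi_indices m)"
            by (simp add: wedge_def)
          moreover have "c' \<alpha> * T (mono (multi_add m (multi_unit m j) \<alpha>)) \<nu> x =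
              (\<Sum>\<mu>\<in>Pow \<nu>. exterior_sign \<mu> (\<nu> - \<mu>) * a \<mu> * (c' \<alpha> * T (mono \<alpha>) (\<nu> - \<mu>) x))"
            if "\<alpha> \<in> multi_indices m" for \<alpha>
          proof -
            have "T (mono (multi_add m (multi_unit m j) \<alpha>)) \<nu> x = wedge a (\<lambda>\<nu>. T (mono \<alpha>) \<nu> x) \<nu>"
              using T_mult[OF mono_in[OF multi_unit_in[of m j]] mono_in[OF that] Suc.prems(2) x]
              by (simp add: mono_add super_mult_def a_def[abs_def])
            then show ?thesis by (simp add: wedge_def sum_distrib_left mult_ac)
          qed
          ultimately show "((\<lambda>\<alpha>. c' \<alpha> * T (mono (multi_add m (multi_unit m j) \<alpha>)) \<nu> x) has_sum wedge a (S c') \<nu>) (multi_indices m)"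
            by (simp cong: has_sum_cong)
        qed
        moreover note ev[rule_format, of "\<lambda>\<alpha>. T (mono \<alpha>) \<nu> x", OF Tm[OF _ Suc.prems(2)]]
        ultimately show ?thesis by (simp add: S_def)
      qed
      have fin: "finite \<nu>" using finite_subset[OF Suc.prems(2)] by simp
      have "E c \<nu> = E c'' \<nu> + (wedge a (E c') \<nu> - b * E c' \<nu>)"
        unfolding E_def Tser Sser wedge_diff_right by (simp add: algebra_simps)
      also have "wedge a (E c') \<nu> = b * E c' \<nu>"
      proof -
        have "E c' (\<nu> - \<mu>) = 0" if "\<mu> \<in> Pow \<nu> - {{}}" for \<mu>
        proof (rule lower[OF c'])
          show "\<nu> - \<mu> \<subseteq> {..<n}" using Suc.prems(2) by auto
          have "card (\<nu> - \<mu>) < card \<nu>" using that fin by (intro psubset_card_mono) auto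
          then show "card (\<nu> - \<mu>) < k" using Suc.prems(3) by simp
        qed
        then have "wedge a (E c') \<nu> = (\<Sum>\<mu>\<in>{{}}. exterior_sign \<mu> (\<nu> - \<mu>) * a \<mu> * E c' (\<nu> - \<mu>))"
          unfolding wedge_def using fin by (intro sum.mono_neutral_right) auto
        then show ?thesis by (simp add: b_def)
      qed
      finally show ?case using E'' by simp
    qed
    from this[OF Suc.prems, of m] show ?case by simp
  qed simp
  from this[OF c \<nu>, of "Suc (card \<nu>)"] show ?thesis by (simp add: E_def S_def)
qed

lemma super_majorized_monomial:
  assumes "D \<subseteq> W" "in_polydisc m D y r" "0 < r" "\<alpha> \<in> multi_indices m"
  shows "super_majorized m n D y r (r ^ multi_degree m \<alpha>) (mono \<alpha>)"
proof (rule super_majorized_scalar)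
  have "majorized m D y r (r ^ multi_degree m \<alpha>) (\<lambda>x. multi_power m (y x) \<alpha>)"
    using assms by (intro majorized_multi_power majorized_coordinate) auto
  then show "majorized m D y r (r ^ multi_degree m \<alpha>) (mono \<alpha> {})"
    by (rule majorized_cong) (use assms(1) in \<open>auto simp: super_monomial_def\<close>)
qed (simp add: super_monomial_def)

lemma super_majorized_basis:
  assumes "D \<subseteq> W" "0 < r" "\<mu> \<subseteq> {..<n}"
  shows "super_majorized m n D y r 1 (exterior_basis W \<mu>)"
proof (rule super_majorizedI[where b = "\<lambda>\<nu>. if \<nu> = \<mu> then 1 else 0"])
  fix \<nu> assume "\<nu> \<subseteq> {..<n}"
  have "majorized m D y r (if \<nu> = \<mu> then 1 else 0) (\<lambda>x. if \<nu> = \<mu> then 1 else 0)"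
    using assms(2) by (intro majorized_const) auto
  then show "majorized m D y r (if \<nu> = \<mu> then 1 else 0) (exterior_basis W \<mu> \<nu>)"
    by (rule majorized_cong) (use assms(1) in \<open>auto simp: exterior_basis_def\<close>)
qed (use assms in simp)

text \<open>
  If \<open>T\<close> moves the coordinates by at most \<open>d\<close>, the product rule for differences bounds the
  displacement of a monomial by what it would be for positive numbers \<open>r\<close> and \<open>r + d\<close>.
\<close>

lemma T_mono_minus_id:
  assumes D: "D \<subseteq> W'" "in_polydisc m D y r" "0 < r"
    and H: "\<And>j. j < m \<Longrightarrow> super_majorized m n D y r d (\<lambda>\<nu> x. T (coord j) \<nu> x - coord j \<nu> x)" "0 \<le> d"
    and \<alpha>: "\<alpha> \<in> multi_indices m"
  shows "super_majorized m n D y r ((r + d) ^ multi_degree m \<alpha> - r ^ multi_degree m \<alpha>)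
      (\<lambda>\<nu> x. T (mono \<alpha>) \<nu> x - mono \<alpha> \<nu> x)" (is "?P \<alpha>")
    and "super_majorized m n D y r ((r + d) ^ multi_degree m \<alpha>) (T (mono \<alpha>))" (is "?Q \<alpha>")
proof -
  have DW: "D \<subseteq> W" using D(1) sub by blast
  have PQ: "?Q \<beta>" if \<beta>: "\<beta> \<in> multi_indices m" and "?P \<beta>" for \<beta>
    using super_majorized_add[OF that(2) super_majorized_monomial[OF DW D(2,3) \<beta>]] D by simp
  show P: "?P \<alpha>" using \<alpha>
  proof (induction rule: multi_index_induct)
    case zero
    have "super_majorized m n D y r 0 (\<lambda>\<nu> x. T (mono (multi_zero m)) \<nu> x - mono (multi_zero m) \<nu> x)"
      using super_majorized_zero
      by (rule super_majorized_cong) (use D(1) DW in \<open>auto simp: mono_zero T_one subset_iff exterior_basis_def\<close>)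
    then show ?case by simp
  next
    case (add j \<beta>)
    let ?k = "multi_degree m \<beta>" and ?u = "multi_unit m j"
    have Y: "super_majorized m n D y r r (coord j)"
      using super_majorized_monomial[OF DW D(2,3) multi_unit_in[of m j]] add.hyps by simp
    have "super_majorized m n D y r (d * (r + d) ^ ?k + r * ((r + d) ^ ?k - r ^ ?k))
      (\<lambda>\<nu> x. super_mult (\<lambda>\<nu> x. T (coord j) \<nu> x - coord j \<nu> x) (T (mono \<beta>)) \<nu> x +
         super_mult (coord j) (\<lambda>\<nu> x. T (mono \<beta>) \<nu> x - mono \<beta> \<nu> x) \<nu> x)"
      using D by (intro super_majorized_add super_majorized_mult H(1) Y add PQ) auto
    then have "super_majorized m n D y r (d * (r + d) ^ ?k + r * ((r + d) ^ ?k - r ^ ?k))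
      (\<lambda>\<nu> x. T (mono (multi_add m ?u \<beta>)) \<nu> x - mono (multi_add m ?u \<beta>) \<nu> x)"
    proof (rule super_majorized_cong)
      fix \<nu> x assume \<nu>: "\<nu> \<subseteq> {..<n}" and "x \<in> D"
      then have x: "x \<in> W'" using D(1) by blast
      show "super_mult (\<lambda>\<nu> x. T (coord j) \<nu> x - coord j \<nu> x) (T (mono \<beta>)) \<nu> x +
         super_mult (coord j) (\<lambda>\<nu> x. T (mono \<beta>) \<nu> x - mono \<beta> \<nu> x) \<nu> x =
         T (mono (multi_add m ?u \<beta>)) \<nu> x - mono (multi_add m ?u \<beta>) \<nu> x"
        using T_mult[OF mono_in[OF multi_unit_in[of m j]] mono_in[OF add.hyps(2)] \<nu> x]
        by (simp add: mono_add super_mult_def wedge_diff_left wedge_diff_right)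
    qed
    moreover have "d * (r + d) ^ ?k + r * ((r + d) ^ ?k - r ^ ?k) =
        (r + d) ^ multi_degree m (multi_add m ?u \<beta>) - r ^ multi_degree m (multi_add m ?u \<beta>)"
      using add.hyps by (simp add: algebra_simps)
    ultimately show ?case by simp
  qed
  show "?Q \<alpha>" by (rule PQ[OF \<alpha> P])
qed

text \<open>Convexity of \<open>d \<mapsto> (r + d)\<^sup>k\<close>.\<close>

lemma power_gap_le:
  fixes r d \<sigma> :: real
  assumes "0 \<le> r" "0 \<le> d" "d \<le> \<sigma>" "0 < \<sigma>"
  shows "(r + d) ^ k - r ^ k \<le> d / \<sigma> * ((r + \<sigma>) ^ k - r ^ k)"
proof -
  have gap: "(r + d) ^ k - r ^ k = d * (\<Sum>i<k. r ^ (k - Suc i) * (r + d) ^ i)" for d :: real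
    using power_diff_sumr2[of "r + d" k r] by simp
  have "(r + d) ^ k - r ^ k \<le> d * (\<Sum>i<k. r ^ (k - Suc i) * (r + \<sigma>) ^ i)"
    unfolding gap using assms by (intro mult_left_mono sum_mono power_mono) auto
  also have "\<dots> = d / \<sigma> * ((r + \<sigma>) ^ k - r ^ k)" using assms by (simp add: gap)
  finally show ?thesis .
qed

text \<open>
  If \<open>T\<close> moves the coordinates and the products \<open>\<theta>\<^sup>\<mu>\<close> of odd coordinates by at most \<open>d\<close>, then it moves
  every superfunction by at most a multiple of \<open>d\<close>, at the expense of a loss \<open>\<sigma>\<close> of radius: this is
  the estimate that Cauchy's inequality gives for a differential operator of order one. It is linear
  in \<open>d\<close> with a constant that does not depend on \<open>T\<close>, which makes iteration possible.
\<close>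

lemma map_minus_id:
  assumes D: "D \<subseteq> W'" "in_polydisc m D y r" "0 < r"
    and H: "\<And>j. j < m \<Longrightarrow> super_majorized m n D y r d (\<lambda>\<nu> x. T (coord j) \<nu> x - coord j \<nu> x)"
      "\<And>\<mu>. \<mu> \<subseteq> {..<n} \<Longrightarrow>
        super_majorized m n D y r d (\<lambda>\<nu> x. T (exterior_basis W \<mu>) \<nu> x - exterior_basis W \<mu> \<nu> x)"
    and d: "0 \<le> d" "d \<le> \<sigma>" and \<sigma>: "0 < \<sigma>" "\<sigma> \<le> 1" "r + \<sigma> < R"
    and s: "s \<in> A" "\<And>\<nu> x. \<nu> \<subseteq> {..<n} \<Longrightarrow> x \<in> W \<Longrightarrow> s \<nu> x = series_value m (c \<nu>) (y x)"
    and c: "\<And>\<nu>. \<nu> \<subseteq> {..<n} \<Longrightarrow> series_bounded m R B' (c \<nu>)"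
      "\<And>\<nu>. \<nu> \<subseteq> {..<n} \<Longrightarrow> series_bounded m (r + \<sigma>) (b \<nu>) (c \<nu>)" "(\<Sum>\<nu>\<in>Pow {..<n}. b \<nu>) \<le> B"
  shows "super_majorized m n D y r (2 * d / \<sigma> * B) (\<lambda>\<nu> x. T s \<nu> x - s \<nu> x)"
proof -
  have DW: "D \<subseteq> W" using D(1) sub by blast
  let ?e = "exterior_basis W" and ?deg = "multi_degree m"
  define G where "G \<alpha> \<mu> \<nu> x = super_mult (T (mono \<alpha>)) (T (?e \<mu>)) \<nu> x - super_mult (mono \<alpha>) (?e \<mu>) \<nu> x"
    for \<alpha> \<mu> \<nu> x
  have G: "super_majorized m n D y r (2 * d / \<sigma> * (r + \<sigma>) ^ ?deg \<alpha>) (G \<alpha> \<mu>)"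
    if \<alpha>: "\<alpha> \<in> multi_indices m" and \<mu>: "\<mu> \<subseteq> {..<n}" for \<alpha> \<mu>
  proof -
    let ?k = "?deg \<alpha>"
    have e: "super_majorized m n D y r (d + 1) (T (?e \<mu>))"
      using super_majorized_add[OF H(2)[OF \<mu>] super_majorized_basis[OF DW D(3) \<mu>]] D by simp
    have "super_majorized m n D y r (((r + d) ^ ?k - r ^ ?k) * (d + 1) + r ^ ?k * d)
      (\<lambda>\<nu> x. super_mult (\<lambda>\<nu> x. T (mono \<alpha>) \<nu> x - mono \<alpha> \<nu> x) (T (?e \<mu>)) \<nu> x +
         super_mult (mono \<alpha>) (\<lambda>\<nu> x. T (?e \<mu>) \<nu> x - ?e \<mu> \<nu> x) \<nu> x)"
      using D by (intro super_majorized_add super_majorized_mult T_mono_minus_id(1) H \<mu> e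
          super_majorized_monomial DW \<alpha> d(1)) auto
    then have *: "super_majorized m n D y r (((r + d) ^ ?k - r ^ ?k) * (d + 1) + r ^ ?k * d) (G \<alpha> \<mu>)"
      by (rule super_majorized_cong) (simp add: G_def super_mult_def wedge_diff_left wedge_diff_right)
    have "((r + d) ^ ?k - r ^ ?k) * (d + 1) + r ^ ?k * d \<le> 2 * d / \<sigma> * (r + \<sigma>) ^ ?k"
    proof -
      have g0: "0 \<le> (r + \<sigma>) ^ ?k - r ^ ?k" using D \<sigma> by (simp add: power_mono)
      have "((r + d) ^ ?k - r ^ ?k) * (d + 1) \<le> d / \<sigma> * ((r + \<sigma>) ^ ?k - r ^ ?k) * 2"
        using power_gap_le[of r d \<sigma> ?k] D d \<sigma> g0 by (intro mult_mono) auto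
      moreover have "r ^ ?k * d \<le> d / \<sigma> * r ^ ?k * 2"
      proof -
        have "d \<le> d / \<sigma>" using d \<sigma> by (simp add: pos_le_divide_eq mult_left_le)
        then have "d * r ^ ?k \<le> d / \<sigma> * r ^ ?k" using D by (intro mult_right_mono) auto
        moreover have "0 \<le> d / \<sigma> * r ^ ?k" using D d \<sigma> by simp
        moreover have "a \<le> b * 2" if "a \<le> b" "0 \<le> b" for a b :: real using that by linarith
        ultimately show ?thesis unfolding mult.commute[of "r ^ ?k" d] by blast
      qed
      ultimately have "((r + d) ^ ?k - r ^ ?k) * (d + 1) + r ^ ?k * d \<le>
          d / \<sigma> * ((r + \<sigma>) ^ ?k - r ^ ?k) * 2 + d / \<sigma> * r ^ ?k * 2" by (rule add_mono)
      also have "\<dots> = 2 * d / \<sigma> * (r + \<sigma>) ^ ?k" by (simp add: algebra_simps)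
      finally show ?thesis .
    qed
    then show ?thesis using D(3) by (intro super_majorized_mono[OF *]) auto
  qed
  have coord_norm: "wedge_norm n (\<lambda>\<nu>. T (coord j) \<nu> x) \<le> r + d" if "j < m" "x \<in> D" for j x
  proof -
    have "super_majorized m n D y r (d + r) (\<lambda>\<nu> x. (T (coord j) \<nu> x - coord j \<nu> x) + coord j \<nu> x)"
      using super_majorized_monomial[OF DW D(2,3) multi_unit_in[of m j]] that(1) D
      by (intro super_majorized_add H) auto
    then have "wedge_norm n (\<lambda>\<nu>. (T (coord j) \<nu> x - coord j \<nu> x) + coord j \<nu> x) \<le> d + r"
      by (rule wedge_norm_le_of_super_majorized[OF _ D(2) that(2)])
    then show ?thesis by (simp add: add.commute)
  qed
  have T_mono_le: "cmod (T (mono \<alpha>) \<nu> x) \<le> R ^ ?deg \<alpha>"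
    if "\<alpha> \<in> multi_indices m" "\<nu> \<subseteq> {..<n}" "x \<in> D" for \<alpha> \<nu> x
  proof -
    have "cmod (T (mono \<alpha>) \<nu> x) \<le> wedge_norm n (\<lambda>\<nu>. T (mono \<alpha>) \<nu> x)"
      using norm_le_wedge_norm[OF that(2), of "\<lambda>\<nu>. T (mono \<alpha>) \<nu> x"] by simp
    also have "\<dots> \<le> (r + d) ^ ?deg \<alpha>"
      using that D d by (intro wedge_norm_T_mono coord_norm) auto
    also have "\<dots> \<le> R ^ ?deg \<alpha>" using D d \<sigma> by (intro power_mono) auto
    finally show ?thesis .
  qed
  define Q where "Q \<mu> \<nu> x = super_mult (T (series (c \<mu>))) (T (?e \<mu>)) \<nu> x - super_mult (series (c \<mu>)) (?e \<mu>) \<nu> x"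
    for \<mu> \<nu> x
  have basis_prod: "super_mult f (?e \<mu>) = (\<lambda>\<nu> x. f {} x * ?e \<mu> \<nu> x)"
    if "\<mu> \<subseteq> {..<n}" "\<And>\<nu> x. \<nu> \<noteq> {} \<Longrightarrow> f \<nu> x = 0" for f \<mu>
    using that finite_subset[OF that(1)] by (intro super_mult_scalar) (auto simp: exterior_basis_def)
  have Q: "super_majorized m n D y r (2 * d / \<sigma> * b \<mu>) (Q \<mu>)" if \<mu>: "\<mu> \<subseteq> {..<n}" for \<mu>
  proof (rule super_majorized_infsum[where K = "multi_indices m" and f = "\<lambda>\<alpha> \<nu> x. c \<mu> \<alpha> * G \<alpha> \<mu> \<nu> x"
        and \<beta> = "\<lambda>\<alpha>. cmod (c \<mu> \<alpha>) * (2 * d / \<sigma> * (r + \<sigma>) ^ ?deg \<alpha>)", OF _ _ _ D(2,3)])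
    fix \<alpha> assume "\<alpha> \<in> multi_indices m"
    then show "super_majorized m n D y r (cmod (c \<mu> \<alpha>) * (2 * d / \<sigma> * (r + \<sigma>) ^ ?deg \<alpha>))
        (\<lambda>\<nu> x. c \<mu> \<alpha> * G \<alpha> \<mu> \<nu> x)"
      using \<mu> by (intro super_majorized_cmult G)
  next
    fix F assume F: "finite F" "F \<subseteq> multi_indices m"
    have "(\<Sum>\<alpha>\<in>F. cmod (c \<mu> \<alpha>) * (2 * d / \<sigma> * (r + \<sigma>) ^ ?deg \<alpha>)) =
        2 * d / \<sigma> * (\<Sum>\<alpha>\<in>F. cmod (c \<mu> \<alpha>) * (r + \<sigma>) ^ ?deg \<alpha>)"
      by (simp add: sum_distrib_left mult_ac)
    also have "\<dots> \<le> 2 * d / \<sigma> * b \<mu>"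
      using c(2)[OF \<mu>] F d \<sigma> unfolding l1_bounded_def by (intro mult_left_mono) auto
    finally show "(\<Sum>\<alpha>\<in>F. cmod (c \<mu> \<alpha>) * (2 * d / \<sigma> * (r + \<sigma>) ^ ?deg \<alpha>)) \<le> 2 * d / \<sigma> * b \<mu>" .
  next
    fix \<nu> x assume \<nu>: "\<nu> \<subseteq> {..<n}" and x: "x \<in> D"
    have xW: "x \<in> W'" "x \<in> W" using x D(1) DW by auto
    have 1: "((\<lambda>\<alpha>. \<Sum>\<kappa>\<in>Pow \<nu>. exterior_sign \<kappa> (\<nu> - \<kappa>) * (c \<mu> \<alpha> * T (mono \<alpha>) \<kappa> x) * T (?e \<mu>) (\<nu> - \<kappa>) x) has_sum
        (\<Sum>\<kappa>\<in>Pow \<nu>. exterior_sign \<kappa> (\<nu> - \<kappa>) * T (series (c \<mu>)) \<kappa> x * T (?e \<mu>) (\<nu> - \<kappa>) x)) (multi_indices m)"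
    proof (rule has_sum_finite_sum)
      show "finite (Pow \<nu>)" using finite_subset[OF \<nu>] by simp
      fix \<kappa> assume "\<kappa> \<in> Pow \<nu>"
      then have \<kappa>: "\<kappa> \<subseteq> {..<n}" using \<nu> by auto
      have "T (series (c \<mu>)) \<kappa> x = (\<Sum>\<^sub>\<infinity>\<alpha>\<in>multi_indices m. c \<mu> \<alpha> * T (mono \<alpha>) \<kappa> x)"
        using D d \<sigma> x \<kappa> by (intro map_series[OF c(1)[OF \<mu>] xW(1), of "r + d"] coord_norm) auto
      then have "((\<lambda>\<alpha>. c \<mu> \<alpha> * T (mono \<alpha>) \<kappa> x) has_sum T (series (c \<mu>)) \<kappa> x) (multi_indices m)"
        using l1_bounded_has_sum(1)[OF c(1)[OF \<mu>], of "\<lambda>\<alpha>. T (mono \<alpha>) \<kappa> x"] T_mono_le[OF _ \<kappa> x] by simp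
      then show "((\<lambda>\<alpha>. exterior_sign \<kappa> (\<nu> - \<kappa>) * (c \<mu> \<alpha> * T (mono \<alpha>) \<kappa> x) * T (?e \<mu>) (\<nu> - \<kappa>) x) has_sum
        exterior_sign \<kappa> (\<nu> - \<kappa>) * T (series (c \<mu>)) \<kappa> x * T (?e \<mu>) (\<nu> - \<kappa>) x) (multi_indices m)"
        by (intro has_sum_cmult_left has_sum_cmult_right)
    qed
    have "((\<lambda>\<alpha>. c \<mu> \<alpha> * multi_power m (y x) \<alpha>) has_sum series_value m (c \<mu>) (y x)) (multi_indices m)"
      using polydisc xW by (intro series_value_has_sum(1)[OF c(1)[OF \<mu>]]) (auto simp: in_polydisc_def)
    then have 2: "((\<lambda>\<alpha>. c \<mu> \<alpha> * multi_power m (y x) \<alpha> * ?e \<mu> \<nu> x) has_sum series_value m (c \<mu>) (y x) * ?e \<mu> \<nu> x) (multi_indices m)"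
      by (rule has_sum_cmult_left)
    have p1: "super_mult (mono \<alpha>) (?e \<mu>) \<nu> x = multi_power m (y x) \<alpha> * ?e \<mu> \<nu> x" for \<alpha>
      by (subst basis_prod[OF \<mu>]) (use xW in \<open>auto simp: super_monomial_def\<close>)
    have p2: "super_mult (series (c \<mu>)) (?e \<mu>) \<nu> x = series_value m (c \<mu>) (y x) * ?e \<mu> \<nu> x"
      by (subst basis_prod[OF \<mu>]) (use xW in \<open>auto simp: super_series_def\<close>)
    have "((\<lambda>\<alpha>. (\<Sum>\<kappa>\<in>Pow \<nu>. exterior_sign \<kappa> (\<nu> - \<kappa>) * (c \<mu> \<alpha> * T (mono \<alpha>) \<kappa> x) * T (?e \<mu>) (\<nu> - \<kappa>) x) -
        c \<mu> \<alpha> * multi_power m (y x) \<alpha> * ?e \<mu> \<nu> x) has_sum Q \<mu> \<nu> x) (multi_indices m)"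
      using has_sum_add[OF 1 has_sum_uminusI[OF 2]] unfolding Q_def p2 by (simp add: super_mult_def wedge_def)
    moreover have "(\<Sum>\<kappa>\<in>Pow \<nu>. exterior_sign \<kappa> (\<nu> - \<kappa>) * (c \<mu> \<alpha> * T (mono \<alpha>) \<kappa> x) * T (?e \<mu>) (\<nu> - \<kappa>) x) -
        c \<mu> \<alpha> * multi_power m (y x) \<alpha> * ?e \<mu> \<nu> x = c \<mu> \<alpha> * G \<alpha> \<mu> \<nu> x" for \<alpha>
      unfolding G_def p1 unfolding right_diff_distrib super_mult_def wedge_def sum_distrib_left by (simp add: mult_ac)
    ultimately show "((\<lambda>\<alpha>. c \<mu> \<alpha> * G \<alpha> \<mu> \<nu> x) has_sum Q \<mu> \<nu> x) (multi_indices m)" by simp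
  qed
  have ser_in: "series (c \<mu>) \<in> A" if "\<mu> \<subseteq> {..<n}" for \<mu> by (rule A_series[OF c(1)[OF that]])
  have s_eq: "s = (\<lambda>\<nu> x. \<Sum>\<mu>\<in>Pow {..<n}. super_mult (series (c \<mu>)) (?e \<mu>) \<nu> x)"
  proof (intro ext)
    fix \<nu> x
    have "(\<Sum>\<mu>\<in>Pow {..<n}. super_mult (series (c \<mu>)) (?e \<mu>) \<nu> x) =
        (\<Sum>\<mu>\<in>Pow {..<n}. if \<mu> = \<nu> then (if x \<in> W then series_value m (c \<nu>) (y x) else 0) else 0)"
    proof (rule sum.cong[OF refl])
      fix \<mu> assume "\<mu> \<in> Pow {..<n}"
      then have \<mu>: "\<mu> \<subseteq> {..<n}" by simp
      show "super_mult (series (c \<mu>)) (?e \<mu>) \<nu> x = (if \<mu> = \<nu> then (if x \<in> W then series_value m (c \<nu>) (y x) else 0) else 0)"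
        by (subst basis_prod[OF \<mu>]) (auto simp: super_series_def exterior_basis_def)
    qed
    also have "\<dots> = (if \<nu> \<subseteq> {..<n} \<and> x \<in> W then series_value m (c \<nu>) (y x) else 0)" by simp
    also have "\<dots> = s \<nu> x" using s(2) A_zero[OF s(1)] by auto
    finally show "s \<nu> x = (\<Sum>\<mu>\<in>Pow {..<n}. super_mult (series (c \<mu>)) (?e \<mu>) \<nu> x)" by simp
  qed
  have "super_majorized m n D y r (\<Sum>\<mu>\<in>Pow {..<n}. 2 * d / \<sigma> * b \<mu>) (\<lambda>\<nu> x. \<Sum>\<mu>\<in>Pow {..<n}. Q \<mu> \<nu> x)"
    using D by (intro super_majorized_sum Q) auto
  then have "super_majorized m n D y r (2 * d / \<sigma> * B) (\<lambda>\<nu> x. \<Sum>\<mu>\<in>Pow {..<n}. Q \<mu> \<nu> x)"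
  proof (rule super_majorized_mono)
    show "(\<Sum>\<mu>\<in>Pow {..<n}. 2 * d / \<sigma> * b \<mu>) \<le> 2 * d / \<sigma> * B"
      using c(3) d \<sigma> unfolding sum_distrib_left[symmetric] by (intro mult_left_mono) auto
  qed (use D in auto)
  then show ?thesis
  proof (rule super_majorized_cong)
    fix \<nu> x assume \<nu>: "\<nu> \<subseteq> {..<n}" and "x \<in> D"
    then have x: "x \<in> W'" using D(1) by blast
    have "T s \<nu> x = (\<Sum>\<mu>\<in>Pow {..<n}. T (super_mult (series (c \<mu>)) (?e \<mu>)) \<nu> x)"
      unfolding s_eq using \<nu> x by (intro T_sum A_mult ser_in A_basis) auto
    also have "\<dots> = (\<Sum>\<mu>\<in>Pow {..<n}. super_mult (T (series (c \<mu>))) (T (?e \<mu>)) \<nu> x)"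
      using \<nu> x by (intro sum.cong refl T_mult ser_in A_basis) auto
    finally show "(\<Sum>\<mu>\<in>Pow {..<n}. Q \<mu> \<nu> x) = T s \<nu> x - s \<nu> x"
      unfolding Q_def sum_subtractf by (simp add: s_eq)
  qed
qed

end

section \<open>Local flows\<close>

text \<open>The map \<open>d \<mapsto> a + d / 2\<close> contracts to \<open>2 a\<close>; finitely many iterations reach \<open>3 a\<close>.\<close>

lemma contraction_iterate:
  fixes a \<epsilon> :: real
  assumes P: "P \<epsilon>" and step: "\<And>d. P d \<Longrightarrow> 0 \<le> d \<Longrightarrow> d \<le> \<epsilon> \<Longrightarrow> P (a + d / 2)"
    and mono: "\<And>d d'. P d \<Longrightarrow> d \<le> d' \<Longrightarrow> P d'" and a: "0 < a" "2 * a \<le> \<epsilon>"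
  shows "P (3 * a)"
proof -
  have iter: "P (2 * a + (\<epsilon> - 2 * a) / 2 ^ k)" for k
  proof (induction k)
    case (Suc k)
    let ?d = "2 * a + (\<epsilon> - 2 * a) / 2 ^ k"
    have "(\<epsilon> - 2 * a) / 2 ^ k \<le> (\<epsilon> - 2 * a) / 1" using a by (intro divide_left_mono) auto
    then have "P (a + ?d / 2)" using a by (intro step Suc.IH) auto
    moreover have "a + ?d / 2 = 2 * a + (\<epsilon> - 2 * a) / 2 ^ Suc k" by (simp add: field_simps)
    ultimately show ?case by (simp only:)
  qed (use P in simp)
  have "(\<lambda>k. (\<epsilon> - 2 * a) / 2 ^ k) \<longlonglongrightarrow> 0" by (rule LIMSEQ_divide_realpow_zero) simp
  then have "\<forall>\<^sub>F k in sequentially. (\<epsilon> - 2 * a) / 2 ^ k < a" using a(1) by (rule order_tendstoD)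
  then obtain k where "(\<epsilon> - 2 * a) / 2 ^ k < a" by (auto simp: eventually_sequentially)
  then show ?thesis by (intro mono[OF iter[of k]]) simp
qed

text \<open>
  The maps \<open>T h\<close> take superfunctions on the polydisc of radius \<open>R\<close> to superfunctions on that of radius
  \<open>R'\<close>, so they cannot be iterated and a group law cannot be imposed on them. It is imposed instead on
  the curves \<open>F\<close> to which they are applied: for an orbit, the group law says that \<open>T h\<close> advances the
  parameter by \<open>h\<close>, and repeated differences of \<open>F\<close> in time become powers of \<open>T h - 1\<close>.
\<close>

locale local_flow =
  fixes m n :: nat and W :: "'p set" and y :: "'p \<Rightarrow> nat \<Rightarrow> complex" and R R' :: real
    and A :: "(nat set \<Rightarrow> 'p \<Rightarrow> complex) set"
    and T :: "real \<Rightarrow> (nat set \<Rightarrow> 'p \<Rightarrow> complex) \<Rightarrow> nat set \<Rightarrow> 'p \<Rightarrow> complex" and t\<^sub>0 :: real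
  assumes map: "\<And>h. \<bar>h\<bar> \<le> t\<^sub>0 \<Longrightarrow> superdomain_map m n W y R A {x \<in> W. \<forall>i<m. cmod (y x i) < R'} (T h)"
    and t\<^sub>0: "0 < t\<^sub>0" and R': "0 < R'" "R' < R"
    and onto: "\<And>w. \<forall>i<m. cmod (w i) < R \<Longrightarrow> \<exists>x\<in>W. \<forall>i<m. y x i = w i"
begin

abbreviation W' where "W' \<equiv> {x \<in> W. \<forall>i<m. cmod (y x i) < R'}"

definition cpoly where "cpoly r = {x \<in> W. \<forall>i<m. cmod (y x i) \<le> r}"

definition orbit :: "(real \<Rightarrow> nat set \<Rightarrow> 'p \<Rightarrow> complex) \<Rightarrow> bool"
  where "orbit F \<longleftrightarrow> (\<forall>t. \<bar>t\<bar> \<le> t\<^sub>0 \<longrightarrow> F t \<in> A) \<and>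
    (\<forall>s h. \<bar>s\<bar> \<le> t\<^sub>0 \<and> \<bar>h\<bar> \<le> t\<^sub>0 \<and> \<bar>s + h\<bar> \<le> t\<^sub>0 \<longrightarrow>
      (\<forall>\<nu>\<subseteq>{..<n}. \<forall>x\<in>W'. T h (F s) \<nu> x = F (s + h) \<nu> x))"

interpretation map0: superdomain_map m n W y R A W' "T 0"
  by (rule map) (use t\<^sub>0 in simp)

lemma R_pos: "0 < R" using R' by simp

lemma cpoly_polydisc: "in_polydisc m (cpoly r) y r"
  by (simp add: in_polydisc_def cpoly_def)

lemma cpoly_sub: "cpoly r \<subseteq> W" "r < R' \<Longrightarrow> cpoly r \<subseteq> W'" "r \<le> r' \<Longrightarrow> cpoly r \<subseteq> cpoly r'"
  by (force simp: cpoly_def)+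

text \<open>
  Norm bounds at a smaller radius hold for the coefficients of the given expansion, because the
  functions \<open>y\<close> attain all values in the polydisc.
\<close>

lemma series_unique_on:
  assumes c: "series_bounded m R B c" and f: "\<And>x. x \<in> cpoly r \<Longrightarrow> f x = series_value m c (y x)"
    and maj: "majorized m (cpoly r) y r b f" and r: "0 < r" "r \<le> R"
  shows "series_bounded m r b c"
proof -
  obtain c' where c': "series_bounded m r b c'" "\<forall>x. x \<in> cpoly r \<longrightarrow> f x = series_value m c' (y x)"
    using maj unfolding majorized_def by blast
  have cr: "series_bounded m r B c" by (rule series_bounded_radius_mono[OF c]) (use r in auto)
  have "c \<alpha> = c' \<alpha>" if "\<alpha> \<in> multi_indices m" for \<alpha>
  proof (rule series_unique[OF cr c'(1) r(1) _ that])
    fix w :: "nat \<Rightarrow> complex" assume w: "\<And>i. i < m \<Longrightarrow> cmod (w i) < r"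
    have "\<forall>i<m. cmod (w i) < R" using w r(2) by fastforce
    from onto[OF this] obtain x where x: "x \<in> W" "\<forall>i<m. y x i = w i" by blast
    have "cmod (y x i) \<le> r" if "i < m" for i using w[OF that] x(2) that by simp
    then have "x \<in> cpoly r" using x(1) by (simp add: cpoly_def)
    then have "series_value m c (y x) = series_value m c' (y x)" using f c'(2) by metis
    moreover have "series_value m c'' (y x) = series_value m c'' w" for c''
      using x(2) by (intro series_value_cong) simp
    ultimately show "series_value m c w = series_value m c' w" by simp
  qed
  then show ?thesis
    by (intro l1_bounded_weight_mono[OF c'(1)]) simp
qed

lemma T_minus_id:
  assumes h: "\<bar>h\<bar> \<le> t\<^sub>0" and r: "0 < r" and \<sigma>: "0 < \<sigma>" "\<sigma> \<le> 1" "r + \<sigma> \<le> R'"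
    and d: "0 \<le> d" "d \<le> \<sigma>"
    and H: "\<And>j. j < m \<Longrightarrow> super_majorized m n (cpoly r) y r d
        (\<lambda>\<nu> x. T h (super_monomial m W y (multi_unit m j)) \<nu> x - super_monomial m W y (multi_unit m j) \<nu> x)"
      "\<And>\<mu>. \<mu> \<subseteq> {..<n} \<Longrightarrow> super_majorized m n (cpoly r) y r d
        (\<lambda>\<nu> x. T h (exterior_basis W \<mu>) \<nu> x - exterior_basis W \<mu> \<nu> x)"
    and s: "s \<in> A" "\<And>\<nu>. \<nu> \<subseteq> {..<n} \<Longrightarrow> majorized m W y R B' (s \<nu>)"
      "super_majorized m n (cpoly (r + \<sigma>)) y (r + \<sigma>) B s"
  shows "super_majorized m n (cpoly r) y r (2 * d / \<sigma> * B) (\<lambda>\<nu> x. T h s \<nu> x - s \<nu> x)"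
proof -
  interpret superdomain_map m n W y R A W' "T h" by (rule map[OF h])
  have "\<forall>\<nu>\<in>Pow {..<n}. \<exists>c. series_bounded m R B' c \<and> (\<forall>x. x \<in> W \<longrightarrow> s \<nu> x = series_value m c (y x))"
    using s(2) unfolding majorized_def by simp
  from bchoice[OF this] obtain c where
    c: "\<forall>\<nu>\<in>Pow {..<n}. series_bounded m R B' (c \<nu>) \<and> (\<forall>x. x \<in> W \<longrightarrow> s \<nu> x = series_value m (c \<nu>) (y x))" ..
  show ?thesis
  proof (rule super_majorizedE[OF s(3)])
    fix b assume b: "\<And>\<nu>. \<nu> \<subseteq> {..<n} \<Longrightarrow> majorized m (cpoly (r + \<sigma>)) y (r + \<sigma>) (b \<nu>) (s \<nu>)"
      "(\<Sum>\<nu>\<in>Pow {..<n}. b \<nu>) \<le> B"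
    show ?thesis
    proof (rule map_minus_id[OF _ cpoly_polydisc r H d \<sigma>(1,2) _ s(1), where c = c and B' = B' and b = b])
      show "cpoly r \<subseteq> W'" using \<sigma> by (intro cpoly_sub) simp
      show "r + \<sigma> < R" using \<sigma> R' by simp
      show "series_bounded m (r + \<sigma>) (b \<nu>) (c \<nu>)" if "\<nu> \<subseteq> {..<n}" for \<nu>
      proof (rule series_unique_on[OF _ _ b(1)[OF that]])
        show "series_bounded m R B' (c \<nu>)" using c that by blast
        show "s \<nu> x = series_value m (c \<nu>) (y x)" if "x \<in> cpoly (r + \<sigma>)" for x
          using c \<open>\<nu> \<subseteq> {..<n}\<close> that cpoly_sub(1)[of "r + \<sigma>"] by blast
      qed (use r \<sigma> R' in auto)
    qed (use c b(2) in auto)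
  qed
qed

text \<open>
  Smallness of the displacement for all times up to \<open>t\<^sub>0\<close> improves to a Lipschitz bound, by
  averaging. With \<open>E = (1/N) \<Sum>\<^sub>j\<^sub><\<^sub>N (F(j h) - F(0))\<close> and \<open>N h\<close> close to \<open>t\<^sub>0\<close>, telescoping gives
  \<open>F(h) - F(0) = (F(N h) - F(0)) / N - (T h - 1) E\<close>. The first summand has norm at most \<open>\<epsilon> / N\<close>, which
  is of order \<open>h\<close>. The second is bounded by a small multiple of the displacement of the generators,
  since \<open>E\<close> has norm at most \<open>\<epsilon>\<close>. If the generators belong to the family, a bound \<open>d\<close> for the
  displacements therefore improves to \<open>\<epsilon> / N + d / 2\<close>. There is no loss of radius in the iteration
  because \<open>E\<close> is always controlled at the large radius.
\<close>

lemma generator_lipschitz: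
  assumes orb: "\<And>F. F \<in> \<F> \<Longrightarrow> orbit F"
    and coords: "\<And>j. j < m \<Longrightarrow> \<exists>F\<in>\<F>. F 0 = super_monomial m W y (multi_unit m j)"
    and basis: "\<And>\<mu>. \<mu> \<subseteq> {..<n} \<Longrightarrow> \<exists>F\<in>\<F>. F 0 = exterior_basis W \<mu>"
    and small: "\<And>F t. F \<in> \<F> \<Longrightarrow> \<bar>t\<bar> \<le> t\<^sub>0 \<Longrightarrow> super_majorized m n W y R \<epsilon> (\<lambda>\<nu> x. F t \<nu> x - F 0 \<nu> x)"
    and r: "0 < r" and \<sigma>: "0 < \<sigma>" "\<sigma> \<le> 1" "r + \<sigma> \<le> R'" and \<epsilon>: "0 < \<epsilon>" "4 * \<epsilon> \<le> \<sigma>"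
    and F: "F \<in> \<F>" and h: "0 < h" "h \<le> t\<^sub>0"
  shows "super_majorized m n (cpoly r) y r (6 * \<epsilon> / t\<^sub>0 * h) (\<lambda>\<nu> x. F h \<nu> x - F 0 \<nu> x)"
proof -
  have h': "\<bar>h\<bar> \<le> t\<^sub>0" using h by simp
  interpret superdomain_map m n W y R A W' "T h" by (rule map[OF h'])
  define N where "N = nat \<lfloor>t\<^sub>0 / h\<rfloor>"
  have "1 \<le> t\<^sub>0 / h" using h by simp
  then have fl: "1 \<le> \<lfloor>t\<^sub>0 / h\<rfloor>" by (simp only: one_le_floor)
  have N1: "1 \<le> N" unfolding N_def using fl by linarith
  have Nr: "real N = of_int \<lfloor>t\<^sub>0 / h\<rfloor>" unfolding N_def using fl by (intro of_nat_nat) linarith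
  have Nle: "real N * h \<le> t\<^sub>0"
  proof -
    have "real N \<le> t\<^sub>0 / h" unfolding Nr by simp
    then show ?thesis using h by (simp add: pos_le_divide_eq)
  qed
  have Nge: "t\<^sub>0 \<le> 2 * real N * h"
  proof -
    have "t\<^sub>0 / h < real N + 1" unfolding Nr by linarith
    then have "t\<^sub>0 / h \<le> 2 * real N" using N1 by linarith
    then show ?thesis using h by (simp add: pos_divide_le_eq)
  qed
  have jh: "\<bar>real j * h\<bar> \<le> t\<^sub>0" if "j \<le> N" for j
  proof -
    have "real j * h \<le> real N * h" using that h by (intro mult_right_mono) auto
    also note Nle
    finally show ?thesis using h by simp
  qed
  have FA: "F t \<in> A" if "F \<in> \<F>" "\<bar>t\<bar> \<le> t\<^sub>0" for F t
    using orb[OF that(1)] that(2) by (simp add: orbit_def)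
  have flow: "T h (F s) \<nu> x = F (s + h) \<nu> x"
    if "F \<in> \<F>" "\<bar>s\<bar> \<le> t\<^sub>0" "\<bar>s + h\<bar> \<le> t\<^sub>0" "\<nu> \<subseteq> {..<n}" "x \<in> W'" for F s \<nu> x
    using orb[OF that(1)] that(2-) h' unfolding orbit_def by blast
  have subW: "cpoly r \<subseteq> W'" using \<sigma> by (intro cpoly_sub) simp
  define P where "P d \<longleftrightarrow> (\<forall>F\<in>\<F>. super_majorized m n (cpoly r) y r d (\<lambda>\<nu> x. F h \<nu> x - F 0 \<nu> x))" for d
  have P\<epsilon>: "P \<epsilon>"
    unfolding P_def
  proof
    fix F assume "F \<in> \<F>"
    then show "super_majorized m n (cpoly r) y r \<epsilon> (\<lambda>\<nu> x. F h \<nu> x - F 0 \<nu> x)"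
      using cpoly_sub(1)[of r] r \<sigma> R' by (intro super_majorized_mono[OF small[OF _ h']]) auto
  qed
  have Pmono: "P d'" if "P d" "d \<le> d'" for d d'
    unfolding P_def
  proof
    fix F assume "F \<in> \<F>"
    then have "super_majorized m n (cpoly r) y r d (\<lambda>\<nu> x. F h \<nu> x - F 0 \<nu> x)"
      using that(1) by (simp add: P_def)
    then show "super_majorized m n (cpoly r) y r d' (\<lambda>\<nu> x. F h \<nu> x - F 0 \<nu> x)"
      by (rule super_majorized_mono) (use that(2) r in auto)
  qed
  have Pstep: "P (\<epsilon> / real N + d / 2)" if Pd: "P d" and d: "0 \<le> d" "d \<le> \<epsilon>" for d
    unfolding P_def
  proof
    fix F assume F: "F \<in> \<F>"
    have F0: "\<bar>0\<bar> \<le> t\<^sub>0" using t\<^sub>0 by simp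
    define E where "E \<nu> x = (1 / of_nat N) * (\<Sum>j<N. F (real j * h) \<nu> x - F 0 \<nu> x)" for \<nu> x
    have dif: "(\<lambda>\<nu> x. F (real j * h) \<nu> x - F 0 \<nu> x) \<in> A" if "j < N" for j
      using that by (intro A_diff FA F F0 jh) simp
    have sumA: "(\<lambda>\<nu> x. \<Sum>j<N. F (real j * h) \<nu> x - F 0 \<nu> x) \<in> A"
      using dif by (intro A_sum) auto
    have EA: "E \<in> A" unfolding E_def[abs_def] by (rule A_cmult[OF sumA])
    have E_maj: "super_majorized m n W y R \<epsilon> E"
    proof -
      have "super_majorized m n W y R (\<Sum>j<N. \<epsilon>) (\<lambda>\<nu> x. \<Sum>j<N. F (real j * h) \<nu> x - F 0 \<nu> x)"
        using R_pos polydisc by (intro super_majorized_sum small F jh) auto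
      from super_majorized_cmult[OF this, of "1 / of_nat N"]
      show ?thesis using N1 unfolding E_def[abs_def] by (simp add: norm_divide)
    qed
    have TE: "super_majorized m n (cpoly r) y r (2 * d / \<sigma> * \<epsilon>) (\<lambda>\<nu> x. T h E \<nu> x - E \<nu> x)"
    proof (rule T_minus_id[OF h' r \<sigma> d(1) _ _ _ EA, where B' = \<epsilon>])
      show "d \<le> \<sigma>" using d \<epsilon> by simp
      show "super_majorized m n (cpoly r) y r d
        (\<lambda>\<nu> x. T h (super_monomial m W y (multi_unit m j)) \<nu> x - super_monomial m W y (multi_unit m j) \<nu> x)"
        if j: "j < m" for j
      proof -
        from coords[OF j] obtain G where G: "G \<in> \<F>" "G 0 = super_monomial m W y (multi_unit m j)" by blast
        have "super_majorized m n (cpoly r) y r d (\<lambda>\<nu> x. G h \<nu> x - G 0 \<nu> x)" using Pd G(1) by (simp add: P_def)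
        then show ?thesis
          by (rule super_majorized_cong) (use flow[OF G(1) F0] h' subW G(2) in auto)
      qed
      show "super_majorized m n (cpoly r) y r d
        (\<lambda>\<nu> x. T h (exterior_basis W \<mu>) \<nu> x - exterior_basis W \<mu> \<nu> x)"
        if \<mu>: "\<mu> \<subseteq> {..<n}" for \<mu>
      proof -
        from basis[OF \<mu>] obtain G where G: "G \<in> \<F>" "G 0 = exterior_basis W \<mu>" by blast
        have "super_majorized m n (cpoly r) y r d (\<lambda>\<nu> x. G h \<nu> x - G 0 \<nu> x)" using Pd G(1) by (simp add: P_def)
        then show ?thesis
          by (rule super_majorized_cong) (use flow[OF G(1) F0] h' subW G(2) in auto)
      qed
      show "majorized m W y R \<epsilon> (E \<nu>)" if "\<nu> \<subseteq> {..<n}" for \<nu>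
        using R_pos by (intro super_majorized_component[OF E_maj that]) simp
      show "super_majorized m n (cpoly (r + \<sigma>)) y (r + \<sigma>) \<epsilon> E"
        using cpoly_sub(1)[of "r + \<sigma>"] r \<sigma> R' by (intro super_majorized_mono[OF E_maj]) auto
    qed
    have FN: "super_majorized m n (cpoly r) y r (1 / real N * \<epsilon>) (\<lambda>\<nu> x. (1 / of_nat N) * (F (real N * h) \<nu> x - F 0 \<nu> x))"
    proof -
      have "super_majorized m n (cpoly r) y r \<epsilon> (\<lambda>\<nu> x. F (real N * h) \<nu> x - F 0 \<nu> x)"
        using cpoly_sub(1)[of r] r \<sigma> R' by (intro super_majorized_mono[OF small[OF F jh]]) auto
      from super_majorized_cmult[OF this, of "1 / of_nat N"] show ?thesis by (simp add: norm_divide)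
    qed
    have "super_majorized m n (cpoly r) y r (1 / real N * \<epsilon> + 2 * d / \<sigma> * \<epsilon>)
      (\<lambda>\<nu> x. (1 / of_nat N) * (F (real N * h) \<nu> x - F 0 \<nu> x) - (T h E \<nu> x - E \<nu> x))"
      using r by (intro super_majorized_diff FN TE cpoly_polydisc) simp
    then have "super_majorized m n (cpoly r) y r (1 / real N * \<epsilon> + 2 * d / \<sigma> * \<epsilon>) (\<lambda>\<nu> x. F h \<nu> x - F 0 \<nu> x)"
    proof (rule super_majorized_cong)
      fix \<nu> x assume \<nu>: "\<nu> \<subseteq> {..<n}" and "x \<in> cpoly r"
      then have x: "x \<in> W'" using subW by blast
      have "T h E \<nu> x = 1 / of_nat N * (\<Sum>j<N. T h (\<lambda>\<nu> x. F (real j * h) \<nu> x - F 0 \<nu> x) \<nu> x)"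
        unfolding E_def[abs_def] using dif by (subst T_cmult[OF sumA \<nu> x], subst T_sum[OF _ _ \<nu> x]) auto
      also have "(\<Sum>j<N. T h (\<lambda>\<nu> x. F (real j * h) \<nu> x - F 0 \<nu> x) \<nu> x) =
          (\<Sum>j<N. F (real (Suc j) * h) \<nu> x - F h \<nu> x)"
      proof (rule sum.cong[OF refl])
        fix j assume "j \<in> {..<N}"
        then have j: "j < N" by simp
        have eq: "real j * h + h = real (Suc j) * h" by (simp add: algebra_simps)
        have jh1: "\<bar>real j * h\<bar> \<le> t\<^sub>0" "\<bar>real (Suc j) * h\<bar> \<le> t\<^sub>0" using j by (intro jh; simp)+
        have "T h (\<lambda>\<nu> x. F (real j * h) \<nu> x - F 0 \<nu> x) \<nu> x = T h (F (real j * h)) \<nu> x - T h (F 0) \<nu> x"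
          by (rule T_diff[OF FA[OF F jh1(1)] FA[OF F F0] \<nu> x])
        also have "T h (F (real j * h)) \<nu> x = F (real (Suc j) * h) \<nu> x"
          using flow[OF F jh1(1) _ \<nu> x] jh1(2) unfolding eq by simp
        also have "T h (F 0) \<nu> x = F h \<nu> x" using flow[OF F F0 _ \<nu> x] h' by simp
        finally show "T h (\<lambda>\<nu> x. F (real j * h) \<nu> x - F 0 \<nu> x) \<nu> x = F (real (Suc j) * h) \<nu> x - F h \<nu> x" .
      qed
      finally have TE_eq: "T h E \<nu> x = 1 / of_nat N * (\<Sum>j<N. F (real (Suc j) * h) \<nu> x - F h \<nu> x)" .
      have tel: "(\<Sum>j<N. F (real (Suc j) * h) \<nu> x) - (\<Sum>j<N. F (real j * h) \<nu> x) = F (real N * h) \<nu> x - F 0 \<nu> x"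
        using sum_lessThan_telescope[of "\<lambda>j. F (real j * h) \<nu> x" N] by (simp add: sum_subtractf)
      have "T h E \<nu> x - E \<nu> x = 1 / of_nat N * ((F (real N * h) \<nu> x - F 0 \<nu> x) - of_nat N * (F h \<nu> x - F 0 \<nu> x))"
        unfolding TE_eq E_def tel[symmetric] right_diff_distrib[symmetric]
        by (simp add: sum_subtractf algebra_simps)
      then show "(1 / of_nat N) * (F (real N * h) \<nu> x - F 0 \<nu> x) - (T h E \<nu> x - E \<nu> x) = F h \<nu> x - F 0 \<nu> x"
        using N1 by (simp add: field_simps)
    qed
    then show "super_majorized m n (cpoly r) y r (\<epsilon> / real N + d / 2) (\<lambda>\<nu> x. F h \<nu> x - F 0 \<nu> x)"
    proof (rule super_majorized_mono)
      have "2 * d / \<sigma> * \<epsilon> = d / 2 * (4 * \<epsilon> / \<sigma>)" by simp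
      also have "\<dots> \<le> d / 2 * 1" using d \<epsilon> \<sigma> by (intro mult_left_mono) (auto simp: pos_divide_le_eq)
      finally show "1 / real N * \<epsilon> + 2 * d / \<sigma> * \<epsilon> \<le> \<epsilon> / real N + d / 2" by simp
    qed (use r in auto)
  qed
  \<comment> \<open>As \<open>N h \<ge> t\<^sub>0 / 2\<close>, the bound \<open>3 \<epsilon> / N\<close> is at most a fixed multiple of \<open>h\<close>; for \<open>N = 1\<close> so is the initial bound \<open>\<epsilon>\<close>.\<close>
  have P6: "P (6 * \<epsilon> / t\<^sub>0 * h)"
  proof (cases "N = 1")
    case True
    have "\<epsilon> \<le> 6 * \<epsilon> / t\<^sub>0 * h"
    proof -
      have "t\<^sub>0 \<le> 6 * h" using Nge h True by simp
      then have "\<epsilon> * t\<^sub>0 \<le> \<epsilon> * (6 * h)" using \<epsilon> by (intro mult_left_mono) auto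
      then show ?thesis using t\<^sub>0 by (simp add: pos_le_divide_eq mult_ac)
    qed
    then show ?thesis by (rule Pmono[OF P\<epsilon>])
  next
    case False
    then have N2: "2 \<le> real N" using N1 by simp
    have "P (3 * (\<epsilon> / real N))"
    proof (rule contraction_iterate[of P \<epsilon>, OF P\<epsilon> Pstep Pmono])
      show "2 * (\<epsilon> / real N) \<le> \<epsilon>" using N2 \<epsilon> by (simp add: pos_divide_le_eq mult.commute)
    qed (use N1 \<epsilon> in auto)
    moreover have "3 * (\<epsilon> / real N) \<le> 6 * \<epsilon> / t\<^sub>0 * h"
    proof -
      have "3 * \<epsilon> * t\<^sub>0 \<le> 3 * \<epsilon> * (2 * real N * h)" using Nge \<epsilon> by (intro mult_left_mono) auto
      then show ?thesis using t\<^sub>0 N1 by (simp add: field_simps)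
    qed
    ultimately show ?thesis by (rule Pmono)
  qed
  then show ?thesis using F by (simp add: P_def)
qed

lemma orbit_series:
  assumes "super_majorized m n W y R B f"
  shows "\<exists>c. \<forall>\<nu>\<subseteq>{..<n}. series_bounded m R B (c \<nu>) \<and> (\<forall>x. x \<in> W \<longrightarrow> f \<nu> x = series_value m (c \<nu>) (y x))"
proof -
  have "\<forall>\<nu>\<in>Pow {..<n}. \<exists>c. series_bounded m R B c \<and> (\<forall>x. x \<in> W \<longrightarrow> f \<nu> x = series_value m c (y x))"
    using super_majorized_component[OF assms] R_pos unfolding majorized_def by auto
  from bchoice[OF this] show ?thesis by auto
qed

text \<open>
  Expansions in time of the coefficients of an expansion in space combine to a joint expansion, by
  absolute convergence of the double series on the polydisc of half the radii.
\<close>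

lemma has_sum_time_space:
  fixes b :: "nat \<Rightarrow> (nat \<Rightarrow> nat) \<Rightarrow> complex"
  assumes b: "\<And>k \<alpha>. \<alpha> \<in> multi_indices m \<Longrightarrow> cmod (b k \<alpha>) \<le> B / s ^ multi_degree m \<alpha> / L ^ k"
    and pos: "0 < s" "0 < L" and t: "\<bar>t\<bar> \<le> L / 2" and w: "\<And>i. i < m \<Longrightarrow> cmod (w i) \<le> s / 2"
    and c: "\<And>\<alpha>. \<alpha> \<in> multi_indices m \<Longrightarrow> (\<lambda>k. b k \<alpha> * of_real t ^ k) sums c \<alpha>"
    and f: "((\<lambda>\<alpha>. c \<alpha> * multi_power m w \<alpha>) has_sum f) (multi_indices m)"
  shows "((\<lambda>(k, \<alpha>). b k \<alpha> * of_real t ^ k * multi_power m w \<alpha>) has_sum f) (UNIV \<times> multi_indices m)"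
proof -
  let ?I = "multi_indices m"
  have B: "0 \<le> B" using b[OF multi_zero_in, of 0] by (auto intro: order_trans[OF norm_ge_zero])
  have term_le: "cmod (b k \<alpha> * of_real t ^ k * multi_power m w \<alpha>) \<le> B * ((1/2) ^ multi_degree m \<alpha> * (1/2) ^ k)"
    if \<alpha>: "\<alpha> \<in> ?I" for k \<alpha>
  proof -
    have "cmod (b k \<alpha> * of_real t ^ k * multi_power m w \<alpha>) = cmod (b k \<alpha>) * \<bar>t\<bar> ^ k * cmod (multi_power m w \<alpha>)"
      by (simp add: norm_mult norm_power)
    also have "\<dots> \<le> B / s ^ multi_degree m \<alpha> / L ^ k * (L / 2) ^ k * (s / 2) ^ multi_degree m \<alpha>"
    proof (rule mult_mono)
      show "cmod (b k \<alpha>) * \<bar>t\<bar> ^ k \<le> B / s ^ multi_degree m \<alpha> / L ^ k * (L / 2) ^ k"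
        by (rule mult_mono[OF b[OF \<alpha>] power_mono[OF t]]) (use B pos in auto)
      show "cmod (multi_power m w \<alpha>) \<le> (s / 2) ^ multi_degree m \<alpha>" by (rule multi_power_bound[OF w])
    qed (use B pos in auto)
    also have "\<dots> = B * ((1/2) ^ multi_degree m \<alpha> * (1/2) ^ k)"
      using pos by (simp add: power_divide)
    finally show ?thesis .
  qed
  have abs_summ: "(\<lambda>(\<alpha>, k). norm (b k \<alpha> * of_real t ^ k * multi_power m w \<alpha>)) summable_on ?I \<times> UNIV"
  proof (rule nonneg_bdd_above_summable_on)
    show "bdd_above (sum (\<lambda>(\<alpha>, k). norm (b k \<alpha> * of_real t ^ k * multi_power m w \<alpha>)) ` {F. F \<subseteq> ?I \<times> UNIV \<and> finite F})"
    proof (rule bdd_aboveI2[of _ _ "B * ((1 / (1 - 1/2)) ^ m * 2)"])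
      fix F :: "((nat \<Rightarrow> nat) \<times> nat) set" assume "F \<in> {F. F \<subseteq> ?I \<times> UNIV \<and> finite F}"
      then have F: "F \<subseteq> ?I \<times> UNIV" "finite F" by auto
      have FI: "fst ` F \<subseteq> ?I" using F by auto
      have "(\<Sum>(\<alpha>, k)\<in>F. norm (b k \<alpha> * of_real t ^ k * multi_power m w \<alpha>)) \<le>
          (\<Sum>(\<alpha>, k)\<in>F. B * ((1/2) ^ multi_degree m \<alpha> * (1/2) ^ k))"
        using F by (intro sum_mono) (auto intro!: term_le)
      also have "\<dots> \<le> (\<Sum>(\<alpha>, k)\<in>fst ` F \<times> snd ` F. B * ((1/2) ^ multi_degree m \<alpha> * (1/2) ^ k))"
        using F B by (intro sum_mono2[OF _ subset_fst_snd]) auto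
      also have "\<dots> = B * ((\<Sum>\<alpha>\<in>fst ` F. (1/2) ^ multi_degree m \<alpha>) * (\<Sum>k\<in>snd ` F. (1/2) ^ k))"
        unfolding sum_product sum.cartesian_product by (simp only: sum_distrib_left case_prod_unfold)
      also have "\<dots> \<le> B * ((1 / (1 - 1/2)) ^ m * 2)"
      proof (intro mult_left_mono mult_mono)
        show "(\<Sum>\<alpha>\<in>fst ` F. (1/2) ^ multi_degree m \<alpha>) \<le> (1 / (1 - 1/2 :: real)) ^ m"
          using F FI by (intro geometric_multi_sum) auto
        have "(\<Sum>k\<in>snd ` F. (1/2) ^ k) \<le> (\<Sum>k. (1/2) ^ k :: real)"
          using F by (intro sum_le_suminf summable_geometric) auto
        also have "\<dots> = 2" by (subst suminf_geometric) auto
        finally show "(\<Sum>k\<in>snd ` F. (1/2) ^ k) \<le> (2::real)" .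
      qed (use B in \<open>auto intro: sum_nonneg\<close>)
      finally show "(\<Sum>(\<alpha>, k)\<in>F. norm (b k \<alpha> * of_real t ^ k * multi_power m w \<alpha>)) \<le> B * ((1 / (1 - 1/2)) ^ m * 2)" .
    qed
  qed auto
  have "((\<lambda>(\<alpha>, k). b k \<alpha> * of_real t ^ k * multi_power m w \<alpha>) has_sum f) (?I \<times> UNIV)"
  proof (rule has_sum_SigmaI[OF _ f])
    fix \<alpha> assume \<alpha>: "\<alpha> \<in> ?I"
    have "summable (\<lambda>k. norm (b k \<alpha> * of_real t ^ k))"
    proof (rule summable_comparison_test'[of "\<lambda>k. B / s ^ multi_degree m \<alpha> * (1/2) ^ k" 0])
      fix k
      have "cmod (b k \<alpha> * of_real t ^ k) \<le> B / s ^ multi_degree m \<alpha> / L ^ k * (L / 2) ^ k"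
        unfolding norm_mult norm_power norm_of_real
        by (rule mult_mono[OF b[OF \<alpha>] power_mono[OF t]]) (use B pos in auto)
      also have "\<dots> = B / s ^ multi_degree m \<alpha> * (1/2) ^ k" using pos by (simp add: power_divide)
      finally show "norm (norm (b k \<alpha> * of_real t ^ k)) \<le> B / s ^ multi_degree m \<alpha> * (1/2) ^ k" by simp
    qed (intro summable_mult summable_geometric, simp)
    then have "((\<lambda>k. b k \<alpha> * of_real t ^ k) has_sum c \<alpha>) UNIV"
      using c[OF \<alpha>] by (rule norm_summable_imp_has_sum)
    then show "((\<lambda>k. case (\<alpha>, k) of (\<alpha>, k) \<Rightarrow> b k \<alpha> * of_real t ^ k * multi_power m w \<alpha>) has_sum c \<alpha> * multi_power m w \<alpha>) UNIV"
      unfolding prod.case by (rule has_sum_cmult_left)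
  next
    show "(\<lambda>(\<alpha>, k). b k \<alpha> * of_real t ^ k * multi_power m w \<alpha>) summable_on ?I \<times> UNIV"
      by (rule abs_summable_summable) (use abs_summ in \<open>simp add: case_prod_unfold\<close>)
  qed
  then show ?thesis by (subst has_sum_swap) simp
qed

text \<open>
  The difference of order \<open>K\<close> of an orbit is \<open>(T h - 1)\<^sup>K F(s)\<close>. Each factor \<open>T h - 1\<close> has norm of
  order \<open>h / \<sigma>\<close> with loss \<open>\<sigma>\<close> of radius. The total loss \<open>\<rho>\<close> is distributed evenly,
  \<open>\<sigma> = \<rho> / K\<close>, as in Nagumo's proof of the theorem of Cauchy and Kovalevskaya; the bound \<open>(K h)\<^sup>K\<close> that results is the one required by Newton's series.
\<close>

lemma diff_bound:
  assumes F: "orbit F" and B: "\<And>t. \<bar>t\<bar> \<le> t\<^sub>0 \<Longrightarrow> super_majorized m n W y R B (F t)"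
    and lip: "\<And>h j. 0 < h \<Longrightarrow> h \<le> t\<^sub>0 \<Longrightarrow> j < m \<Longrightarrow> super_majorized m n (cpoly r) y r (C * h)
        (\<lambda>\<nu> x. T h (super_monomial m W y (multi_unit m j)) \<nu> x - super_monomial m W y (multi_unit m j) \<nu> x)"
      "\<And>h \<mu>. 0 < h \<Longrightarrow> h \<le> t\<^sub>0 \<Longrightarrow> \<mu> \<subseteq> {..<n} \<Longrightarrow> super_majorized m n (cpoly r) y r (C * h)
        (\<lambda>\<nu> x. T h (exterior_basis W \<mu>) \<nu> x - exterior_basis W \<mu> \<nu> x)"
    and r: "r \<le> R'" and \<rho>: "0 < \<rho>" "\<rho> < r" "\<rho> \<le> 1" and C: "0 \<le> C"
    and c: "\<And>t \<nu>. \<bar>t\<bar> \<le> t\<^sub>0 \<Longrightarrow> \<nu> \<subseteq> {..<n} \<Longrightarrow> series_bounded m R B (c t \<nu>)"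
      "\<And>t \<nu> x. \<bar>t\<bar> \<le> t\<^sub>0 \<Longrightarrow> \<nu> \<subseteq> {..<n} \<Longrightarrow> x \<in> W \<Longrightarrow> F t \<nu> x = series_value m (c t \<nu>) (y x)"
    and h: "0 < h" "h \<le> t\<^sub>0" and K: "C * h * real K \<le> \<rho>"
    and s: "\<And>j. j \<le> K \<Longrightarrow> \<bar>s + real j * h\<bar> \<le> t\<^sub>0"
    and \<nu>: "\<nu> \<subseteq> {..<n}" and \<alpha>: "\<alpha> \<in> multi_indices m"
  shows "cmod (forward_diff K (\<lambda>j. c (s + real j * h) \<nu> \<alpha>) 0) \<le> B / (r - \<rho>) ^ multi_degree m \<alpha> * (2 * C / \<rho> * real K * h) ^ K"
proof -
  have h': "\<bar>h\<bar> \<le> t\<^sub>0" using h by simp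
  interpret superdomain_map m n W y R A W' "T h" by (rule map[OF h'])
  define \<tau> where "\<tau> j = s + real j * h" for j
  have \<tau>: "\<bar>\<tau> j\<bar> \<le> t\<^sub>0" if "j \<le> K" for j using s[OF that] by (simp add: \<tau>_def)
  have \<tau>S: "\<tau> j + h = \<tau> (Suc j)" for j by (simp add: \<tau>_def algebra_simps)
  define G where "G k j \<nu> x = forward_diff k (\<lambda>j. F (\<tau> j) \<nu> x) j" for k j \<nu> x
  define cG where "cG k j \<nu> \<alpha> = forward_diff k (\<lambda>j. c (\<tau> j) \<nu> \<alpha>) j" for k j \<nu> \<alpha>
  have GS: "G (Suc k) j = (\<lambda>\<nu> x. G k (Suc j) \<nu> x - G k j \<nu> x)" for k j by (simp add: G_def fun_eq_iff)
  have GA: "G k j \<in> A" if "j + k \<le> K" for k j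
    using that
  proof (induction k arbitrary: j)
    case 0
    then show ?case using F \<tau>[of j] by (simp add: G_def orbit_def)
  next
    case (Suc k)
    show ?case unfolding GS using Suc.prems by (intro A_diff Suc.IH) auto
  qed
  have GT: "T h (G k j) \<nu> x = G k (Suc j) \<nu> x" if "j + k < K" "\<nu> \<subseteq> {..<n}" "x \<in> W'" for k j \<nu> x
    using that
  proof (induction k arbitrary: j)
    case 0
    have "G 0 i = F (\<tau> i)" for i by (simp add: G_def fun_eq_iff)
    moreover have "T h (F (\<tau> j)) \<nu> x = F (\<tau> j + h) \<nu> x"
      using F 0 \<tau>[of j] \<tau>[of "Suc j"] h' unfolding orbit_def \<tau>S[symmetric] by simp
    ultimately show ?case by (simp add: \<tau>S)
  next
    case (Suc k)
    have "T h (G (Suc k) j) \<nu> x = T h (G k (Suc j)) \<nu> x - T h (G k j) \<nu> x"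
      unfolding GS using Suc.prems by (intro T_diff GA) auto
    also have "\<dots> = G k (Suc (Suc j)) \<nu> x - G k (Suc j) \<nu> x"
      using Suc.prems by (subst (1 2) Suc.IH) auto
    finally show ?case by (simp add: GS)
  qed
  have cGb: "series_bounded m R (2 ^ k * B) (cG k j \<nu>) \<and> (\<forall>x. x \<in> W \<longrightarrow> G k j \<nu> x = series_value m (cG k j \<nu>) (y x))"
    if "j + k \<le> K" "\<nu> \<subseteq> {..<n}" for k j \<nu>
    using that
  proof (induction k arbitrary: j)
    case 0
    then show ?case using c(1)[OF \<tau>[of j]] c(2)[OF \<tau>[of j]] by (simp add: G_def cG_def)
  next
    case (Suc k)
    have IH1: "series_bounded m R (2 ^ k * B) (cG k (Suc j) \<nu>)"
        "\<And>x. x \<in> W \<Longrightarrow> G k (Suc j) \<nu> x = series_value m (cG k (Suc j) \<nu>) (y x)"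
      and IH0: "series_bounded m R (2 ^ k * B) (cG k j \<nu>)"
        "\<And>x. x \<in> W \<Longrightarrow> G k j \<nu> x = series_value m (cG k j \<nu>) (y x)"
      using Suc.IH[of "Suc j"] Suc.IH[of j] Suc.prems by auto
    have neg: "series_bounded m R (2 ^ k * B) (\<lambda>\<alpha>. - cG k j \<nu> \<alpha>)"
      using l1_bounded_cmult[OF IH0(1), of "-1"] by simp
    have "series_bounded m R (2 ^ k * B + 2 ^ k * B) (\<lambda>\<alpha>. cG k (Suc j) \<nu> \<alpha> + - cG k j \<nu> \<alpha>)"
      using R_pos by (intro l1_bounded_add IH1(1) neg) simp
    moreover have "cG (Suc k) j \<nu> = (\<lambda>\<alpha>. cG k (Suc j) \<nu> \<alpha> + - cG k j \<nu> \<alpha>)" by (simp add: cG_def fun_eq_iff)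
    moreover have "G (Suc k) j \<nu> x = series_value m (\<lambda>\<alpha>. cG k (Suc j) \<nu> \<alpha> + - cG k j \<nu> \<alpha>) (y x)" if x: "x \<in> W" for x
    proof -
      have "series_value m (\<lambda>\<alpha>. cG k (Suc j) \<nu> \<alpha> + - cG k j \<nu> \<alpha>) (y x) =
          series_value m (cG k (Suc j) \<nu>) (y x) + series_value m (\<lambda>\<alpha>. - cG k j \<nu> \<alpha>) (y x)"
        using polydisc x by (intro series_value_add[OF IH1(1) neg]) (auto simp: in_polydisc_def)
      then show ?thesis using IH1(2)[OF x] IH0(2)[OF x] by (simp add: GS series_value_def infsum_uminus)
    qed
    moreover have "2 ^ Suc k * B = 2 ^ k * B + 2 ^ k * B" by simp
    ultimately show ?case by metis
  qed
  have maj: "super_majorized m n (cpoly (r - real k * \<sigma>)) y (r - real k * \<sigma>) ((2 * (C * h) / \<sigma>) ^ k * B) (G k 0)"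
    if "k \<le> K" "\<sigma> = \<rho> / real K" for k \<sigma>
    using that(1)
  proof (induction k)
    case 0
    have "super_majorized m n W y R B (G 0 0)" using B[OF \<tau>[of 0]] by (simp add: G_def[abs_def])
    from super_majorized_mono[OF this cpoly_sub(1)[of r], of r B] show ?case using r \<rho> R' by simp
  next
    case (Suc k)
    have K0: "0 < real K" using Suc.prems by simp
    have \<sigma>: "0 < \<sigma>" using \<rho> K0 by (simp add: that(2))
    have K\<sigma>: "real K * \<sigma> = \<rho>" using K0 by (simp add: that(2))
    have "real (Suc k) * \<sigma> \<le> real K * \<sigma>" using Suc.prems \<sigma> by (intro mult_right_mono) auto
    then have Sk: "real (Suc k) * \<sigma> \<le> \<rho>" using K\<sigma> by simp
    have "1 * \<sigma> \<le> real (Suc k) * \<sigma>" using \<sigma> by (intro mult_right_mono) auto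
    then have \<sigma>1: "\<sigma> \<le> 1" using Sk \<rho> by simp
    let ?r = "r - real (Suc k) * \<sigma>"
    have r': "0 < ?r" "?r \<le> r" using Sk \<rho> \<sigma> by auto
    have step: "?r + \<sigma> = r - real k * \<sigma>" by (simp add: algebra_simps)
    have "super_majorized m n (cpoly ?r) y ?r (2 * (C * h) / \<sigma> * ((2 * (C * h) / \<sigma>) ^ k * B))
        (\<lambda>\<nu> x. T h (G k 0) \<nu> x - G k 0 \<nu> x)"
    proof (rule T_minus_id[OF h' r'(1) \<sigma> \<sigma>1 _ _ _ _ _ GA, where B' = "2 ^ k * B"])
      have "0 \<le> real k * \<sigma>" using \<sigma> by simp
      then show "?r + \<sigma> \<le> R'" unfolding step using r by linarith
      show "0 \<le> C * h" using C h by simp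
      show "C * h \<le> \<sigma>" using K K0 by (simp add: that(2) pos_le_divide_eq)
      show "super_majorized m n (cpoly ?r) y ?r (C * h)
        (\<lambda>\<nu> x. T h (super_monomial m W y (multi_unit m j)) \<nu> x - super_monomial m W y (multi_unit m j) \<nu> x)" if "j < m" for j
        using r' by (intro super_majorized_mono[OF lip(1)[OF h that]] cpoly_sub) auto
      show "super_majorized m n (cpoly ?r) y ?r (C * h)
        (\<lambda>\<nu> x. T h (exterior_basis W \<mu>) \<nu> x - exterior_basis W \<mu> \<nu> x)" if "\<mu> \<subseteq> {..<n}" for \<mu>
        using r' by (intro super_majorized_mono[OF lip(2)[OF h that]] cpoly_sub) auto
      show "majorized m W y R (2 ^ k * B) (G k 0 \<nu>)" if "\<nu> \<subseteq> {..<n}" for \<nu>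
        using cGb[of 0 k \<nu>] Suc.prems that unfolding majorized_def by auto
      show "super_majorized m n (cpoly (?r + \<sigma>)) y (?r + \<sigma>) ((2 * (C * h) / \<sigma>) ^ k * B) (G k 0)"
        unfolding step using Suc.IH Suc.prems by simp
    qed (use Suc.prems in simp)
    then have "super_majorized m n (cpoly ?r) y ?r (2 * (C * h) / \<sigma> * ((2 * (C * h) / \<sigma>) ^ k * B)) (G (Suc k) 0)"
    proof (rule super_majorized_cong)
      fix \<nu> x assume "\<nu> \<subseteq> {..<n}" "x \<in> cpoly ?r"
      moreover have "0 < real (Suc k) * \<sigma>" using \<sigma> by simp
      then have "?r < R'" using r by linarith
      then have "cpoly ?r \<subseteq> W'" by (rule cpoly_sub)
      ultimately show "T h (G k 0) \<nu> x - G k 0 \<nu> x = G (Suc k) 0 \<nu> x"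
        using GT[of 0 k \<nu> x] Suc.prems by (auto simp: GS)
    qed
    then show ?case by (simp only: power_Suc mult.assoc)
  qed
  have r3: "0 < r - \<rho>" "r - \<rho> \<le> R" using \<rho> r R' by auto
  have main: "super_majorized m n (cpoly (r - \<rho>)) y (r - \<rho>) ((2 * C / \<rho> * real K * h) ^ K * B) (G K 0)"
  proof (cases "K = 0")
    case True
    have "super_majorized m n (cpoly r) y r B (G 0 0)" using maj[of 0 0] True by simp
    from super_majorized_mono[OF this cpoly_sub(3), of "r - \<rho>" "r - \<rho>" B]
    have "super_majorized m n (cpoly (r - \<rho>)) y (r - \<rho>) B (G 0 0)" using \<rho> by simp
    then show ?thesis using True by simp
  next
    case False
    have eq1: "r - real K * (\<rho> / real K) = r - \<rho>" using False by simp
    have eq2: "2 * (C * h) / (\<rho> / real K) = 2 * C / \<rho> * real K * h" using False by simp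
    show ?thesis using maj[OF order_refl refl] unfolding eq1 eq2 .
  qed
  have "series_bounded m (r - \<rho>) ((2 * C / \<rho> * real K * h) ^ K * B) (cG K 0 \<nu>)"
  proof (rule series_unique_on)
    show "series_bounded m R (2 ^ K * B) (cG K 0 \<nu>)" using cGb[of 0 K \<nu>] \<nu> by simp
    show "G K 0 \<nu> x = series_value m (cG K 0 \<nu>) (y x)" if "x \<in> cpoly (r - \<rho>)" for x
      using cGb[of 0 K \<nu>] \<nu> that cpoly_sub(1)[of "r - \<rho>"] by auto
    show "majorized m (cpoly (r - \<rho>)) y (r - \<rho>) ((2 * C / \<rho> * real K * h) ^ K * B) (G K 0 \<nu>)"
      using r3 by (intro super_majorized_component[OF main \<nu>]) simp
  qed (use r3 in auto)
  from l1_bounded_coeff[OF this \<alpha>] show ?thesis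
    using r3 by (simp add: cG_def \<tau>_def pos_le_divide_eq mult_ac)
qed

text \<open>
  The bounds on differences, applied to each coefficient of the expansion in space, make that coefficient
  an analytic function of time on an interval whose length does not depend on the coefficient. The case
  \<open>K = 1\<close> gives its continuity.
\<close>

proposition orbit_analytic:
  assumes F: "orbit F" and B: "\<And>t. \<bar>t\<bar> \<le> t\<^sub>0 \<Longrightarrow> super_majorized m n W y R B (F t)"
    and lip: "\<And>h j. 0 < h \<Longrightarrow> h \<le> t\<^sub>0 \<Longrightarrow> j < m \<Longrightarrow> super_majorized m n (cpoly r) y r (C * h)
        (\<lambda>\<nu> x. T h (super_monomial m W y (multi_unit m j)) \<nu> x - super_monomial m W y (multi_unit m j) \<nu> x)"
      "\<And>h \<mu>. 0 < h \<Longrightarrow> h \<le> t\<^sub>0 \<Longrightarrow> \<mu> \<subseteq> {..<n} \<Longrightarrow> super_majorized m n (cpoly r) y r (C * h)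
        (\<lambda>\<nu> x. T h (exterior_basis W \<mu>) \<nu> x - exterior_basis W \<mu> \<nu> x)"
    and r: "0 < r" "r \<le> R'" and C: "0 \<le> C"
  shows "\<exists>\<epsilon>>0. \<forall>\<nu>\<subseteq>{..<n}. \<exists>b. \<forall>t x. \<bar>t\<bar> < \<epsilon> \<and> x \<in> W \<and> (\<forall>i<m. cmod (y x i) < \<epsilon>) \<longrightarrow>
    ((\<lambda>(k, \<alpha>). b k \<alpha> * of_real t ^ k * multi_power m (y x) \<alpha>) has_sum F t \<nu> x) (UNIV \<times> multi_indices m)"
proof -
  define \<rho> where "\<rho> = min (r / 2) 1"
  have \<rho>: "0 < \<rho>" "\<rho> < r" "\<rho> \<le> 1" using r by (auto simp: \<rho>_def)
  define L where "L = min t\<^sub>0 (\<rho> / (24 * (C + 1)))"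
  have L: "0 < L" "L \<le> t\<^sub>0" using t\<^sub>0 \<rho> C by (auto simp: L_def)
  have "L \<le> \<rho> / (24 * (C + 1))" by (simp add: L_def)
  then have CL: "24 * (C + 1) * L \<le> \<rho>" using C by (simp add: pos_le_divide_eq mult.commute)
  have CL1: "C * L \<le> \<rho>"
  proof -
    have "C * L \<le> 24 * (C + 1) * L" using C L by (intro mult_right_mono) auto
    then show ?thesis using CL by simp
  qed
  have QL: "4 * exp 1 * (2 * C / \<rho>) * L \<le> 1"
  proof -
    have "4 * exp 1 * (2 * C) * L \<le> 4 * 3 * (2 * C) * L"
      using exp_le C L by (intro mult_right_mono) auto
    also have "\<dots> \<le> 24 * (C + 1) * L" using L by (intro mult_right_mono) auto
    also have "\<dots> \<le> \<rho>" by (rule CL)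
    finally show ?thesis using \<rho> by (simp add: field_simps)
  qed
  have "\<forall>t\<in>{-t\<^sub>0..t\<^sub>0}. \<exists>c. \<forall>\<nu>\<subseteq>{..<n}. series_bounded m R B (c \<nu>) \<and> (\<forall>x. x \<in> W \<longrightarrow> F t \<nu> x = series_value m (c \<nu>) (y x))"
    by (intro ballI orbit_series B) auto
  from bchoice[OF this] obtain c where c_all: "\<forall>t\<in>{-t\<^sub>0..t\<^sub>0}. \<forall>\<nu>\<subseteq>{..<n}.
      series_bounded m R B (c t \<nu>) \<and> (\<forall>x. x \<in> W \<longrightarrow> F t \<nu> x = series_value m (c t \<nu>) (y x))" ..
  have c: "series_bounded m R B (c t \<nu>)" if "\<bar>t\<bar> \<le> t\<^sub>0" "\<nu> \<subseteq> {..<n}" for t \<nu>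
    using c_all that by (simp add: abs_le_iff)
  have cF: "F t \<nu> x = series_value m (c t \<nu>) (y x)" if "\<bar>t\<bar> \<le> t\<^sub>0" "\<nu> \<subseteq> {..<n}" "x \<in> W" for t \<nu> x
    using c_all that by (simp add: abs_le_iff)
  have B0: "0 \<le> B" using B[of 0] t\<^sub>0 by (intro super_majorized_nonneg[OF B[of 0]]) simp
  have r\<rho>: "0 < r - \<rho>" using \<rho> by simp
  have diff: "cmod (forward_diff K (\<lambda>j. c (s + real j * h) \<nu> \<alpha>) 0) \<le> B / (r - \<rho>) ^ multi_degree m \<alpha> * (2 * C / \<rho> * real K * h) ^ K"
    if "0 < h" "h \<le> t\<^sub>0" "C * h * real K \<le> \<rho>" "\<And>j. j \<le> K \<Longrightarrow> \<bar>s + real j * h\<bar> \<le> t\<^sub>0" "\<nu> \<subseteq> {..<n}" "\<alpha> \<in> multi_indices m"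
    for K s h \<nu> \<alpha>
    by (rule diff_bound[OF F B lip r(2) \<rho> C c cF that])
  have coeff: "\<exists>b. (\<forall>k. cmod (b k) \<le> 2 * (B / (r - \<rho>) ^ multi_degree m \<alpha>) / L ^ k) \<and>
      (\<forall>t. \<bar>t\<bar> \<le> L / 2 \<longrightarrow> (\<lambda>k. b k * of_real t ^ k) sums c t \<nu> \<alpha>)"
    if \<nu>: "\<nu> \<subseteq> {..<n}" and \<alpha>: "\<alpha> \<in> multi_indices m" for \<nu> \<alpha>
  proof -
    define u where "u t = c (- L / 2 + t) \<nu> \<alpha>" for t
    let ?A = "B / (r - \<rho>) ^ multi_degree m \<alpha>"
    have A0: "0 \<le> ?A" using B0 r\<rho> by simp
    have lip_u: "cmod (u t' - u t) \<le> ?A * (2 * C / \<rho>) * (t' - t)" if "0 \<le> t" "t < t'" "t' \<le> L" for t t'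
    proof -
      have "cmod (forward_diff 1 (\<lambda>j. c ((- L / 2 + t) + real j * (t' - t)) \<nu> \<alpha>) 0) \<le> ?A * (2 * C / \<rho> * real 1 * (t' - t)) ^ 1"
      proof (rule diff[OF _ _ _ _ \<nu> \<alpha>])
        show "0 < t' - t" "t' - t \<le> t\<^sub>0" using that L by auto
        have "C * (t' - t) \<le> C * L" using that C by (intro mult_left_mono) auto
        then show "C * (t' - t) * real 1 \<le> \<rho>" using CL1 by simp
        show "\<bar>- L / 2 + t + real j * (t' - t)\<bar> \<le> t\<^sub>0" if "j \<le> 1" for j
        proof -
          have "j = 0 \<or> j = 1" using that by auto
          then show ?thesis using L \<open>0 \<le> t\<close> \<open>t < t'\<close> \<open>t' \<le> L\<close> by (auto simp: abs_le_iff)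
        qed
      qed
      then show ?thesis by (simp add: u_def mult.assoc)
    qed
    have u_cont: "continuous_on {0..L} u"
    proof (rule lipschitz_on_continuous_on)
      show "(?A * (2 * C / \<rho>))-lipschitz_on {0..L} u"
      proof (rule lipschitz_onI)
        fix t t' assume t: "t \<in> {0..L}" "t' \<in> {0..L}"
        consider "t < t'" | "t = t'" | "t' < t" by linarith
        then show "dist (u t) (u t') \<le> ?A * (2 * C / \<rho>) * dist t t'"
        proof cases
          case 1
          then show ?thesis using lip_u[of t t'] t by (simp add: dist_norm norm_minus_commute)
        next
          case 3
          then show ?thesis using lip_u[of t' t] t by (simp add: dist_norm)
        qed simp
      qed (intro mult_nonneg_nonneg A0, use C \<rho> in simp)
    qed
    have "\<exists>b. (\<forall>k. cmod (b k) \<le> 2 * ?A / L ^ k) \<and>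
      (\<forall>t. \<bar>t\<bar> \<le> L / 2 \<longrightarrow> (\<lambda>k. b k * of_real t ^ k) sums u (L / 2 + t))"
    proof (rule analytic_from_differences[OF L(1) _ QL A0 u_cont, where ?N0.0 = 0])
      fix N k :: nat assume k: "k \<le> 2 ^ N"
      have kL: "real j * (L / 2 ^ N) \<le> L" if "j \<le> 2 ^ N" for j
      proof -
        have "real j \<le> real (2 ^ N)" using that by (simp only: of_nat_le_iff)
        then have "real j * (L / 2 ^ N) \<le> 2 ^ N * (L / 2 ^ N)" using L by (intro mult_right_mono) auto
        then show ?thesis by simp
      qed
      have "cmod (forward_diff k (\<lambda>j. c (- L / 2 + real j * (L / 2 ^ N)) \<nu> \<alpha>) 0) \<le> ?A * (2 * C / \<rho> * real k * (L / 2 ^ N)) ^ k"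
      proof (rule diff[OF _ _ _ _ \<nu> \<alpha>])
        show "0 < L / 2 ^ N" using L by simp
        show "L / 2 ^ N \<le> t\<^sub>0" using kL[of 1] L by simp
        have "C * (real k * (L / 2 ^ N)) \<le> C * L" using kL[OF k] C by (rule mult_left_mono)
        then show "C * (L / 2 ^ N) * real k \<le> \<rho>" using CL1 by (simp add: mult_ac)
        show "\<bar>- L / 2 + real j * (L / 2 ^ N)\<bar> \<le> t\<^sub>0" if "j \<le> k" for j
        proof -
          have "real j * (L / 2 ^ N) \<le> L" using that k by (intro kL) simp
          moreover have "0 \<le> real j * (L / 2 ^ N)" using L by simp
          ultimately have "\<bar>- L / 2 + real j * (L / 2 ^ N)\<bar> \<le> L" using L(1) unfolding abs_le_iff by linarith
          then show ?thesis using L(2) by (rule order_trans)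
        qed
      qed
      then show "cmod (forward_diff k (\<lambda>j. u (real j * (L / 2 ^ N))) 0) \<le> ?A * (2 * C / \<rho> * real k * (L / 2 ^ N)) ^ k"
        by (simp only: u_def)
    qed (use C \<rho> in simp)
    then show ?thesis by (simp add: u_def)
  qed
  define \<epsilon> where "\<epsilon> = min (L / 2) (min ((r - \<rho>) / 2) R)"
  have "\<exists>b. \<forall>t x. \<bar>t\<bar> < \<epsilon> \<and> x \<in> W \<and> (\<forall>i<m. cmod (y x i) < \<epsilon>) \<longrightarrow>
    ((\<lambda>(k, \<alpha>). b k \<alpha> * of_real t ^ k * multi_power m (y x) \<alpha>) has_sum F t \<nu> x) (UNIV \<times> multi_indices m)"
    if \<nu>: "\<nu> \<subseteq> {..<n}" for \<nu>
  proof -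
    have "\<forall>\<alpha>\<in>multi_indices m. \<exists>b. (\<forall>k. cmod (b k) \<le> 2 * (B / (r - \<rho>) ^ multi_degree m \<alpha>) / L ^ k) \<and>
      (\<forall>t. \<bar>t\<bar> \<le> L / 2 \<longrightarrow> (\<lambda>k. b k * of_real t ^ k) sums c t \<nu> \<alpha>)"
      using coeff[OF \<nu>] by blast
    from bchoice[OF this] obtain b where b: "\<forall>\<alpha>\<in>multi_indices m.
      (\<forall>k. cmod (b \<alpha> k) \<le> 2 * (B / (r - \<rho>) ^ multi_degree m \<alpha>) / L ^ k) \<and>
      (\<forall>t. \<bar>t\<bar> \<le> L / 2 \<longrightarrow> (\<lambda>k. b \<alpha> k * of_real t ^ k) sums c t \<nu> \<alpha>)" ..
    show ?thesis
    proof (intro exI[of _ "\<lambda>k \<alpha>. b \<alpha> k"] allI impI, elim conjE)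
      fix t x assume t: "\<bar>t\<bar> < \<epsilon>" and x: "x \<in> W" "\<forall>i<m. cmod (y x i) < \<epsilon>"
      have t': "\<bar>t\<bar> \<le> L / 2" "\<bar>t\<bar> \<le> t\<^sub>0" using t L by (auto simp: \<epsilon>_def)
      show "((\<lambda>(k, \<alpha>). b \<alpha> k * of_real t ^ k * multi_power m (y x) \<alpha>) has_sum F t \<nu> x) (UNIV \<times> multi_indices m)"
      proof (rule has_sum_time_space[where b = "\<lambda>k \<alpha>. b \<alpha> k" and B = "2 * B" and s = "r - \<rho>" and L = L and c = "c t \<nu>"])
        show "cmod (b \<alpha> k) \<le> 2 * B / (r - \<rho>) ^ multi_degree m \<alpha> / L ^ k" if "\<alpha> \<in> multi_indices m" for k \<alpha>
          using b that by simp
        show "(\<lambda>k. b \<alpha> k * of_real t ^ k) sums c t \<nu> \<alpha>" if "\<alpha> \<in> multi_indices m" for \<alpha>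
          using b that t'(1) by blast
        show "cmod (y x i) \<le> (r - \<rho>) / 2" if "i < m" for i using x(2) that by (fastforce simp: \<epsilon>_def)
        show "((\<lambda>\<alpha>. c t \<nu> \<alpha> * multi_power m (y x) \<alpha>) has_sum F t \<nu> x) (multi_indices m)"
          unfolding cF[OF t'(2) \<nu> x(1)]
          by (rule series_value_has_sum(1)[OF c[OF t'(2) \<nu>]]) (use x(2) in \<open>force simp: \<epsilon>_def\<close>)
      qed (use r\<rho> L t' in auto)
    qed
  qed
  moreover have "0 < \<epsilon>" using L r\<rho> R_pos by (simp add: \<epsilon>_def)
  ultimately show ?thesis by blast
qed

end

section \<open>Local power series expansions on a manifold\<close>

definition expandable_at ::
    "nat \<Rightarrow> 'p set \<Rightarrow> ('p \<Rightarrow> nat \<Rightarrow> complex) \<Rightarrow> ('p \<Rightarrow> complex) \<Rightarrow> 'p \<Rightarrow> bool"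
  where "expandable_at m W z f p \<longleftrightarrow>
    (\<exists>r>0. \<exists>B. majorized m {x \<in> W. \<forall>i<m. cmod (z x i - z p i) \<le> r} (\<lambda>x i. z x i - z p i) r B f)"

lemma expandable_at_subset:
  assumes "expandable_at m W z f p" "W' \<subseteq> W"
  shows "expandable_at m W' z f p"
proof -
  obtain r B where r: "r > 0" "majorized m {x \<in> W. \<forall>i<m. cmod (z x i - z p i) \<le> r} (\<lambda>x i. z x i - z p i) r B f"
    using assms(1) unfolding expandable_at_def by blast
  have "majorized m {x \<in> W'. \<forall>i<m. cmod (z x i - z p i) \<le> r} (\<lambda>x i. z x i - z p i) r B f"
    by (rule majorized_mono[OF r(2)]) (use assms(2) r(1) in auto)
  then show ?thesis using r(1) unfolding expandable_at_def by blast
qed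

lemma expandable_at_change_chart:
  assumes p: "p \<in> W" and z: "\<And>i. i < m \<Longrightarrow> expandable_at m W w (\<lambda>x. z x i) p"
    and f: "expandable_at m W z f p"
  shows "expandable_at m W w f p"
proof -
  obtain r B where r: "r > 0" "majorized m {x \<in> W. \<forall>i<m. cmod (z x i - z p i) \<le> r} (\<lambda>x i. z x i - z p i) r B f"
    using f unfolding expandable_at_def by blast
  define D where "D s = {x \<in> W. \<forall>i<m. cmod (w x i - w p i) \<le> s}" for s
  let ?y = "\<lambda>x i. w x i - w p i"
  have Dp: "in_polydisc m (D s) ?y s" for s by (simp add: D_def in_polydisc_def)
  have "\<forall>i\<in>{..<m}. \<exists>sb. fst sb > 0 \<and> majorized m (D (fst sb)) ?y (fst sb) (snd sb) (\<lambda>x. z x i)"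
    using z unfolding expandable_at_def D_def by fastforce
  from bchoice[OF this] obtain sb where
    sb: "\<forall>i\<in>{..<m}. fst (sb i) > 0 \<and> majorized m (D (fst (sb i))) ?y (fst (sb i)) (snd (sb i)) (\<lambda>x. z x i)" ..
  define s where "s = Min (insert 1 ((\<lambda>i. fst (sb i)) ` {..<m}))"
  define C where "C = Max (insert 0 ((\<lambda>i. snd (sb i)) ` {..<m}))"
  have s: "0 < s" unfolding s_def using sb by (subst Min_gr_iff) auto
  have s_le: "s \<le> fst (sb i)" if "i < m" for i unfolding s_def using that by (intro Min_le) auto
  have C_ge: "snd (sb i) \<le> C" if "i < m" for i unfolding C_def using that by (intro Max_ge) auto
  have C0: "0 \<le> C" unfolding C_def by (intro Max_ge) auto
  have zs: "majorized m (D s) ?y s C (\<lambda>x. z x i)" if "i < m" for i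
  proof (rule majorized_mono)
    show "majorized m (D (fst (sb i))) ?y (fst (sb i)) (snd (sb i)) (\<lambda>x. z x i)" using sb that by blast
    show "D s \<subseteq> D (fst (sb i))" using s_le[OF that] unfolding D_def by fastforce
  qed (use s s_le C_ge that in auto)
  define s' where "s' = min s (s * r / (C + 1))"
  have s': "0 < s'" "s' \<le> s" using s r C0 by (auto simp: s'_def)
  have "s' \<le> s * r / (C + 1)" by (simp add: s'_def)
  then have "s' * (C + 1) \<le> s * r" using C0 by (simp add: pos_le_divide_eq)
  then have "s' * C \<le> s * r" using s' by (simp add: distrib_left)
  then have le: "s' / s * C \<le> r" using s by (simp add: pos_divide_le_eq mult.commute)
  have zr: "majorized m (D s') ?y s' r (\<lambda>x. z x i - z p i)" if i: "i < m" for i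
  proof (rule majorized_mono)
    show "majorized m (D s) ?y s' (s' / s * C) (\<lambda>x. z x i - z p i)"
      by (rule majorized_shrink[OF zs[OF i]]) (use s' s p Dp in \<open>auto simp: D_def\<close>)
    show "D s' \<subseteq> D s" using s'(2) unfolding D_def by fastforce
  qed (use s' le in auto)
  have sub: "D s' \<subseteq> {x \<in> W. \<forall>i<m. cmod (z x i - z p i) \<le> r}"
    using majorized_norm_le[OF zr Dp] by (auto simp: D_def)
  have "majorized m (D s') ?y s' B f"
  proof (rule majorized_compose[where Y = "\<lambda>x i. z x i - z p i", OF zr _ Dp s'(1)])
    show "majorized m (D s') (\<lambda>x i. z x i - z p i) r B f"
      by (rule majorized_mono[OF r(2) sub]) (use r(1) in auto)
  qed
  then show ?thesis unfolding expandable_at_def D_def using s'(1) by blast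
qed

lemma polydisc_in_open:
  assumes "openin (complex_space m) V" "q \<in> V"
  obtains R where "0 < R" "open_polydisc m q R \<subseteq> V"
proof -
  obtain U where U: "\<forall>i\<in>{..<m}. openin euclidean (U i)" "q \<in> PiE {..<m} U" "PiE {..<m} U \<subseteq> V"
    using assms unfolding complex_space_def openin_product_topology_alt by meson
  have "\<forall>i\<in>{..<m}. \<exists>r>0. ball (q i) r \<subseteq> U i"
    using U(1,2) by (auto simp: open_openin[symmetric] open_contains_ball PiE_iff)
  from bchoice[OF this] obtain r where r: "\<forall>i\<in>{..<m}. 0 < r i \<and> ball (q i) (r i) \<subseteq> U i" ..
  define R where "R = Min (insert 1 (r ` {..<m}))"
  have R: "0 < R" unfolding R_def using r by (subst Min_gr_iff) auto
  have R_le: "R \<le> r i" if "i < m" for i unfolding R_def using that by (intro Min_le) auto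
  have "open_polydisc m q R \<subseteq> V"
  proof
    fix w assume w: "w \<in> open_polydisc m q R"
    have "w i \<in> U i" if "i < m" for i
    proof -
      have "w i \<in> ball (q i) (r i)"
        using w that R_le[OF that] by (auto simp: open_polydisc_def dist_norm norm_minus_commute)
      then show ?thesis using r that by blast
    qed
    then have "w \<in> PiE {..<m} U" using w by (simp add: open_polydisc_def PiE_iff)
    then show "w \<in> V" using U(3) by blast
  qed
  with R show ?thesis by (rule that)
qed

context
  fixes m :: nat and S :: "'p topology" and U :: "'p set" and z :: "'p \<Rightarrow> nat \<Rightarrow> complex"
  assumes chart: "chart m S U z"
begin

lemma chart_openin: "openin S U"
  and chart_image_openin: "openin (complex_space m) (z ` U)"
  and chart_homeo: "homeomorphic_map (subtopology S U) (subtopology (complex_space m) (z ` U)) z"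
  using chart by (auto simp: chart_def)

lemma chart_topspace: "topspace (subtopology S U) = U"
  using openin_subset[OF chart_openin] by auto

lemma chart_inj: "inj_on z U"
  using homeomorphic_imp_injective_map[OF chart_homeo] unfolding chart_topspace .

lemma chart_extensional: "x \<in> U \<Longrightarrow> z x \<in> extensional {..<m}"
  using openin_subset[OF chart_image_openin] by (auto simp: complex_space_def PiE_iff)

lemma chart_open_image:
  assumes "openin S W" "W \<subseteq> U" shows "openin (complex_space m) (z ` W)"
proof -
  have "openin (subtopology S U) W" using assms chart_openin by (simp add: openin_open_subtopology)
  then have "openin (subtopology (complex_space m) (z ` U)) (z ` W)"
    using homeomorphic_imp_open_map[OF chart_homeo] by (simp add: open_map_def)
  then show ?thesis using chart_image_openin by (simp add: openin_open_subtopology)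
qed

lemma chart_polydisc_open: "openin S {x \<in> U. \<forall>i<m. cmod (z x i - q i) < r}"
proof -
  let ?P = "PiE {..<m} (\<lambda>i. ball (q i) r)"
  have "openin (complex_space m) (PiE {..<m} (\<lambda>i. if i < m then ball (q i) r else UNIV))"
    unfolding complex_space_def
  proof (rule product_topology_basis)
    show "finite {i. (if i < m then ball (q i) r else UNIV) \<noteq> topspace euclidean}"
      by (rule finite_subset[of _ "{..<m}"]) auto
  qed simp
  also have "PiE {..<m} (\<lambda>i. if i < m then ball (q i) r else UNIV) = ?P" by (rule PiE_cong) simp
  finally have "openin (complex_space m) ?P" .
  then have "openin (subtopology (complex_space m) (z ` U)) (z ` U \<inter> ?P)"
    by (rule openin_subtopology_Int2)
  from openin_continuous_map_preimage[OF homeomorphic_imp_continuous_map[OF chart_homeo] this]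
  have "openin (subtopology S U) {x \<in> U. z x \<in> z ` U \<inter> ?P}" by (simp only: chart_topspace)
  also have "{x \<in> U. z x \<in> z ` U \<inter> ?P} = {x \<in> U. \<forall>i<m. cmod (z x i - q i) < r}"
    using chart_extensional by (auto simp: PiE_iff dist_norm norm_minus_commute)
  finally show ?thesis using chart_openin by (simp add: openin_open_subtopology)
qed

lemma chart_polydisc_compact:
  assumes "open_polydisc m q R \<subseteq> z ` U" "r < R"
  shows "compactin S {x \<in> U. \<forall>i<m. cmod (z x i - q i) \<le> r}" (is "compactin S ?C")
proof -
  let ?P = "PiE {..<m} (\<lambda>i. cball (q i) r)"
  have "compactin (complex_space m) ?P"
    unfolding complex_space_def by (subst compactin_PiE) auto
  moreover have "?P \<subseteq> open_polydisc m q R"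
  proof
    fix w assume w: "w \<in> ?P"
    have "cmod (w i - q i) < R" if "i < m" for i
    proof -
      have "w i \<in> cball (q i) r" using w that by (simp add: PiE_iff)
      then show ?thesis using assms(2) by (simp add: dist_norm norm_minus_commute)
    qed
    then show "w \<in> open_polydisc m q R" using w by (simp add: open_polydisc_def PiE_iff)
  qed
  then have PU: "?P \<subseteq> z ` U" using assms(1) by blast
  ultimately have "compactin (subtopology (complex_space m) (z ` U)) ?P"
    by (simp add: compactin_subtopology)
  moreover have "?P = z ` ?C"
  proof
    show "?P \<subseteq> z ` ?C"
    proof
      fix w assume w: "w \<in> ?P"
      then obtain x where x: "x \<in> U" "w = z x" using PU by blast
      have "cmod (z x i - q i) \<le> r" if "i < m" for i
      proof -
        have "z x i \<in> cball (q i) r" using w x(2) that by (simp add: PiE_iff)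
        then show ?thesis by (simp add: dist_norm norm_minus_commute)
      qed
      then show "w \<in> z ` ?C" using x by blast
    qed
    show "z ` ?C \<subseteq> ?P"
    proof
      fix w assume "w \<in> z ` ?C"
      then obtain x where "x \<in> U" "\<forall>i<m. cmod (z x i - q i) \<le> r" "w = z x" by blast
      then show "w \<in> ?P" using chart_extensional[of x] by (simp add: PiE_iff dist_norm norm_minus_commute)
    qed
  qed
  ultimately have "compactin (subtopology (complex_space m) (z ` U)) (z ` ?C)" by simp
  moreover have "?C \<subseteq> topspace (subtopology S U)" unfolding chart_topspace by blast
  ultimately have "compactin (subtopology S U) ?C"
    using homeomorphic_map_compactness[OF chart_homeo, of ?C] by blast
  then show ?thesis by (simp add: compactin_subtopology)
qed

lemma holomorphic_imp_expandable:
  assumes W: "openin S W" "W \<subseteq> U" and p: "p \<in> W"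
    and hol: "holomorphic_fun_on m (z ` W) (\<lambda>q. f (inv_into U z q))"
  shows "expandable_at m W z f p"
proof -
  have zp: "z p \<in> z ` W" using p by simp
  obtain c r where r: "r > 0" and c: "\<forall>w\<in>z ` W. (\<forall>i<m. cmod (w i - z p i) < r) \<longrightarrow>
    ((\<lambda>\<alpha>. c \<alpha> * multi_power m (\<lambda>i. w i - z p i) \<alpha>) has_sum f (inv_into U z w)) (multi_indices m)"
    using holomorphic_fun_onD[OF hol zp] by (elim exE conjE) (rule that)
  obtain R where R: "0 < R" "open_polydisc m (z p) R \<subseteq> z ` W"
    using polydisc_in_open[OF chart_open_image[OF W] zp] .
  define s where "s = min r R / 2"
  have s: "0 < s" "s < r" "s < R" using r R by (auto simp: s_def)
  define w where "w = (\<lambda>i\<in>{..<m}. z p i + of_real s)"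
  have w: "w \<in> z ` W" using R s by (auto simp: open_polydisc_def w_def)
  have wi: "w i - z p i = of_real s" if "i < m" for i using that by (simp add: w_def)
  have "\<forall>i<m. cmod (w i - z p i) < r" using wi s by simp
  then have "((\<lambda>\<alpha>. c \<alpha> * multi_power m (\<lambda>i. w i - z p i) \<alpha>) has_sum f (inv_into U z w)) (multi_indices m)"
    using bspec[OF c w] by (rule rev_mp)
  moreover have "multi_power m (\<lambda>i. w i - z p i) \<alpha> = of_real (s ^ multi_degree m \<alpha>)" for \<alpha>
    by (subst multi_power_cong[OF wi]) (simp_all add: multi_power_def multi_degree_def power_sum)
  ultimately have "(\<lambda>\<alpha>. c \<alpha> * of_real (s ^ multi_degree m \<alpha>)) summable_on multi_indices m"
    by (simp only: has_sum_imp_summable)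
  then have "(\<lambda>\<alpha>. cmod (c \<alpha> * of_real (s ^ multi_degree m \<alpha>))) summable_on multi_indices m"
    by (simp only: summable_on_iff_abs_summable_on_complex)
  then have cb: "series_bounded m s (\<Sum>\<^sub>\<infinity>\<alpha>\<in>multi_indices m. cmod (c \<alpha> * of_real (s ^ multi_degree m \<alpha>))) c"
    by (rule l1_boundedI_abs_summable) (use s in auto)
  have "f x = series_value m c (\<lambda>i. z x i - z p i)"
    if x: "x \<in> W" "\<forall>i<m. cmod (z x i - z p i) \<le> s" for x
  proof -
    have "\<forall>i<m. cmod (z x i - z p i) < r" using x(2) s(2) by fastforce
    then have "((\<lambda>\<alpha>. c \<alpha> * multi_power m (\<lambda>i. z x i - z p i) \<alpha>) has_sum f (inv_into U z (z x))) (multi_indices m)"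
      using c x(1) by blast
    moreover have "inv_into U z (z x) = x" using chart_inj x(1) W(2) by (simp add: subset_iff)
    ultimately show ?thesis by (simp add: series_value_def infsumI)
  qed
  then have "majorized m {x \<in> W. \<forall>i<m. cmod (z x i - z p i) \<le> s} (\<lambda>x i. z x i - z p i) s
      (\<Sum>\<^sub>\<infinity>\<alpha>\<in>multi_indices m. cmod (c \<alpha> * of_real (s ^ multi_degree m \<alpha>))) f"
    unfolding majorized_def using cb by blast
  then show ?thesis unfolding expandable_at_def using s(1) by blast
qed

lemma expandable_imp_holomorphic:
  assumes W: "W \<subseteq> U" and f: "\<And>p. p \<in> W \<Longrightarrow> expandable_at m W z f p"
  shows "holomorphic_fun_on m (z ` W) (\<lambda>q. f (inv_into U z q))"
  unfolding holomorphic_fun_on_def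
proof
  fix q assume "q \<in> z ` W"
  then obtain p where p: "p \<in> W" "q = z p" by blast
  obtain r B where r: "r > 0" and "majorized m {x \<in> W. \<forall>i<m. cmod (z x i - z p i) \<le> r} (\<lambda>x i. z x i - z p i) r B f"
    using f[OF p(1)] unfolding expandable_at_def by blast
  then obtain c where c: "series_bounded m r B c"
    "\<forall>x. x \<in> {x \<in> W. \<forall>i<m. cmod (z x i - z p i) \<le> r} \<longrightarrow> f x = series_value m c (\<lambda>i. z x i - z p i)"
    unfolding majorized_def by blast
  have "((\<lambda>\<alpha>. c \<alpha> * multi_power m (\<lambda>i. w i - q i) \<alpha>) has_sum f (inv_into U z w)) (multi_indices m)"
    if w: "w \<in> z ` W" "\<forall>i<m. cmod (w i - q i) < r" for w
  proof -
    obtain x where x: "x \<in> W" "w = z x" using w(1) by blast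
    have le: "cmod (z x i - z p i) \<le> r" if "i < m" for i using w(2) that x p by (simp add: less_imp_le)
    have "inv_into U z w = x" using chart_inj x W by (simp add: subset_iff)
    moreover have "f x = series_value m c (\<lambda>i. z x i - z p i)" using c(2) x(1) le by blast
    ultimately show ?thesis
      using series_value_has_sum(1)[OF c(1) le] x(2) p(2) by simp
  qed
  then show "\<exists>c. \<exists>r>0. \<forall>w\<in>z ` W. (\<forall>i<m. cmod (w i - q i) < r) \<longrightarrow>
      ((\<lambda>\<alpha>. c \<alpha> * multi_power m (\<lambda>i. w i - q i) \<alpha>) has_sum f (inv_into U z w)) (multi_indices m)"
    using r by blast
qed

lemma expandable_at_local:
  assumes W: "openin S W'" "W' \<subseteq> W" "W \<subseteq> U" and p: "p \<in> W'" and f: "expandable_at m W' z f p"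
  shows "expandable_at m W z f p"
proof -
  obtain r B where r: "r > 0" "majorized m {x \<in> W'. \<forall>i<m. cmod (z x i - z p i) \<le> r} (\<lambda>x i. z x i - z p i) r B f"
    using f unfolding expandable_at_def by blast
  have W'U: "W' \<subseteq> U" using W by blast
  obtain R where R: "0 < R" "open_polydisc m (z p) R \<subseteq> z ` W'"
    using polydisc_in_open[OF chart_open_image[OF W(1) W'U], of "z p"] p by blast
  define s where "s = min r (R / 2)"
  have s: "0 < s" "s \<le> r" "s < R" using r R by (auto simp: s_def)
  have "{x \<in> W. \<forall>i<m. cmod (z x i - z p i) \<le> s} \<subseteq> {x \<in> W'. \<forall>i<m. cmod (z x i - z p i) \<le> r}"
  proof
    fix x assume "x \<in> {x \<in> W. \<forall>i<m. cmod (z x i - z p i) \<le> s}"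
    then have x: "x \<in> W" "\<forall>i<m. cmod (z x i - z p i) \<le> s" by auto
    then have "z x \<in> open_polydisc m (z p) R"
      using s(3) W(3) chart_extensional by (force simp: open_polydisc_def)
    then obtain x' where x': "x' \<in> W'" "z x = z x'" using R(2) by blast
    then have "x = x'" using inj_onD[OF chart_inj x'(2)] x(1) W W'U by blast
    moreover have "\<forall>i<m. cmod (z x i - z p i) \<le> r" using x(2) s(2) by fastforce
    ultimately show "x \<in> {x \<in> W'. \<forall>i<m. cmod (z x i - z p i) \<le> r}" using x' by blast
  qed
  from majorized_mono[OF r(2) this less_imp_le[OF s(1)] s(2) order_refl] s(1) show ?thesis
    unfolding expandable_at_def by blast
qed

lemma chart_open_polydisc_image:
  assumes "open_polydisc m q R \<subseteq> z ` U"
  shows "z ` {x \<in> U. \<forall>i<m. cmod (z x i - q i) < R} = open_polydisc m q R"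
proof
  show "open_polydisc m q R \<subseteq> z ` {x \<in> U. \<forall>i<m. cmod (z x i - q i) < R}"
  proof
    fix w assume w: "w \<in> open_polydisc m q R"
    then obtain x where "x \<in> U" "w = z x" using assms by blast
    then show "w \<in> z ` {x \<in> U. \<forall>i<m. cmod (z x i - q i) < R}" using w by (auto simp: open_polydisc_def)
  qed
qed (use chart_extensional in \<open>auto simp: open_polydisc_def\<close>)

lemma Cauchy_chart:
  assumes q: "open_polydisc m q R \<subseteq> z ` U" and r: "0 \<le> r" "r < R"
    and P: "P = {x \<in> U. \<forall>i<m. cmod (z x i - q i) < R}"
    and f: "\<And>p. p \<in> P \<Longrightarrow> expandable_at m P z f p" and B: "\<And>x. x \<in> P \<Longrightarrow> cmod (f x) \<le> B"
  shows "majorized m {x \<in> U. \<forall>i<m. cmod (z x i - q i) \<le> r} (\<lambda>x i. z x i - q i) r (B * (1 / (1 - r / R)) ^ m) f"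
proof -
  have PU: "P \<subseteq> U" by (auto simp: P)
  have im: "z ` P = open_polydisc m q R" unfolding P by (rule chart_open_polydisc_image[OF q])
  have R: "0 < R" using r by simp
  have "holomorphic_fun_on m (z ` P) (\<lambda>w. f (inv_into U z w))"
    by (rule expandable_imp_holomorphic[OF PU f])
  then have hol: "holomorphic_fun_on m (open_polydisc m q R) (\<lambda>w. f (inv_into U z w))" by (simp only: im)
  have inv: "inv_into U z (z x) = x" if "x \<in> P" for x using chart_inj that PU by (simp add: subset_iff)
  have bd: "cmod (f (inv_into U z w)) \<le> B" if "w \<in> open_polydisc m q R" for w
  proof -
    have "w \<in> z ` P" using that by (simp only: im)
    then obtain x where x: "w = z x" "x \<in> P" by (rule imageE)
    show ?thesis unfolding x(1) inv[OF x(2)] by (rule B[OF x(2)])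
  qed
  obtain c where c: "\<forall>\<alpha>\<in>multi_indices m. cmod (c \<alpha>) * R ^ multi_degree m \<alpha> \<le> B"
    "\<forall>w\<in>open_polydisc m q R. f (inv_into U z w) = series_value m c (\<lambda>i. w i - q i)"
    using Cauchy_polydisc[OF hol R bd] by blast
  have "f x = series_value m c (\<lambda>i. z x i - q i)" if x: "x \<in> U" "\<forall>i<m. cmod (z x i - q i) \<le> r" for x
  proof -
    have lt: "cmod (z x i - q i) < R" if "i < m" for i using x(2) r(2) that by fastforce
    then have xP: "x \<in> P" using x(1) unfolding P by blast
    have "z x \<in> open_polydisc m q R" using imageI[OF xP, of z] by (simp only: im)
    from bspec[OF c(2) this] show ?thesis unfolding inv[OF xP] .
  qed
  then show ?thesis
    unfolding majorized_def using series_bounded_of_coeff_bound[OF c(1)[rule_format] r] by blast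
qed

end

section \<open>Sections and pullbacks in local coordinates\<close>

text \<open>
  Holomorphy of sections refers to the charts of the atlas, to which the coordinates \<open>z\<close> need not
  belong. The transition functions are holomorphic, so expansions can be rewritten in \<open>z\<close> by
  composition of power series.
\<close>

lemma holomorphic_section_expandable:
  assumes M: "complex_manifold m M" and z: "holomorphic_chart m M U z"
    and W: "openin (points M) W" "W \<subseteq> U" and f: "holomorphic_on_manifold m M W f" and p: "p \<in> W"
  shows "expandable_at m W z f p"
proof -
  have ch: "chart m (points M) U z" using z by (simp add: holomorphic_chart_def)
  have "p \<in> topspace (points M)" using openin_subset[OF W(1)] p by blast
  then have "p \<in> (\<Union>(V, w)\<in>atlas M. V)" using M by (simp add: complex_manifold_def)
  then obtain V w where Vw: "(V, w) \<in> atlas M" "p \<in> V" by blast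
  have chV: "chart m (points M) V w" using M Vw(1) by (auto simp: complex_manifold_def)
  have VW: "openin (points M) (V \<inter> W)" using chart_openin[OF chV] W(1) by (rule openin_Int)
  have UV: "openin (points M) (U \<inter> V)" using chart_openin[OF ch] chart_openin[OF chV] by (rule openin_Int)
  have "holomorphic_fun_on m (w ` (V \<inter> W)) (\<lambda>q. f (inv_into V w q))"
    using f Vw(1) by (auto simp: holomorphic_on_manifold_def)
  then have fw: "expandable_at m (V \<inter> W) w f p"
    using Vw(2) p by (intro holomorphic_imp_expandable[OF chV VW]) auto
  have "holomorphic_transition m U z V w" using z Vw(1) by (auto simp: holomorphic_chart_def)
  then have trans: "holomorphic_fun_on m (z ` (U \<inter> V)) (\<lambda>q. w (inv_into U z q) i)" if "i < m" for i
    using that by (simp add: holomorphic_transition_def)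
  have wz: "expandable_at m (V \<inter> W) z (\<lambda>x. w x i) p" if "i < m" for i
  proof (rule expandable_at_subset)
    show "expandable_at m (U \<inter> V) z (\<lambda>x. w x i) p"
      using Vw(2) p W(2) by (intro holomorphic_imp_expandable[OF ch UV _ _ trans[OF that]]) auto
  qed (use W in auto)
  have fz: "expandable_at m (V \<inter> W) z f p"
    by (rule expandable_at_change_chart[OF _ wz fw]) (use Vw(2) p in auto)
  show ?thesis by (rule expandable_at_local[OF ch VW _ W(2) _ fz]) (use Vw(2) p in auto)
qed

lemma expandable_imp_holomorphic_section:
  assumes M: "complex_manifold m M" and z: "holomorphic_chart m M U z" and W: "W \<subseteq> U"
    and f: "\<And>p. p \<in> W \<Longrightarrow> expandable_at m W z f p"
  shows "holomorphic_on_manifold m M W f"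
  unfolding holomorphic_on_manifold_def
proof (intro ballI, unfold case_prod_unfold)
  fix Vw assume Vw: "Vw \<in> atlas M"
  let ?V = "fst Vw" and ?w = "snd Vw"
  have Vw': "(?V, ?w) \<in> atlas M" using Vw by simp
  have ch: "chart m (points M) U z" using z by (simp add: holomorphic_chart_def)
  have chV: "chart m (points M) ?V ?w" using M Vw' by (auto simp: complex_manifold_def)
  have VU: "openin (points M) (?V \<inter> U)" using chart_openin[OF chV] chart_openin[OF ch] by (rule openin_Int)
  have "holomorphic_transition m ?V ?w U z" using z Vw' by (auto simp: holomorphic_chart_def)
  then have trans: "holomorphic_fun_on m (?w ` (?V \<inter> U)) (\<lambda>q. z (inv_into ?V ?w q) i)" if "i < m" for i
    using that by (simp add: holomorphic_transition_def)
  show "holomorphic_fun_on m (?w ` (?V \<inter> W)) (\<lambda>q. f (inv_into ?V ?w q))"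
  proof (rule expandable_imp_holomorphic[OF chV])
    fix p assume p: "p \<in> ?V \<inter> W"
    have zw: "expandable_at m (?V \<inter> W) ?w (\<lambda>x. z x i) p" if "i < m" for i
    proof (rule expandable_at_subset)
      show "expandable_at m (?V \<inter> U) ?w (\<lambda>x. z x i) p"
        using p W by (intro holomorphic_imp_expandable[OF chV VU _ _ trans[OF that]]) auto
    qed (use W in auto)
    have fz: "expandable_at m (?V \<inter> W) z f p" using p by (intro expandable_at_subset[OF f]) auto
    show "expandable_at m (?V \<inter> W) ?w f p" by (rule expandable_at_change_chart[OF p zw fz])
  qed auto
qed

lemma exterior_sections [simp]:
  "carrier (sections (exterior_sheaf m n M) W) = exterior_carrier m n M W"
  "mult (sections (exterior_sheaf m n M) W) = super_mult"
  "one (sections (exterior_sheaf m n M) W) = exterior_basis W {}"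
  "add (sections (exterior_sheaf m n M) W) = (\<lambda>f g \<nu> x. f \<nu> x + g \<nu> x)"
  "smult (sections (exterior_sheaf m n M) W) = (\<lambda>c f \<nu> x. c * f \<nu> x)"
  by (simp_all add: exterior_sheaf_def exterior_basis_def super_mult_def wedge_def fun_eq_iff)

lemma exterior_res [simp]: "res (exterior_sheaf m n M) V W f = (\<lambda>\<nu> x. if x \<in> W then f \<nu> x else 0)"
  by (simp add: exterior_sheaf_def)

lemma superalgebra_homD:
  assumes "h \<in> superalgebra_hom A B"
  shows "s \<in> carrier A \<Longrightarrow> h s \<in> carrier B"
    and "s \<in> carrier A \<Longrightarrow> s' \<in> carrier A \<Longrightarrow> h (s \<oplus>\<^bsub>A\<^esub> s') = h s \<oplus>\<^bsub>B\<^esub> h s'"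
    and "s \<in> carrier A \<Longrightarrow> s' \<in> carrier A \<Longrightarrow> h (s \<otimes>\<^bsub>A\<^esub> s') = h s \<otimes>\<^bsub>B\<^esub> h s'"
    and "h \<one>\<^bsub>A\<^esub> = \<one>\<^bsub>B\<^esub>"
    and "s \<in> carrier A \<Longrightarrow> h (c \<odot>\<^bsub>A\<^esub> s) = c \<odot>\<^bsub>B\<^esub> h s"
proof -
  have h: "h \<in> ring_hom A B" and sm: "\<forall>c. \<forall>x\<in>carrier A. h (c \<odot>\<^bsub>A\<^esub> x) = c \<odot>\<^bsub>B\<^esub> h x"
    using assms by (auto simp: superalgebra_hom_def)
  show "s \<in> carrier A \<Longrightarrow> h s \<in> carrier B" by (rule ring_hom_closed[OF h])
  show "s \<in> carrier A \<Longrightarrow> s' \<in> carrier A \<Longrightarrow> h (s \<oplus>\<^bsub>A\<^esub> s') = h s \<oplus>\<^bsub>B\<^esub> h s'" by (rule ring_hom_add[OF h])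
  show "s \<in> carrier A \<Longrightarrow> s' \<in> carrier A \<Longrightarrow> h (s \<otimes>\<^bsub>A\<^esub> s') = h s \<otimes>\<^bsub>B\<^esub> h s'" by (rule ring_hom_mult[OF h])
  show "h \<one>\<^bsub>A\<^esub> = \<one>\<^bsub>B\<^esub>" by (rule ring_hom_one[OF h])
  show "s \<in> carrier A \<Longrightarrow> h (c \<odot>\<^bsub>A\<^esub> s) = c \<odot>\<^bsub>B\<^esub> h s" using sm by blast
qed

text \<open>
  Local coordinates on \<open>U\<close> identify sections over \<open>W \<subseteq> U\<close> with their families of coefficients. All
  estimates concern coefficient families, and all algebraic properties are transported from the
  structure sheaf through this identification.
\<close>

locale super_chart =
  fixes m n :: nat and M :: "('p, 's) supermanifold" and U :: "'p set" and z :: "'p \<Rightarrow> nat \<Rightarrow> complex"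
    and \<Phi> :: "'p set \<Rightarrow> 's \<Rightarrow> nat set \<Rightarrow> 'p \<Rightarrow> complex"
  assumes supermanifold: "complex_supermanifold m n M" and coordinates: "local_coordinates m n M U z \<Phi>"
begin

abbreviation "S \<equiv> points M"
abbreviation "F \<equiv> structure_sheaf M"
abbreviation "sect W \<equiv> carrier (superfunctions M W)"
abbreviation "super_coeffs W \<equiv> exterior_carrier m n M W"

lemma manifold: "complex_manifold m M" using supermanifold by (simp add: complex_supermanifold_def)
lemma sheaf: "superalgebra_sheaf S F" using supermanifold by (simp add: complex_supermanifold_def)
lemma holo_chart: "holomorphic_chart m M U z" using coordinates by (simp add: local_coordinates_def)
lemma chart: "chart m S U z" using holo_chart by (simp add: holomorphic_chart_def)
lemma U_open: "openin S U" by (rule chart_openin[OF chart])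
lemma iso: "sheaf_iso_on S U F (exterior_sheaf m n M) \<Phi>" using coordinates by (simp add: local_coordinates_def)

lemma superalgebra_sect: "openin S W \<Longrightarrow> superalgebra (superfunctions M W)"
  using sheaf by (simp add: superalgebra_sheaf_def)

lemma sect_closed:
  assumes "openin S W"
  shows "s \<in> sect W \<Longrightarrow> s' \<in> sect W \<Longrightarrow> s \<oplus>\<^bsub>superfunctions M W\<^esub> s' \<in> sect W"
    and "s \<in> sect W \<Longrightarrow> s' \<in> sect W \<Longrightarrow> s \<otimes>\<^bsub>superfunctions M W\<^esub> s' \<in> sect W"
    and "\<one>\<^bsub>superfunctions M W\<^esub> \<in> sect W"
    and "s \<in> sect W \<Longrightarrow> c \<odot>\<^bsub>superfunctions M W\<^esub> s \<in> sect W"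
proof -
  have ring: "ring (superfunctions M W)"
    and mod: "module (ring_of_type_algebra :: complex ring) (superfunctions M W)"
    using superalgebra_sect[OF assms] by (auto simp: superalgebra_def)
  show "s \<in> sect W \<Longrightarrow> s' \<in> sect W \<Longrightarrow> s \<oplus>\<^bsub>superfunctions M W\<^esub> s' \<in> sect W"
    by (rule ring.ring_simprules(1)[OF ring])
  show "s \<in> sect W \<Longrightarrow> s' \<in> sect W \<Longrightarrow> s \<otimes>\<^bsub>superfunctions M W\<^esub> s' \<in> sect W"
    by (rule ring.ring_simprules(5)[OF ring])
  show "\<one>\<^bsub>superfunctions M W\<^esub> \<in> sect W" by (rule ring.ring_simprules(6)[OF ring])
  show "s \<in> sect W \<Longrightarrow> c \<odot>\<^bsub>superfunctions M W\<^esub> s \<in> sect W"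
    by (rule module.smult_closed[OF mod]) (simp add: ring_of_type_algebra_def)
qed

lemma res_hom: "openin S V \<Longrightarrow> openin S W \<Longrightarrow> W \<subseteq> V \<Longrightarrow> res F V W \<in> superalgebra_hom (superfunctions M V) (superfunctions M W)"
  using sheaf by (simp add: superalgebra_sheaf_def)

lemma res_in: "openin S V \<Longrightarrow> openin S W \<Longrightarrow> W \<subseteq> V \<Longrightarrow> s \<in> sect V \<Longrightarrow> res F V W s \<in> sect W"
  using superalgebra_homD(1)[OF res_hom] .

lemma res_id: "openin S W \<Longrightarrow> s \<in> sect W \<Longrightarrow> res F W W s = s"
  using sheaf by (simp add: superalgebra_sheaf_def)

lemma res_res: "openin S V \<Longrightarrow> openin S V' \<Longrightarrow> openin S W \<Longrightarrow> W \<subseteq> V' \<Longrightarrow> V' \<subseteq> V \<Longrightarrow> s \<in> sect V \<Longrightarrow>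
    res F V' W (res F V V' s) = res F V W s"
  using sheaf unfolding superalgebra_sheaf_def by blast

lemma \<Phi>_hom: "openin S W \<Longrightarrow> W \<subseteq> U \<Longrightarrow> \<Phi> W \<in> superalgebra_hom (superfunctions M W) (sections (exterior_sheaf m n M) W)"
  and \<Phi>_bij: "openin S W \<Longrightarrow> W \<subseteq> U \<Longrightarrow> bij_betw (\<Phi> W) (sect W) (super_coeffs W)"
  using iso by (auto simp: sheaf_iso_on_def)

lemma \<Phi>_res: "openin S V \<Longrightarrow> openin S W \<Longrightarrow> W \<subseteq> V \<Longrightarrow> V \<subseteq> U \<Longrightarrow> s \<in> sect V \<Longrightarrow>
    \<Phi> W (res F V W s) = (\<lambda>\<nu> x. if x \<in> W then \<Phi> V s \<nu> x else 0)"
  using iso unfolding sheaf_iso_on_def by simp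

definition section_of :: "'p set \<Rightarrow> (nat set \<Rightarrow> 'p \<Rightarrow> complex) \<Rightarrow> 's"
  where "section_of W f = inv_into (sect W) (\<Phi> W) f"

context
  fixes W assumes W: "openin S W" "W \<subseteq> U"
begin

lemma section_of_in: "f \<in> super_coeffs W \<Longrightarrow> section_of W f \<in> sect W"
  and \<Phi>_section_of: "f \<in> super_coeffs W \<Longrightarrow> \<Phi> W (section_of W f) = f"
  and section_of_\<Phi>: "s \<in> sect W \<Longrightarrow> section_of W (\<Phi> W s) = s"
  and \<Phi>_in: "s \<in> sect W \<Longrightarrow> \<Phi> W s \<in> super_coeffs W"
  using \<Phi>_bij[OF W] unfolding section_of_def
  by (auto simp: bij_betw_def inv_into_into f_inv_into_f)

lemma coeffs_add:
  assumes "f \<in> super_coeffs W" "g \<in> super_coeffs W"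
  shows "(\<lambda>\<nu> x. f \<nu> x + g \<nu> x) \<in> super_coeffs W"
    and "section_of W (\<lambda>\<nu> x. f \<nu> x + g \<nu> x) = section_of W f \<oplus>\<^bsub>superfunctions M W\<^esub> section_of W g"
proof -
  let ?s = "section_of W f \<oplus>\<^bsub>superfunctions M W\<^esub> section_of W g"
  have s: "?s \<in> sect W" using assms by (intro sect_closed W section_of_in)
  have "\<Phi> W ?s = (\<lambda>\<nu> x. f \<nu> x + g \<nu> x)"
    using superalgebra_homD(2)[OF \<Phi>_hom[OF W] section_of_in[OF assms(1)] section_of_in[OF assms(2)]]
    by (simp add: \<Phi>_section_of assms)
  then show "(\<lambda>\<nu> x. f \<nu> x + g \<nu> x) \<in> super_coeffs W" "section_of W (\<lambda>\<nu> x. f \<nu> x + g \<nu> x) = ?s"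
    using \<Phi>_in[OF s] section_of_\<Phi>[OF s] by simp_all
qed

lemma coeffs_mult:
  assumes "f \<in> super_coeffs W" "g \<in> super_coeffs W"
  shows "super_mult f g \<in> super_coeffs W"
    and "section_of W (super_mult f g) = section_of W f \<otimes>\<^bsub>superfunctions M W\<^esub> section_of W g"
proof -
  let ?s = "section_of W f \<otimes>\<^bsub>superfunctions M W\<^esub> section_of W g"
  have s: "?s \<in> sect W" using assms by (intro sect_closed W section_of_in)
  have "\<Phi> W ?s = super_mult f g"
    using superalgebra_homD(3)[OF \<Phi>_hom[OF W] section_of_in[OF assms(1)] section_of_in[OF assms(2)]]
    by (simp add: \<Phi>_section_of assms)
  then show "super_mult f g \<in> super_coeffs W" "section_of W (super_mult f g) = ?s"
    using \<Phi>_in[OF s] section_of_\<Phi>[OF s] by simp_all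
qed

lemma coeffs_cmult:
  assumes "f \<in> super_coeffs W"
  shows "(\<lambda>\<nu> x. k * f \<nu> x) \<in> super_coeffs W"
    and "section_of W (\<lambda>\<nu> x. k * f \<nu> x) = k \<odot>\<^bsub>superfunctions M W\<^esub> section_of W f"
proof -
  let ?s = "k \<odot>\<^bsub>superfunctions M W\<^esub> section_of W f"
  have s: "?s \<in> sect W" using assms by (intro sect_closed W section_of_in)
  have "\<Phi> W ?s = (\<lambda>\<nu> x. k * f \<nu> x)"
    using superalgebra_homD(5)[OF \<Phi>_hom[OF W] section_of_in[OF assms(1)], of k]
    by (simp add: \<Phi>_section_of assms)
  then show "(\<lambda>\<nu> x. k * f \<nu> x) \<in> super_coeffs W" "section_of W (\<lambda>\<nu> x. k * f \<nu> x) = ?s"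
    using \<Phi>_in[OF s] section_of_\<Phi>[OF s] by simp_all
qed

lemma section_of_one: "section_of W (exterior_basis W {}) = \<one>\<^bsub>superfunctions M W\<^esub>"
  using superalgebra_homD(4)[OF \<Phi>_hom[OF W]] section_of_\<Phi>[OF sect_closed(3)[OF W(1)]] by simp

lemma coeffs_zero: "f \<in> super_coeffs W \<Longrightarrow> \<not> (\<nu> \<subseteq> {..<n} \<and> x \<in> W) \<Longrightarrow> f \<nu> x = 0"
  unfolding exterior_carrier_def by blast

lemma coeffs_expandable: "f \<in> super_coeffs W \<Longrightarrow> p \<in> W \<Longrightarrow> expandable_at m W z (f \<nu>) p"
  by (rule holomorphic_section_expandable[OF manifold holo_chart W]) (auto simp: exterior_carrier_def)

lemma coeffsI:
  assumes "\<And>\<nu> p. \<nu> \<subseteq> {..<n} \<Longrightarrow> p \<in> W \<Longrightarrow> expandable_at m W z (f \<nu>) p"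
    and "\<And>\<nu> x. \<not> (\<nu> \<subseteq> {..<n} \<and> x \<in> W) \<Longrightarrow> f \<nu> x = 0"
  shows "f \<in> super_coeffs W"
proof -
  have "holomorphic_on_manifold m M W (f \<nu>)" for \<nu>
  proof (rule expandable_imp_holomorphic_section[OF manifold holo_chart W(2)])
    fix p assume p: "p \<in> W"
    show "expandable_at m W z (f \<nu>) p"
    proof (cases "\<nu> \<subseteq> {..<n}")
      case False
      have "majorized m {x \<in> W. \<forall>i<m. cmod (z x i - z p i) \<le> 1} (\<lambda>x i. z x i - z p i) 1 0 (f \<nu>)"
        using majorized_zero by (rule majorized_cong) (use assms(2) False in auto)
      then show ?thesis unfolding expandable_at_def by (intro exI[of _ 1] conjI exI[of _ 0]) auto
    qed (use assms(1) p in auto)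
  qed
  then show ?thesis using assms(2) unfolding exterior_carrier_def by blast
qed

lemma coeffs_basis: "\<mu> \<subseteq> {..<n} \<Longrightarrow> exterior_basis W \<mu> \<in> super_coeffs W"
proof (rule coeffsI)
  fix \<nu> p assume "p \<in> W"
  have "majorized m {x \<in> W. \<forall>i<m. cmod (z x i - z p i) \<le> 1} (\<lambda>x i. z x i - z p i) 1 1 (\<lambda>x. if \<nu> = \<mu> then 1 else 0)"
    by (rule majorized_const) auto
  then have "majorized m {x \<in> W. \<forall>i<m. cmod (z x i - z p i) \<le> 1} (\<lambda>x i. z x i - z p i) 1 1 (exterior_basis W \<mu> \<nu>)"
    by (rule majorized_cong) (auto simp: exterior_basis_def)
  then show "expandable_at m W z (exterior_basis W \<mu> \<nu>) p"
    unfolding expandable_at_def by (intro exI[of _ 1] conjI exI[of _ 1]) auto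
qed (auto simp: exterior_basis_def)

end

text \<open>
  Pullback in terms of coefficients. The result is restricted to a set \<open>W'\<close> inside the preimage of
  \<open>W\<close>, so that source and target stay fixed while the morphism varies.
\<close>

definition pull :: "('p, 's) morphism \<Rightarrow> 'p set \<Rightarrow> 'p set \<Rightarrow> (nat set \<Rightarrow> 'p \<Rightarrow> complex) \<Rightarrow> nat set \<Rightarrow> 'p \<Rightarrow> complex"
  where "pull \<phi> W W' f = \<Phi> W' (res F (preimage M \<phi> W) W' (pullback \<phi> W (section_of W f)))"

lemma preimage_open: "endomorphism M \<phi> \<Longrightarrow> openin S V \<Longrightarrow> openin S (preimage M \<phi> V)"
  unfolding endomorphism_def preimage_def by (auto intro: openin_continuous_map_preimage)

lemma preimage_mono: "W \<subseteq> V \<Longrightarrow> preimage M \<phi> W \<subseteq> preimage M \<phi> V"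
  by (auto simp: preimage_def)

lemma pullback_hom: "endomorphism M \<phi> \<Longrightarrow> openin S V \<Longrightarrow>
    pullback \<phi> V \<in> superalgebra_hom (superfunctions M V) (superfunctions M (preimage M \<phi> V))"
  unfolding endomorphism_def by blast

lemma pullback_in: "endomorphism M \<phi> \<Longrightarrow> openin S V \<Longrightarrow> s \<in> sect V \<Longrightarrow> pullback \<phi> V s \<in> sect (preimage M \<phi> V)"
  using superalgebra_homD(1)[OF pullback_hom] .

lemma pullback_res: "endomorphism M \<phi> \<Longrightarrow> openin S V \<Longrightarrow> openin S W \<Longrightarrow> W \<subseteq> V \<Longrightarrow> s \<in> sect V \<Longrightarrow>
    pullback \<phi> W (res F V W s) = res F (preimage M \<phi> V) (preimage M \<phi> W) (pullback \<phi> V s)"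
  unfolding endomorphism_def by blast

text \<open>
  Through this lemma, sections over open sets that are not contained in the coordinate domain
  enter.
\<close>

lemma pull_res:
  assumes \<phi>: "endomorphism M \<phi>" and V: "openin S V" "s \<in> sect V" and W: "openin S W" "W \<subseteq> V" "W \<subseteq> U"
    and W': "openin S W'" "W' \<subseteq> preimage M \<phi> W"
  shows "pull \<phi> W W' (\<Phi> W (res F V W s)) = \<Phi> W' (res F (preimage M \<phi> V) W' (pullback \<phi> V s))"
proof -
  have sW: "res F V W s \<in> sect W" using V W by (intro res_in) auto
  have "res F (preimage M \<phi> W) W' (pullback \<phi> W (res F V W s)) = res F (preimage M \<phi> V) W' (pullback \<phi> V s)"
    unfolding pullback_res[OF \<phi> V(1) W(1,2) V(2)]
    by (rule res_res)
      (use \<phi> V W W' preimage_mono[OF W(2), of \<phi>] in \<open>auto intro: preimage_open pullback_in\<close>)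
  then show ?thesis by (simp add: pull_def section_of_\<Phi>[OF W(1,3) sW])
qed

context
  fixes \<phi> W W'
  assumes \<phi>: "endomorphism M \<phi>" and W: "openin S W" "W \<subseteq> U" and W': "openin S W'" "W' \<subseteq> U" "W' \<subseteq> preimage M \<phi> W"
begin

lemma pull_homs:
  "pullback \<phi> W \<in> superalgebra_hom (superfunctions M W) (superfunctions M (preimage M \<phi> W))"
  "res F (preimage M \<phi> W) W' \<in> superalgebra_hom (superfunctions M (preimage M \<phi> W)) (superfunctions M W')"
  "\<Phi> W' \<in> superalgebra_hom (superfunctions M W') (sections (exterior_sheaf m n M) W')"
  using \<phi> W W' by (auto intro: pullback_hom res_hom preimage_open \<Phi>_hom)

lemma pull_in: "f \<in> super_coeffs W \<Longrightarrow> pull \<phi> W W' f \<in> super_coeffs W'"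
  unfolding pull_def
  by (intro \<Phi>_in[OF W'(1,2)] superalgebra_homD(1)[OF pull_homs(2)] superalgebra_homD(1)[OF pull_homs(1)]
      section_of_in[OF W])

lemma pull_add: "f \<in> super_coeffs W \<Longrightarrow> g \<in> super_coeffs W \<Longrightarrow>
    pull \<phi> W W' (\<lambda>\<nu> x. f \<nu> x + g \<nu> x) = (\<lambda>\<nu> x. pull \<phi> W W' f \<nu> x + pull \<phi> W W' g \<nu> x)"
  using section_of_in[OF W, of f] section_of_in[OF W, of g]
  by (simp add: pull_def coeffs_add(2)[OF W] superalgebra_homD(1,2)[OF pull_homs(1)]
      superalgebra_homD(1,2)[OF pull_homs(2)] superalgebra_homD(2)[OF pull_homs(3)])

lemma pull_mult: "f \<in> super_coeffs W \<Longrightarrow> g \<in> super_coeffs W \<Longrightarrow>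
    pull \<phi> W W' (super_mult f g) = super_mult (pull \<phi> W W' f) (pull \<phi> W W' g)"
  using section_of_in[OF W, of f] section_of_in[OF W, of g]
  by (simp add: pull_def coeffs_mult(2)[OF W] superalgebra_homD(1,3)[OF pull_homs(1)]
      superalgebra_homD(1,3)[OF pull_homs(2)] superalgebra_homD(3)[OF pull_homs(3)])

lemma pull_cmult: "f \<in> super_coeffs W \<Longrightarrow>
    pull \<phi> W W' (\<lambda>\<nu> x. k * f \<nu> x) = (\<lambda>\<nu> x. k * pull \<phi> W W' f \<nu> x)"
  using section_of_in[OF W, of f]
  by (simp add: pull_def coeffs_cmult(2)[OF W] superalgebra_homD(1,5)[OF pull_homs(1)]
      superalgebra_homD(1,5)[OF pull_homs(2)] superalgebra_homD(5)[OF pull_homs(3)])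

lemma pull_one: "pull \<phi> W W' (exterior_basis W {}) = exterior_basis W' {}"
  by (simp add: pull_def section_of_one[OF W] superalgebra_homD(4)[OF pull_homs(1)]
      superalgebra_homD(4)[OF pull_homs(2)] superalgebra_homD(4)[OF pull_homs(3)])

lemma pull_subset:
  assumes "openin S W''" "W'' \<subseteq> W'" "f \<in> super_coeffs W" "x \<in> W''"
  shows "pull \<phi> W W'' f \<nu> x = pull \<phi> W W' f \<nu> x"
proof -
  let ?s = "pullback \<phi> W (section_of W f)"
  have s: "?s \<in> sect (preimage M \<phi> W)"
    using superalgebra_homD(1)[OF pull_homs(1) section_of_in[OF W assms(3)]] .
  have "res F (preimage M \<phi> W) W'' ?s = res F W' W'' (res F (preimage M \<phi> W) W' ?s)"
    using assms W' s preimage_open[OF \<phi> W(1)] by (subst res_res) auto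
  then have "pull \<phi> W W'' f = (\<lambda>\<nu> x. if x \<in> W'' then pull \<phi> W W' f \<nu> x else 0)"
    unfolding pull_def using assms W' superalgebra_homD(1)[OF pull_homs(2) s] by (simp add: \<Phi>_res)
  then show ?thesis using assms(4) by simp
qed

end

end

section \<open>One-parameter subgroups in local coordinates\<close>

lemma expandable_at_continuous:
  assumes f: "expandable_at m W z f p" and p: "p \<in> W" and e: "0 < e"
  shows "\<exists>s>0. \<forall>x\<in>W. (\<forall>i<m. cmod (z x i - z p i) \<le> s) \<longrightarrow> cmod (f x - f p) < e"
proof -
  let ?D = "\<lambda>s. {x \<in> W. \<forall>i<m. cmod (z x i - z p i) \<le> s}"
  let ?y = "\<lambda>x i. z x i - z p i"
  obtain r B where r: "r > 0" and maj: "majorized m (?D r) ?y r B f"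
    using f unfolding expandable_at_def by blast
  have B: "0 \<le> B" by (rule majorized_nonneg[OF maj])
  define s where "s = min r (r * e / (2 * (B + 1)))"
  have s: "0 < s" "s \<le> r" using r e B by (auto simp: s_def)
  have "s \<le> r * e / (2 * (B + 1))" by (simp add: s_def)
  then have "s * (2 * (B + 1)) \<le> r * e" using B by (simp add: pos_le_divide_eq)
  then have "s * B * 2 < r * e" using s by (simp add: algebra_simps)
  then have lt: "s / r * B < e" using r e by (simp add: pos_divide_less_eq) (smt (verit) e mult.commute mult_pos_pos r)
  have "majorized m (?D r) ?y s (s / r * B) (\<lambda>x. f x - f p)"
    by (rule majorized_shrink[OF maj]) (use s r p in \<open>auto simp: in_polydisc_def\<close>)
  moreover have "?D s \<subseteq> ?D r" using s(2) by fastforce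
  ultimately have "majorized m (?D s) ?y s (s / r * B) (\<lambda>x. f x - f p)"
    using s by (intro majorized_mono[of m "?D r" ?y s "s / r * B" "\<lambda>x. f x - f p" "?D s" s "s / r * B"]) auto
  from majorized_norm_le[OF this] have "cmod (f x - f p) \<le> s / r * B" if "x \<in> ?D s" for x
    using that by (simp add: in_polydisc_def)
  then show ?thesis using s(1) lt by (intro exI[of _ s]) fastforce
qed

lemma finite_common_radius:
  fixes P :: "'a \<Rightarrow> real \<Rightarrow> bool"
  assumes "finite I" "\<And>i. i \<in> I \<Longrightarrow> \<exists>s>0. P i s" "\<And>i s s'. P i s \<Longrightarrow> 0 < s' \<Longrightarrow> s' \<le> s \<Longrightarrow> P i s'"
  shows "\<exists>s>0. \<forall>i\<in>I. P i s"
  using assms(1,2)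
proof (induction I rule: finite_induct)
  case (insert i I)
  then obtain s s' where "0 < s" "P i s" "0 < s'" "\<forall>j\<in>I. P j s'" by blast
  have "P i (min s s')" using \<open>0 < s\<close> \<open>0 < s'\<close> by (intro assms(3)[OF \<open>P i s\<close>]) auto
  moreover have "P j (min s s')" if "j \<in> I" for j
    using \<open>0 < s\<close> \<open>0 < s'\<close> \<open>\<forall>j\<in>I. P j s'\<close> that by (intro assms(3)[of j s' "min s s'"]) auto
  ultimately show ?case using \<open>0 < s\<close> \<open>0 < s'\<close> by (intro exI[of _ "min s s'"]) auto
qed (auto intro: exI[of _ 1])

context super_chart
begin

definition disc :: "(nat \<Rightarrow> complex) \<Rightarrow> real \<Rightarrow> 'p set"
  where "disc q r = {x \<in> U. \<forall>i<m. cmod (z x i - q i) < r}"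

abbreviation dev :: "(nat \<Rightarrow> complex) \<Rightarrow> 'p \<Rightarrow> nat \<Rightarrow> complex"
  where "dev q \<equiv> (\<lambda>x i. z x i - q i)"

lemma disc_open: "openin S (disc q r)"
  unfolding disc_def by (rule chart_polydisc_open[OF chart])

lemma disc_sub: "disc q r \<subseteq> U" "r \<le> r' \<Longrightarrow> disc q r \<subseteq> disc q r'"
  by (force simp: disc_def)+

lemma disc_polydisc: "in_polydisc m (disc q r) (dev q) r"
  by (auto simp: in_polydisc_def disc_def less_imp_le)

lemma restrict_coeffs:
  assumes "openin S V" "openin S W" "W \<subseteq> V" "V \<subseteq> U" "f \<in> super_coeffs V"
  shows "(\<lambda>\<nu> x. if x \<in> W then f \<nu> x else 0) \<in> super_coeffs W"
proof -
  have WU: "W \<subseteq> U" using assms by blast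
  have s: "section_of V f \<in> sect V" using assms by (intro section_of_in)
  have "\<Phi> W (res F V W (section_of V f)) = (\<lambda>\<nu> x. if x \<in> W then f \<nu> x else 0)"
    using \<Phi>_res[OF assms(1,2,3,4) s] unfolding \<Phi>_section_of[OF assms(1,4,5)] .
  moreover have "\<Phi> W (res F V W (section_of V f)) \<in> super_coeffs W"
    by (rule \<Phi>_in[OF assms(2) WU]) (use assms s in \<open>auto intro: res_in\<close>)
  ultimately show ?thesis by simp
qed

text \<open>
  Supremum bounds, which the topology of the automorphism group controls, give norm bounds on
  smaller polydiscs.
\<close>

lemma super_Cauchy:
  assumes q: "open_polydisc m q R \<subseteq> z ` U" and r: "0 \<le> r" "r < R"
    and f: "f \<in> super_coeffs (disc q R)" and B: "\<And>\<nu> x. \<nu> \<subseteq> {..<n} \<Longrightarrow> x \<in> disc q R \<Longrightarrow> cmod (f \<nu> x) \<le> B"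
  shows "super_majorized m n (disc q r) (dev q) r (2 ^ n * (B * (1 / (1 - r / R)) ^ m)) f"
proof (rule super_majorizedI)
  fix \<nu> :: "nat set" assume \<nu>: "\<nu> \<subseteq> {..<n}"
  have "majorized m {x \<in> U. \<forall>i<m. cmod (z x i - q i) \<le> r} (dev q) r (B * (1 / (1 - r / R)) ^ m) (f \<nu>)"
    by (rule Cauchy_chart[OF chart q r disc_def coeffs_expandable[OF disc_open disc_sub(1) f] B[OF \<nu>]])
  then show "majorized m (disc q r) (dev q) r (B * (1 / (1 - r / R)) ^ m) (f \<nu>)"
    by (rule majorized_mono) (use r in \<open>auto simp: disc_def less_imp_le\<close>)
qed (simp add: card_Pow)

lemma coeffs_series:
  assumes c: "series_bounded m R B c" and R: "0 < R"
  shows "super_series m (disc q R) (dev q) c \<in> super_coeffs (disc q R)"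
proof (rule coeffsI[OF disc_open disc_sub(1)])
  fix \<nu> p assume p: "p \<in> disc q R"
  let ?W = "disc q R" and ?f = "super_series m (disc q R) (dev q) c"
  show "expandable_at m ?W z (?f \<nu>) p"
  proof (cases "\<nu> = {}")
    case False
    have "majorized m {x \<in> ?W. \<forall>i<m. cmod (z x i - z p i) \<le> 1} (\<lambda>x i. z x i - z p i) 1 0 (?f \<nu>)"
      using majorized_zero by (rule majorized_cong) (use False in \<open>simp add: super_series_def\<close>)
    then show ?thesis unfolding expandable_at_def by (intro exI[of _ 1] conjI exI[of _ 0]) auto
  next
    case True
    have "\<exists>s>0. \<forall>i\<in>{..<m}. s \<le> R - cmod (z p i - q i)"
      by (rule finite_common_radius) (use p in \<open>auto simp: disc_def intro!: exI[of _ "R - cmod (z p _ - q _)"]\<close>)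
    then obtain s where s: "0 < s" "\<And>i. i < m \<Longrightarrow> s \<le> R - cmod (z p i - q i)" by auto
    let ?D = "{x \<in> ?W. \<forall>i<m. cmod (z x i - z p i) \<le> s}" and ?y = "\<lambda>x i. z x i - z p i"
    have D: "in_polydisc m ?D ?y s" by (simp add: in_polydisc_def)
    have coord: "majorized m ?D ?y s R (\<lambda>x. dev q x i)" if i: "i < m" for i
    proof -
      have "majorized m ?D ?y s (s + cmod (z p i - q i)) (\<lambda>x. (z x i - z p i) + (z p i - q i))"
        using s(1) i by (intro majorized_add majorized_coordinate[where y = ?y] majorized_const D) auto
      then have "majorized m ?D ?y s (s + cmod (z p i - q i)) (\<lambda>x. dev q x i)" by simp
      then show ?thesis by (rule majorized_mono) (use s(1) s(2)[OF i] in auto)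
    qed
    have "majorized m ?D (dev q) R B (?f \<nu>)"
      unfolding majorized_def using c by (intro exI[of _ c]) (auto simp: super_series_def True)
    from majorized_compose[OF coord this D s(1)] show ?thesis
      unfolding expandable_at_def using s(1) by blast
  qed
qed (auto simp: super_series_def)

end

locale flow_chart = super_chart m n M U z \<Phi>
  for m n :: nat and M :: "('p, 's) supermanifold" and U :: "'p set" and z :: "'p \<Rightarrow> nat \<Rightarrow> complex"
    and \<Phi> :: "'p set \<Rightarrow> 's \<Rightarrow> nat set \<Rightarrow> 'p \<Rightarrow> complex" +
  fixes \<phi> :: "real \<Rightarrow> ('p, 's) morphism"
  assumes subgroup: "one_parameter_subgroup m n M \<phi>"
begin

lemma flow_automorphism: "automorphism M (\<phi> t)"
  using subgroup by (auto simp: one_parameter_subgroup_def hom_def Aut_def ring_of_type_algebra_def Pi_iff)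

lemma endo: "endomorphism M (\<phi> t)"
  using flow_automorphism by (simp add: automorphism_def)

lemma flow_add: "\<phi> (s + t) = compose_morphism M (\<phi> s) (\<phi> t)"
  using subgroup by (auto simp: one_parameter_subgroup_def hom_def Aut_def ring_of_type_algebra_def)

lemma underlying_in: "x \<in> topspace S \<Longrightarrow> underlying (\<phi> t) x \<in> topspace S"
  using endo[of t] unfolding endomorphism_def continuous_map_def by blast

lemma underlying_add: "x \<in> topspace S \<Longrightarrow> underlying (\<phi> (s + t)) x = underlying (\<phi> s) (underlying (\<phi> t) x)"
  by (simp add: flow_add compose_morphism_def compose_def)

lemma preimage_add: "preimage M (\<phi> (s + t)) V = preimage M (\<phi> t) (preimage M (\<phi> s) V)"
  using underlying_add underlying_in by (auto simp: preimage_def)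

lemma pullback_add:
  "openin S V \<Longrightarrow> f \<in> sect V \<Longrightarrow>
    pullback (\<phi> (s + t)) V f = pullback (\<phi> t) (preimage M (\<phi> s) V) (pullback (\<phi> s) V f)"
  by (simp add: flow_add compose_morphism_def)

text \<open>By the homomorphism property, \<open>\<phi>\<^sub>0\<close> is idempotent; as it has an inverse, it is the identity.\<close>

lemma underlying_0:
  assumes x: "x \<in> topspace S" shows "underlying (\<phi> 0) x = x"
proof -
  obtain \<psi> where "compose_morphism M \<psi> (\<phi> 0) = identity_morphism M"
    using flow_automorphism[of 0] by (auto simp: automorphism_def)
  then have "compose (topspace S) (underlying \<psi>) (underlying (\<phi> 0)) = (\<lambda>x\<in>topspace S. x)"
    by (simp add: compose_morphism_def identity_morphism_def)
  then have inv: "underlying \<psi> (underlying (\<phi> 0) x) = x" if "x \<in> topspace S" for x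
    using that by (metis compose_eq restrict_apply')
  have "underlying (\<phi> 0) (underlying (\<phi> 0) x) = underlying (\<phi> 0) x"
    using underlying_add[OF x, of 0 0] by simp
  then show ?thesis using inv[OF x] inv[OF underlying_in[OF x, of 0]] by simp
qed

lemma preimage_0: "openin S V \<Longrightarrow> preimage M (\<phi> 0) V = V"
  using openin_subset[of S V] by (auto simp: preimage_def underlying_0 subset_iff)

lemma pullback_0:
  assumes V: "openin S V" and f: "f \<in> sect V" shows "pullback (\<phi> 0) V f = f"
proof -
  obtain \<psi> where "compose_morphism M (\<phi> 0) \<psi> = identity_morphism M"
    using flow_automorphism[of 0] by (auto simp: automorphism_def)
  then have eq: "pullback (compose_morphism M (\<phi> 0) \<psi>) V g = pullback (identity_morphism M) V g" for g by simp
  have inv: "pullback \<psi> V (pullback (\<phi> 0) V g) = g" if "g \<in> sect V" for g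
    using that V eq[of g] by (simp add: compose_morphism_def identity_morphism_def preimage_0)
  have P: "pullback (\<phi> 0) V f \<in> sect V" using pullback_in[OF endo V f, of 0] by (simp add: preimage_0[OF V])
  have "pullback (\<phi> 0) V (pullback (\<phi> 0) V f) = pullback (\<phi> 0) V f"
    using pullback_add[OF V f, of 0 0] by (simp add: preimage_0[OF V])
  then show ?thesis using inv[OF f] inv[OF P] by simp
qed

lemma flow_open:
  assumes "openin (Aut_topology m n M) Q" shows "open {t. \<phi> t \<in> Q}"
proof -
  have "continuous_map euclidean (Aut_topology m n M) \<phi>"
    using subgroup by (simp add: one_parameter_subgroup_def)
  from openin_continuous_map_preimage[OF this assms] show ?thesis by simp
qed

lemma pull_0:
  assumes V: "openin S V" "V \<subseteq> U" and W: "openin S W" "W \<subseteq> V" and g: "g \<in> super_coeffs V"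
  shows "pull (\<phi> 0) V W g = (\<lambda>\<nu> x. if x \<in> W then g \<nu> x else 0)"
  unfolding pull_def preimage_0[OF V(1)] pullback_0[OF V(1) section_of_in[OF V g]]
    \<Phi>_res[OF V(1) W V(2) section_of_in[OF V g]] \<Phi>_section_of[OF V g] ..

text \<open>
  The group law, read in coordinates. Each of the three pullbacks is restricted to a set on which it is
  defined, and the law holds on the smallest of these sets.
\<close>

lemma pull_flow:
  assumes V: "openin S V" "V \<subseteq> U" and W: "openin S W" "W \<subseteq> U" "W \<subseteq> preimage M (\<phi> s) V"
    and W': "openin S W'" "W' \<subseteq> W" "W' \<subseteq> preimage M (\<phi> h) W" and Wsh: "W \<subseteq> preimage M (\<phi> (s + h)) V"
    and g: "g \<in> super_coeffs V" and x: "x \<in> W'"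
  shows "pull (\<phi> h) W W' (pull (\<phi> s) V W g) \<nu> x = pull (\<phi> (s + h)) V W g \<nu> x"
proof -
  let ?V = "preimage M (\<phi> s) V" and ?s = "pullback (\<phi> s) V (section_of V g)"
  have sV: "section_of V g \<in> sect V" by (rule section_of_in[OF V g])
  have V': "openin S ?V" "?s \<in> sect ?V" using preimage_open[OF endo V(1)] pullback_in[OF endo V(1) sV] .
  have W'U: "W' \<subseteq> U" using W W' by blast
  have "pull (\<phi> h) W W' (pull (\<phi> s) V W g) = \<Phi> W' (res F (preimage M (\<phi> h) ?V) W' (pullback (\<phi> h) ?V ?s))"
    unfolding pull_def[of "\<phi> s"] by (rule pull_res[OF endo V' W(1,3,2) W'(1,3)])
  also have "\<dots> = pull (\<phi> (s + h)) V W' g"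
    by (simp add: pull_def preimage_add pullback_add[OF V(1) sV])
  finally have "pull (\<phi> h) W W' (pull (\<phi> s) V W g) \<nu> x = pull (\<phi> (s + h)) V W' g \<nu> x" by simp
  also have "pull (\<phi> (s + h)) V W' g \<nu> x = pull (\<phi> (s + h)) V W g \<nu> x"
    by (rule pull_subset[OF endo V W(1,2) Wsh W'(1,2) g x])
  finally show ?thesis .
qed

text \<open>
  The subbasic open sets of the automorphism group compare the values of a coefficient on a compact
  set with one fixed open subset of \<open>\<complex>\<close>. Therefore the closed polydisc is covered by finitely many
  neighbourhoods on which the coefficients of \<open>g\<close> vary by less than \<open>\<epsilon> / 2\<close>, and continuity at time
  \<open>0\<close> is used on each of them. This is the only use of continuity of the subgroup.
\<close>

lemma flow_near_identity:
  assumes q: "open_polydisc m q R \<subseteq> z ` U" and r: "r < R" and g: "g \<in> super_coeffs (disc q R)" and \<epsilon>: "0 < \<epsilon>"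
  shows "\<exists>\<tau>>0. \<forall>t. \<bar>t\<bar> < \<tau> \<longrightarrow> disc q r \<subseteq> preimage M (\<phi> t) (disc q R) \<and>
    (\<forall>\<nu>\<subseteq>{..<n}. \<forall>x\<in>disc q r. cmod (pull (\<phi> t) (disc q R) (disc q r) g \<nu> x - g \<nu> x) < \<epsilon>)"
proof -
  let ?P = "disc q R" and ?C = "{x \<in> U. \<forall>i<m. cmod (z x i - q i) \<le> r}"
  let ?s = "section_of ?P g"
  note P = disc_open[of q R] disc_sub(1)[of q R]
  have s: "?s \<in> sect ?P" by (rule section_of_in[OF P g])
  have CP: "?C \<subseteq> ?P" using r by (force simp: disc_def)
  define near where "near N \<tau> \<longleftrightarrow> (\<forall>t. \<bar>t\<bar> < \<tau> \<longrightarrow> (\<forall>x'\<in>N. underlying (\<phi> t) x' \<in> ?P \<and>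
      (\<forall>\<nu>\<subseteq>{..<n}. cmod (pullback_coeff M U \<Phi> ?P ?s (\<phi> t) \<nu> x' - g \<nu> x') < \<epsilon>)))" for N \<tau>
  have loc: "\<exists>N \<tau>. openin S N \<and> x \<in> N \<and> 0 < \<tau> \<and> near N \<tau>"
    if xC: "x \<in> ?C" for x
  proof -
    have x: "x \<in> ?P" using xC CP by blast
    have "\<exists>s>0. \<forall>\<nu>\<in>Pow {..<n}. \<forall>x'\<in>?P. (\<forall>i<m. cmod (z x' i - z x i) \<le> s) \<longrightarrow> cmod (g \<nu> x' - g \<nu> x) < \<epsilon> / 2"
    proof (rule finite_common_radius)
      show "\<exists>s>0. \<forall>x'\<in>?P. (\<forall>i<m. cmod (z x' i - z x i) \<le> s) \<longrightarrow> cmod (g \<nu> x' - g \<nu> x) < \<epsilon> / 2" for \<nu>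
        by (rule expandable_at_continuous[OF coeffs_expandable[OF P g x] x]) (use \<epsilon> in simp)
    qed (simp, meson order_trans)
    then obtain s0 where s0: "0 < s0" "\<And>\<nu> x'. \<nu> \<subseteq> {..<n} \<Longrightarrow> x' \<in> ?P \<Longrightarrow> (\<forall>i<m. cmod (z x' i - z x i) \<le> s0) \<Longrightarrow>
        cmod (g \<nu> x' - g \<nu> x) < \<epsilon> / 2" by auto
    obtain Rx where Rx: "0 < Rx" "open_polydisc m (z x) Rx \<subseteq> z ` ?P"
      using polydisc_in_open[OF chart_open_image[OF chart P], of "z x"] x by blast
    define s1 where "s1 = min s0 (Rx / 2)"
    have s1: "0 < s1" "s1 \<le> s0" "s1 < Rx" using s0 Rx by (auto simp: s1_def)
    define K where "K = {x' \<in> U. \<forall>i<m. cmod (z x' i - z x i) \<le> s1}"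
    define N where "N = disc (z x) s1"
    have RxU: "open_polydisc m (z x) Rx \<subseteq> z ` U" using Rx(2) P(2) by blast
    have Kc: "compactin S K" unfolding K_def by (rule chart_polydisc_compact[OF chart RxU s1(3)])
    have KP: "K \<subseteq> ?P"
    proof
      fix x' assume x': "x' \<in> K"
      have "\<forall>i<m. cmod (z x' i - z x i) < Rx" using x' s1(3) by (force simp: K_def)
      then have "z x' \<in> open_polydisc m (z x) Rx"
        using chart_extensional[OF chart, of x'] x' by (simp add: K_def open_polydisc_def)
      then obtain x'' where x'': "x'' \<in> ?P" "z x' = z x''" using Rx(2) by blast
      then have "x' = x''" using inj_onD[OF chart_inj[OF chart] x''(2)] x' P(2) by (auto simp: K_def)
      then show "x' \<in> ?P" using x'' by simp
    qed
    have gK: "cmod (g \<nu> x' - g \<nu> x) < \<epsilon> / 2" if "\<nu> \<subseteq> {..<n}" "x' \<in> K" for \<nu> x'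
    proof (rule s0(2)[OF that(1)])
      show "x' \<in> ?P" using that KP by blast
      show "\<forall>i<m. cmod (z x' i - z x i) \<le> s0" using that(2) s1(2) by (force simp: K_def)
    qed
    define Q where "Q = Aut_subbasic n M K U \<Phi> ?P ?s (\<lambda>\<nu>. ball (g \<nu> x) (\<epsilon> / 2))"
    have "openin (Aut_topology m n M) Q"
      unfolding Aut_topology_def Q_def
    proof (rule topology_generated_by_Basis, rule CollectI, intro exI conjI)
      show "local_coordinates m n M U z \<Phi>" by (rule coordinates)
      show "K \<subseteq> U" by (auto simp: K_def)
    qed (use Kc P s in auto)
    then have Qopen: "open {t. \<phi> t \<in> Q}" by (rule flow_open)
    have "\<phi> 0 \<in> Q"
    proof -
      have "underlying (\<phi> 0) ` K \<subseteq> ?P"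
        using KP openin_subset[OF P(1)] by (auto simp: image_subset_iff underlying_0 subset_iff)
      moreover have "pullback_coeff M U \<Phi> ?P ?s (\<phi> 0) = g"
      proof -
        have "U \<inter> ?P = ?P" using P(2) by blast
        then show ?thesis
          using res_id[OF P(1) s] \<Phi>_section_of[OF P g]
          by (simp add: pullback_coeff_def Let_def preimage_0[OF P(1)] pullback_0[OF P(1) s])
      qed
      ultimately show ?thesis
        using gK flow_automorphism[of 0]
        by (auto simp: Q_def Aut_subbasic_def Aut_def dist_norm norm_minus_commute)
    qed
    then obtain \<tau> where \<tau>: "0 < \<tau>" "ball 0 \<tau> \<subseteq> {t. \<phi> t \<in> Q}"
      using Qopen unfolding open_contains_ball by blast
    have "underlying (\<phi> t) x' \<in> ?P \<and> (\<forall>\<nu>\<subseteq>{..<n}. cmod (pullback_coeff M U \<Phi> ?P ?s (\<phi> t) \<nu> x' - g \<nu> x') < \<epsilon>)"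
      if t: "\<bar>t\<bar> < \<tau>" and x': "x' \<in> N" for t x'
    proof -
      have "\<phi> t \<in> Q" using \<tau>(2) t by (auto simp: dist_norm)
      moreover have xK: "x' \<in> K" using x' by (auto simp: N_def K_def disc_def less_imp_le)
      ultimately have u: "underlying (\<phi> t) x' \<in> ?P"
        and im: "\<forall>\<nu>\<subseteq>{..<n}. pullback_coeff M U \<Phi> ?P ?s (\<phi> t) \<nu> ` K \<subseteq> ball (g \<nu> x) (\<epsilon> / 2)"
        unfolding Q_def Aut_subbasic_def by blast+
      have pc: "pullback_coeff M U \<Phi> ?P ?s (\<phi> t) \<nu> x' \<in> ball (g \<nu> x) (\<epsilon> / 2)" if "\<nu> \<subseteq> {..<n}" for \<nu>
        using im that xK by blast
      have "cmod (pullback_coeff M U \<Phi> ?P ?s (\<phi> t) \<nu> x' - g \<nu> x') < \<epsilon>" if \<nu>: "\<nu> \<subseteq> {..<n}" for \<nu>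
      proof -
        have "cmod (pullback_coeff M U \<Phi> ?P ?s (\<phi> t) \<nu> x' - g \<nu> x) < \<epsilon> / 2"
          using pc[OF \<nu>] by (simp add: dist_norm norm_minus_commute)
        then show ?thesis using gK[OF \<nu> xK] norm_triangle_lt[of "_ - g \<nu> x" "g \<nu> x - g \<nu> x'" \<epsilon>]
          by (smt (verit) diff_add_cancel add_diff_eq field_sum_of_halves norm_minus_commute)
      qed
      then show ?thesis using u by blast
    qed
    then have "near N \<tau>" by (simp add: near_def)
    moreover have "x \<in> N" using xC s1(1) by (simp add: N_def disc_def)
    moreover have "openin S N" unfolding N_def by (rule disc_open)
    ultimately show ?thesis using \<tau>(1) by blast
  qed
  have "\<forall>x\<in>?C. \<exists>N. \<exists>\<tau>. openin S N \<and> x \<in> N \<and> 0 < \<tau> \<and> near N \<tau>"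
    using loc by (rule ballI)
  from bchoice[OF this] obtain N where N: "\<forall>x\<in>?C. \<exists>\<tau>. openin S (N x) \<and> x \<in> N x \<and> 0 < \<tau> \<and> near (N x) \<tau>" ..
  have "compactin S ?C" by (rule chart_polydisc_compact[OF chart q r])
  moreover have "openin S N'" if N': "N' \<in> N ` ?C" for N'
  proof -
    obtain x where x: "x \<in> ?C" "N' = N x" using N' by (rule imageE)
    show ?thesis unfolding x(2) using bspec[OF N x(1)] by (elim exE conjE)
  qed
  moreover have "?C \<subseteq> \<Union>(N ` ?C)"
  proof
    fix x assume x: "x \<in> ?C"
    have "x \<in> N x" using bspec[OF N x] by (elim exE conjE)
    then show "x \<in> \<Union>(N ` ?C)" using x by (rule UN_I[rotated])
  qed
  ultimately have "\<exists>\<F>. finite \<F> \<and> \<F> \<subseteq> N ` ?C \<and> ?C \<subseteq> \<Union>\<F>"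
    by (rule compactinD)
  then obtain \<F> where \<F>: "finite \<F>" "\<F> \<subseteq> N ` ?C" "?C \<subseteq> \<Union>\<F>" by blast
  then obtain X0 where X0: "finite X0" "X0 \<subseteq> ?C" "\<F> = N ` X0" by (meson finite_subset_image)
  have "\<exists>\<tau>>0. \<forall>x\<in>X0. near (N x) \<tau>"
  proof (rule finite_common_radius[OF X0(1)])
    show "\<exists>\<tau>>0. near (N x) \<tau>" if x: "x \<in> X0" for x
    proof -
      from bspec[OF N subsetD[OF X0(2) x]] obtain \<tau> where "0 < \<tau> \<and> near (N x) \<tau>" by (elim exE conjE) (rule that, rule conjI)
      then show ?thesis ..
    qed
  qed (auto simp: near_def)
  then obtain \<tau> where \<tau>: "0 < \<tau>" and near: "\<forall>x\<in>X0. near (N x) \<tau>" by blast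
  have disc_near: "underlying (\<phi> t) x' \<in> ?P \<and>
      (\<forall>\<nu>\<subseteq>{..<n}. cmod (pullback_coeff M U \<Phi> ?P ?s (\<phi> t) \<nu> x' - g \<nu> x') < \<epsilon>)"
    if "\<bar>t\<bar> < \<tau>" "x' \<in> disc q r" for t x'
  proof -
    have "x' \<in> ?C" using that(2) by (auto simp: disc_def less_imp_le)
    then obtain x where "x \<in> X0" "x' \<in> N x" using \<F>(3) X0(3) by blast
    then show ?thesis using near that(1) unfolding near_def by blast
  qed
  show ?thesis
  proof (intro exI[of _ \<tau>] conjI \<tau> allI impI ballI)
    fix t assume t: "\<bar>t\<bar> < \<tau>"
    show sub: "disc q r \<subseteq> preimage M (\<phi> t) ?P"
      using disc_near[OF t] disc_sub(1)[of q r] openin_subset[OF U_open] by (auto simp: preimage_def)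
    fix \<nu> x assume \<nu>: "\<nu> \<subseteq> {..<n}" and x: "x \<in> disc q r"
    let ?W = "U \<inter> preimage M (\<phi> t) ?P"
    have "pull (\<phi> t) ?P (disc q r) g \<nu> x = pull (\<phi> t) ?P ?W g \<nu> x"
      by (rule pull_subset[OF endo P]) (use disc_open disc_sub(1)[of q r] sub g x U_open preimage_open[OF endo P(1)] in auto)
    also have "\<dots> = pullback_coeff M U \<Phi> ?P ?s (\<phi> t) \<nu> x" by (simp add: pullback_coeff_def pull_def Let_def)
    finally show "cmod (pull (\<phi> t) ?P (disc q r) g \<nu> x - g \<nu> x) < \<epsilon>" using disc_near[OF t x] \<nu> by simp
  qed
qed

end

section \<open>Analyticity of the action\<close>

lemma (in super_chart) coeffs_diff:
  assumes W: "openin S W" "W \<subseteq> U" and f: "f \<in> super_coeffs W" "g \<in> super_coeffs W"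
  shows "(\<lambda>\<nu> x. f \<nu> x - g \<nu> x) \<in> super_coeffs W"
  using coeffs_add(1)[OF W f(1) coeffs_cmult(1)[OF W f(2), of "-1"]] by simp

lemma (in super_chart) super_monomial_in:
  assumes \<alpha>: "\<alpha> \<in> multi_indices m" and R: "0 < R"
  shows "super_monomial m (disc q R) (dev q) \<alpha> \<in> super_coeffs (disc q R)"
  unfolding super_monomial_eq_series[OF \<alpha>]
  by (rule coeffs_series[where B = "R ^ multi_degree m \<alpha>"], rule l1_bounded_single) (use R in auto)

context flow_chart
begin

lemma flow_local_flow:
  assumes q: "open_polydisc m q R \<subseteq> z ` U" and r: "0 < r" "r < R" and t\<^sub>0: "0 < t\<^sub>0"
    and dom: "\<And>h. \<bar>h\<bar> \<le> t\<^sub>0 \<Longrightarrow> disc q r \<subseteq> preimage M (\<phi> h) (disc q R)"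
  shows "local_flow m n (disc q R) (dev q) R r (super_coeffs (disc q R))
    (\<lambda>h. pull (\<phi> h) (disc q R) (disc q r)) t\<^sub>0"
proof (rule local_flow.intro)
  fix h assume h: "\<bar>h\<bar> \<le> t\<^sub>0"
  note P = disc_open[of q R] disc_sub(1)[of q R]
  note hom = endo[of h] P disc_open[of q r] disc_sub(1)[of q r] dom[OF h]
  have W': "{x \<in> disc q R. \<forall>i<m. cmod (z x i - q i) < r} = disc q r"
    using r by (force simp: disc_def)
  show "superdomain_map m n (disc q R) (dev q) R (super_coeffs (disc q R))
      {x \<in> disc q R. \<forall>i<m. cmod (z x i - q i) < r} (pull (\<phi> h) (disc q R) (disc q r))"
    unfolding W'
  proof
    show "in_polydisc m (disc q R) (dev q) R" by (rule disc_polydisc)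
    show "disc q r \<subseteq> disc q R" using r by (intro disc_sub) simp
    show "f \<nu> x = 0" if "f \<in> super_coeffs (disc q R)" "\<not> (\<nu> \<subseteq> {..<n} \<and> x \<in> disc q R)" for f \<nu> x
      by (rule coeffs_zero[OF P that])
    show "pull (\<phi> h) (disc q R) (disc q r) (exterior_basis (disc q R) {}) \<nu> x = (if \<nu> = {} then 1 else 0)"
      if "x \<in> disc q r" for \<nu> x
      using that by (simp add: pull_one[OF hom] exterior_basis_def)
  qed (use r in \<open>auto simp: pull_add[OF hom] pull_cmult[OF hom] pull_mult[OF hom]
      intro: coeffs_add(1)[OF P] coeffs_cmult(1)[OF P] coeffs_mult(1)[OF P] coeffs_basis[OF P] coeffs_series\<close>)
next
  fix w :: "nat \<Rightarrow> complex" assume w: "\<forall>i<m. cmod (w i) < R"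
  let ?w = "\<lambda>i\<in>{..<m}. q i + w i"
  have "?w \<in> open_polydisc m q R" using w by (simp add: open_polydisc_def)
  then obtain x where x: "x \<in> U" "?w = z x" using q by blast
  have eq: "z x i = q i + w i" if "i < m" for i using fun_cong[OF x(2), of i] that by simp
  show "\<exists>x\<in>disc q R. \<forall>i<m. z x i - q i = w i"
    using x(1) w eq by (intro bexI[of _ x]) (auto simp: disc_def)
qed (use t\<^sub>0 r in auto)

text \<open>
  Analyticity near time \<open>0\<close> at the centre of a polydisc. The family of orbits consists of those of the
  coordinates, of the products \<open>\<theta>\<^sup>\<mu>\<close> of odd coordinates and of \<open>g\<close> itself. They are computed from the
  polydisc of radius \<open>R\<close> to that of radius \<open>R / 2\<close>; the intermediate radius \<open>3 R / 4\<close> is where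
  displacements are bounded in supremum, and the flow is used from radius \<open>R / 2\<close> to \<open>R / 4\<close>.
\<close>

proposition pull_analytic:
  assumes q: "open_polydisc m q R \<subseteq> z ` U" and R: "0 < R"
    and g: "g \<in> super_coeffs (disc q R)" and B: "\<forall>\<nu>\<subseteq>{..<n}. \<forall>x\<in>disc q R. cmod (g \<nu> x) \<le> B"
  shows "\<exists>\<epsilon>>0. (\<forall>t. \<bar>t\<bar> < \<epsilon> \<longrightarrow> disc q (R / 2) \<subseteq> preimage M (\<phi> t) (disc q R)) \<and>
    (\<forall>\<nu>\<subseteq>{..<n}. \<exists>b. \<forall>t x. \<bar>t\<bar> < \<epsilon> \<and> x \<in> disc q (R / 2) \<and> (\<forall>i<m. cmod (z x i - q i) < \<epsilon>) \<longrightarrow>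
      ((\<lambda>(k, \<alpha>). b k \<alpha> * of_real t ^ k * multi_power m (\<lambda>i. z x i - q i) \<alpha>) has_sum
        pull (\<phi> t) (disc q R) (disc q (R / 2)) g \<nu> x) (UNIV \<times> multi_indices m))"
proof -
  define R\<^sub>1 R\<^sub>2 R\<^sub>3 where "R\<^sub>1 = 3 * R / 4" and "R\<^sub>2 = R / 2" and "R\<^sub>3 = R / 4"
  have radii: "0 < R\<^sub>3" "R\<^sub>3 < R\<^sub>2" "R\<^sub>2 < R\<^sub>1" "R\<^sub>1 < R" "0 < R\<^sub>2" "0 < R\<^sub>1" using R by (auto simp: R\<^sub>1_def R\<^sub>2_def R\<^sub>3_def)
  let ?D = "disc q R" and ?D\<^sub>1 = "disc q R\<^sub>1" and ?D\<^sub>2 = "disc q R\<^sub>2" and ?D\<^sub>3 = "disc q R\<^sub>3"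
  have polydisc_mono: "open_polydisc m q r \<subseteq> z ` U" if "r \<le> R" for r
    using q that by (force simp: open_polydisc_def)
  have D: "openin S ?D" "?D \<subseteq> U" and D\<^sub>1: "openin S ?D\<^sub>1" "?D\<^sub>1 \<subseteq> U" and D\<^sub>2: "openin S ?D\<^sub>2" "?D\<^sub>2 \<subseteq> U"
    and D\<^sub>3: "openin S ?D\<^sub>3" "?D\<^sub>3 \<subseteq> U"
    by (rule disc_open, rule disc_sub(1))+
  have nest: "?D\<^sub>1 \<subseteq> ?D" "?D\<^sub>2 \<subseteq> ?D\<^sub>1" "?D\<^sub>3 \<subseteq> ?D\<^sub>2" "?D\<^sub>2 \<subseteq> ?D" using radii by (auto intro!: disc_sub(2))
  define \<sigma> where "\<sigma> = min (R\<^sub>3 / 2) 1"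
  define \<epsilon> where "\<epsilon> = \<sigma> / 4"
  \<comment> \<open>\<open>2\<^sup>n 3\<^sup>m\<close> is the constant of Cauchy's estimate from radius \<open>3 R / 4\<close> to \<open>R / 2\<close>\<close>
  define \<delta> where "\<delta> = \<epsilon> / (2 ^ n * 3 ^ m)"
  have \<sigma>: "0 < \<sigma>" "\<sigma> \<le> 1" "R\<^sub>3 / 2 + \<sigma> \<le> R\<^sub>3" and \<epsilon>: "0 < \<epsilon>" "4 * \<epsilon> \<le> \<sigma>" and \<delta>: "0 < \<delta>"
    using radii by (auto simp: \<sigma>_def \<epsilon>_def \<delta>_def)
  define \<G> where "\<G> = (\<lambda>j. super_monomial m ?D (dev q) (multi_unit m j)) ` {..<m} \<union> exterior_basis ?D ` Pow {..<n} \<union> {g}"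
  have \<G>: "finite \<G>" "\<G> \<subseteq> super_coeffs ?D"
    using g R by (auto simp: \<G>_def intro!: super_monomial_in coeffs_basis[OF D])
  have "\<exists>\<tau>>0. \<forall>G\<in>\<G>. \<forall>t. \<bar>t\<bar> < \<tau> \<longrightarrow> ?D\<^sub>1 \<subseteq> preimage M (\<phi> t) ?D \<and>
      (\<forall>\<nu>\<subseteq>{..<n}. \<forall>x\<in>?D\<^sub>1. cmod (pull (\<phi> t) ?D ?D\<^sub>1 G \<nu> x - G \<nu> x) < \<delta>)"
  proof (rule finite_common_radius[OF \<G>(1)])
    show "\<exists>\<tau>>0. \<forall>t. \<bar>t\<bar> < \<tau> \<longrightarrow> ?D\<^sub>1 \<subseteq> preimage M (\<phi> t) ?D \<and>
      (\<forall>\<nu>\<subseteq>{..<n}. \<forall>x\<in>?D\<^sub>1. cmod (pull (\<phi> t) ?D ?D\<^sub>1 G \<nu> x - G \<nu> x) < \<delta>)" if "G \<in> \<G>" for G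
      using \<G>(2) that by (intro flow_near_identity q radii \<delta>) auto
  qed simp
  then obtain \<tau> where \<tau>: "0 < \<tau>" and near: "\<forall>G\<in>\<G>. \<forall>t. \<bar>t\<bar> < \<tau> \<longrightarrow> ?D\<^sub>1 \<subseteq> preimage M (\<phi> t) ?D \<and>
      (\<forall>\<nu>\<subseteq>{..<n}. \<forall>x\<in>?D\<^sub>1. cmod (pull (\<phi> t) ?D ?D\<^sub>1 G \<nu> x - G \<nu> x) < \<delta>)" by blast
  have gG: "g \<in> \<G>" by (simp add: \<G>_def)
  have "exterior_basis ?D\<^sub>2 {} \<in> super_coeffs ?D\<^sub>2" by (rule coeffs_basis[OF D\<^sub>2]) simp
  from flow_near_identity[OF polydisc_mono radii(2) this zero_less_one]
  obtain \<tau>' where \<tau>': "0 < \<tau>'" and near': "\<forall>t. \<bar>t\<bar> < \<tau>' \<longrightarrow> ?D\<^sub>3 \<subseteq> preimage M (\<phi> t) ?D\<^sub>2"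
    using radii by auto
  define t\<^sub>0 where "t\<^sub>0 = min \<tau> \<tau>' / 2"
  have t\<^sub>0: "0 < t\<^sub>0" "t\<^sub>0 < \<tau>" "t\<^sub>0 < \<tau>'" using \<tau> \<tau>' by (auto simp: t\<^sub>0_def)
  have dom1: "?D\<^sub>1 \<subseteq> preimage M (\<phi> t) ?D" if "\<bar>t\<bar> \<le> t\<^sub>0" for t using near gG that t\<^sub>0 by auto
  have dom2: "?D\<^sub>2 \<subseteq> preimage M (\<phi> t) ?D" if "\<bar>t\<bar> \<le> t\<^sub>0" for t using dom1[OF that] nest by blast
  have dom3: "?D\<^sub>3 \<subseteq> preimage M (\<phi> t) ?D\<^sub>2" if "\<bar>t\<bar> \<le> t\<^sub>0" for t using near' that t\<^sub>0 by auto
  let ?T = "\<lambda>h. pull (\<phi> h) ?D\<^sub>2 ?D\<^sub>3"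
  interpret flow: local_flow m n ?D\<^sub>2 "dev q" R\<^sub>2 R\<^sub>3 "super_coeffs ?D\<^sub>2" ?T t\<^sub>0
    by (rule flow_local_flow[OF polydisc_mono radii(1,2) t\<^sub>0(1) dom3]) (use radii in auto)
  have W'_eq: "{x \<in> ?D\<^sub>2. \<forall>i<m. cmod (z x i - q i) < R\<^sub>3} = ?D\<^sub>3"
    using radii by (force simp: disc_def)
  define E where "E G t = pull (\<phi> t) ?D ?D\<^sub>2 G" for G t
  have E0: "E G 0 = (\<lambda>\<nu> x. if x \<in> ?D\<^sub>2 then G \<nu> x else 0)" if "G \<in> \<G>" for G
    unfolding E_def by (rule pull_0[OF D D\<^sub>2(1) nest(4)]) (use that \<G> in blast)
  have E_in: "E G t \<in> super_coeffs ?D\<^sub>2" if "G \<in> \<G>" "\<bar>t\<bar> \<le> t\<^sub>0" for G t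
    unfolding E_def by (rule pull_in[OF endo D D\<^sub>2 dom2[OF that(2)]]) (use that \<G> in blast)
  have E_flow: "?T h (E G s) \<nu> x = E G (s + h) \<nu> x"
    if G: "G \<in> \<G>" and "\<bar>s\<bar> \<le> t\<^sub>0" "\<bar>h\<bar> \<le> t\<^sub>0" "\<bar>s + h\<bar> \<le> t\<^sub>0" and x: "x \<in> ?D\<^sub>3" for G s h \<nu> x
    unfolding E_def
    by (rule pull_flow[OF D D\<^sub>2 dom2 D\<^sub>3(1) nest(3) dom3 dom2]) (use that \<G> in auto)
  have orb: "flow.orbit (E G)" if "G \<in> \<G>" for G
    unfolding flow.orbit_def W'_eq using E_in E_flow that by blast
  have small: "super_majorized m n ?D\<^sub>2 (dev q) R\<^sub>2 \<epsilon> (\<lambda>\<nu> x. E G t \<nu> x - E G 0 \<nu> x)"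
    if G: "G \<in> \<G>" and t: "\<bar>t\<bar> \<le> t\<^sub>0" for G t
  proof -
    let ?P = "pull (\<phi> t) ?D ?D\<^sub>1 G" and ?G = "\<lambda>\<nu> x. if x \<in> ?D\<^sub>1 then G \<nu> x else 0"
    have G': "G \<in> super_coeffs ?D" using G \<G> by blast
    have "?P \<in> super_coeffs ?D\<^sub>1" by (rule pull_in[OF endo D D\<^sub>1 dom1[OF t] G'])
    moreover have "?G \<in> super_coeffs ?D\<^sub>1" by (rule restrict_coeffs[OF D(1) D\<^sub>1(1) nest(1) D(2) G'])
    ultimately have dif: "(\<lambda>\<nu> x. ?P \<nu> x - ?G \<nu> x) \<in> super_coeffs ?D\<^sub>1" by (rule coeffs_diff[OF D\<^sub>1])
    have "super_majorized m n ?D\<^sub>2 (dev q) R\<^sub>2 (2 ^ n * (\<delta> * (1 / (1 - R\<^sub>2 / R\<^sub>1)) ^ m)) (\<lambda>\<nu> x. ?P \<nu> x - ?G \<nu> x)"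
    proof (rule super_Cauchy[OF polydisc_mono _ radii(3) dif])
      show "cmod (?P \<nu> x - ?G \<nu> x) \<le> \<delta>" if "\<nu> \<subseteq> {..<n}" "x \<in> ?D\<^sub>1" for \<nu> x
      proof -
        have "\<bar>t\<bar> < \<tau>" using t t\<^sub>0 by simp
        then have "cmod (?P \<nu> x - G \<nu> x) < \<delta>" using near G that by blast
        then show ?thesis using that(2) by simp
      qed
    qed (use radii in auto)
    moreover have "2 ^ n * (\<delta> * (1 / (1 - R\<^sub>2 / R\<^sub>1)) ^ m) = \<epsilon>"
    proof -
      have "1 / (1 - R\<^sub>2 / R\<^sub>1) = 3" using R by (simp add: R\<^sub>1_def R\<^sub>2_def)
      then show ?thesis by (simp add: \<delta>_def)
    qed
    ultimately have "super_majorized m n ?D\<^sub>2 (dev q) R\<^sub>2 \<epsilon> (\<lambda>\<nu> x. ?P \<nu> x - ?G \<nu> x)" by simp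
    then show ?thesis
    proof (rule super_majorized_cong)
      fix \<nu> x assume x: "x \<in> ?D\<^sub>2"
      have "E G t \<nu> x = ?P \<nu> x"
        unfolding E_def by (rule pull_subset[OF endo D D\<^sub>1 dom1[OF t] D\<^sub>2(1) nest(2) G' x])
      then show "?P \<nu> x - ?G \<nu> x = E G t \<nu> x - E G 0 \<nu> x" using x nest(2) by (simp add: E0[OF G] subset_iff)
    qed
  qed
  have coord: "E (super_monomial m ?D (dev q) (multi_unit m j)) 0 = super_monomial m ?D\<^sub>2 (dev q) (multi_unit m j)"
    if "j < m" for j
  proof -
    have "super_monomial m ?D (dev q) (multi_unit m j) \<in> \<G>" using that by (simp add: \<G>_def)
    from E0[OF this] show ?thesis using nest(4) by (auto simp: super_monomial_def fun_eq_iff)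
  qed
  have basis: "E (exterior_basis ?D \<mu>) 0 = exterior_basis ?D\<^sub>2 \<mu>" if "\<mu> \<subseteq> {..<n}" for \<mu>
  proof -
    have "exterior_basis ?D \<mu> \<in> \<G>" using that by (simp add: \<G>_def)
    from E0[OF this] show ?thesis using nest(4) by (auto simp: exterior_basis_def fun_eq_iff)
  qed
  define C where "C = 6 * \<epsilon> / t\<^sub>0"
  have C: "0 \<le> C" using \<epsilon> t\<^sub>0 by (simp add: C_def)
  have lip: "super_majorized m n (flow.cpoly (R\<^sub>3 / 2)) (dev q) (R\<^sub>3 / 2) (C * h) (\<lambda>\<nu> x. ?T h (E G 0) \<nu> x - E G 0 \<nu> x)"
    if G: "G \<in> \<G>" and h: "0 < h" "h \<le> t\<^sub>0" for G h
  proof -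
    have "super_majorized m n (flow.cpoly (R\<^sub>3 / 2)) (dev q) (R\<^sub>3 / 2) (6 * \<epsilon> / t\<^sub>0 * h) (\<lambda>\<nu> x. E G h \<nu> x - E G 0 \<nu> x)"
    proof (rule flow.generator_lipschitz[where \<F> = "E ` \<G>", OF _ _ _ _ _ \<sigma> \<epsilon> _ h])
      show "\<exists>F\<in>E ` \<G>. F 0 = super_monomial m ?D\<^sub>2 (dev q) (multi_unit m j)" if "j < m" for j
        using coord[OF that] that by (auto simp: \<G>_def)
      show "\<exists>F\<in>E ` \<G>. F 0 = exterior_basis ?D\<^sub>2 \<mu>" if "\<mu> \<subseteq> {..<n}" for \<mu>
        using basis[OF that] that by (auto simp: \<G>_def)
    qed (use orb small G radii in auto)
    then show ?thesis unfolding C_def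
    proof (rule super_majorized_cong)
      fix \<nu> x assume "x \<in> flow.cpoly (R\<^sub>3 / 2)"
      then have "x \<in> ?D\<^sub>3" using flow.cpoly_sub(2)[of "R\<^sub>3 / 2"] radii unfolding W'_eq by auto
      then show "E G h \<nu> x - E G 0 \<nu> x = ?T h (E G 0) \<nu> x - E G 0 \<nu> x"
        using E_flow[OF G, of 0 h x \<nu>] h t\<^sub>0 by simp
    qed
  qed
  define B' where "B' = 2 ^ n * (B * (1 / (1 - R\<^sub>2 / R)) ^ m)"
  have "super_majorized m n ?D\<^sub>2 (dev q) R\<^sub>2 B' g"
    unfolding B'_def by (rule super_Cauchy[OF q _ _ g]) (use radii B in auto)
  then have g0: "super_majorized m n ?D\<^sub>2 (dev q) R\<^sub>2 B' (E g 0)"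
    by (rule super_majorized_cong) (simp add: E0[OF gG])
  have bound: "super_majorized m n ?D\<^sub>2 (dev q) R\<^sub>2 (\<epsilon> + B') (E g t)" if "\<bar>t\<bar> \<le> t\<^sub>0" for t
  proof -
    have "super_majorized m n ?D\<^sub>2 (dev q) R\<^sub>2 (\<epsilon> + B') (\<lambda>\<nu> x. (E g t \<nu> x - E g 0 \<nu> x) + E g 0 \<nu> x)"
      using radii by (intro super_majorized_add small[OF gG that] g0 disc_polydisc) simp
    then show ?thesis by simp
  qed
  have "\<exists>\<epsilon>>0. \<forall>\<nu>\<subseteq>{..<n}. \<exists>b. \<forall>t x. \<bar>t\<bar> < \<epsilon> \<and> x \<in> ?D\<^sub>2 \<and> (\<forall>i<m. cmod (z x i - q i) < \<epsilon>) \<longrightarrow>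
    ((\<lambda>(k, \<alpha>). b k \<alpha> * of_real t ^ k * multi_power m (\<lambda>i. z x i - q i) \<alpha>) has_sum E g t \<nu> x) (UNIV \<times> multi_indices m)"
  proof (rule flow.orbit_analytic[OF orb[OF gG] bound _ _ _ _ C, where r = "R\<^sub>3 / 2"])
    show "super_majorized m n (flow.cpoly (R\<^sub>3 / 2)) (dev q) (R\<^sub>3 / 2) (C * h)
        (\<lambda>\<nu> x. ?T h (super_monomial m ?D\<^sub>2 (dev q) (multi_unit m j)) \<nu> x - super_monomial m ?D\<^sub>2 (dev q) (multi_unit m j) \<nu> x)"
      if "0 < h" "h \<le> t\<^sub>0" "j < m" for h j
      using lip[of "super_monomial m ?D (dev q) (multi_unit m j)" h] that coord[OF that(3)] by (simp add: \<G>_def)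
    show "super_majorized m n (flow.cpoly (R\<^sub>3 / 2)) (dev q) (R\<^sub>3 / 2) (C * h)
        (\<lambda>\<nu> x. ?T h (exterior_basis ?D\<^sub>2 \<mu>) \<nu> x - exterior_basis ?D\<^sub>2 \<mu> \<nu> x)"
      if "0 < h" "h \<le> t\<^sub>0" "\<mu> \<subseteq> {..<n}" for h \<mu>
      using lip[of "exterior_basis ?D \<mu>" h] that basis[OF that(3)] by (simp add: \<G>_def)
  qed (use radii in auto)
  then obtain \<epsilon>' where \<epsilon>': "0 < \<epsilon>'" and an: "\<forall>\<nu>\<subseteq>{..<n}. \<exists>b. \<forall>t x. \<bar>t\<bar> < \<epsilon>' \<and> x \<in> ?D\<^sub>2 \<and> (\<forall>i<m. cmod (z x i - q i) < \<epsilon>') \<longrightarrow>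
    ((\<lambda>(k, \<alpha>). b k \<alpha> * of_real t ^ k * multi_power m (\<lambda>i. z x i - q i) \<alpha>) has_sum E g t \<nu> x) (UNIV \<times> multi_indices m)"
    by blast
  show ?thesis
    unfolding R\<^sub>2_def[symmetric]
  proof (intro exI[of _ "min \<epsilon>' t\<^sub>0"] conjI allI impI)
    fix \<nu> :: "nat set" assume "\<nu> \<subseteq> {..<n}"
    then obtain b where b: "\<forall>t x. \<bar>t\<bar> < \<epsilon>' \<and> x \<in> ?D\<^sub>2 \<and> (\<forall>i<m. cmod (z x i - q i) < \<epsilon>') \<longrightarrow>
      ((\<lambda>(k, \<alpha>). b k \<alpha> * of_real t ^ k * multi_power m (\<lambda>i. z x i - q i) \<alpha>) has_sum E g t \<nu> x) (UNIV \<times> multi_indices m)"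
      using an by blast
    show "\<exists>b. \<forall>t x. \<bar>t\<bar> < min \<epsilon>' t\<^sub>0 \<and> x \<in> ?D\<^sub>2 \<and> (\<forall>i<m. cmod (z x i - q i) < min \<epsilon>' t\<^sub>0) \<longrightarrow>
      ((\<lambda>(k, \<alpha>). b k \<alpha> * of_real t ^ k * multi_power m (\<lambda>i. z x i - q i) \<alpha>) has_sum pull (\<phi> t) ?D ?D\<^sub>2 g \<nu> x) (UNIV \<times> multi_indices m)"
      using b unfolding E_def by (intro exI[of _ b]) simp
  qed (use \<epsilon>' t\<^sub>0 dom2 in auto)
qed

text \<open>
  An arbitrary time \<open>s\<close> is reduced to time \<open>0\<close> by the group law: near \<open>t = s\<close>, the pullback of \<open>f\<close>
  by \<open>\<phi>\<^sub>t\<close> is the pullback by \<open>\<phi>\<^sub>t\<^sub>-\<^sub>s\<close> of the section \<open>\<phi>\<^sub>s\<^sup>*(f)\<close>, which is defined on a neighbourhood of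
  \<open>U\<close> and has coefficients that are bounded on a small polydisc around the given point.
\<close>

proposition pullback_coeff_analytic:
  assumes V: "openin S V" and f: "f \<in> sect V" and UV: "\<And>t. t \<in> {a..b} \<Longrightarrow> underlying (\<phi> t) ` U \<subseteq> V"
    and \<nu>: "\<nu> \<subseteq> {..<n}"
  shows "jointly_analytic_on m a b (z ` U) (\<lambda>t p. pullback_coeff M U \<Phi> V f (\<phi> t) \<nu> (inv_into U z p))"
  unfolding jointly_analytic_on_def
proof (intro ballI)
  fix s p assume s: "s \<in> {a..b}" and "p \<in> z ` U"
  then obtain x\<^sub>0 where x\<^sub>0: "x\<^sub>0 \<in> U" "p = z x\<^sub>0" by blast
  have pre: "U \<subseteq> preimage M (\<phi> t) V" if "t \<in> {a..b}" for t
    using UV[OF that] openin_subset[OF U_open] by (auto simp: preimage_def)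
  define P where "P = preimage M (\<phi> s) V"
  define \<sigma> where "\<sigma> = pullback (\<phi> s) V f"
  have P: "openin S P" unfolding P_def by (rule preimage_open[OF endo V])
  have \<sigma>: "\<sigma> \<in> sect P" unfolding P_def \<sigma>_def by (rule pullback_in[OF endo V f])
  have UP: "U \<subseteq> P" unfolding P_def by (rule pre[OF s])
  define g\<^sub>0 where "g\<^sub>0 = \<Phi> U (res F P U \<sigma>)"
  have rU: "res F P U \<sigma> \<in> sect U" by (rule res_in[OF P U_open UP \<sigma>])
  have g\<^sub>0: "g\<^sub>0 \<in> super_coeffs U" unfolding g\<^sub>0_def by (rule \<Phi>_in[OF U_open order_refl rU])
  obtain R\<^sub>0 where R\<^sub>0: "0 < R\<^sub>0" "open_polydisc m p R\<^sub>0 \<subseteq> z ` U"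
    using polydisc_in_open[OF chart_open_image[OF chart U_open order_refl], of p] x\<^sub>0 by blast
  have "\<exists>r>0. \<forall>\<mu>\<in>Pow {..<n}. \<forall>x\<in>U. (\<forall>i<m. cmod (z x i - z x\<^sub>0 i) \<le> r) \<longrightarrow> cmod (g\<^sub>0 \<mu> x - g\<^sub>0 \<mu> x\<^sub>0) < 1"
  proof (rule finite_common_radius)
    show "\<exists>r>0. \<forall>x\<in>U. (\<forall>i<m. cmod (z x i - z x\<^sub>0 i) \<le> r) \<longrightarrow> cmod (g\<^sub>0 \<mu> x - g\<^sub>0 \<mu> x\<^sub>0) < 1" for \<mu>
      by (rule expandable_at_continuous[OF coeffs_expandable[OF U_open order_refl g\<^sub>0 x\<^sub>0(1)] x\<^sub>0(1)]) simp
  qed (simp, meson order_trans)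
  then obtain r\<^sub>0 where r\<^sub>0: "0 < r\<^sub>0"
    "\<forall>\<mu>\<in>Pow {..<n}. \<forall>x\<in>U. (\<forall>i<m. cmod (z x i - z x\<^sub>0 i) \<le> r\<^sub>0) \<longrightarrow> cmod (g\<^sub>0 \<mu> x - g\<^sub>0 \<mu> x\<^sub>0) < 1" by blast
  define R where "R = min r\<^sub>0 R\<^sub>0"
  have R: "0 < R" "R \<le> r\<^sub>0" "R \<le> R\<^sub>0" using r\<^sub>0 R\<^sub>0 by (auto simp: R_def)
  have q: "open_polydisc m p R \<subseteq> z ` U" using R\<^sub>0(2) R(3) by (force simp: open_polydisc_def)
  let ?D = "disc p R" and ?D' = "disc p (R / 2)"
  note D = disc_open[of p R] disc_sub(1)[of p R] and D' = disc_open[of p "R / 2"] disc_sub(1)[of p "R / 2"]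
  have DP: "?D \<subseteq> P" using D(2) UP by blast
  define g where "g = \<Phi> ?D (res F P ?D \<sigma>)"
  have g: "g \<in> super_coeffs ?D" unfolding g_def by (intro \<Phi>_in D res_in P DP \<sigma>)
  have g_eq: "g \<mu> x = g\<^sub>0 \<mu> x" if "x \<in> ?D" for \<mu> x
  proof -
    have "g = (\<lambda>\<nu> x. if x \<in> ?D then g\<^sub>0 \<nu> x else 0)"
      using \<Phi>_res[OF U_open D order_refl rU] unfolding res_res[OF P U_open D UP \<sigma>] g_def g\<^sub>0_def .
    then show ?thesis using that by simp
  qed
  have B: "\<forall>\<mu>\<subseteq>{..<n}. \<forall>x\<in>?D. cmod (g \<mu> x) \<le> 1 + wedge_norm n (\<lambda>\<nu>. g\<^sub>0 \<nu> x\<^sub>0)"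
  proof (intro allI impI ballI)
    fix \<mu> x assume \<mu>: "\<mu> \<subseteq> {..<n}" and x: "x \<in> ?D"
    have "\<forall>i<m. cmod (z x i - z x\<^sub>0 i) \<le> r\<^sub>0" using x R(2) x\<^sub>0(2) by (force simp: disc_def)
    then have "cmod (g\<^sub>0 \<mu> x - g\<^sub>0 \<mu> x\<^sub>0) < 1" using r\<^sub>0(2) \<mu> x D(2) by blast
    moreover have "cmod (g\<^sub>0 \<mu> x\<^sub>0) \<le> wedge_norm n (\<lambda>\<nu>. g\<^sub>0 \<nu> x\<^sub>0)"
      using norm_le_wedge_norm[OF \<mu>, of "\<lambda>\<nu>. g\<^sub>0 \<nu> x\<^sub>0"] .
    moreover have "cmod (g\<^sub>0 \<mu> x) \<le> cmod (g\<^sub>0 \<mu> x - g\<^sub>0 \<mu> x\<^sub>0) + cmod (g\<^sub>0 \<mu> x\<^sub>0)"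
      using norm_triangle_ineq[of "g\<^sub>0 \<mu> x - g\<^sub>0 \<mu> x\<^sub>0" "g\<^sub>0 \<mu> x\<^sub>0"] by simp
    ultimately show "cmod (g \<mu> x) \<le> 1 + wedge_norm n (\<lambda>\<nu>. g\<^sub>0 \<nu> x\<^sub>0)" by (simp add: g_eq[OF x])
  qed
  obtain \<epsilon> where \<epsilon>: "0 < \<epsilon>" "\<forall>t. \<bar>t\<bar> < \<epsilon> \<longrightarrow> ?D' \<subseteq> preimage M (\<phi> t) ?D"
    and an: "\<forall>\<nu>\<subseteq>{..<n}. \<exists>c. \<forall>t x. \<bar>t\<bar> < \<epsilon> \<and> x \<in> ?D' \<and> (\<forall>i<m. cmod (z x i - p i) < \<epsilon>) \<longrightarrow>
      ((\<lambda>(k, \<alpha>). c k \<alpha> * of_real t ^ k * multi_power m (\<lambda>i. z x i - p i) \<alpha>) has_sum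
        pull (\<phi> t) ?D ?D' g \<nu> x) (UNIV \<times> multi_indices m)"
    using pull_analytic[OF q R(1) g B] by (elim exE conjE) (rule that)
  obtain c where c: "\<forall>t x. \<bar>t\<bar> < \<epsilon> \<and> x \<in> ?D' \<and> (\<forall>i<m. cmod (z x i - p i) < \<epsilon>) \<longrightarrow>
      ((\<lambda>(k, \<alpha>). c k \<alpha> * of_real t ^ k * multi_power m (\<lambda>i. z x i - p i) \<alpha>) has_sum
        pull (\<phi> t) ?D ?D' g \<nu> x) (UNIV \<times> multi_indices m)"
    using an \<nu> by blast
  have transport: "pullback_coeff M U \<Phi> V f (\<phi> t) \<nu> x = pull (\<phi> (t - s)) ?D ?D' g \<nu> x"
    if t: "t \<in> {a..b}" "\<bar>t - s\<bar> < \<epsilon>" and x: "x \<in> ?D'" for t x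
  proof -
    let ?h = "t - s"
    let ?Q = "preimage M (\<phi> t) V" and ?f = "pullback (\<phi> t) V f"
    have Q: "?Q = preimage M (\<phi> ?h) P" and f': "?f = pullback (\<phi> ?h) P \<sigma>"
      using preimage_add[of s ?h V] pullback_add[OF V f, of s ?h] by (simp_all add: P_def \<sigma>_def)
    have Q': "openin S ?Q" and f_in: "?f \<in> sect ?Q" by (rule preimage_open[OF endo V], rule pullback_in[OF endo V f])
    have rf: "res F ?Q U ?f \<in> sect U" by (rule res_in[OF Q' U_open pre[OF t(1)] f_in])
    have UQ: "U \<inter> ?Q = U" using pre[OF t(1)] by blast
    have "pull (\<phi> ?h) ?D ?D' g = \<Phi> ?D' (res F ?Q ?D' ?f)"
      unfolding g_def Q f' by (rule pull_res[OF endo P \<sigma> D(1) DP D(2) D'(1)]) (use \<epsilon>(2) t(2) in blast)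
    also have "\<dots> = (\<lambda>\<nu> x. if x \<in> ?D' then \<Phi> U (res F ?Q U ?f) \<nu> x else 0)"
      using \<Phi>_res[OF U_open D' order_refl rf] unfolding res_res[OF Q' U_open D' pre[OF t(1)] f_in] .
    also have "\<Phi> U (res F ?Q U ?f) = pullback_coeff M U \<Phi> V f (\<phi> t)"
      by (simp add: pullback_coeff_def Let_def UQ)
    finally show ?thesis using x by simp
  qed
  show "\<exists>c. \<exists>r>0. \<forall>t\<in>{a..b}. \<forall>w\<in>z ` U. \<bar>t - s\<bar> < r \<and> (\<forall>i<m. cmod (w i - p i) < r) \<longrightarrow>
      ((\<lambda>(k, \<alpha>). c k \<alpha> * of_real (t - s) ^ k * multi_power m (\<lambda>i. w i - p i) \<alpha>) has_sum
        pullback_coeff M U \<Phi> V f (\<phi> t) \<nu> (inv_into U z w)) (UNIV \<times> multi_indices m)"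
  proof (intro exI[of _ c] exI[of _ "min \<epsilon> (R / 2)"] conjI ballI impI)
    fix t w assume t: "t \<in> {a..b}" and w: "w \<in> z ` U"
      and near: "\<bar>t - s\<bar> < min \<epsilon> (R / 2) \<and> (\<forall>i<m. cmod (w i - p i) < min \<epsilon> (R / 2))"
    obtain x where x: "x \<in> U" "w = z x" using w by blast
    have inv: "inv_into U z w = x" unfolding x(2) by (rule inv_into_f_f[OF chart_inj[OF chart] x(1)])
    have xD: "x \<in> ?D'" using near x by (simp add: disc_def)
    have "\<bar>t - s\<bar> < \<epsilon> \<and> x \<in> ?D' \<and> (\<forall>i<m. cmod (z x i - p i) < \<epsilon>)"
      using near xD x(2) by simp
    then have "((\<lambda>(k, \<alpha>). c k \<alpha> * of_real (t - s) ^ k * multi_power m (\<lambda>i. z x i - p i) \<alpha>) has_sum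
        pull (\<phi> (t - s)) ?D ?D' g \<nu> x) (UNIV \<times> multi_indices m)"
      using c by blast
    moreover have "pullback_coeff M U \<Phi> V f (\<phi> t) \<nu> (inv_into U z w) = pull (\<phi> (t - s)) ?D ?D' g \<nu> x"
      unfolding inv using near by (intro transport[OF t _ xD]) simp
    ultimately show "((\<lambda>(k, \<alpha>). c k \<alpha> * of_real (t - s) ^ k * multi_power m (\<lambda>i. w i - p i) \<alpha>) has_sum
        pullback_coeff M U \<Phi> V f (\<phi> t) \<nu> (inv_into U z w)) (UNIV \<times> multi_indices m)"
      by (simp only: x(2))
  qed (use \<epsilon>(1) R(1) in auto)
qed

end

theorem proposition5p3:
  fixes m n :: nat
    and M :: "('p, 's) supermanifold"
    and \<phi> :: "real \<Rightarrow> ('p, 's) morphism"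
  assumes "compact_complex_supermanifold m n M"
    and "one_parameter_subgroup m n M \<phi>"
  shows "analytic_action m n M \<phi>"
  unfolding analytic_action_def
proof (intro allI impI)
  fix U V a b z \<Phi> f \<nu>
  assume *: "openin (points M) U \<and> openin (points M) V \<and> a \<le> b \<and>
       (\<forall>t\<in>{a..b}. underlying (\<phi> t) ` U \<subseteq> V) \<and>
       local_coordinates m n M U z \<Phi> \<and> f \<in> carrier (superfunctions M V)"
    and \<nu>: "\<nu> \<subseteq> {..<n}"
  interpret flow_chart m n M U z \<Phi> \<phi>
    using assms * by unfold_locales (auto simp: compact_complex_supermanifold_def)
  show "jointly_analytic_on m a b (z ` U) (\<lambda>t p. pullback_coeff M U \<Phi> V f (\<phi> t) \<nu> (inv_into U z p))"
    using * \<nu> by (intro pullback_coeff_analytic) auto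
qed

end
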